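(* Let $\mathsf f$ be an a.s. uniformly bounded, irreducible additive functional on a uniformly elliptic Markov chain $\mathsf X$. For every $R$ large enough there are functions $$\rho_N:\mathfrak S_1\times[\hat a_N^R,\hat b_N^R]\to\mathbb R^+,\qquad \xi_N:[\hat a_N^R,\hat b_N^R]\to\mathbb R$$ as follows. (1) There is $c>0$ such that $[\hat a_N^R,\hat b_N^R]\supset[-c,c]$ for all $N$ large enough. (2) Non-lattice case: suppose $G_{alg}(\mathsf X,\mathsf f)=\mathbb R$. Then for every sequence $z_N\in\mathbb R$ with $\frac{z_N-\mathbb E(S_N)}{V_N}\in[\hat a_N^R,\hat b_N^R]$, for all finite non-empty intervals $(a,b)$ and every $x\in\mathfrak S_1$, as $N\to\infty$, $$\mathbb P_x[S_N-z_N\in(a,b)]=[1+o(1)]\cdot\frac{e^{-V_N\mathcal I_N(\frac{z_N}{V_N})}}{\sqrt{2\pi V_N}}\;\rho_N\!\left(x,\tfrac{z_N-\mathbb E(S_N)}{V_N}\right)\int_a^be^{-t\,\xi_N\left(\frac{z_N-\mathbb E(S_N)}{V_N}\right)}dt.$$ (3) Lattice case: suppose $G_{alg}(\mathsf X,\mathsf f)=\mathbb Z$ and $S_N\in c_N+\mathbb Z$ a.s. Then for every sequence $z_N\in c_N+\mathbb Z$ with $\frac{z_N-\mathbb E(S_N)}{V_N}\in[\hat a_N^R,\hat b_N^R]$, for all finite non-empty intervals $(a,b)$ and every $x\in\mathfrak S_1$, as $N\to\infty$, $$\mathbb P_x[S_N-z_N\in(a,b)]=[1+o(1)]\cdot\frac{e^{-V_N\mathcal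 I_N(\frac{z_N}{V_N})}}{\sqrt{2\pi V_N}}\;\rho_N\!\left(x,\tfrac{z_N-\mathbb E(S_N)}{V_N}\right)\sum_{t\in(a,b)\cap\mathbb Z}e^{-t\,\xi_N\left(\frac{z_N-\mathbb E(S_N)}{V_N}\right)}.$$ (4) Properties of the error terms: (a) $\rho_N(x,\eta)$ are bounded away from $0$ and $\infty$ on $\mathfrak S_1\times[\hat a_N^R,\hat b_N^R]$ uniformly in $N$, and $\rho_N(x,\eta)\to1$ as $\eta\to0$, uniformly in $N$ and $x$. (b) For each $R>0$ there is $C=C_R>0$ such that for all $N$ and $\eta\in[\hat a_N^R,\hat b_N^R]$, $C^{-1}|\eta|\le|\xi_N(\eta)|\le C|\eta|$ and $\mathrm{sgn}(\xi_N(\eta))=\mathrm{sgn}(\eta)$.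
   Context: A Markov chain $\mathsf X=\{X_n\}_{n\ge1}$ (possibly inhomogeneous) has complete separable metric state spaces $\mathfrak S_n\ni X_n$ with Borel $\sigma$-algebras, an initial distribution on $\mathfrak S_1$, and transition kernels $\pi_{n,n+1}(x,dy)$, so that $\mathbb P(X_{n+1}\in E\mid X_n,\dots,X_1)=\pi_{n,n+1}(X_n,E)$. $\mathbb P_x$ denotes probability when the initial distribution is replaced by the point mass at $x\in\mathfrak S_1$. The chain is uniformly elliptic if there are $0<\epsilon_0<1$, Borel probability measures $\mu_n$ on $\mathfrak S_n$ and measurable $p_n:\mathfrak S_n\times\mathfrak S_{n+1}\to[0,\infty)$ such that for all $n\ge1$: (a) $\pi_{n,n+1}(x,dy)=p_n(x,y)\mu_{n+1}(dy)$; (b) $0\le p_n\le1/\epsilon_0$; (c) $\int_{\mathfrak S_{n+1}}p_n(x,y)p_{n+1}(y,z)\mu_{n+1}(dy)>\epsilon_0$ for all $x\in\mathfrak S_n$, $z\in\mathfrak S_{n+2}$. An additive functional is a sequence $\mathsf f=\{f_n\}$ of measurable $f_n:\mathfrak S_n\times\mathfrak S_{n+1}\to\mathbb R$; $S_N=\sum_{n=1}^Nf_n(X_n,X_{n+1})$; $V_N=\mathrm{Var}(S_N)$. $\mathsf f$ is a.s. uniformly bounded if $\sup_n\mathrm{ess\,sup}|f_n(X_n,X_{n+1})|<\infty$. $\mathsf f$ is center-tight if there are constants $m_N$ such that for every $\epsilon>0$ there is $M$ with $\mathbb P[|S_N-m_N|>M]<\epsilon$ for all $N$. $G_{alg}(\mathsf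 X,\mathsf f)$ (algebraic range) is the intersection of all closed subgroups $G\le\mathbb R$ for which there are $c_n\in\mathbb R$ with $\mathbb P[f_n(X_n,X_{n+1})-c_n\in G]=1$ for all $n\ge1$. $G_{ess}(\mathsf X,\mathsf f)=\bigcap\{G_{alg}(\mathsf X,\mathsf g):\mathsf g$ an additive functional on $\mathsf X$ with $\mathsf f-\mathsf g$ center-tight$\}$. $\mathsf f$ is irreducible if $G_{ess}(\mathsf X,\mathsf f)=G_{alg}(\mathsf X,\mathsf f)$. The theorem concerns algebraic range $\mathbb R$ or $\mathbb Z$. Rate functions (for $N$ with $V_N\ne0$; only such $N$ are considered). $\mathcal F_N(\xi)=\frac1{V_N}\log\mathbb E(e^{\xi S_N})$ ($\xi\in\mathbb R$), which is smooth and strictly convex. $\mathcal I_N$ is its Legendre transform: for $\eta\in(\inf\mathcal F_N',\sup\mathcal F_N')$, $\mathcal I_N(\eta)=\xi\eta-\mathcal F_N(\xi)$ for the unique $\xi$ with $\mathcal F_N'(\xi)=\eta$. For $R>0$, $$[\hat a_N^R,\hat b_N^R]=\left[\mathcal F_N'(-R)-\frac{\mathbb E(S_N)}{V_N},\ \mathcal F_N'(R)-\frac{\mathbb E(S_N)}{V_N}\right].$$ $\mathrm{sgn}(x)$ is $+1$, $-1$, $0$ for $x>0$, $x<0$, $x=0$ respectively.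
   Formalization: In (2) and (3), x ranges over points where f is also a.s. bounded under P_x by an arbitrary fixed K, and in (3) S_N lies in c_N+Z also P_x-a.s.; without this the claim fails at points x that the initial distribution does not charge. *)

theory Defs
  imports "HOL-Probability.Probability"
begin

text \<open>
  Sequences are indexed by \<open>n \<ge> 1\<close>; values at index \<open>0\<close> are never used.  The state spaces may change
  with \<open>n\<close>, so they are metric carriers \<open>S n\<close> (with metric \<open>d n\<close>) inside one arbitrary type.
\<close>

definition polish_metric :: "'a set \<Rightarrow> ('a \<Rightarrow> 'a \<Rightarrow> real) \<Rightarrow> bool" where
  "polish_metric S d \<longleftrightarrow> Metric_space S d \<and> Metric_space.mcomplete S d \<and>
     separable_space (Metric_space.mtopology S d)"

definition borel_spaces :: "(nat \<Rightarrow> 'a set) \<Rightarrow> (nat \<Rightarrow> 'a \<Rightarrow> 'a \<Rightarrow> real) \<Rightarrow> nat \<Rightarrow> 'a measure" where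
  "borel_spaces S d n = sigma (S n) {U. openin (Metric_space.mtopology (S n) (d n)) U}"

text \<open>
  In the next definitions \<open>B n\<close> is the measurable space of the \<open>n\<close>-th state and \<open>Q n\<close> is the kernel
  from state \<open>n\<close> to state \<open>n + 1\<close>.
\<close>

definition transition_kernels :: "(nat \<Rightarrow> 'a measure) \<Rightarrow> (nat \<Rightarrow> 'a \<Rightarrow> 'a measure) \<Rightarrow> bool" where
  "transition_kernels B Q \<longleftrightarrow> (\<forall>n\<ge>1. Q n \<in> B n \<rightarrow>\<^sub>M prob_algebra (B (Suc n)))"

definition past_algebra ::
    "(nat \<Rightarrow> 'a measure) \<Rightarrow> 'w measure \<Rightarrow> (nat \<Rightarrow> 'w \<Rightarrow> 'a) \<Rightarrow> nat \<Rightarrow> 'w measure" where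
  "past_algebra B M X n =
     vimage_algebra (space M) (\<lambda>\<omega>. \<lambda>i\<in>{1..n}. X i \<omega>) (PiM {1..n} B)"

definition markov_chain ::
    "(nat \<Rightarrow> 'a measure) \<Rightarrow> 'a measure \<Rightarrow> (nat \<Rightarrow> 'a \<Rightarrow> 'a measure) \<Rightarrow>
     'w measure \<Rightarrow> (nat \<Rightarrow> 'w \<Rightarrow> 'a) \<Rightarrow> bool" where
  "markov_chain B \<nu> Q M X \<longleftrightarrow>
     prob_space M \<and> (\<forall>n\<ge>1. X n \<in> M \<rightarrow>\<^sub>M B n) \<and> distr M (B 1) (X 1) = \<nu> \<and>
     (\<forall>n\<ge>1. \<forall>E\<in>sets (B (Suc n)). AE \<omega> in M.
        real_cond_exp M (past_algebra B M X n) (\<lambda>\<omega>'. indicator E (X (Suc n) \<omega>')) \<omega>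
          = measure (Q n (X n \<omega>)) E)"

definition uniformly_elliptic :: "(nat \<Rightarrow> 'a measure) \<Rightarrow> (nat \<Rightarrow> 'a \<Rightarrow> 'a measure) \<Rightarrow> bool" where
  "uniformly_elliptic B Q \<longleftrightarrow>
     (\<exists>(\<epsilon>::real) \<mu> p. 0 < \<epsilon> \<and> \<epsilon> < 1 \<and>
        (\<forall>n\<ge>1. \<mu> n \<in> space (prob_algebra (B n)) \<and>
               (\<lambda>(x, y). p n x y) \<in> borel_measurable (B n \<Otimes>\<^sub>M B (Suc n))) \<and>
        (\<forall>n\<ge>1. \<forall>x\<in>space (B n). Q n x = density (\<mu> (Suc n)) (\<lambda>y. ennreal (p n x y))) \<and>
        (\<forall>n\<ge>1. \<forall>x\<in>space (B n). \<forall>y\<in>space (B (Suc n)). 0 \<le> p n x y \<and> p n x y \<le> 1 / \<epsilon>) \<and>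
        (\<forall>n\<ge>1. \<forall>x\<in>space (B n). \<forall>z\<in>space (B (n + 2)).
           (\<integral>y. p n x y * p (Suc n) y z \<partial>\<mu> (Suc n)) > \<epsilon>))"

definition additive_functional ::
    "(nat \<Rightarrow> 'a measure) \<Rightarrow> (nat \<Rightarrow> 'a \<Rightarrow> 'a \<Rightarrow> real) \<Rightarrow> bool" where
  "additive_functional B f \<longleftrightarrow>
     (\<forall>n\<ge>1. (\<lambda>(x, y). f n x y) \<in> borel_measurable (B n \<Otimes>\<^sub>M B (Suc n)))"

definition chain_sum ::
    "(nat \<Rightarrow> 'w \<Rightarrow> 'a) \<Rightarrow> (nat \<Rightarrow> 'a \<Rightarrow> 'a \<Rightarrow> real) \<Rightarrow> nat \<Rightarrow> 'w \<Rightarrow> real" where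
  "chain_sum X f N \<omega> = (\<Sum>n=1..N. f n (X n \<omega>) (X (Suc n) \<omega>))"

definition ess_bound ::
    "'w measure \<Rightarrow> (nat \<Rightarrow> 'w \<Rightarrow> 'a) \<Rightarrow> (nat \<Rightarrow> 'a \<Rightarrow> 'a \<Rightarrow> real) \<Rightarrow> ereal" where
  "ess_bound M X f = (SUP n\<in>{1..}. esssup M (\<lambda>\<omega>. ereal \<bar>f n (X n \<omega>) (X (Suc n) \<omega>)\<bar>))"

text \<open>
  \<open>ess_bound\<close> is also applied to the chain started at a point \<open>x\<close>.  Almost-sure hypotheses on \<open>f\<close> under
  the given initial distribution say nothing about the law started at an exceptional \<open>x\<close> (one charged
  with probability zero), where \<open>f 1 x _\<close> may be arbitrary; a local limit theorem from \<open>x\<close> can hold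
  only if those hypotheses hold under the law started at \<open>x\<close> as well.
\<close>

definition as_uniformly_bounded ::
    "'w measure \<Rightarrow> (nat \<Rightarrow> 'w \<Rightarrow> 'a) \<Rightarrow> (nat \<Rightarrow> 'a \<Rightarrow> 'a \<Rightarrow> real) \<Rightarrow> bool" where
  "as_uniformly_bounded M X f \<longleftrightarrow> ess_bound M X f < \<infinity>"

definition center_tight ::
    "'w measure \<Rightarrow> (nat \<Rightarrow> 'w \<Rightarrow> 'a) \<Rightarrow> (nat \<Rightarrow> 'a \<Rightarrow> 'a \<Rightarrow> real) \<Rightarrow> bool" where
  "center_tight M X f \<longleftrightarrow>
     (\<exists>m :: nat \<Rightarrow> real. \<forall>\<epsilon>>0. \<exists>T. \<forall>N\<ge>1.
        measure M {\<omega> \<in> space M. \<bar>chain_sum X f N \<omega> - m N\<bar> > T} < \<epsilon>)"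

definition closed_subgroup :: "real set \<Rightarrow> bool" where
  "closed_subgroup G \<longleftrightarrow>
     closed G \<and> 0 \<in> G \<and> (\<forall>x\<in>G. \<forall>y\<in>G. x + y \<in> G) \<and> (\<forall>x\<in>G. - x \<in> G)"

definition G_alg ::
    "'w measure \<Rightarrow> (nat \<Rightarrow> 'w \<Rightarrow> 'a) \<Rightarrow> (nat \<Rightarrow> 'a \<Rightarrow> 'a \<Rightarrow> real) \<Rightarrow> real set" where
  "G_alg M X f = \<Inter> {G. closed_subgroup G \<and>
     (\<exists>c :: nat \<Rightarrow> real. \<forall>n\<ge>1. AE \<omega> in M. f n (X n \<omega>) (X (Suc n) \<omega>) - c n \<in> G)}"

definition G_ess ::
    "(nat \<Rightarrow> 'a measure) \<Rightarrow> 'w measure \<Rightarrow> (nat \<Rightarrow> 'w \<Rightarrow> 'a) \<Rightarrow>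
     (nat \<Rightarrow> 'a \<Rightarrow> 'a \<Rightarrow> real) \<Rightarrow> real set" where
  "G_ess B M X f = \<Inter> {G_alg M X g | g. additive_functional B g \<and>
     center_tight M X (\<lambda>n x y. f n x y - g n x y)}"

definition irreducible_functional ::
    "(nat \<Rightarrow> 'a measure) \<Rightarrow> 'w measure \<Rightarrow> (nat \<Rightarrow> 'w \<Rightarrow> 'a) \<Rightarrow>
     (nat \<Rightarrow> 'a \<Rightarrow> 'a \<Rightarrow> real) \<Rightarrow> bool" where
  "irreducible_functional B M X f \<longleftrightarrow> G_ess B M X f = G_alg M X f"

definition mean_S ::
    "'w measure \<Rightarrow> (nat \<Rightarrow> 'w \<Rightarrow> 'a) \<Rightarrow> (nat \<Rightarrow> 'a \<Rightarrow> 'a \<Rightarrow> real) \<Rightarrow> nat \<Rightarrow> real" where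
  "mean_S M X f N = prob_space.expectation M (chain_sum X f N)"

definition var_S ::
    "'w measure \<Rightarrow> (nat \<Rightarrow> 'w \<Rightarrow> 'a) \<Rightarrow> (nat \<Rightarrow> 'a \<Rightarrow> 'a \<Rightarrow> real) \<Rightarrow> nat \<Rightarrow> real" where
  "var_S M X f N = prob_space.variance M (chain_sum X f N)"

definition free_energy ::
    "'w measure \<Rightarrow> (nat \<Rightarrow> 'w \<Rightarrow> 'a) \<Rightarrow> (nat \<Rightarrow> 'a \<Rightarrow> 'a \<Rightarrow> real) \<Rightarrow> nat \<Rightarrow> real \<Rightarrow> real" where
  "free_energy M X f N \<xi> =
     ln (prob_space.expectation M (\<lambda>\<omega>. exp (\<xi> * chain_sum X f N \<omega>))) / var_S M X f N"

text \<open>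
  The Legendre transform of \<open>free_energy\<close>; it is meaningful only for \<open>\<eta>\<close> in the range of the
  derivative, where the maximizer \<open>\<xi>\<close> is unique.
\<close>

definition rate_function ::
    "'w measure \<Rightarrow> (nat \<Rightarrow> 'w \<Rightarrow> 'a) \<Rightarrow> (nat \<Rightarrow> 'a \<Rightarrow> 'a \<Rightarrow> real) \<Rightarrow> nat \<Rightarrow> real \<Rightarrow> real" where
  "rate_function M X f N \<eta> =
     (let \<xi> = (THE \<xi>. deriv (free_energy M X f N) \<xi> = \<eta>) in \<xi> * \<eta> - free_energy M X f N \<xi>)"

definition window ::
    "'w measure \<Rightarrow> (nat \<Rightarrow> 'w \<Rightarrow> 'a) \<Rightarrow> (nat \<Rightarrow> 'a \<Rightarrow> 'a \<Rightarrow> real) \<Rightarrow> real \<Rightarrow> nat \<Rightarrow> real set" where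
  "window M X f R N =
     {deriv (free_energy M X f N) (- R) - mean_S M X f N / var_S M X f N ..
      deriv (free_energy M X f N) R - mean_S M X f N / var_S M X f N}"

definition deviation ::
    "'w measure \<Rightarrow> (nat \<Rightarrow> 'w \<Rightarrow> 'a) \<Rightarrow> (nat \<Rightarrow> 'a \<Rightarrow> 'a \<Rightarrow> real) \<Rightarrow> nat \<Rightarrow> real \<Rightarrow> real" where
  "deviation M X f N z = (z - mean_S M X f N) / var_S M X f N"

definition ld_factor ::
    "'w measure \<Rightarrow> (nat \<Rightarrow> 'w \<Rightarrow> 'a) \<Rightarrow> (nat \<Rightarrow> 'a \<Rightarrow> 'a \<Rightarrow> real) \<Rightarrow> nat \<Rightarrow> real \<Rightarrow> real" where
  "ld_factor M X f N z =
     exp (- var_S M X f N * rate_function M X f N (z / var_S M X f N))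
       / sqrt (2 * pi * var_S M X f N)"

end

theory Submission
 imports Defs "HOL-Complex_Analysis.Complex_Analysis"
begin

text \<open>
Let \<open>Z N xi\<close> be the moment generating function of the partial sum. Two-step ellipticity gives a contraction over six steps:
twisting the kernels by \<open>exp (i th f)\<close> loses a factor governed by the mean squared circular size of the balance of \<open>f\<close>
around random hexagons, so the moment generating function at \<open>xi+i th\<close> is at most \<open>Z N xi * exp (-c * Dsum N th)\<close>,
where \<open>Dsum N th\<close> adds up these sizes. If \<open>Dsum N th\<close> stays bounded, then \<open>f\<close> differs by a center-tight
functional from one with values in the multiples of \<open>2 pi/th\<close>, which irreducibility excludes; otherwise it diverges,
uniformly on compact sets of \<open>th\<close>. The same gradient argument bounds the variance of the sum under the tilted law
from both sides by \<open>Dsum N th\<close> at a small angle. Since \<open>Z\<close> has no zeros near the real axis, a Borel-Caratheodory estimate controls the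
third derivative of its logarithm; with the decay away from \<open>0\<close> this yields a local limit theorem for the tilted chain.
Undoing the tilt gives the asymptotics, \<open>rho\<close> being the ratio of the moment generating functions from \<open>x\<close> and from the
initial law, corrected by the ratio of the standard deviations.
\<close>

\<comment> \<open>Kernels and state spaces vary with time, so spectral theory cannot be used.
  Tilting is instead a Doob transform of the kernels: the tilted chain is again elliptic, with the
  same \<open>mu\<close> and \<open>f\<close> and worse constants, so each estimate is proved once,
  untilted, and then instantiated. The hexagon balance is a natural invariant because it does not
  change when a gradient \<open>a(y)-a(x)\<close> or a constant is added to \<open>f\<close>.
  Conversely, a sampled trajectory serves as reference path; fixing one side of the hexagons along
  it turns the balance into an explicit gradient. Away from angle \<open>0\<close> the sums
  \<open>Dsum N th\<close> may diverge arbitrarily slowly compared with the variance, so decay of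
  the characteristic function at each angle cannot beat the normalisation by the standard deviation.
  Near-subadditivity of \<open>Dsum N\<close> in the angle gives a Gaussian profile around its
  minimum on every short interval, and integrating this profile supplies the missing factor. The law
  started at a point lives on another probability space; it is reached through \<open>W\<close>,
  which depends on the kernels only.\<close>
syntax "_NN" ::"pttrn => 'a measure => ennreal => ennreal" ("NN _|_. _" [0,110,60] 60)
translations "NN x|M. f" == "CONST nn_integral M (%x. f)"

notation LIMSEQ ("((_)/ ----> (_))" [60,60] 60)

abbreviation (input) bm where "bm \<equiv> borel_measurable"
abbreviation (input) Suc2 where "Suc2 n \<equiv> Suc (Suc n)"
abbreviation (input) Suc3 where "Suc3 n \<equiv> Suc (Suc (Suc n))"

lemmas LINT_cong = Bochner_Integration.integral_cong[OF refl]
 and LINT_add = Bochner_Integration.integral_add and LINT_diff = Bochner_Integration.integral_diff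
 and LINT_nonneg = Bochner_Integration.integral_nonneg and LINT_sum = Bochner_Integration.integral_sum
 and LINT_cnj = Bochner_Integration.integral_cnj
 and LINT_integrable_add = Bochner_Integration.integrable_add and LINT_integrable_diff = Bochner_Integration.integrable_diff
 and LINT_integrable_bound = Bochner_Integration.integrable_bound and LINT_integrable_sum = Bochner_Integration.integrable_sum
 and LINT_integrable_cong = Bochner_Integration.integrable_cong and LINT_integrable_cnj = Bochner_Integration.integrable_cnj

section \<open>Averages under probability measures\<close>

text \<open>No integrability is assumed: a non-integrable function has Bochner integral 0, and
  \<open>C\<close> is nonnegative because the space is nonempty.\<close>

lemma (in prob_space) norm_integral_le_bound:
 fixes u ::"'a => 'b::{banach,second_countable_topology}"
 assumes "!!x. x : space M ==> norm (u x)<=C"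
 shows "norm (integral\<^sup>L M u)<=C"
proof (cases "integrable M u")
 case True
 have "norm (integral\<^sup>L M u)<=(LINT x|M. norm (u x))"
 by (rule integral_norm_bound)
 also have "...<=(LINT x|M. C)"
 using True assms by (intro integral_mono) auto
 finally show ?thesis by (simp add:prob_space)
next
 case False
 obtain x where "x : space M" using not_empty by blast
 hence "0<=C" using assms norm_ge_zero order_trans by blast
 thus ?thesis using False by (simp add:not_integrable_integral_eq)
qed

text \<open>Both integrals are averages of \<open>u\<close>, so their difference is an average of
  differences \<open>u x-u y\<close>; only the diameter of the range enters, and complex values are
  covered.\<close>

lemma prob_integral_diff_le_diameter:
 fixes u ::"'a => 'b::{banach,second_countable_topology}"
 assumes A:"prob_space A" and A':"prob_space A'" and sets_eq:"sets A = sets A'"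
 and u[measurable]:"u : bm A"
 and D:"!!x y. x : space A ==> y : space A ==> norm (u x-u y)<=D"
 shows "norm (integral\<^sup>L A u-integral\<^sup>L A' u)<=D"
proof -
 interpret A: prob_space A by fact
 interpret A': prob_space A' by fact
 have sp:"space A = space A'" using sets_eq by (rule sets_eq_imp_space_eq)
 have u'[measurable]:"u : bm A'" using u sets_eq by (simp cong: measurable_cong_sets)
 obtain x0 where x0:"x0 : space A" using A.not_empty by blast
 have bd:"norm (u x)<=norm (u x0)+D" if "x : space A" for x
 using D[OF that x0] norm_triangle_sub[of "u x" "u x0"] by linarith
 have iA:"integrable A u"
 by (rule A.integrable_const_bound[where B = "norm (u x0)+D"]) (use bd in auto)
 have iA':"integrable A' u"
 by (rule A'.integrable_const_bound[where B = "norm (u x0)+D"]) (use bd sp in auto)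
 have 1:"norm (u x-integral\<^sup>L A' u)<=D" if x:"x : space A" for x
 proof -
 have "u x-integral\<^sup>L A' u = (LINT y|A'. u x-u y)"
 using iA' by (simp add:A'.prob_space)
 also have "norm ...<=D"
 by (rule A'.norm_integral_le_bound) (use D x sp in auto)
 finally show ?thesis .
 qed
 have "integral\<^sup>L A u-integral\<^sup>L A' u = (LINT x|A. u x-integral\<^sup>L A' u)"
 using iA by (simp add:A.prob_space)
 also have "norm ...<=D"
 by (rule A.norm_integral_le_bound) (use 1 in auto)
 finally show ?thesis .
qed

lemma (in sigma_finite_measure) borel_measurable_lebesgue_integral_section:
 "(%x. LINT y|M. u x y) : bm N"
 if "case_prod u : bm (N \<Otimes>\<^sub>M M)" for u ::"_ => _ => 'b::{banach,second_countable_topology}"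
 using that by (rule borel_measurable_lebesgue_integral)

section \<open>Transition kernels with bounded densities\<close>

text \<open>Time starts at 0 here; the given chain will enter with spaces \<open>B (Suc n)\<close>.
  The bounds on \<open>p\<close> hold at all arguments, also off the carriers (the density is set to
  0 there), which spares side conditions in the estimates below.\<close>

locale elliptic_kernels =
 fixes B mu ::"nat => 'a measure" and p ::"nat => 'a => 'a => real" and ep :: real
 assumes eps:"0 < ep" "ep < 1"
 and prob_mu:"!!n. prob_space (mu n)"
 and sets_mu [measurable_cong,simp]:"!!n. sets (mu n) = sets (B n)"
 and p_meas0:"!!n. (%(x,y). p n x y) : bm (B n \<Otimes>\<^sub>M B (Suc n))"
 and p_nonneg [simp]:"!!n x y. 0<=p n x y"
 and p_le:"!!n x y. p n x y<=1/ep"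
 and p_total:"!!n x. x : space (B n) ==> (LINT y|mu (Suc n). p n x y) = 1"
 and two_step:"!!n x z. x : space (B n) ==> z : space (B (Suc2 n)) ==>
 ep<=(LINT y|mu (Suc n). p n x y * p (Suc n) y z)"
begin

definition K ::"nat => 'a => 'a measure" where
 "K n x = density (mu (Suc n)) (%y. ennreal (p n x y))"

lemma space_mu [simp]:"space (mu n) = space (B n)"
 by (rule sets_eq_imp_space_eq) simp

lemma p_measurable [measurable (raw)]:
 "g : M \<rightarrow>\<^sub>M B n ==> h : M \<rightarrow>\<^sub>M B (Suc n) ==> (%om. p n (g om) (h om)) : bm M"
 using measurable_compose[OF measurable_Pair p_meas0,of g M n h] by simp

lemma sets_K [measurable_cong,simp]:"sets (K n x) = sets (B (Suc n))"
 and space_K [simp]:"space (K n x) = space (B (Suc n))"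
 by (simp_all add:K_def)

lemma finite_mu:"finite_measure (mu n)" and sigma_finite_mu:"sigma_finite_measure (mu n)"
 using prob_mu[of n] by (simp_all add:prob_space_def finite_measure_def prob_space_imp_sigma_finite)

lemma p_section [measurable]:"x : space (B n) ==> p n x : bm (B (Suc n))"
 using p_measurable[of "%_. x" "B (Suc n)" n "%y. y"] by simp

lemma integrable_mu:
 fixes u ::"'a => 'b::{banach,second_countable_topology}"
 assumes "u : bm (B n)" "!!x. x : space (B n) ==> norm (u x)<=C"
 shows "integrable (mu n) u"
 by (rule finite_measure.integrable_const_bound[OF finite_mu,where B = C]) (use assms in auto)

lemma prob_K:"x : space (B n) ==> prob_space (K n x)"
proof (rule prob_spaceI)
 assume x [measurable]:"x : space (B n)"
 have "emeasure (K n x) (space (K n x)) = (NN y|mu (Suc n). ennreal (p n x y))"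
 unfolding K_def by (subst emeasure_density) (auto intro!:nn_integral_cong simp:indicator_def)
 also have "... = ennreal (LINT y|mu (Suc n). p n x y)"
 by (rule nn_integral_eq_integral)
 (auto intro!:integrable_mu[where C = "1/ep"] simp:p_le)
 finally show "emeasure (K n x) (space (K n x)) = 1" using x by (simp add:p_total)
qed

lemma integral_K:
 fixes u ::"'a => 'b::{banach,second_countable_topology}"
 assumes [measurable]:"x : space (B n)" "u : bm (B (Suc n))"
 shows "(LINT y|K n x. u y) = (LINT y|mu (Suc n). p n x y *\<^sub>R u y)"
 unfolding K_def by (rule integral_density) auto

lemma nn_integral_K:
 assumes [measurable]:"x : space (B n)" "u : bm (B (Suc n))"
 shows "(NN y|K n x. u y) = (NN y|mu (Suc n). ennreal (p n x y) * u y)"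
 unfolding K_def by (rule nn_integral_density) auto

lemma integrable_K:
 fixes u ::"'a => 'b::{banach,second_countable_topology}"
 assumes "x : space (B n)" "u : bm (B (Suc n))"
 and "!!y. y : space (B (Suc n)) ==> norm (u y)<=C"
 shows "integrable (K n x) u"
proof -
 interpret prob_space "K n x" by (rule prob_K) fact
 show ?thesis
 by (rule integrable_const_bound[where B = C]) (use assms in auto)
qed

lemma norm_integral_K_le:
 fixes u ::"'a => 'b::{banach,second_countable_topology}"
 assumes "x : space (B n)" "!!y. y : space (B (Suc n)) ==> norm (u y)<=C"
 shows "norm (LINT y|K n x. u y)<=C"
 by (rule prob_space.norm_integral_le_bound[OF prob_K]) (use assms in auto)

lemma integral_K_measurable [measurable (raw)]:
 fixes u ::"_ => 'a => 'b::{banach,second_countable_topology}"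
 assumes [measurable]:"g : M \<rightarrow>\<^sub>M B n" "case_prod u : bm (M \<Otimes>\<^sub>M B (Suc n))"
 shows "(%om. LINT y|K n (g om). u om y) : bm M"
proof -
 interpret sigma_finite_measure "mu (Suc n)" by (rule sigma_finite_mu)
 have "(%om. LINT y|mu (Suc n). p n (g om) y *\<^sub>R u om y) : bm M"
 by measurable
 also have "?this \<longleftrightarrow> ?thesis"
 by (intro measurable_cong integral_K[symmetric]) (auto intro:measurable_space[OF assms(1)])
 finally show ?thesis .
qed

lemma nn_integral_K_measurable [measurable (raw)]:
 fixes u ::"_ => 'a => ennreal"
 assumes [measurable]:"g : M \<rightarrow>\<^sub>M B n" "case_prod u : bm (M \<Otimes>\<^sub>M B (Suc n))"
 shows "(%om. NN y|K n (g om). u om y) : bm M"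
proof -
 interpret sigma_finite_measure "mu (Suc n)" by (rule sigma_finite_mu)
 have "(%om. NN y|mu (Suc n). ennreal (p n (g om) y) * u om y) : bm M"
 by measurable
 also have "?this \<longleftrightarrow> ?thesis"
 by (intro measurable_cong nn_integral_K[symmetric]) (auto intro:measurable_space[OF assms(1)])
 finally show ?thesis .
qed

end

section \<open>Cancellation in means of unimodular functions\<close>

lemma cmod_diff_unimodular:
 fixes u v :: complex
 assumes "cmod u = 1" "cmod v = 1"
 shows "(cmod (u-v))^2 = 2-2 * Re (u * cnj v)"
proof -
 have "(cmod (u-v))^2 = (cmod u)^2+(cmod v)^2-2 * Re (u * cnj v)"
 unfolding cmod_power2 by (simp add:power2_eq_square algebra_simps)
 thus ?thesis using assms by simp
qed

text \<open>The variance identity for unit vectors: \<open>2-2 * Re (u y * cnj (u y'))\<close> is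
  the squared distance of \<open>u y\<close> and \<open>u y'\<close>, so the mean squared distance
  of two independent copies measures exactly how much is lost in the modulus of the mean.\<close>

lemma double_integral_unimodular:
 fixes u ::"'x => complex" and g ::"'x => real"
 assumes fin:"finite_measure rh"
 and [measurable]:"g : bm rh" "u : bm rh"
 and g:"!!y. y : space rh ==> abs (g y)<=C"
 and u:"!!y. y : space rh ==> cmod (u y) = 1"
 shows "(LINT y|rh. LINT y'|rh. g y * g y'*(2-2 * Re (u y * cnj (u y'))))
 = 2*((LINT y|rh. g y)^2-(cmod (LINT y|rh. g y * u y))^2)"
proof -
 interpret finite_measure rh by fact
 have ig:"integrable rh g"
 by (rule integrable_const_bound[where B = C]) (use g in auto)
 have ign:"integrable rh (%y. complex_of_real (g y) * u y)"
 by (rule integrable_const_bound[where B = C]) (use g u in \<open>auto simp:norm_mult\<close>)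
 let ?I = "LINT y|rh. complex_of_real (g y) * u y" and ?g = "LINT y|rh. g y"
 have 1:"(LINT y'|rh. g y * g y'*(2-2 * Re (u y * cnj (u y'))))
 = 2*?g * g y-2 * Re ((g y * u y) * cnj ?I)" for y
 proof -
 have eq:"g y * g y'*(2-2 * Re (u y * cnj (u y')))
 = 2 * g y * g y'-2 * Re ((g y * u y) * cnj (g y' * u y'))" for y'
 by (simp add:algebra_simps)
 have i2:"integrable rh (%y'. (g y * u y) * cnj (g y' * u y'))"
 by (intro integrable_mult_right LINT_integrable_cnj ign)
 have "(LINT y'|rh. Re ((g y * u y) * cnj (g y' * u y'))) = Re (LINT y'|rh. (g y * u y) * cnj (g y' * u y'))"
 using i2 by (rule integral_Re)
 also have "(LINT y'|rh. (g y * u y) * cnj (g y' * u y')) = (g y * u y) * cnj ?I"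
 unfolding integral_mult_right_zero by (subst LINT_cnj) (rule refl)
 finally show ?thesis
 unfolding eq using ig integrable_Re[OF i2]
 by (subst LINT_diff) (simp_all del: times_complex.simps complex_cnj_mult)
 qed
 have "(LINT y|rh. 2*?g * g y-2 * Re ((g y * u y) * cnj ?I))
 = 2*?g*?g-2 * Re (?I * cnj ?I)"
 proof -
 have i2:"integrable rh (%y. (g y * u y) * cnj ?I)"
 by (intro integrable_mult_left ign)
 have "(LINT y|rh. Re ((g y * u y) * cnj ?I)) = Re (?I * cnj ?I)"
 using integral_Re[OF i2] by (simp only: integral_mult_left_zero)
 thus ?thesis using ig integrable_Re[OF i2]
 by (subst LINT_diff) (simp_all del: times_complex.simps)
 qed
 also have "Re (?I * cnj ?I) = (cmod ?I)^2"
 by (simp only: complex_norm_square[symmetric] Re_complex_of_real)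
 finally show ?thesis unfolding 1 by (simp add:power2_eq_square)
qed

section \<open>Two-step Doeblin contraction\<close>

context elliptic_kernels
begin

text \<open>What remains of the two-step kernel after the part \<open>ep\<close> times
  \<open>mu (Suc2 n)\<close> has been split off, rescaled to mass 1.\<close>

definition doeblin ::"nat => 'a => 'a measure" where
 "doeblin n x = density (mu (Suc2 n))
 (%z. ennreal (((LINT y|mu (Suc n). p n x y * p (Suc n) y z)-ep)/(1-ep)))"

lemma integral_K_K:
 fixes u ::"'a => 'b::{banach,second_countable_topology}"
 assumes x [measurable]:"x : space (B n)" and [measurable]:"u : bm (B (Suc2 n))"
 and u:"!!z. z : space (B (Suc2 n)) ==> norm (u z)<=C"
 shows "(LINT y|K n x. (LINT z|K (Suc n) y. u z))
 = (LINT z|mu (Suc2 n). (LINT y|mu (Suc n). p n x y * p (Suc n) y z) *\<^sub>R u z)"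
proof -
 interpret A: prob_space "mu (Suc n)" by (rule prob_mu)
 interpret A': prob_space "mu (Suc2 n)" by (rule prob_mu)
 interpret AA: pair_prob_space "mu (Suc n)" "mu (Suc2 n)" ..
 have "(LINT y|K n x. (LINT z|K (Suc n) y. u z))
 = (LINT y|mu (Suc n). p n x y *\<^sub>R (LINT z|K (Suc n) y. u z))"
 by (rule integral_K) (auto intro:x)
 also have "... = (LINT y|mu (Suc n). (LINT z|mu (Suc2 n). (p n x y * p (Suc n) y z) *\<^sub>R u z))"
 by (intro LINT_cong) (auto simp:integral_K simp flip: scaleR_scaleR)
 also have "... = (LINT z|mu (Suc2 n). (LINT y|mu (Suc n). (p n x y * p (Suc n) y z) *\<^sub>R u z))"
 proof (rule AA.Fubini_integral[symmetric])
 show "integrable (mu (Suc n) \<Otimes>\<^sub>M mu (Suc2 n)) (%(y,z). (p n x y * p (Suc n) y z) *\<^sub>R u z)"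
 proof (rule AA.P.integrable_const_bound[where B = "(1/ep)*(1/ep) * C"])
 have "norm ((p n x y * p (Suc n) y z) *\<^sub>R u z)<=(1/ep)*(1/ep) * C"
 if "z : space (B (Suc2 n))" for y z
 unfolding norm_scaleR abs_mult
 by (intro mult_mono u that) (auto intro!:mult_nonneg_nonneg p_le less_imp_le eps(1))
 thus "AE q in mu (Suc n) \<Otimes>\<^sub>M mu (Suc2 n). norm (case q of (y,z) => (p n x y * p (Suc n) y z) *\<^sub>R u z)<=(1/ep)*(1/ep) * C"
 by (auto simp:space_pair_measure)
 qed measurable
 qed
 also have "... = (LINT z|mu (Suc2 n). (LINT y|mu (Suc n). p n x y * p (Suc n) y z) *\<^sub>R u z)"
 proof (intro LINT_cong integral_scaleR_left)
 fix z assume "z : space (mu (Suc2 n))"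
 hence [measurable]:"z : space (B (Suc2 n))" by simp
 have "norm (p n x y * p (Suc n) y z)<=(1/ep)*(1/ep)" for y
 unfolding norm_mult by (intro mult_mono) (auto intro!:p_le less_imp_le eps(1))
 thus "integrable (mu (Suc n)) (%y. p n x y * p (Suc n) y z)"
 by (intro integrable_mu[where C = "(1/ep)*(1/ep)"]) auto
 qed
 finally show ?thesis .
qed

lemma two_step_le: 
 assumes x [measurable]:"x : space (B n)" and z:"z : space (B (Suc2 n))"
 shows "(LINT y|mu (Suc n). p n x y * p (Suc n) y z)<=1/ep"
proof -
 have "(LINT y|mu (Suc n). p n x y * p (Suc n) y z) = (LINT y|K n x. p (Suc n) y z)"
 using z by (subst integral_K) (auto intro:x)
 also have "...<=1/ep"
 using norm_integral_K_le[OF x,of "%y. p (Suc n) y z" "1/ep"] p_le by auto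
 finally show ?thesis .
qed

lemma two_step_lower:
 assumes x [measurable]:"x : space (B n)" and [measurable]:"s : bm (B (Suc2 n))"
 and s:"!!z. z : space (B (Suc2 n)) ==> 0<=s z" "!!z. z : space (B (Suc2 n)) ==> s z<=C"
 shows "ep*(LINT z|mu (Suc2 n). s z)<=(LINT y|K n x. (LINT z|K (Suc n) y. s z))"
proof -
 interpret A: prob_space "mu (Suc n)" by (rule prob_mu)
 have m [measurable]:"(%z. LINT y|mu (Suc n). p n x y * p (Suc n) y z) : bm (B (Suc2 n))"
 by measurable
 have "ep*(LINT z|mu (Suc2 n). s z) = (LINT z|mu (Suc2 n). ep * s z)" by simp
 also have "...<=(LINT z|mu (Suc2 n). (LINT y|mu (Suc n). p n x y * p (Suc n) y z) * s z)"
 proof (rule integral_mono)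
 show "integrable (mu (Suc2 n)) (%z. ep * s z)"
 using s eps by (intro integrable_mu[where C = "ep * C"]) (auto simp:abs_mult)
 show "integrable (mu (Suc2 n)) (%z. (LINT y|mu (Suc n). p n x y * p (Suc n) y z) * s z)"
 proof (rule integrable_mu[where C = "(1/ep) * C"])
 fix z assume z:"z : space (B (Suc2 n))"
 have "0<=(LINT y|mu (Suc n). p n x y * p (Suc n) y z)" using two_step[OF x z] eps by linarith
 thus "norm ((LINT y|mu (Suc n). p n x y * p (Suc n) y z) * s z)<=(1/ep) * C"
 using two_step_le[OF x z] s[OF z] eps unfolding norm_mult by (intro mult_mono) auto
 qed measurable
 show "!!z. z : space (mu (Suc2 n)) ==> ep * s z<=(LINT y|mu (Suc n). p n x y * p (Suc n) y z) * s z"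
 using s two_step[OF x] by (intro mult_right_mono) auto
 qed
 also have "... = (LINT y|K n x. (LINT z|K (Suc n) y. s z))"
 by (subst integral_K_K[where C = C]) (use s x in auto)
 finally show ?thesis .
qed

lemma prob_doeblin:
 assumes x:"x : space (B n)"
 shows "prob_space (doeblin n x)"
proof (rule prob_spaceI)
 note [measurable] = x
 interpret A: prob_space "mu (Suc n)" by (rule prob_mu)
 interpret A': prob_space "mu (Suc2 n)" by (rule prob_mu)
 interpret P: prob_space "K n x" by (rule prob_K) fact
 let ?q = "%z. LINT y|mu (Suc n). p n x y * p (Suc n) y z"
 have [measurable]:"?q : bm (B (Suc2 n))" by measurable
 have iq:"integrable (mu (Suc2 n)) ?q"
 using two_step_le[OF x] two_step[OF x] eps
 by (intro integrable_mu[where C = "1/ep"]) (auto simp:abs_le_iff intro:order_trans[of _ 0] order_trans[of 0 ep])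
 have "(LINT z|mu (Suc2 n). ?q z) = (LINT y|K n x. (LINT z|K (Suc n) y. 1))"
 by (subst integral_K_K[where C = 1]) (auto intro:x)
 also have "... = (LINT y|K n x. 1)"
 proof (intro LINT_cong)
 fix y assume "y : space (K n x)"
 then interpret P': prob_space "K (Suc n) y" by (intro prob_K) auto
 show "(LINT z|K (Suc n) y. 1) = (1::real)" using P'.prob_space by simp
 qed
 also have "... = 1" using P.prob_space by simp
 finally have q1:"(LINT z|mu (Suc2 n). ?q z) = 1" .
 have "emeasure (doeblin n x) (space (doeblin n x)) = (NN z|mu (Suc2 n). ennreal ((?q z-ep)/(1-ep)))"
 unfolding doeblin_def by (subst emeasure_density) (auto intro!:nn_integral_cong simp:indicator_def)
 also have "... = ennreal (LINT z|mu (Suc2 n). (?q z-ep)/(1-ep))"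
 using iq eps two_step[OF x] by (intro nn_integral_eq_integral) auto
 also have "(LINT z|mu (Suc2 n). (?q z-ep)/(1-ep)) = 1"
 using iq eps q1 A'.prob_space by simp
 finally show "emeasure (doeblin n x) (space (doeblin n x)) = 1" by simp
qed

text \<open>Two steps are \<open>1-ep\<close> times \<open>doeblin\<close> plus \<open>ep\<close>
  times \<open>mu\<close>. The second part does not depend on the starting point and cancels; the
  first contributes at most \<open>1-ep\<close> times the diameter of the range of
  \<open>u\<close>.\<close>

lemma doeblin_contraction:
 fixes u ::"'a => 'b::{banach,second_countable_topology}"
 assumes x:"x : space (B n)" and x':"x' : space (B n)"
 and [measurable]:"u : bm (B (Suc2 n))"
 and D:"!!z z'. z : space (B (Suc2 n)) ==> z' : space (B (Suc2 n)) ==> norm (u z-u z')<=D"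
 shows "norm ((LINT y|K n x. (LINT z|K (Suc n) y. u z))-(LINT y|K n x'. (LINT z|K (Suc n) y. u z)))
<=(1-ep) * D"
proof -
 interpret A: prob_space "mu (Suc n)" by (rule prob_mu)
 interpret A': prob_space "mu (Suc2 n)" by (rule prob_mu)
 obtain z0 where z0:"z0 : space (B (Suc2 n))" using A'.not_empty by auto
 have bd:"norm (u z)<=norm (u z0)+D" if "z : space (B (Suc2 n))" for z
 using D[OF that z0] norm_triangle_sub[of "u z" "u z0"] by linarith
 have eq:"(LINT y|K n x. (LINT z|K (Suc n) y. u z)) = (1-ep) *\<^sub>R (LINT z|doeblin n x. u z)+ep *\<^sub>R (LINT z|mu (Suc2 n). u z)"
 if x:"x : space (B n)" for x
 proof -
 note [measurable] = x
 let ?q = "%z. LINT y|mu (Suc n). p n x y * p (Suc n) y z"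
 have [measurable]:"?q : bm (B (Suc2 n))" by measurable
 have ib:"integrable (mu (Suc2 n)) (%z. ?q z *\<^sub>R u z)"
 proof (rule integrable_mu[where C = "(1/ep)*(norm (u z0)+D)"])
 fix z assume z:"z : space (B (Suc2 n))"
 have "0<=?q z" using two_step[OF x z] eps by linarith
 thus "norm (?q z *\<^sub>R u z)<=(1/ep)*(norm (u z0)+D)"
 using two_step_le[OF x z] bd[OF z] eps unfolding norm_scaleR by (intro mult_mono) auto
 qed measurable
 have iu:"integrable (mu (Suc2 n)) u"
 by (rule integrable_mu[where C = "norm (u z0)+D"]) (use bd in auto)
 have "(1-ep) *\<^sub>R (LINT z|doeblin n x. u z) = (1-ep) *\<^sub>R (LINT z|mu (Suc2 n). ((?q z-ep)/(1-ep)) *\<^sub>R u z)"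
 unfolding doeblin_def using two_step[OF x] eps by (subst integral_density) auto
 also have "... = (LINT z|mu (Suc2 n). (1-ep) *\<^sub>R (((?q z-ep)/(1-ep)) *\<^sub>R u z))"
 by (rule integral_scaleR_right[symmetric])
 also have "... = (LINT z|mu (Suc2 n). ?q z *\<^sub>R u z-ep *\<^sub>R u z)"
 using eps by (intro LINT_cong) (simp add:scaleR_diff_left)
 also have "... = (LINT z|mu (Suc2 n). ?q z *\<^sub>R u z)-ep *\<^sub>R (LINT z|mu (Suc2 n). u z)"
 using ib iu by simp
 also have "(LINT z|mu (Suc2 n). ?q z *\<^sub>R u z) = (LINT y|K n x. (LINT z|K (Suc n) y. u z))"
 by (rule integral_K_K[symmetric,OF x _ bd]) auto
 finally show ?thesis by simp
 qed
 have "norm ((LINT z|doeblin n x. u z)-(LINT z|doeblin n x'. u z))<=D"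
 by (rule prob_integral_diff_le_diameter[OF prob_doeblin prob_doeblin])
 (use x x' D in \<open>auto simp:doeblin_def\<close>)
 thus ?thesis
 unfolding eq[OF x] eq[OF x'] using eps
 by (simp flip: scaleR_diff_right)
qed

end

section \<open>Moment generating functions by backward recursion\<close>

locale elliptic_functional = elliptic_kernels B mu p ep for B mu p ep +
 fixes f ::"nat => 'a => 'a => real" and L :: real
 assumes f_meas0:"!!n. (%(x,y). f n x y) : bm (B n \<Otimes>\<^sub>M B (Suc n))"
 and f_bound:"!!n x y. abs (f n x y)<=L"
 and L_pos:"0 < L"
begin

lemma f_measurable [measurable (raw)]:
 "g : M \<rightarrow>\<^sub>M B n ==> h : M \<rightarrow>\<^sub>M B (Suc n) ==> (%om. f n (g om) (h om)) : bm M"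
 using measurable_compose[OF measurable_Pair f_meas0,of g M n h] by simp

text \<open>\<open>W k n w x\<close> is the expectation of \<open>exp (w * s)\<close>, where
  \<open>s\<close> sums the \<open>k\<close> increments from time \<open>n\<close> of the chain at
  \<open>x\<close>. The recursion needs no process, and its polymorphic type lets the real and the
  complex case share their lemmas.\<close>

primrec W ::"nat => nat => 'b::{real_normed_field,banach,second_countable_topology} => 'a => 'b" where
 "W 0 = (%n w x. 1)"
| "W (Suc k) = (%n w x. LINT y|K n x. exp (w * of_real (f n x y)) * W k (Suc n) w y)"

lemma W_measurable [measurable]:"W k n w : bm (B n)"
 by (induction k arbitrary: n) simp_all

lemma norm_exp_f_le:"norm (exp (w * of_real (f n x y)))<=exp (norm w * L)"
 for w ::"'b::{real_normed_field,banach,second_countable_topology}"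
proof -
 have "norm (exp (w * of_real (f n x y)))<=exp (norm (w * of_real (f n x y) :: 'b))"
 by (rule norm_exp)
 also have "...<=exp (norm w * L)"
 using f_bound[of n x y] by (auto simp:norm_mult intro:mult_left_mono)
 finally show ?thesis .
qed

lemma norm_W_le:
 "x : space (B n) ==> norm (W k n w x)<=exp (norm w * L) ^ k"
proof (induction k arbitrary: n x)
 case (Suc k)
 have "norm (exp (w * of_real (f n x y)) * W k (Suc n) w y)<=exp (norm w * L) * exp (norm w * L) ^ k"
 if "y : space (B (Suc n))" for y
 unfolding norm_mult using that by (intro mult_mono norm_exp_f_le Suc.IH) auto
 thus ?case using Suc.prems by (auto intro!:norm_integral_K_le)
qed simp

definition step ::"real => nat => ('a => complex) => 'a => complex" where
 "step th n u x = (LINT y|K n x. cis (th * f n x y) * u y)"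

lemma step_measurable [measurable]:
 assumes [measurable]:"u : bm (B (Suc n))"
 shows "step th n u : bm (B n)"
 unfolding step_def[abs_def] cis_conv_exp by measurable

lemma norm_step_le:
 assumes "x : space (B n)" "!!y. y : space (B (Suc n)) ==> cmod (u y)<=C"
 shows "cmod (step th n u x)<=C"
 unfolding step_def using assms by (intro norm_integral_K_le) (auto simp:norm_mult)

lemma W_Suc_step:"W (Suc k) n (\<i> * of_real th) x = step th n (W k (Suc n) (\<i> * of_real th)) x"
 by (simp add:step_def cis_conv_exp mult.assoc)

section \<open>Hexagons and three-step operators\<close>

definition wt ::"nat => 'a => 'a => 'a => 'a => real" where
 "wt n x y z w = p n x y * p (Suc n) y z * p (Suc2 n) z w"

definition path_sum ::"nat => 'a => 'a => 'a => 'a => real" where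
 "path_sum n x y z w = f n x y+f (Suc n) y z+f (Suc2 n) z w"

lemma wt_measurable [measurable (raw)]:
 assumes [measurable]:"a : M \<rightarrow>\<^sub>M B n" "b : M \<rightarrow>\<^sub>M B (Suc n)" "c : M \<rightarrow>\<^sub>M B (Suc2 n)"
 "d : M \<rightarrow>\<^sub>M B (Suc3 n)"
 shows "(%om. wt n (a om) (b om) (c om) (d om)) : bm M"
 and path_sum_measurable [measurable (raw)]:"(%om. path_sum n (a om) (b om) (c om) (d om)) : bm M"
 unfolding wt_def path_sum_def by measurable

lemma wt_nonneg [simp]:"0<=wt n x y z w"
 by (simp add:wt_def)

lemma wt_le:"wt n x y z w<=1/ep ^ 3"
proof -
 have "wt n x y z w<=(1/ep)*(1/ep)*(1/ep)"
 unfolding wt_def using eps by (intro mult_mono p_le) (auto intro:p_le)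
 thus ?thesis by (simp add:power3_eq_cube)
qed

definition mid ::"nat => ('a \<times> 'a) measure" where
 "mid n = mu (Suc n) \<Otimes>\<^sub>M mu (Suc2 n)"

text \<open>A hexagon \<open>((x,w),(y,z),(y',z'))\<close> is a pair of three-step paths from
  \<open>x\<close> to \<open>w\<close>, one through \<open>y,z\<close> and one through
  \<open>y',z'\<close>. The points are independent with laws \<open>mu\<close>; the transition
  densities are kept apart in \<open>hexw\<close>.\<close>

definition hexM ::"nat => (('a \<times> 'a) \<times> ('a \<times> 'a) \<times> ('a \<times> 'a)) measure" where
 "hexM n = (mu n \<Otimes>\<^sub>M mu (Suc3 n)) \<Otimes>\<^sub>M (mid n \<Otimes>\<^sub>M mid n)"

definition hexw ::"nat => ('a \<times> 'a) \<times> ('a \<times> 'a) \<times> ('a \<times> 'a) => real" where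
 "hexw n h = wt n (fst (fst h)) (fst (fst (snd h))) (snd (fst (snd h))) (snd (fst h)) *
 wt n (fst (fst h)) (fst (snd (snd h))) (snd (snd (snd h))) (snd (fst h))"

definition balance ::"nat => ('a \<times> 'a) \<times> ('a \<times> 'a) \<times> ('a \<times> 'a) => real" where
 "balance n h = path_sum n (fst (fst h)) (fst (fst (snd h))) (snd (fst (snd h))) (snd (fst h)) -
 path_sum n (fst (fst h)) (fst (snd (snd h))) (snd (snd (snd h))) (snd (fst h))"

text \<open>\<open>2-2 * cos t\<close> is the squared distance of \<open>cis t\<close> from 1. Hence
  \<open>dsq n th\<close> measures how far the balance is, on average, from the multiples of
  \<open>2 pi/th\<close>. The weight \<open>hexw\<close> is not normalised to a probability
  density.\<close>

definition dsq ::"nat => real => real" where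
 "dsq n th = (LINT h|hexM n. hexw n h*(2-2 * cos (th * balance n h)))"

lemma sets_mid [measurable_cong]:"sets (mid n) = sets (B (Suc n) \<Otimes>\<^sub>M B (Suc2 n))"
 unfolding mid_def by (intro sets_pair_measure_cong) auto

lemma sets_hexM [measurable_cong]:"sets (hexM n) = sets ((B n \<Otimes>\<^sub>M B (Suc3 n)) \<Otimes>\<^sub>M
 ((B (Suc n) \<Otimes>\<^sub>M B (Suc2 n)) \<Otimes>\<^sub>M (B (Suc n) \<Otimes>\<^sub>M B (Suc2 n))))"
 unfolding hexM_def by (intro sets_pair_measure_cong sets_mid) auto

lemma hexw_measurable [measurable]:"hexw n : bm (hexM n)"
 and balance_measurable [measurable]:"balance n : bm (hexM n)"
 unfolding hexw_def[abs_def] balance_def[abs_def] by measurable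

lemma hexw_nonneg [simp]:"0<=hexw n h"
 by (simp add:hexw_def)

lemma hexw_le:"hexw n h<=(1/ep ^ 3)^2"
 unfolding hexw_def power2_eq_square by (intro mult_mono wt_le) (use eps in auto)

lemma balance_le:"abs (balance n h)<=6 * L"
proof -
 have *:"abs (path_sum n x y z w)<=3 * L" for x y z w
 unfolding path_sum_def using f_bound[of n x y] f_bound[of "Suc n" y z] f_bound[of "Suc2 n" z w] by linarith
 show ?thesis unfolding balance_def
 using *[of "fst (fst h)" "fst (fst (snd h))" "snd (fst (snd h))" "snd (fst h)"]
 *[of "fst (fst h)" "fst (snd (snd h))" "snd (snd (snd h))" "snd (fst h)"] by linarith
qed

lemma prob_pair:"prob_space A ==> prob_space A' ==> prob_space (A \<Otimes>\<^sub>M A')"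
 by (simp add:prob_space_pair)

lemma prob_mid:"prob_space (mid n)" and prob_hexM:"prob_space (hexM n)"
 unfolding hexM_def mid_def by (intro prob_pair prob_mu)+

lemma one_minus_cos_nonneg:"0<=2-2 * cos (t::real)" and one_minus_cos_le:"2-2 * cos (t::real)<=4"
 using cos_le_one[of t] cos_ge_minus_one[of t] by linarith+

lemma integrable_hex:
 assumes [measurable]:"g : bm (hexM n)" and "!!h. abs (g h)<=C"
 shows "integrable (hexM n) (%h. hexw n h * g h)"
proof -
 interpret prob_space "hexM n" by (rule prob_hexM)
 show ?thesis
 proof (rule integrable_const_bound[where B = "(1/ep ^ 3)^2 * C"])
 have "norm (hexw n h * g h)<=(1/ep ^ 3)^2 * C" for h
 unfolding norm_mult using assms(2)[of h] hexw_le[of n h] by (intro mult_mono) auto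
 thus "AE h in hexM n. norm (hexw n h * g h)<=(1/ep ^ 3)^2 * C" by auto
 qed measurable
qed

lemma integrable_dsq:"integrable (hexM n) (%h. hexw n h*(2-2 * cos (th * balance n h)))"
 using one_minus_cos_nonneg one_minus_cos_le by (intro integrable_hex[where C = 4]) auto

lemma dsq_nonneg [simp]:"0<=dsq n th"
 unfolding dsq_def using one_minus_cos_nonneg by (intro LINT_nonneg) auto

definition path_op ::"nat => real => 'a => 'a => complex" where
 "path_op n th x w = (LINT m|mid n. of_real (wt n x (fst m) (snd m) w) * cis (th * path_sum n x (fst m) (snd m) w))"

definition path_density ::"nat => 'a => 'a => real" where
 "path_density n x w = (LINT m|mid n. wt n x (fst m) (snd m) w)"

lemma path_op_measurable [measurable]: 
 "case_prod (path_op n th) : bm (B n \<Otimes>\<^sub>M B (Suc3 n))"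
 "case_prod (path_density n) : bm (B n \<Otimes>\<^sub>M B (Suc3 n))"
proof -
 interpret prob_space "mid n" by (rule prob_mid)
 show "case_prod (path_op n th) : bm (B n \<Otimes>\<^sub>M B (Suc3 n))"
 unfolding path_op_def[abs_def] cis_conv_exp by measurable
 show "case_prod (path_density n) : bm (B n \<Otimes>\<^sub>M B (Suc3 n))"
 unfolding path_density_def[abs_def] by measurable
qed

text \<open>For fixed endpoints the interior pairs of the two paths are independent copies, so
  \<open>double_integral_unimodular\<close> applies with \<open>g\<close> the path density and
  \<open>u\<close> the phase of the path.\<close>

lemma dsq_eq_path_op:
 "dsq n th = (LINT x|mu n. LINT w|mu (Suc3 n). 2*((path_density n x w)^2-(cmod (path_op n th x w))^2))"
proof -
 interpret M0: prob_space "mu n" by (rule prob_mu)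
 interpret M3: prob_space "mu (Suc3 n)" by (rule prob_mu)
 interpret m: prob_space "mid n" by (rule prob_mid)
 interpret P: pair_prob_space "mu n" "mu (Suc3 n)" ..
 interpret m: pair_prob_space "mid n" "mid n" ..
 interpret H: pair_prob_space "mu n \<Otimes>\<^sub>M mu (Suc3 n)" "mid n \<Otimes>\<^sub>M mid n" ..
 let ?g = "%h. hexw n h*(2-2 * cos (th * balance n h))"
 have bd:"norm (?g h)<=(1/ep ^ 3)^2*4" for h
 unfolding norm_mult using hexw_le[of n h] one_minus_cos_nonneg[of "th * balance n h"] one_minus_cos_le[of "th * balance n h"]
 by (intro mult_mono) auto
 note meas = integrable_dsq[of n th,THEN borel_measurable_integrable,unfolded hexM_def]
 have "dsq n th = (LINT e|(mu n \<Otimes>\<^sub>M mu (Suc3 n)). LINT m|(mid n \<Otimes>\<^sub>M mid n). ?g (e,m))"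
 unfolding dsq_def hexM_def
 by (rule H.integral_fst'[symmetric]) (use integrable_dsq[of n th] in \<open>simp add:hexM_def\<close>)
 also have "... = (LINT x|mu n. LINT w|mu (Suc3 n). LINT m|(mid n \<Otimes>\<^sub>M mid n). ?g ((x,w),m))"
 by (rule P.integral_fst'[symmetric])
 (rule H.integrable_fst',use integrable_dsq[of n th] in \<open>simp add:hexM_def\<close>)
 also have "... = (LINT x|mu n. LINT w|mu (Suc3 n). 2*((path_density n x w)^2-(cmod (path_op n th x w))^2))"
 proof (intro LINT_cong)
 fix x w assume "x : space (mu n)" "w : space (mu (Suc3 n))"
 hence [measurable]:"x : space (B n)" "w : space (B (Suc3 n))" by auto
 let ?wt = "%m. wt n x (fst m) (snd m) w" and ?u = "%m. cis (th * path_sum n x (fst m) (snd m) w)"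
 have [measurable]:"?u : bm (mid n)" unfolding cis_conv_exp by measurable
 have g:"?g ((x,w),m) = ?wt (fst m)*?wt (snd m)*(2-2 * Re (?u (fst m) * cnj (?u (snd m))))" for m
 by (simp add:hexw_def balance_def cis_cnj cis_mult right_diff_distrib)
 have "(LINT m|(mid n \<Otimes>\<^sub>M mid n). ?g ((x,w),m))
 = (LINT y|mid n. LINT y'|mid n. ?g ((x,w),y,y'))"
 proof (rule m.integral_fst'[symmetric],rule m.P.integrable_const_bound)
 show "AE m in mid n \<Otimes>\<^sub>M mid n. norm (?g ((x,w),m))<=(1/ep ^ 3)^2*4" using bd by auto
 show "(%m. ?g ((x,w),m)) : bm (mid n \<Otimes>\<^sub>M mid n)"
 unfolding hexw_def balance_def fst_conv snd_conv by measurable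
 qed
 also have "... = (LINT y|mid n. LINT y'|mid n. ?wt y*?wt y'*(2-2 * Re (?u y * cnj (?u y'))))"
 unfolding g by simp
 also have "... = 2*((LINT y|mid n. ?wt y)^2-(cmod (LINT y|mid n. ?wt y*?u y))^2)"
 by (rule double_integral_unimodular[where C = "1/ep ^ 3"]) (auto simp:wt_le intro:prob_space.axioms(1) prob_mid)
 finally show "(LINT m|(mid n \<Otimes>\<^sub>M mid n). ?g ((x,w),m)) = 2*((path_density n x w)^2-(cmod (path_op n th x w))^2)"
 by (simp add:path_density_def path_op_def)
 qed
 finally show ?thesis .
qed

lemma step3_eq_path_op:
 assumes x:"x : space (B n)" and [measurable]:"u : bm (B (Suc3 n))"
 and u:"!!w. w : space (B (Suc3 n)) ==> cmod (u w)<=C"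
 shows "step th n (step th (Suc n) (step th (Suc2 n) u)) x
 = (LINT w|mu (Suc3 n). path_op n th x w * u w)"
proof -
 note [measurable] = x
 interpret M1: prob_space "mu (Suc n)" by (rule prob_mu)
 interpret M2: prob_space "mu (Suc2 n)" by (rule prob_mu)
 interpret M3: prob_space "mu (Suc3 n)" by (rule prob_mu)
 interpret m: prob_space "mid n" by (rule prob_mid)
 interpret P: pair_prob_space "mu (Suc n)" "mu (Suc2 n)" ..
 interpret m3: pair_prob_space "mid n" "mu (Suc3 n)" ..
 let ?g = "%y z w. of_real (wt n x y z w) * cis (th * path_sum n x y z w) * u w"
 have bd:"norm (?g y z w)<=1/ep ^ 3 * C" if "w : space (B (Suc3 n))" for y z w
 proof -
 have "norm (?g y z w) = wt n x y z w * cmod (u w)" by (simp add:norm_mult)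
 also have "...<=1/ep ^ 3 * C"
 using eps by (intro mult_mono u that wt_le) auto
 finally show ?thesis .
 qed
 have i3:"integrable (mid n \<Otimes>\<^sub>M mu (Suc3 n)) (%(m,w). ?g (fst m) (snd m) w)"
 by (rule m3.P.integrable_const_bound[where B = "1/ep ^ 3 * C"])
 (use bd in \<open>auto simp:space_pair_measure cis_conv_exp\<close>)
 have "step th n (step th (Suc n) (step th (Suc2 n) u)) x
 = (LINT y|mu (Suc n). p n x y *\<^sub>R (cis (th * f n x y) * step th (Suc n) (step th (Suc2 n) u) y))"
 unfolding step_def[of th n] by (rule integral_K) (auto simp:cis_conv_exp x)
 also have "... = (LINT y|mu (Suc n). LINT z|mu (Suc2 n). LINT w|mu (Suc3 n). ?g y z w)"
 proof (intro LINT_cong)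
 fix y assume "y : space (mu (Suc n))"
 hence y [measurable]:"y : space (B (Suc n))" by simp
 have "step th (Suc n) (step th (Suc2 n) u) y
 = (LINT z|mu (Suc2 n). p (Suc n) y z *\<^sub>R (cis (th * f (Suc n) y z) * step th (Suc2 n) u z))"
 unfolding step_def[of th "Suc n"] by (rule integral_K) (auto simp:cis_conv_exp y)
 also have "p n x y *\<^sub>R (cis (th * f n x y)*...)
 = (LINT z|mu (Suc2 n). p n x y *\<^sub>R (cis (th * f n x y)*(p (Suc n) y z *\<^sub>R (cis (th * f (Suc n) y z) * step th (Suc2 n) u z))))"
 by (simp only: integral_scaleR_right integral_mult_right_zero)
 also have "... = (LINT z|mu (Suc2 n). LINT w|mu (Suc3 n). ?g y z w)"
 proof (intro LINT_cong)
 fix z assume "z : space (mu (Suc2 n))"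
 hence z [measurable]:"z : space (B (Suc2 n))" by simp
 have "step th (Suc2 n) u z
 = (LINT w|mu (Suc3 n). p (Suc2 n) z w *\<^sub>R (cis (th * f (Suc2 n) z w) * u w))"
 unfolding step_def by (rule integral_K) (auto simp:cis_conv_exp z)
 also have "p n x y *\<^sub>R (cis (th * f n x y)*(p (Suc n) y z *\<^sub>R (cis (th * f (Suc n) y z)*...)))
 = (LINT w|mu (Suc3 n). p n x y *\<^sub>R (cis (th * f n x y)*(p (Suc n) y z *\<^sub>R (cis (th * f (Suc n) y z)*(p (Suc2 n) z w *\<^sub>R (cis (th * f (Suc2 n) z w) * u w))))))"
 by (simp only: integral_scaleR_right integral_mult_right_zero)
 also have "... = (LINT w|mu (Suc3 n). ?g y z w)"
 by (intro LINT_cong)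
 (simp add:wt_def path_sum_def scaleR_conv_of_real distrib_left mult_ac flip: cis_mult)
 finally show "p n x y *\<^sub>R (cis (th * f n x y)*(p (Suc n) y z *\<^sub>R (cis (th * f (Suc n) y z) * step th (Suc2 n) u z))) = ..." .
 qed
 finally show "p n x y *\<^sub>R (cis (th * f n x y) * step th (Suc n) (step th (Suc2 n) u) y) = ..." .
 qed
 also have "... = (LINT m|mid n. LINT w|mu (Suc3 n). ?g (fst m) (snd m) w)"
 proof -
 have "integrable (mu (Suc n) \<Otimes>\<^sub>M mu (Suc2 n)) (%m. LINT w|mu (Suc3 n). ?g (fst m) (snd m) w)"
 using m3.integrable_fst'[OF i3] by (simp add:mid_def split_beta')
 from P.integral_fst'[OF this] show ?thesis by (simp add:mid_def)
 qed
 also have "... = (LINT w|mu (Suc3 n). LINT m|mid n. ?g (fst m) (snd m) w)"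
 by (rule m3.Fubini_integral[symmetric,OF i3])
 also have "... = (LINT w|mu (Suc3 n). path_op n th x w * u w)"
 unfolding path_op_def by simp
 finally show ?thesis .
qed

end

section \<open>Contraction over six steps\<close>

context elliptic_functional
begin

lemma path_op_measurable2 [measurable (raw)]:
 assumes g:"g : M \<rightarrow>\<^sub>M B n" and h:"h : M \<rightarrow>\<^sub>M B (Suc3 n)"
 shows "(%om. path_op n th (g om) (h om)) : bm M"
 and "(%om. path_density n (g om) (h om)) : bm M"
 using measurable_compose[OF measurable_Pair path_op_measurable(1),OF g h]
 measurable_compose[OF measurable_Pair path_op_measurable(2),OF g h] by simp_all

lemma norm_path_op_le:
 assumes [measurable]:"x : space (B n)" "w : space (B (Suc3 n))"
 shows "cmod (path_op n th x w)<=path_density n x w"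
 unfolding path_op_def path_density_def
 using integral_norm_bound[of "mid n" "%m. of_real (wt n x (fst m) (snd m) w) * cis (th * path_sum n x (fst m) (snd m) w)"]
 by (simp add:norm_mult)

lemma path_density_le:
 assumes x:"x : space (B n)" and w:"w : space (B (Suc3 n))"
 shows "path_density n x w<=1/ep"
proof -
 note [measurable] = x w
 interpret M1: prob_space "mu (Suc n)" by (rule prob_mu)
 interpret M2: prob_space "mu (Suc2 n)" by (rule prob_mu)
 interpret m: prob_space "mid n" by (rule prob_mid)
 interpret P: pair_prob_space "mu (Suc n)" "mu (Suc2 n)" ..
 have "integrable (mid n) (%m. wt n x (fst m) (snd m) w)"
 by (rule m.integrable_const_bound[where B = "1/ep ^ 3"]) (auto simp:wt_le)
 from P.integral_fst'[OF this[unfolded mid_def]]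
 have "path_density n x w = (LINT y|mu (Suc n). LINT z|mu (Suc2 n). p n x y *\<^sub>R (p (Suc n) y z *\<^sub>R p (Suc2 n) z w))"
 by (simp add:path_density_def mid_def wt_def mult_ac)
 also have "... = (LINT y|mu (Suc n). p n x y *\<^sub>R (LINT z|mu (Suc2 n). p (Suc n) y z *\<^sub>R p (Suc2 n) z w))"
 by simp
 also have "... = (LINT y|mu (Suc n). p n x y *\<^sub>R (LINT z|K (Suc n) y. p (Suc2 n) z w))"
 by (intro LINT_cong) (simp add:integral_K)
 also have "... = (LINT y|K n x. LINT z|K (Suc n) y. p (Suc2 n) z w)"
 using x by (simp add:integral_K)
 also have "norm ...<=1/ep"
 by (intro norm_integral_K_le x) (auto simp:p_le)
 finally show ?thesis by simp
qed

lemma path_density_nonneg:"0<=path_density n x w"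
 unfolding path_density_def by simp

lemma integral_path_density:
 assumes x:"x : space (B n)"
 shows "(LINT w|mu (Suc3 n). path_density n x w) = 1"
proof -
 have one:"step 0 n (%y. 1) x = 1" if "x : space (B n)" for n x
 using prob_space.prob_space[OF prob_K[OF that]] by (simp add:step_def)
 have cong:"step 0 n u x = 1" if "x : space (B n)" "!!y. y : space (B (Suc n)) ==> u y = 1" for n u x
 proof -
 have "step 0 n u x = step 0 n (%y. 1) x"
 unfolding step_def by (intro LINT_cong) (use that in auto)
 thus ?thesis using one[OF that(1)] by simp
 qed
 \<comment> \<open>At angle 0 the operator \<open>step\<close> is the Markov operator itself, so the
   total mass of the three-step density is read off from the constant function 1.\<close>
 have "of_real (LINT w|mu (Suc3 n). path_density n x w) = (LINT w|mu (Suc3 n). path_op n 0 x w*1)"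
 by (simp add:path_op_def path_density_def flip: integral_complex_of_real)
 also have "... = step 0 n (step 0 (Suc n) (step 0 (Suc2 n) (%w. 1))) x"
 by (rule step3_eq_path_op[symmetric,OF x,where C = 1]) auto
 also have "... = 1"
 using x by (intro cong one) auto
 finally show ?thesis by (simp only: of_real_eq_1_iff)
qed

definition defect ::"nat => real => 'a => real" where
 "defect n th x = (LINT w|mu (Suc3 n). path_density n x w-cmod (path_op n th x w))"

lemma integrable_path:
 assumes x [measurable]:"x : space (B n)"
 shows "integrable (mu (Suc3 n)) (path_density n x)"
 and "integrable (mu (Suc3 n)) (%w. cmod (path_op n th x w))"
 and "integrable (mu (Suc3 n)) (%w. (path_density n x w)^2-(cmod (path_op n th x w))^2)"
proof -
 have "path_density n x : bm (B (Suc3 n))"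
 by measurable
 moreover have "norm (path_density n x w)<=1/ep" if "w : space (B (Suc3 n))" for w
 using path_density_le[OF x that] path_density_nonneg[of n x w] by simp
 ultimately show "integrable (mu (Suc3 n)) (path_density n x)"
 by (rule integrable_mu)
 have "norm (cmod (path_op n th x w))<=1/ep" if "w : space (B (Suc3 n))" for w
 using order_trans[OF norm_path_op_le[OF x that] path_density_le[OF x that]] by simp
 thus "integrable (mu (Suc3 n)) (%w. cmod (path_op n th x w))"
 by (intro integrable_mu[where C = "1/ep"]) auto
 have "norm ((path_density n x w)^2-(cmod (path_op n th x w))^2)<=(1/ep)^2" if "w : space (B (Suc3 n))" for w
 proof -
 have "(cmod (path_op n th x w))^2<=(path_density n x w)^2" "(path_density n x w)^2<=(1/ep)^2"
 using path_density_le[OF x that] norm_path_op_le[OF x that] path_density_nonneg[of n x w]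
 by (auto intro:power_mono)
 thus ?thesis unfolding real_norm_def using zero_le_power2[of "cmod (path_op n th x w)"] by linarith
 qed
 thus "integrable (mu (Suc3 n)) (%w. (path_density n x w)^2-(cmod (path_op n th x w))^2)"
 by (intro integrable_mu[where C = "(1/ep)^2"]) auto
qed

lemma defect_measurable [measurable]:"defect n th : bm (B n)"
proof -
 interpret prob_space "mu (Suc3 n)" by (rule prob_mu)
 show ?thesis unfolding defect_def[abs_def] by measurable
qed

lemma defect_nonneg:"x : space (B n) ==> 0<=defect n th x"
 and defect_le_1:"x : space (B n) ==> defect n th x<=1"
proof -
 assume x:"x : space (B n)"
 show "0<=defect n th x"
 unfolding defect_def using norm_path_op_le[OF x] by (intro LINT_nonneg) auto
 have "defect n th x<=(LINT w|mu (Suc3 n). path_density n x w)"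
 unfolding defect_def using integrable_path[OF x] by (intro integral_mono) auto
 thus "defect n th x<=1" using integral_path_density[OF x] by simp
qed

text \<open>With \<open>q\<close> the path density and \<open>T\<close> the modulus of
  \<open>path_op\<close>, \<open>q^2-T^2\<close> equals \<open>(q+T)*(q-T)\<close> and is at most
  \<open>(2/ep)*(q-T)\<close>, since both are bounded by \<open>1/ep\<close>. The factor 2 in
  \<open>dsq_eq_path_op\<close> turns \<open>ep/2\<close> into \<open>ep/4\<close>.\<close>

lemma dsq_le_integral_defect:"(ep/4) * dsq n th<=(LINT x|mu n. defect n th x)"
proof -
 interpret M3: prob_space "mu (Suc3 n)" by (rule prob_mu)
 let ?r = "%x w. (path_density n x w)^2-(cmod (path_op n th x w))^2"
 have pw:"(ep/2)*?r x w<=path_density n x w-cmod (path_op n th x w)"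
 if x:"x : space (B n)" and w:"w : space (B (Suc3 n))" for x w
 proof -
 let ?q = "path_density n x w" and ?T = "cmod (path_op n th x w)"
 have "ep/2*(?q+?T)<=ep/2*(2/ep)"
 using path_density_le[OF x w] norm_path_op_le[OF x w,of th] eps by (intro mult_left_mono) auto
 hence "(ep/2*(?q+?T))*(?q-?T)<=1*(?q-?T)"
 using norm_path_op_le[OF x w,of th] eps by (intro mult_right_mono) auto
 thus ?thesis by (simp add:power2_eq_square algebra_simps)
 qed
 have in_le:"(ep/4)*(LINT w|mu (Suc3 n). 2*?r x w)<=defect n th x" if x:"x : space (B n)" for x
 proof -
 have "(ep/4)*(LINT w|mu (Suc3 n). 2*?r x w) = (LINT w|mu (Suc3 n). (ep/2)*?r x w)"
 unfolding integral_mult_right_zero by simp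
 also have "...<=defect n th x"
 unfolding defect_def using integrable_path[OF x] pw[OF x] by (intro integral_mono) auto
 finally show ?thesis .
 qed
 have "(ep/4) * dsq n th = (LINT x|mu n. (ep/4)*(LINT w|mu (Suc3 n). 2*?r x w))"
 unfolding dsq_eq_path_op by simp
 also have "...<=(LINT x|mu n. defect n th x)"
 proof (rule integral_mono)
 show "integrable (mu n) (defect n th)"
 using defect_nonneg defect_le_1 by (intro integrable_mu[where C = 1]) auto
 have nn:"0<=(LINT w|mu (Suc3 n). 2*?r x w)" if "x : space (B n)" for x
 using norm_path_op_le[OF that] by (intro LINT_nonneg) (auto intro!:power_mono)
 show "integrable (mu n) (%x. (ep/4)*(LINT w|mu (Suc3 n). 2*?r x w))"
 proof (rule integrable_mu[where C = 1])
 fix x assume x:"x : space (B n)"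
 have "0<=(ep/4)*(LINT w|mu (Suc3 n). 2*?r x w)"
 using nn[OF x] eps by simp
 thus "norm ((ep/4)*(LINT w|mu (Suc3 n). 2*?r x w))<=1"
 using in_le[OF x] defect_le_1[OF x,of th] unfolding real_norm_def by linarith
 qed measurable
 show "!!x. x : space (mu n) ==> (ep/4)*(LINT w|mu (Suc3 n). 2*?r x w)<=defect n th x"
 using in_le by simp
 qed
 finally show ?thesis .
qed

lemma norm_step3_le:
 assumes x:"x : space (B n)" and [measurable]:"u : bm (B (Suc3 n))"
 and u:"!!w. w : space (B (Suc3 n)) ==> cmod (u w)<=C"
 shows "cmod (step th n (step th (Suc n) (step th (Suc2 n) u)) x)<=C*(1-defect n th x)"
proof -
 note [measurable] = x
 interpret M3: prob_space "mu (Suc3 n)" by (rule prob_mu)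
 obtain w0 where "w0 : space (B (Suc3 n))" using M3.not_empty by auto
 hence C:"0<=C" using u norm_ge_zero order_trans by blast
 have "cmod (step th n (step th (Suc n) (step th (Suc2 n) u)) x)
<=(LINT w|mu (Suc3 n). cmod (path_op n th x w * u w))"
 by (subst step3_eq_path_op[where C = C]) (use x u in auto)
 also have "...<=(LINT w|mu (Suc3 n). cmod (path_op n th x w) * C)"
 proof (rule integral_mono)
 have "path_op n th x : bm (mu (Suc3 n))" by measurable
 thus "integrable (mu (Suc3 n)) (%w. cmod (path_op n th x w * u w))"
 using integrable_path(2)[OF x,of th] u C
 by (intro LINT_integrable_bound[OF integrable_mult_left[OF integrable_path(2)[OF x,of th],of C]])
 (auto simp:norm_mult intro!:AE_I2 mult_left_mono)
 show "integrable (mu (Suc3 n)) (%w. cmod (path_op n th x w) * C)"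
 using integrable_path(2)[OF x] by auto
 qed (use u in \<open>auto simp:norm_mult intro!:mult_left_mono\<close>)
 also have "... = C*(1-defect n th x)"
 unfolding defect_def using integrable_path[OF x] by (simp add:integral_path_density[OF x])
 finally show ?thesis .
qed

text \<open>The last three steps lose \<open>defect\<close> at the state of time \<open>n+3\<close>.
  The defect may vanish at particular states, but the two steps before them spread the chain over at
  least \<open>ep\<close> times \<open>mu\<close>, so on average \<open>ep\<close> times the
  integrated defect is lost, hence \<open>ep * (ep/4) * dsq\<close>.\<close>

lemma norm_step6_le:
 assumes x:"x : space (B n)" and [measurable]:"u : bm (B (Suc (Suc (Suc (Suc3 n)))))"
 and u:"!!w. w : space (B (Suc (Suc (Suc (Suc3 n))))) ==> cmod (u w)<=C"
 shows "cmod (step th n (step th (Suc n) (step th (Suc2 n) (step th (Suc3 n) (step th (Suc (Suc3 n)) (step th (Suc (Suc (Suc3 n))) u))))) x)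
<=(1-ep^2/4 * dsq (Suc3 n) th) * C"
proof -
 interpret M6: prob_space "mu (Suc (Suc (Suc (Suc3 n))))" by (rule prob_mu)
 obtain w0 where "w0 : space (B (Suc (Suc (Suc (Suc3 n)))))" using M6.not_empty by auto
 hence C:"0<=C" using u norm_ge_zero order_trans by blast
 define G where "G = step th (Suc3 n) (step th (Suc (Suc3 n)) (step th (Suc (Suc (Suc3 n))) u))"
 have G_meas [measurable]:"G : bm (B (Suc3 n))"
 proof -
 have "step th (Suc (Suc (Suc3 n))) u : bm (B (Suc (Suc (Suc3 n))))" by (rule step_measurable) (simp)
 hence "step th (Suc (Suc3 n)) (step th (Suc (Suc (Suc3 n))) u) : bm (B (Suc (Suc3 n)))" by (intro step_measurable) (simp)
 thus ?thesis unfolding G_def by (intro step_measurable) (simp)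
 qed
 have G:"cmod (G y)<=C*(1-defect (Suc3 n) th y)" if "y : space (B (Suc3 n))" for y
 using norm_step3_le[of y "Suc3 n" u C th] that u unfolding G_def by simp
 let ?s = "defect (Suc3 n) th"
 have s_int:"0<=(LINT z|K (Suc2 n) y. ?s z)" "(LINT z|K (Suc2 n) y. ?s z)<=1" 
 if y:"y : space (B (Suc2 n))" for y
 proof -
 show "0<=(LINT z|K (Suc2 n) y. ?s z)"
 by (intro LINT_nonneg) (auto intro!:defect_nonneg)
 have "norm (LINT z|K (Suc2 n) y. ?s z)<=1"
 using defect_nonneg[of _ "Suc3 n" th] defect_le_1[of _ "Suc3 n" th]
 by (intro norm_integral_K_le that) (auto)
 thus "(LINT z|K (Suc2 n) y. ?s z)<=1" by simp
 qed
 have one:"cmod (step th (Suc2 n) G y)<=C*(1-(LINT z|K (Suc2 n) y. ?s z))" if y:"y : space (B (Suc2 n))" for y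
 proof -
 note [measurable] = y
 interpret P: prob_space "K (Suc2 n) y" by (rule prob_K) fact
 have ints:"integrable (K (Suc2 n) y) ?s"
 using defect_nonneg defect_le_1 y
 by (intro integrable_K[where C = 1]) (auto)
 have "cmod (step th (Suc2 n) G y)<=(LINT z|K (Suc2 n) y. cmod (cis (th * f (Suc2 n) y z) * G z))"
 unfolding step_def by (rule integral_norm_bound)
 also have "...<=(LINT z|K (Suc2 n) y. C*(1-?s z))"
 proof (rule integral_mono_AE')
 show "integrable (K (Suc2 n) y) (%z. C*(1-?s z))" using ints by simp
 qed (use G C defect_le_1 in \<open>auto simp:norm_mult intro!:AE_I2 mult_nonneg_nonneg\<close>)
 also have "... = C*(1-(LINT z|K (Suc2 n) y. ?s z))"
 using ints P.prob_space by simp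
 finally show ?thesis .
 qed
 have two:"cmod (step th (Suc n) (step th (Suc2 n) G) y)<=(1-ep^2/4 * dsq (Suc3 n) th) * C"
 if y:"y : space (B (Suc n))" for y
 proof -
 note [measurable] = y
 interpret P: prob_space "K (Suc n) y" by (rule prob_K) fact
 let ?t = "%z. LINT z'|K (Suc2 n) z. ?s z'"
 have [measurable]:"?t : bm (B (Suc2 n))"
 by (rule integral_K_measurable) (simp_all)
 have it:"integrable (K (Suc n) y) ?t"
 using s_int y by (intro integrable_K[where C = 1]) (auto)
 have "cmod (step th (Suc n) (step th (Suc2 n) G) y)<=(LINT z|K (Suc n) y. cmod (cis (th * f (Suc n) y z) * step th (Suc2 n) G z))"
 unfolding step_def[of th "Suc n"] by (rule integral_norm_bound)
 also have "...<=(LINT z|K (Suc n) y. C*(1-?t z))"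
 proof (rule integral_mono_AE')
 show "integrable (K (Suc n) y) (%z. C*(1-?t z))" using it by simp
 qed (use one C s_int in \<open>auto simp:norm_mult intro!:AE_I2 mult_nonneg_nonneg\<close>)
 also have "... = C*(1-(LINT z|K (Suc n) y. ?t z))"
 using it P.prob_space by simp
 also have "...<=C*(1-ep*((ep/4) * dsq (Suc3 n) th))"
 proof (intro mult_left_mono diff_left_mono C)
 have "ep*((ep/4) * dsq (Suc3 n) th)<=ep*(LINT x|mu (Suc3 n). ?s x)"
 using eps by (intro mult_left_mono dsq_le_integral_defect) auto
 also have "...<=(LINT z|K (Suc n) y. ?t z)"
 using two_step_lower[of y "Suc n" ?s 1] y defect_nonneg defect_le_1 by (simp)
 finally show "ep*((ep/4) * dsq (Suc3 n) th)<=(LINT z|K (Suc n) y. ?t z)" .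
 qed
 also have "... = (1-ep^2/4 * dsq (Suc3 n) th) * C" by (simp add:power2_eq_square)
 finally show ?thesis .
 qed
 \<comment> \<open>The first of the six steps only serves to arrive at time \<open>Suc n\<close>; it
   is bounded without gain.\<close>
 show ?thesis
 unfolding G_def[symmetric] by (rule norm_step_le[OF x two])
qed

text \<open>A hexagon at \<open>i\<close> gains only if three steps precede it and the three steps
  that it spans fit before \<open>N\<close>. For \<open>N < 6\<close> the range is empty, also under
  truncated subtraction.\<close>

definition Dsum ::"nat => real => real" where
 "Dsum N th = (\<Sum>i\<in>{3..N-3}. dsq i th)"

lemma norm_W_le_1:"x : space (B n) ==> cmod (W k n (\<i> * of_real th) x)<=1"
proof (induction k arbitrary: n x)
 case (Suc k)
 thus ?case unfolding W_Suc_step by (intro norm_step_le) auto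
qed simp

text \<open>Time is cut into consecutive blocks of six steps starting at \<open>n\<close>; the
  hexagon of each block sits three steps after its beginning, which fixes the residue class modulo
  6. Each block gives a factor \<open>1-t\<close>, at most \<open>exp (- t)\<close>.\<close>

lemma norm_W_le_class:
 "x : space (B n) ==>
 cmod (W k n (\<i> * of_real th) x)
<=exp (- (ep^2/4)*(\<Sum>i | n+3<=i & i+3<=n+k & i mod 6 = (n+3) mod 6. dsq i th))"
proof (induction k arbitrary: n x rule: less_induct)
 case (less k)
 let ?I = "%n k. {i. n+3<=i & i+3<=n+k & i mod 6 = (n+3) mod 6}"
 show ?case
 proof (cases "k < 6")
 case True
 hence "?I n k = {}" by auto
 hence "(\<Sum>i\<in>?I n k. dsq i th) = 0" by (simp only: sum.empty)
 thus ?thesis using norm_W_le_1[OF less.prems] by simp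
 next
 case False
 then obtain j where k:"k = j+6" by (metis le_add_diff_inverse2 not_less)
 have fin:"finite (?I (n+6) j)"
 by (rule finite_subset[of _ "{.. n+6+j}"]) auto
 have "i = n+3 \<or> n+6+3<=i" if "n+3<=i" "i mod 6 = (n+3) mod 6" for i
 proof -
 have "6 dvd i-(n+3)" using that by (simp add:mod_eq_dvd_iff_nat)
 then obtain c where "i-(n+3) = 6 * c" by (rule dvdE)
 thus ?thesis using that by (cases c) auto
 qed
 moreover have "(n+6+3) mod 6 = (n+3) mod 6" by presburger
 ultimately have I:"?I n k = insert (n+3) (?I (n+6) j)"
 by (auto simp:k)
 have sum:"(\<Sum>i\<in>?I n k. dsq i th) = dsq (n+3) th+(\<Sum>i\<in>?I (n+6) j. dsq i th)"
 unfolding I using fin by (subst sum.insert) auto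
 let ?C = "exp (- (ep^2/4)*(\<Sum>i\<in>?I (n+6) j. dsq i th))"
 have j6:"j+6 = Suc (Suc (Suc (Suc3 j)))" by simp
 have n6:"n+6 = Suc (Suc (Suc (Suc3 n)))" "n+3 = Suc3 n" by simp_all
 have "cmod (W k n (\<i> * of_real th) x)<=(1-ep^2/4 * dsq (n+3) th)*?C"
 proof -
 have fold:"W (Suc k) n (\<i> * of_real th) = step th n (W k (Suc n) (\<i> * of_real th))" for k n
 by (rule ext) (rule W_Suc_step)
 have "j < k" using k by simp
 note IH = less.IH[OF this,of _ "n+6"]
 show ?thesis
 unfolding k j6 fold using norm_step6_le[OF less.prems W_measurable IH[unfolded n6(1)]] unfolding n6 by simp
 qed
 also have "...<=exp (- (ep^2/4 * dsq (n+3) th))*?C"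
 using exp_ge_add_one_self[of "- (ep^2/4 * dsq (n+3) th)"] by (intro mult_right_mono) auto
 also have "... = exp (- (ep^2/4)*(\<Sum>i\<in>?I n k. dsq i th))"
 unfolding sum by (simp add:distrib_left flip: exp_add)
 finally show ?thesis .
 qed
qed

text \<open>Discarding the first \<open>r\<close> steps, which do not increase the modulus, moves
  the blocks to any desired residue.\<close>

lemma norm_W_le_residue:
 assumes r:"r<=N" and x:"x : space (B 0)"
 shows "cmod (W N 0 (\<i> * of_real th) x)
<=exp (- (ep^2/4)*(\<Sum>i | r+3<=i & i+3<=N & i mod 6 = (r+3) mod 6. dsq i th))"
proof -
 let ?E = "exp (- (ep^2/4)*(\<Sum>i | r+3<=i & i+3<=N & i mod 6 = (r+3) mod 6. dsq i th))"
 have "n<=r ==> x : space (B n) ==> cmod (W (N-n) n (\<i> * of_real th) x)<=?E" for n x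
 proof (induction "r-n" arbitrary: n x)
 case 0
 thus ?case using norm_W_le_class[of x n "N-n" th] r by simp
 next
 case (Suc d)
 have N:"N-n = Suc (N-Suc n)" using Suc.hyps(2) r by simp
 show ?case unfolding N W_Suc_step
 using Suc by (intro norm_step_le Suc.hyps(1)) auto
 qed
 from this[of 0 x] show ?thesis using x by simp
qed

text \<open>The six-step contraction uses every sixth hexagon; averaging over residues recovers them all.\<close>

lemma norm_W_le_exp_Dsum:
 assumes x:"x : space (B 0)"
 shows "cmod (W N 0 (\<i> * of_real th) x)<=exp (- (ep^2/24) * Dsum N th)"
proof (cases "N < 6")
 case True
 hence "Dsum N th = 0" by (simp add:Dsum_def)
 thus ?thesis using norm_W_le_1[OF x] by simp
next
 case False
 define I where "I r = {i. r+3<=i & i+3<=N & i mod 6 = (r+3) mod 6}" for r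
 have fin:"finite (I r)" for r by (rule finite_subset[of _ "{..N}"]) (auto simp:I_def)
 let ?a = "cmod (W N 0 (\<i> * of_real th) x)"
 have "Dsum N th<=(\<Sum>r<6. \<Sum>i\<in>I r. dsq i th)"
 proof -
 have "{3..N-3} \<subseteq> (\<Union>r<6. I r)"
 proof
 fix i assume i:"i : {3..N-3}"
 have "i : I ((i-3) mod 6)"
 using i False mod_less_eq_dividend[of "i-3" 6] unfolding I_def
 by (auto simp:mod_add_left_eq)
 thus "i : (\<Union>r<6. I r)" by (intro UN_I) auto
 qed
 hence "Dsum N th<=(\<Sum>i\<in>(\<Union>r<6. I r). dsq i th)"
 unfolding Dsum_def by (intro sum_mono2) (auto simp:fin)
 also have "... = (\<Sum>r<6. \<Sum>i\<in>I r. dsq i th)"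
 proof (rule sum.UNION_disjoint)
 have m:"(r+3) mod 6 = (if r < 3 then r+3 else r-3)" if "r < 6" for r :: nat
 using that by (auto simp:mod_if)
 have "(r+3) mod 6 ~= (s+3) mod 6" if "r < 6" "s < 6" "r ~= s" for r s :: nat
 using that unfolding m[OF that(1)] m[OF that(2)] by (auto split: if_splits)
 thus "\<forall>r\<in>{..<6}. \<forall>s\<in>{..<6}. r ~= s --> I r \<inter> I s = {}"
 unfolding I_def by fastforce
 qed (auto simp:fin)
 finally show ?thesis .
 qed
 moreover have "?a ^ 6<=exp (- (ep^2/4)*(\<Sum>r<6. \<Sum>i\<in>I r. dsq i th))"
 proof -
 have "?a ^ 6 = (\<Prod>r<(6::nat). ?a)" by simp
 also have "...<=(\<Prod>r<6. exp (- (ep^2/4)*(\<Sum>i\<in>I r. dsq i th)))"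
 using norm_W_le_residue[OF _ x,of _ N th] False unfolding I_def by (intro prod_mono) auto
 finally show ?thesis by (simp add:sum_distrib_left exp_sum)
 qed
 moreover have "exp (- (ep^2/4)*(\<Sum>r<6. \<Sum>i\<in>I r. dsq i th))<=exp (- (ep^2/4) * Dsum N th)"
 unfolding exp_le_cancel_iff by (intro mult_left_mono_neg) (use calculation in auto)
 ultimately have "?a ^ 6<=exp (- (ep^2/4) * Dsum N th)" by linarith
 also have "... = exp (- (ep^2/24) * Dsum N th) ^ 6"
 by (simp flip: exp_of_nat_mult)
 finally show ?thesis by (rule power_le_imp_le_base[where n = 5,simplified]) simp
qed

end

section \<open>Functions \<open>W\<close> at small complex parameters\<close>

lemma norm_exp_minus_one_le:"norm (exp v-1)<=exp (norm v)-1"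
 for v ::"'b::{real_normed_field,banach}"
proof -
 have s:"summable (%n. norm v ^ n /\<^sub>R fact n)" by (rule summable_exp_generic)
 have "exp v = 1+(\<Sum>n. v ^ Suc n /\<^sub>R fact (Suc n))"
 unfolding exp_def using suminf_split_head[OF summable_exp_generic[of v]] by simp
 hence "norm (exp v-1) = norm (\<Sum>n. v ^ Suc n /\<^sub>R fact (Suc n))" by simp
 also have "...<=(\<Sum>n. norm v ^ Suc n /\<^sub>R fact (Suc n))"
 by (intro norm_suminf_le summable_Suc_iff[THEN iffD2] s) (simp add:norm_mult norm_power)
 also have "... = exp (norm v)-1"
 unfolding exp_def using suminf_split_head[OF s] by simp
 finally show ?thesis .
qed

context elliptic_kernels
begin

lemma two_step_upper:
 assumes x [measurable]:"x : space (B n)" and [measurable]:"s : bm (B (Suc2 n))"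
 and s:"!!z. z : space (B (Suc2 n)) ==> 0<=s z" "!!z. z : space (B (Suc2 n)) ==> s z<=C"
 shows "(LINT y|K n x. (LINT z|K (Suc n) y. s z))<=(1/ep)*(LINT z|mu (Suc2 n). s z)"
proof -
 interpret A: prob_space "mu (Suc n)" by (rule prob_mu)
 have [measurable]:"(%z. LINT y|mu (Suc n). p n x y * p (Suc n) y z) : bm (B (Suc2 n))"
 by measurable
 have "(LINT y|K n x. (LINT z|K (Suc n) y. s z)) = (LINT z|mu (Suc2 n). (LINT y|mu (Suc n). p n x y * p (Suc n) y z) * s z)"
 by (subst integral_K_K[where C = C]) (use s x in auto)
 also have "...<=(LINT z|mu (Suc2 n). (1/ep) * s z)"
 proof (rule integral_mono)
 show "integrable (mu (Suc2 n)) (%z. (1/ep) * s z)"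
 using s eps by (intro integrable_mu[where C = "(1/ep) * C"]) (auto simp:abs_mult divide_simps)
 show "integrable (mu (Suc2 n)) (%z. (LINT y|mu (Suc n). p n x y * p (Suc n) y z) * s z)"
 proof (rule integrable_mu[where C = "(1/ep) * C"])
 fix z assume z:"z : space (B (Suc2 n))"
 have "0<=(LINT y|mu (Suc n). p n x y * p (Suc n) y z)" using two_step[OF x z] eps by linarith
 thus "norm ((LINT y|mu (Suc n). p n x y * p (Suc n) y z) * s z)<=(1/ep) * C"
 using two_step_le[OF x z] s[OF z] eps unfolding norm_mult by (intro mult_mono) auto
 qed measurable
 show "!!z. z : space (mu (Suc2 n)) ==> (LINT y|mu (Suc n). p n x y * p (Suc n) y z) * s z<=(1/ep) * s z"
 using s two_step_le[OF x] by (intro mult_right_mono) auto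
 qed
 finally show ?thesis by simp
qed

end

context elliptic_functional
begin

lemma W_Suc_Suc:
 fixes w ::"'b::{real_normed_field,banach,second_countable_topology}"
 assumes x:"x : space (B n)"
 shows "W (Suc2 k) n w x = (LINT y|K n x. (LINT z|K (Suc n) y. exp (w * of_real (f n x y+f (Suc n) y z)) * W k (Suc2 n) w z))"
 by (simp add:distrib_left exp_add mult.assoc)

text \<open>Near parameter 0 the function \<open>W k n w\<close> stays close to a nonzero constant,
  uniformly in \<open>k\<close>. Two averaging steps shrink the relative oscillation by
  \<open>1-ep\<close>, while replacing the two exponential factors by 1 costs a relative error of at
  most \<open>exp (2 * L * norm w)-1\<close>; the assumed sizes make \<open>be\<close> reproduce
  itself. Because the contraction takes two steps, the induction has two base cases.\<close>

lemma W_relative_oscillation: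
 fixes w ::"'b::{real_normed_field,banach,second_countable_topology}"
 assumes be:"0 < be" "be<=ep/4" and w:"exp (2 * L * norm w)-1<=ep * be/6"
 shows "x : space (B n) ==> x' : space (B n) ==>
 W k n w x ~= 0 & norm (W k n w x-W k n w x')<=be * norm (W k n w x')"
proof (induction k arbitrary: n x x' rule: induct_nat_012)
 case 0
 thus ?case using be by simp
next
 define et where "et = exp (2 * L * norm w)-1"
 have et:"0<=et" "et<=ep * be/6" unfolding et_def using w L_pos by auto
 have e_beta:"ep * be<=be" using eps be by (simp add:mult_le_cancel_right1)
 {
 case 1
 have *:"norm (W (Suc 0) n w x-1)<=et" if x:"x : space (B n)" for x
 proof -
 note [measurable] = x
 interpret P: prob_space "K n x" by (rule prob_K) fact
 have i:"integrable (K n x) (%y. exp (w * of_real (f n x y)))"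
 using norm_exp_f_le by (intro integrable_K[OF x,where C = "exp (norm w * L)"]) auto
 have "W (Suc 0) n w x-1 = (LINT y|K n x. exp (w * of_real (f n x y))-1)"
 using i P.prob_space by simp
 also have "norm ...<=et"
 proof (rule norm_integral_K_le[OF x])
 fix y
 have "norm (exp (w * of_real (f n x y))-1)<=exp (norm (w * of_real (f n x y)))-1"
 by (rule norm_exp_minus_one_le)
 also have "...<=et"
 proof -
 have "norm w * abs (f n x y)<=norm w*(2 * L)"
 using f_bound[of n x y] L_pos by (intro mult_left_mono) auto
 thus ?thesis unfolding et_def by (simp add:norm_mult mult_ac)
 qed
 finally show "norm (exp (w * of_real (f n x y))-1)<=et" .
 qed
 finally show ?thesis .
 qed
 have small:"et<=1/24" using et e_beta be eps by linarith
 have low:"1-et<=norm (W (Suc 0) n w x)" if "x : space (B n)" for x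
 using *[OF that] norm_triangle_ineq2[of 1 "W (Suc 0) n w x"] norm_minus_commute[of 1 "W (Suc 0) n w x"]
 by (simp add:norm_one del: W.simps)
 have "norm (W (Suc 0) n w x-W (Suc 0) n w x')<=2 * et"
 using *[OF 1(1)] *[OF 1(2)] norm_triangle_ineq4[of "W (Suc 0) n w x-1" "W (Suc 0) n w x'-1"] by (simp del: W.simps)
 also have "2 * et<=be*(23/24)" using et e_beta be by linarith
 also have "...<=be * norm (W (Suc 0) n w x')"
 using low[OF 1(2)] small be by (intro mult_left_mono) auto
 finally show ?case using low[OF 1(1)] small by (auto simp del: W.simps)
 next
 case (ge2 k)
 let ?u = "W k (Suc2 n) w"
 interpret M2: prob_space "mu (Suc2 n)" by (rule prob_mu)
 obtain x0 where x0:"x0 : space (B (Suc2 n))" using M2.not_empty by auto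
 define c where "c = ?u x0"
 have c0:"c ~= 0" unfolding c_def using ge2(1)[OF x0 x0] by auto
 have uc:"norm (?u z-c)<=be * norm c" if "z : space (B (Suc2 n))" for z
 unfolding c_def using ge2(1)[OF that x0] by simp
 have ub:"norm (?u z)<=(1+be) * norm c" if "z : space (B (Suc2 n))" for z
 using uc[OF that] norm_triangle_sub[of "?u z" c] by (simp add:algebra_simps)
 have uu:"norm (?u z-?u z')<=be*((1+be) * norm c)"
 if "z : space (B (Suc2 n))" "z' : space (B (Suc2 n))" for z z'
 proof -
 have "norm (?u z-?u z')<=be * norm (?u z')" using ge2(1)[OF that] by simp
 also have "...<=be*((1+be) * norm c)" using be by (intro mult_left_mono ub that) auto
 finally show ?thesis .
 qed
 define a where "a x = (LINT y|K n x. (LINT z|K (Suc n) y. ?u z))" for x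
 have diff:"norm (a x-a x')<=(1-ep)*(be*((1+be) * norm c))"
 if "x : space (B n)" "x' : space (B n)" for x x'
 unfolding a_def by (rule doeblin_contraction[OF that W_measurable uu])
 have ac:"norm (a x-c)<=be * norm c" if x:"x : space (B n)" for x
 proof -
 interpret P: prob_space "K n x" by (rule prob_K) fact
 have in_y:"norm ((LINT z|K (Suc n) y. ?u z)-c)<=be * norm c" if y:"y : space (B (Suc n))" for y
 proof -
 interpret P': prob_space "K (Suc n) y" by (rule prob_K) fact
 have "integrable (K (Suc n) y) ?u"
 using y ub by (intro integrable_K[where C = "(1+be) * norm c"]) auto
 hence "(LINT z|K (Suc n) y. ?u z)-c = (LINT z|K (Suc n) y. ?u z-c)"
 using P'.prob_space by simp
 also have "norm ...<=be * norm c" by (rule norm_integral_K_le[OF y uc])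
 finally show ?thesis .
 qed
 have "integrable (K n x) (%y. LINT z|K (Suc n) y. ?u z)"
 using ub by (intro integrable_K[OF x,where C = "(1+be) * norm c"] norm_integral_K_le) auto
 hence "a x-c = (LINT y|K n x. (LINT z|K (Suc n) y. ?u z)-c)"
 unfolding a_def using P.prob_space by simp
 also have "norm ...<=be * norm c" by (rule norm_integral_K_le[OF x in_y])
 finally show ?thesis .
 qed
 have b:"norm (W (Suc2 k) n w x-a x)<=et*((1+be) * norm c)" if x:"x : space (B n)" for x
 proof -
 note [measurable] = x
 have e1:"norm (exp (w * of_real (f n x y+f (Suc n) y z))-1)<=et" for y z
 proof -
 have "norm (exp (w * of_real (f n x y+f (Suc n) y z))-1)<=exp (norm (w * of_real (f n x y+f (Suc n) y z)))-1"
 by (rule norm_exp_minus_one_le)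
 also have "...<=et"
 proof -
 have "norm w * abs (f n x y+f (Suc n) y z)<=norm w*(2 * L)"
 using f_bound[of n x y] f_bound[of "Suc n" y z] by (intro mult_left_mono) auto
 thus ?thesis unfolding et_def by (simp add:norm_mult mult_ac flip: of_real_add)
 qed
 finally show ?thesis .
 qed
 have bd:"norm ((exp (w * of_real (f n x y+f (Suc n) y z))-1)*?u z)<=et*((1+be) * norm c)"
 if "z : space (B (Suc2 n))" for y z
 unfolding norm_mult using et by (intro mult_mono e1 ub that) auto
 let ?d = "%y. LINT z|K (Suc n) y. (exp (w * of_real (f n x y+f (Suc n) y z))-1)*?u z"
 have d_meas [measurable]:"?d : bm (B (Suc n))" by measurable
 have id:"integrable (K n x) ?d"
 using bd by (intro integrable_K[OF x,where C = "et*((1+be) * norm c)"] norm_integral_K_le) auto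
 have ia:"integrable (K n x) (%y. LINT z|K (Suc n) y. ?u z)"
 using ub by (intro integrable_K[OF x,where C = "(1+be) * norm c"] norm_integral_K_le) auto
 have "W (Suc2 k) n w x = (LINT y|K n x. ?d y+(LINT z|K (Suc n) y. ?u z))"
 unfolding W_Suc_Suc[OF x]
 proof (intro LINT_cong)
 fix y assume "y : space (K n x)"
 hence y [measurable]:"y : space (B (Suc n))" by simp
 have i1:"integrable (K (Suc n) y) (%z. (exp (w * of_real (f n x y+f (Suc n) y z))-1)*?u z)"
 using bd by (intro integrable_K[OF y,where C = "et*((1+be) * norm c)"]) auto
 have i2:"integrable (K (Suc n) y) ?u"
 using y ub by (intro integrable_K[where C = "(1+be) * norm c"]) auto
 show "(LINT z|K (Suc n) y. exp (w * of_real (f n x y+f (Suc n) y z))*?u z) = ?d y+(LINT z|K (Suc n) y. ?u z)"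
 unfolding LINT_add[OF i1 i2,symmetric]
 by (intro LINT_cong) (simp add:algebra_simps)
 qed
 also have "... = (LINT y|K n x. ?d y)+a x"
 unfolding a_def by (rule LINT_add[OF id ia])
 finally have "W (Suc2 k) n w x-a x = (LINT y|K n x. ?d y)" by simp
 also have "norm ...<=et*((1+be) * norm c)"
 using bd by (intro norm_integral_K_le x) auto
 finally show ?thesis .
 qed
 let ?V = "W (Suc2 k) n w"
 have D:"norm (?V x-?V x')<=((1-ep) * be+2 * et)*(1+be) * norm c"
 proof -
 have "norm (?V x-?V x')<=norm (?V x-a x)+norm (a x-a x')+norm (?V x'-a x')"
 proof -
 have "?V x-?V x' = (?V x-a x)+(a x-a x')-(?V x'-a x')" by simp
 also have "norm ...<=norm ((?V x-a x)+(a x-a x'))+norm (?V x'-a x')" by (rule norm_triangle_ineq4)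
 also have "...<=norm (?V x-a x)+norm (a x-a x')+norm (?V x'-a x')"
 by (intro add_right_mono norm_triangle_ineq)
 finally show ?thesis .
 qed
 thus ?thesis using b[OF ge2(3)] b[OF ge2(4)] diff[OF ge2(3,4)] by (simp add:algebra_simps)
 qed
 have low:"(1-be-et*(1+be)) * norm c<=norm (?V x)" if x:"x : space (B n)" for x
 proof -
 have "norm c<=norm (?V x)+norm (c-?V x)" by (metis norm_triangle_sub add.commute)
 also have "c-?V x = - ((?V x-a x)+(a x-c))" by simp
 also have "norm ...<=norm (?V x-a x)+norm (a x-c)"
 unfolding norm_minus_cancel by (rule norm_triangle_ineq)
 finally have "norm c<=norm (?V x)+(norm (?V x-a x)+norm (a x-c))" by simp
 thus ?thesis using b[OF x] ac[OF x] by (simp add:algebra_simps)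
 qed
 \<comment> \<open>The gain \<open>ep * be\<close> pays for two kinds of error: half of it absorbs
   the terms quadratic in \<open>be\<close> (by \<open>be<=ep/4\<close>), the other half the terms
   in \<open>et\<close> (by \<open>et<=ep * be/6\<close>).\<close>
 have key:"((1-ep) * be+2 * et)*(1+be)<=be*(1-be-et*(1+be))"
 proof -
 have b4:"be<=1/4" using be eps by simp
 have "(1+be) * et*(2+be)<=(5/4)*(ep * be/6)*(9/4)"
 using b4 et be eps by (intro mult_mono) auto
 moreover have "be*((1-ep)*(1+be)+be)<=be*(1-ep/2)"
 proof (rule mult_left_mono)
 have "(1-ep)*(1+be)+be = 1-ep+2 * be-ep * be" by (simp add:algebra_simps)
 also have "...<=1-ep/2" using be eps mult_nonneg_nonneg[of ep be] by linarith
 finally show "(1-ep)*(1+be)+be<=1-ep/2" .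
 qed (use be in simp)
 moreover have "0<=ep * be" using be eps by simp
 ultimately show ?thesis by (simp add:algebra_simps)
 qed
 have pos:"0 < 1-be-et*(1+be)"
 proof -
 have "et*(1+be)<=(1/24)*(5/4)" using et e_beta be eps by (intro mult_mono) linarith+
 thus ?thesis using be eps by simp
 qed
 have "norm (?V x-?V x')<=be*((1-be-et*(1+be)) * norm c)"
 using order_trans[OF D mult_right_mono[OF key,of "norm c"]] by (simp add:mult.assoc)
 also have "...<=be * norm (?V x')" using low[OF ge2(4)] be by (intro mult_left_mono) auto
 finally have "norm (?V x-?V x')<=be * norm (?V x')" .
 moreover have "0 < norm (?V x)"
 using low[OF ge2(3)] pos c0 by (meson less_le_trans mult_pos_pos zero_less_norm_iff)
 ultimately show ?case by auto
 }
qed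

end

section \<open>Exponential tilting as a Doob transform\<close>

context elliptic_functional
begin

lemma exp_f_bounds:
 assumes "abs xi<=R"
 shows "exp (xi * f n x y)<=exp (L * R)" "exp (- (L * R))<=exp (xi * f n x y)"
proof -
 have "abs (xi * f n x y)<=R * L"
 unfolding abs_mult using assms f_bound[of n x y] by (intro mult_mono) auto
 thus "exp (xi * f n x y)<=exp (L * R)" "exp (- (L * R))<=exp (xi * f n x y)"
 by (auto simp:abs_le_iff mult.commute)
qed

text \<open>After time \<open>N\<close> nothing is tilted, so the tilted kernels exist at all times
  and again form an infinite chain.\<close>

definition wexp ::"nat => real => nat => 'a => 'a => real" where
 "wexp N xi n x y = (if n < N then exp (xi * f n x y) else 1)"

text \<open>The harmonic function of the Doob transform: the expected exponential weight still to
  come before \<open>N\<close>. By truncated subtraction it is 1 from time \<open>N\<close>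
  on.\<close>

definition hfun ::"nat => real => nat => 'a => real" where
 "hfun N xi n x = W (N-n) n xi x"

definition ptilt ::"nat => real => nat => 'a => 'a => real" where
 "ptilt N xi n x y = (if x : space (B n) & y : space (B (Suc n))
 then p n x y * wexp N xi n x y * hfun N xi (Suc n) y/hfun N xi n x else 0)"

definition harnack ::"real => real" where
 "harnack R = exp (4 * L * R)/ep^2"

text \<open>The two-step lower bound for \<open>ptilt\<close>: \<open>exp (- (2 * L * R))\<close>
  from the two weights, \<open>1/(exp (2 * L * R) * harnack R)\<close> from the ratio of harmonic
  functions, and \<open>ep\<close> from the original kernels.\<close>

definition tilt_eps ::"real => real" where
 "tilt_eps R = ep ^ 3 * exp (- (8 * L * R))"

lemma wexp_bounds:
 assumes "abs xi<=R"
 shows "wexp N xi n x y<=exp (L * R)" "exp (- (L * R))<=wexp N xi n x y" "0 < wexp N xi n x y"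
proof -
 have "0<=R" using assms by linarith
 hence "0<=L * R" using L_pos by simp
 thus "wexp N xi n x y<=exp (L * R)" "exp (- (L * R))<=wexp N xi n x y" "0 < wexp N xi n x y"
 unfolding wexp_def using exp_f_bounds[OF assms] by auto
qed

lemma wexp_measurable [measurable (raw)]:
 assumes [measurable]:"g : M \<rightarrow>\<^sub>M B n" "h : M \<rightarrow>\<^sub>M B (Suc n)"
 shows "(%om. wexp N xi n (g om) (h om)) : bm M"
 unfolding wexp_def by measurable

lemma hfun_measurable [measurable]:"hfun N xi n : bm (B n)"
 unfolding hfun_def[abs_def] by measurable

lemma hfun_le:"x : space (B n) ==> abs (hfun N xi n x)<=exp (abs xi * L) ^ (N-n)"
 unfolding hfun_def using norm_W_le[of x n "N-n" xi] by simp

lemma integrable_wexp_hfun: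
 assumes x [measurable]:"x : space (B n)"
 shows "integrable (K n x) (%y. wexp N xi n x y * hfun N xi (Suc n) y)"
proof (rule integrable_K[OF x])
 fix y assume y:"y : space (B (Suc n))"
 show "norm (wexp N xi n x y * hfun N xi (Suc n) y)<=exp (L * abs xi) * exp (abs xi * L) ^ (N-Suc n)"
 unfolding norm_mult using wexp_bounds[of xi "abs xi" N n x y] hfun_le[OF y,of N xi] by (intro mult_mono) auto
qed measurable

lemma hfun_rec:
 assumes x:"x : space (B n)"
 shows "hfun N xi n x = (LINT y|K n x. wexp N xi n x y * hfun N xi (Suc n) y)"
proof (cases "n < N")
 case True
 hence "N-n = Suc (N-Suc n)" by simp
 thus ?thesis using True by (simp add:hfun_def wexp_def)
next
 case False
 thus ?thesis using prob_space.prob_space[OF prob_K[OF x]] by (simp add:hfun_def wexp_def)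
qed

lemma hfun_pos:"x : space (B n) ==> 0 < hfun N xi n x"
proof -
 assume x:"x : space (B n)"
 have "x : space (B n) ==> exp (- (L * abs xi)) ^ k<=W k n xi x" for k n x
 proof (induction k arbitrary: n x)
 case (Suc k)
 note [measurable] = Suc.prems
 interpret P: prob_space "K n x" by (rule prob_K) fact
 have "exp (- (L * abs xi)) ^ Suc k = (LINT y|K n x. exp (- (L * abs xi)) * exp (- (L * abs xi)) ^ k)"
 using P.prob_space by simp
 also have "...<=(LINT y|K n x. exp (xi * of_real (f n x y)) * W k (Suc n) xi y)"
 proof (rule integral_mono)
 show "integrable (K n x) (%y. exp (xi * of_real (f n x y)) * W k (Suc n) xi y)"
 proof (rule integrable_K[OF Suc.prems])
 show "norm (exp (xi * of_real (f n x y)) * W k (Suc n) xi y)<=exp (norm xi * L) * exp (norm xi * L) ^ k"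
 if "y : space (B (Suc n))" for y
 unfolding norm_mult using that by (intro mult_mono norm_exp_f_le norm_W_le) auto
 qed measurable
 fix y assume "y : space (K n x)"
 thus "exp (- (L * abs xi)) * exp (- (L * abs xi)) ^ k<=exp (xi * of_real (f n x y)) * W k (Suc n) xi y"
 using exp_f_bounds(2)[of xi "abs xi" n x y] Suc.IH[of y "Suc n"] by (intro mult_mono) auto
 qed auto
 finally show ?case by simp
 qed simp
 from this[OF x,of "N-n"] show ?thesis
 unfolding hfun_def by (rule less_le_trans[rotated]) simp
qed

lemma hfun_mono_step:
 assumes R:"abs xi<=R" and x:"x : space (B n)"
 and c:"!!y. y : space (B (Suc n)) ==> hfun N xi (Suc n) y<=C"
 shows "hfun N xi n x<=exp (L * R) * C"
proof -
 note [measurable] = x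
 have "norm (hfun N xi n x)<=exp (L * R) * C"
 unfolding hfun_rec[OF x]
 proof (rule norm_integral_K_le[OF x])
 fix y assume y:"y : space (B (Suc n))"
 show "norm (wexp N xi n x y * hfun N xi (Suc n) y)<=exp (L * R) * C"
 using wexp_bounds[OF R,of N n x y] hfun_pos[OF y,of N xi] c[OF y] unfolding norm_mult
 by (intro mult_mono) auto
 qed
 thus ?thesis by simp
qed

lemma harnack_ge_1:"0<=R ==> 1<=harnack R"
proof -
 assume "0<=R"
 hence "1<=exp (4 * L * R)" using L_pos by simp
 moreover have "ep^2<=1" using eps by (simp add:power_le_one)
 ultimately have "ep^2<=exp (4 * L * R)" by (rule order_trans[rotated])
 thus ?thesis unfolding harnack_def using eps by simp
qed

text \<open>After two steps the starting point matters only through a density between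
  \<open>ep\<close> and \<open>1/ep\<close>, and the two weights lie between
  \<open>exp (- (2 * L * R))\<close> and its inverse. The quotient of upper and lower bound is
  \<open>exp (4 * L * R)/ep^2\<close>, uniformly in \<open>N\<close> and \<open>n\<close>.\<close>

lemma hfun_harnack:
 assumes R:"abs xi<=R" and x:"x : space (B n)" and x':"x' : space (B n)"
 shows "hfun N xi n x<=harnack R * hfun N xi n x'"
proof -
 define u where "u = hfun N xi (Suc2 n)"
 have R0:"0<=R" using R by linarith
 have u_meas [measurable]:"u : bm (B (Suc2 n))" unfolding u_def by measurable
 define C where "C = exp (abs xi * L) ^ (N-Suc2 n)"
 have u:"0<=u z" "u z<=C" if "z : space (B (Suc2 n))" for z
 using hfun_pos[OF that,of N xi] hfun_le[OF that,of N xi] by (auto simp:u_def C_def)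
 let ?I = "%x. LINT y|K n x. (LINT z|K (Suc n) y. u z)"
 have iK:"integrable (K n x) (%y. LINT z|K (Suc n) y. u z)" if "x : space (B n)" for x
 using u by (intro integrable_K[OF that,where C = C] norm_integral_K_le) auto
 have one:"exp (- (L * R))*(LINT z|K (Suc n) y. u z)<=hfun N xi (Suc n) y \<and>
 hfun N xi (Suc n) y<=exp (L * R)*(LINT z|K (Suc n) y. u z)" if y:"y : space (B (Suc n))" for y
 proof -
 note [measurable] = y
 have iu:"integrable (K (Suc n) y) u"
 using u by (intro integrable_K[OF y,where C = C]) auto
 note i = integrable_wexp_hfun[OF y,of N xi]
 have "exp (- (L * R))*(LINT z|K (Suc n) y. u z) = (LINT z|K (Suc n) y. exp (- (L * R)) * u z)" by simp
 also have "...<=hfun N xi (Suc n) y"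
 unfolding hfun_rec[OF y]
 using iu i u wexp_bounds[OF R] by (intro integral_mono) (auto simp flip: u_def intro!:mult_right_mono)
 moreover have "hfun N xi (Suc n) y<=(LINT z|K (Suc n) y. exp (L * R) * u z)"
 unfolding hfun_rec[OF y]
 using iu i u wexp_bounds[OF R] by (intro integral_mono) (auto simp flip: u_def intro!:mult_right_mono)
 ultimately show ?thesis by simp
 qed
 have lo:"exp (- (2 * L * R))*?I x<=hfun N xi n x" if x:"x : space (B n)" for x
 proof -
 have "exp (- (2 * L * R))*?I x = (LINT y|K n x. exp (- (L * R))*(exp (- (L * R))*(LINT z|K (Suc n) y. u z)))"
 by (simp flip: exp_add mult.assoc)
 also have "...<=hfun N xi n x"
 unfolding hfun_rec[OF x]
 proof (rule integral_mono)
 fix y assume "y : space (K n x)"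
 hence y:"y : space (B (Suc n))" by simp
 have "0<=(LINT z|K (Suc n) y. u z)" using u by (intro LINT_nonneg) auto
 thus "exp (- (L * R))*(exp (- (L * R))*(LINT z|K (Suc n) y. u z))<=wexp N xi n x y * hfun N xi (Suc n) y"
 using wexp_bounds(2,3)[OF R,of N n x y] one[OF y] by (intro mult_mono) auto
 qed (use iK[OF x] integrable_wexp_hfun[OF x] in auto)
 finally show ?thesis .
 qed
 have hi:"hfun N xi n x<=exp (2 * L * R)*?I x" if x:"x : space (B n)" for x
 proof -
 have "hfun N xi n x<=(LINT y|K n x. exp (L * R)*(exp (L * R)*(LINT z|K (Suc n) y. u z)))"
 unfolding hfun_rec[OF x]
 proof (rule integral_mono)
 fix y assume "y : space (K n x)"
 hence y:"y : space (B (Suc n))" by simp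
 show "wexp N xi n x y * hfun N xi (Suc n) y<=exp (L * R)*(exp (L * R)*(LINT z|K (Suc n) y. u z))"
 using wexp_bounds(1)[OF R,of N n x y] one[OF y] hfun_pos[OF y,of N xi] by (intro mult_mono) auto
 qed (use iK[OF x] integrable_wexp_hfun[OF x] in auto)
 also have "... = exp (2 * L * R)*?I x" by (simp flip: exp_add mult.assoc)
 finally show ?thesis .
 qed
 let ?m = "LINT z|mu (Suc2 n). u z"
 have "ep*?m<=?I x'" by (rule two_step_lower[OF x' u_meas u])
 hence m:"?m<=(1/ep)*?I x'" using eps by (simp add:field_simps)
 have "hfun N xi n x<=exp (2 * L * R)*((1/ep)*?m)"
 using hi[OF x] two_step_upper[OF x u_meas u] by (meson exp_ge_zero mult_left_mono order_trans)
 also have "...<=exp (2 * L * R)*((1/ep)*((1/ep)*?I x'))"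
 using m eps by (intro mult_left_mono) auto
 also have "... = harnack R*(exp (- (2 * L * R))*?I x')"
 proof -
 have "exp (2 * L * R) = exp (4 * L * R) * exp (- (2 * L * R))" by (simp flip: exp_add)
 thus ?thesis by (simp add:harnack_def power2_eq_square)
 qed
 also have "...<=harnack R * hfun N xi n x'"
 using harnack_ge_1[OF R0] by (intro mult_left_mono lo x') auto
 finally show ?thesis .
qed

lemma hfun_ratio_next:
 assumes R:"abs xi<=R" and x:"x : space (B n)" and y:"y : space (B (Suc n))"
 shows "hfun N xi (Suc n) y<=exp (L * R) * harnack R * hfun N xi n x"
proof -
 note [measurable] = x
 interpret P: prob_space "K n x" by (rule prob_K) fact
 have R0:"0<=R" using R by linarith
 have hp:"0 < harnack R" using harnack_ge_1[OF R0] by simp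
 have "exp (- (L * R))*(hfun N xi (Suc n) y/harnack R) = (LINT z|K n x. exp (- (L * R))*(hfun N xi (Suc n) y/harnack R))"
 using P.prob_space by simp
 also have "...<=hfun N xi n x"
 unfolding hfun_rec[OF x]
 proof (rule integral_mono)
 fix z assume "z : space (K n x)"
 hence z:"z : space (B (Suc n))" by simp
 have "hfun N xi (Suc n) y/harnack R<=hfun N xi (Suc n) z"
 using hfun_harnack[OF R y z,of N] hp by (simp add:divide_simps mult.commute)
 thus "exp (- (L * R))*(hfun N xi (Suc n) y/harnack R)<=wexp N xi n x z * hfun N xi (Suc n) z"
 using wexp_bounds(2,3)[OF R,of N n x z] hfun_pos[OF y,of N xi] hp by (intro mult_mono) auto
 qed (use integrable_wexp_hfun[OF x] in auto)
 finally show ?thesis using hp by (simp add:exp_minus field_simps)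
qed

lemma ptilt_le_p:
 assumes R:"abs xi<=R"
 shows "ptilt N xi n x y<=exp (2 * L * R) * harnack R * p n x y"
proof (cases "x : space (B n) & y : space (B (Suc n))")
 case True
 have R0:"0<=R" using R by linarith
 have "hfun N xi (Suc n) y/hfun N xi n x<=exp (L * R) * harnack R"
 using hfun_ratio_next[OF R,of x n y N] hfun_pos[of x n N xi] True by (simp add:divide_simps)
 hence "wexp N xi n x y*(hfun N xi (Suc n) y/hfun N xi n x)<=exp (L * R)*(exp (L * R) * harnack R)"
 using wexp_bounds[OF R,of N n x y] hfun_pos[of x n N xi] hfun_pos[of y "Suc n" N xi] True
 by (intro mult_mono) auto
 hence "p n x y*(wexp N xi n x y*(hfun N xi (Suc n) y/hfun N xi n x))<=p n x y*(exp (L * R)*(exp (L * R) * harnack R))"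
 by (intro mult_left_mono) auto
 also have "... = exp (2 * L * R) * harnack R * p n x y"
 by (simp add:mult_ac flip: exp_add)
 finally show ?thesis using True by (simp add:ptilt_def mult_ac)
next
 case False
 have "0<=R" using R by linarith
 thus ?thesis using False harnack_ge_1[of R] by (auto simp:ptilt_def)
qed

text \<open>The reason for tilting by kernels: the tilted chain satisfies the same axioms with
  constants depending on \<open>R\<close> only, so everything proved in this locale may be
  instantiated with \<open>ptilt N xi\<close>.\<close>

lemma ptilt_elliptic:
 assumes R:"abs xi<=R"
 shows "elliptic_functional B mu (ptilt N xi) (tilt_eps R) f L"
proof -
 have R0:"0<=R" using R by linarith
 have hp:"0 < harnack R" using harnack_ge_1[OF R0] by simp
 have e8:"exp (- (8 * L * R))<=1" using R0 L_pos by simp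
 have pt_nonneg:"0<=ptilt N xi n x y" for n x y
 using wexp_bounds[OF R,of N n x y] hfun_pos[of x n N xi] hfun_pos[of y "Suc n" N xi]
 by (auto simp:ptilt_def)
 have eps_t:"1/tilt_eps R = exp (8 * L * R)*(1/ep ^ 3)"
 unfolding tilt_eps_def by (simp add:exp_minus field_simps)
 show ?thesis
 unfolding elliptic_functional_def elliptic_functional_axioms_def elliptic_kernels_def
 proof (intro conjI allI impI)
 show "0 < tilt_eps R" using eps by (simp add:tilt_eps_def)
 have "ep ^ 3 < 1" using eps by (simp add:power_less_one_iff)
 hence "ep ^ 3 * exp (- (8 * L * R)) < 1*1"
 using e8 eps by (intro mult_less_le_imp_less) auto
 thus "tilt_eps R < 1" by (simp add:tilt_eps_def)
 show "prob_space (mu n)" for n by (rule prob_mu)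
 show "sets (mu n) = sets (B n)" for n by simp
 show "(%(x,y). ptilt N xi n x y) : bm (B n \<Otimes>\<^sub>M B (Suc n))" for n
 proof -
 have "(%z. p n (fst z) (snd z) * wexp N xi n (fst z) (snd z) * hfun N xi (Suc n) (snd z)/hfun N xi n (fst z))
 : bm (B n \<Otimes>\<^sub>M B (Suc n))" by measurable
 also have "?this \<longleftrightarrow> ?thesis"
 by (intro measurable_cong) (auto simp:ptilt_def space_pair_measure)
 finally show ?thesis .
 qed
 show "0<=ptilt N xi n x y" for n x y by (rule pt_nonneg)
 show "ptilt N xi n x y<=1/tilt_eps R" for n x y
 proof -
 have "ptilt N xi n x y<=exp (2 * L * R) * harnack R * p n x y" by (rule ptilt_le_p[OF R])
 also have "...<=exp (2 * L * R) * harnack R*(1/ep)"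
 using hp by (intro mult_left_mono p_le) auto
 also have "... = exp (6 * L * R)*(1/ep ^ 3)"
 by (simp add:harnack_def power2_eq_square power3_eq_cube flip: exp_add)
 also have "...<=exp (8 * L * R)*(1/ep ^ 3)"
 using R0 L_pos eps by (intro mult_right_mono) auto
 finally show ?thesis unfolding eps_t .
 qed
 show "(LINT y|mu (Suc n). ptilt N xi n x y) = 1" if x:"x : space (B n)" for n x
 proof -
 note [measurable] = x
 have "(LINT y|mu (Suc n). ptilt N xi n x y) = (LINT y|mu (Suc n). p n x y *\<^sub>R (wexp N xi n x y * hfun N xi (Suc n) y)/hfun N xi n x)"
 by (intro LINT_cong) (use x in \<open>auto simp:ptilt_def\<close>)
 also have "... = (LINT y|K n x. wexp N xi n x y * hfun N xi (Suc n) y)/hfun N xi n x"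
 by (subst integral_K) (auto simp:x)
 also have "... = 1" unfolding hfun_rec[OF x,symmetric] using hfun_pos[OF x,of N xi] by simp
 finally show ?thesis .
 qed
 show "tilt_eps R<=(LINT y|mu (Suc n). ptilt N xi n x y * ptilt N xi (Suc n) y z)"
 if x:"x : space (B n)" and z:"z : space (B (Suc2 n))" for n x z
 proof -
 note [measurable] = x z
 let ?r = "hfun N xi (Suc2 n) z/hfun N xi n x"
 have hx:"hfun N xi n x<=exp (L * R)*(exp (L * R)*(harnack R * hfun N xi (Suc2 n) z))"
 by (intro hfun_mono_step[OF R] x hfun_harnack[OF R] z)
 also have "... = (exp (2 * L * R) * harnack R) * hfun N xi (Suc2 n) z"
 by (simp add:mult.assoc[symmetric] flip: exp_add)
 finally have r:"1/(exp (2 * L * R) * harnack R)<=?r"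
 using hfun_pos[OF x,of N xi] hp by (simp add:field_simps)
 have "tilt_eps R = exp (- (2 * L * R))*(1/(exp (2 * L * R) * harnack R)) * ep"
 unfolding tilt_eps_def harnack_def
 by (simp add:exp_minus field_simps power3_eq_cube power2_eq_square flip: exp_add)
 also have "...<=exp (- (2 * L * R))*?r*(LINT y|mu (Suc n). p n x y * p (Suc n) y z)"
 using r two_step[OF x z] eps hp hfun_pos[OF x,of N xi] hfun_pos[OF z,of N xi] by (intro mult_mono) auto
 also have "... = (LINT y|mu (Suc n). exp (- (2 * L * R))*?r*(p n x y * p (Suc n) y z))"
 by simp
 also have "...<=(LINT y|mu (Suc n). ptilt N xi n x y * ptilt N xi (Suc n) y z)"
 proof (rule integral_mono)
 have pp:"norm (p n x y * p (Suc n) y z)<=(1/ep)*(1/ep)" for y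
 unfolding norm_mult using eps by (intro mult_mono) (auto simp:p_le)
 thus "integrable (mu (Suc n)) (%y. exp (- (2 * L * R))*?r*(p n x y * p (Suc n) y z))"
 by (intro integrable_mult_right integrable_mu[where C = "(1/ep)*(1/ep)"]) auto
 have eq:"ptilt N xi n x y * ptilt N xi (Suc n) y z
 = (p n x y * p (Suc n) y z)*(wexp N xi n x y * wexp N xi (Suc n) y z)*?r" if y:"y : space (B (Suc n))" for y
 using x y z hfun_pos[OF y,of N xi] by (simp add:ptilt_def)
 show "integrable (mu (Suc n)) (%y. ptilt N xi n x y * ptilt N xi (Suc n) y z)"
 proof (rule integrable_mu[where C = "((1/ep)*(1/ep))*(exp (L * R) * exp (L * R)) * abs ?r"])
 have "(%y. (p n x y * p (Suc n) y z)*(wexp N xi n x y * wexp N xi (Suc n) y z)*?r) : bm (B (Suc n))"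
 by measurable
 thus "(%y. ptilt N xi n x y * ptilt N xi (Suc n) y z) : bm (B (Suc n))"
 by (subst measurable_cong[OF eq]) auto
 fix y assume y:"y : space (B (Suc n))"
 have "norm (wexp N xi n x y * wexp N xi (Suc n) y z)<=exp (L * R) * exp (L * R)"
 unfolding norm_mult using wexp_bounds[OF R] wexp_bounds(3)[OF R,THEN less_imp_le] by (intro mult_mono) auto
 thus "norm (ptilt N xi n x y * ptilt N xi (Suc n) y z)<=((1/ep)*(1/ep))*(exp (L * R) * exp (L * R)) * abs ?r"
 unfolding eq[OF y] norm_mult[of _ ?r] norm_mult[of "p n x y * p (Suc n) y z"] real_norm_def[of ?r]
 using pp[of y] by (intro mult_right_mono mult_mono) auto
 qed
 fix y assume "y : space (mu (Suc n))"
 hence y:"y : space (B (Suc n))" by simp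
 have "exp (- (L * R)) * exp (- (L * R))<=wexp N xi n x y * wexp N xi (Suc n) y z"
 using wexp_bounds[OF R] wexp_bounds(3)[OF R,THEN less_imp_le] by (intro mult_mono) auto
 hence "exp (- (2 * L * R))<=wexp N xi n x y * wexp N xi (Suc n) y z"
 by (simp add:mult.assoc flip: exp_add)
 hence "(p n x y * p (Suc n) y z) * exp (- (2 * L * R))*?r<=ptilt N xi n x y * ptilt N xi (Suc n) y z"
 unfolding eq[OF y] using hfun_pos[OF x,of N xi] hfun_pos[OF z,of N xi]
 by (intro mult_right_mono mult_left_mono) auto
 thus "exp (- (2 * L * R))*?r*(p n x y * p (Suc n) y z)<=ptilt N xi n x y * ptilt N xi (Suc n) y z"
 by (simp add:mult_ac)
 qed
 finally show ?thesis .
 qed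
 show "(%(x,y). f n x y) : bm (B n \<Otimes>\<^sub>M B (Suc n))" for n by (rule f_meas0)
 show "abs (f n x y)<=L" for n x y by (rule f_bound)
 show "0 < L" by (rule L_pos)
 qed
qed

end

section \<open>Dependence of \<open>Dsum\<close> on the angle\<close>

lemma chord_sq_upper:"2-2 * cos x<=x^2" for x :: real
proof -
 obtain t where "cos x = (\<Sum>m<2. cos_coeff m * x ^ m)+(cos (t+1/2 * real 2 * pi)/fact 2) * x ^ 2"
 using Maclaurin_cos_expansion[of x 2] by blast
 hence "cos x = 1+cos (t+pi) * x^2/2"
 by (simp add:numeral_2_eq_2 cos_coeff_def)
 moreover have "(-1) * x^2<=cos (t+pi) * x^2"
 by (intro mult_right_mono cos_ge_minus_one) auto
 ultimately show ?thesis by simp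
qed

lemma chord_sq_lower:"abs x<=2 ==> x^2/2<=2-2 * cos x" for x :: real
proof -
 assume x:"abs x<=2"
 obtain t where "cos x = (\<Sum>m<4. cos_coeff m * x ^ m)+(cos (t+1/2 * real 4 * pi)/fact 4) * x ^ 4"
 using Maclaurin_cos_expansion[of x 4] by blast
 also have "(\<Sum>m<4. cos_coeff m * x ^ m) = 1-x^2/2"
 proof -
 have "{..<4::nat} = {0,1,2,3}" by auto
 thus ?thesis by (simp add:cos_coeff_def)
 qed
 finally have "cos x = 1-x^2/2+(cos (t+2 * pi)/24) * x ^ 4"
 by (simp add:fact_numeral)
 moreover have "cos (t+2 * pi) * x ^ 4<=1 * x ^ 4"
 by (intro mult_right_mono cos_le_one) auto
 moreover have "x ^ 4<=6 * x^2"
 proof -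
 have "x^2<=2^2" using x by (metis abs_le_square_iff abs_numeral)
 hence "x^2 * x^2<=6 * x^2" by (intro mult_right_mono) auto
 thus ?thesis by (simp flip: power_add)
 qed
 ultimately show ?thesis by simp
qed

text \<open>The triangle inequality for chords of the unit circle, squared. It makes
  \<open>dsq\<close> and \<open>Dsum\<close> subadditive in the angle up to a factor 2.\<close>

lemma chord_sq_add:"2-2 * cos b<=2*(2-2 * cos (a+b))+2*(2-2 * cos a)" for a b :: real
proof -
 have chord:"(cmod (cis s-cis t))^2 = 2-2 * cos (s-t)" for s t
 by (subst cmod_diff_unimodular) (auto simp:cis_cnj cis_mult)
 have "cmod (cis (a+b)-cis a)<=cmod (cis (a+b)-cis 0)+cmod (cis a-cis 0)"
 using norm_triangle_ineq4[of "cis (a+b)-cis 0" "cis a-cis 0"] by simp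
 hence "(cmod (cis (a+b)-cis a))^2<=(cmod (cis (a+b)-cis 0)+cmod (cis a-cis 0))^2"
 by (intro power_mono) auto
 also have "...<=2*(cmod (cis (a+b)-cis 0))^2+2*(cmod (cis a-cis 0))^2"
 using sum_squares_bound[of "cmod (cis (a+b)-cis 0)" "cmod (cis a-cis 0)"]
 unfolding power2_sum by linarith
 finally show ?thesis unfolding chord by simp
qed

context elliptic_functional
begin

lemma dsq_add:"dsq n h<=2 * dsq n (th+h)+2 * dsq n th"
proof -
 have "dsq n h<=(LINT x|hexM n. 2*(hexw n x*(2-2 * cos ((th+h) * balance n x)))+2*(hexw n x*(2-2 * cos (th * balance n x))))"
 unfolding dsq_def
 proof (rule integral_mono)
 fix x
 have "hexw n x*(2-2 * cos (h * balance n x))<=hexw n x*(2*(2-2 * cos (th * balance n x+h * balance n x))+2*(2-2 * cos (th * balance n x)))"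
 by (intro mult_left_mono chord_sq_add) auto
 thus "hexw n x*(2-2 * cos (h * balance n x))<=2*(hexw n x*(2-2 * cos ((th+h) * balance n x)))+2*(hexw n x*(2-2 * cos (th * balance n x)))"
 by (simp add:algebra_simps)
 qed (intro LINT_integrable_add integrable_mult_right integrable_dsq)+
 also have "... = 2 * dsq n (th+h)+2 * dsq n th"
 unfolding dsq_def using integrable_dsq by (subst LINT_add) auto
 finally show ?thesis .
qed

text \<open>The balance is at most \<open>6 * L\<close>, so under \<open>6 * L * th0<=1\<close> all
  angles stay within 1, where squared chord and squared angle are comparable.\<close>

lemma dsq_scale:
 assumes "6 * L * th0<=1" "0 < th0" "abs th<=th0"
 shows "(th/th0)^2/2 * dsq n th0<=dsq n th"
proof -
 have "(th/th0)^2/2 * dsq n th0 = (LINT x|hexM n. (th/th0)^2/2*(hexw n x*(2-2 * cos (th0 * balance n x))))"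
 unfolding dsq_def by simp
 also have "...<=dsq n th"
 unfolding dsq_def
 proof (rule integral_mono)
 fix x
 have "abs th * abs (balance n x)<=th0*(6 * L)" using assms balance_le[of n x] by (intro mult_mono) auto
 hence 1:"abs (th * balance n x)<=1" using assms by (simp add:abs_mult mult_ac)
 have "(th/th0)^2/2*(2-2 * cos (th0 * balance n x))<=(th/th0)^2/2*(th0 * balance n x)^2"
 by (intro mult_left_mono chord_sq_upper) auto
 also have "... = (th * balance n x)^2/2" using assms by (simp add:power2_eq_square)
 also have "...<=2-2 * cos (th * balance n x)"
 using 1 by (intro chord_sq_lower) auto
 finally have "hexw n x*((th/th0)^2/2*(2-2 * cos (th0 * balance n x)))<=hexw n x*(2-2 * cos (th * balance n x))"
 by (intro mult_left_mono) auto
 thus "(th/th0)^2/2*(hexw n x*(2-2 * cos (th0 * balance n x)))<=hexw n x*(2-2 * cos (th * balance n x))"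
 by (simp add:mult_ac)
 qed (intro integrable_mult_right integrable_dsq)+
 finally show ?thesis .
qed

lemma continuous_on_dsq:"continuous_on A (dsq n)"
proof -
 have "isCont (dsq n) th" for th
 unfolding continuous_at_sequentially
 proof safe
 fix s ::"nat => real" assume s:"s ----> th"
 show "(dsq n \<circ> s) ----> dsq n th"
 unfolding dsq_def comp_def
 proof (rule integral_dominated_convergence[where w = "%h. hexw n h*4"])
 show "integrable (hexM n) (%h. hexw n h*4)" by (rule integrable_hex[where C = 4]) auto
 show "AE x in hexM n. (%i. hexw n x*(2-2 * cos (s i * balance n x))) ----> hexw n x*(2-2 * cos (th * balance n x))"
 by (intro AE_I2 tendsto_intros s)
 show "AE x in hexM n. norm (hexw n x*(2-2 * cos (s i * balance n x)))<=hexw n x*4" for i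
 using one_minus_cos_nonneg one_minus_cos_le by (intro AE_I2) (auto simp:abs_mult intro!:mult_left_mono)
 qed measurable
 qed
 thus ?thesis by (simp add:continuous_at_imp_continuous_on)
qed

lemma Dsum_add:"Dsum N h<=2 * Dsum N (th+h)+2 * Dsum N th"
 unfolding Dsum_def sum_distrib_left sum.distrib[symmetric] by (intro sum_mono dsq_add)

lemma Dsum_scale:
 assumes "6 * L * th0<=1" "0 < th0" "abs th<=th0"
 shows "(th/th0)^2/2 * Dsum N th0<=Dsum N th"
 unfolding Dsum_def sum_distrib_left by (intro sum_mono dsq_scale assms)

lemma continuous_on_Dsum:"continuous_on A (Dsum N)"
 unfolding Dsum_def[abs_def] by (intro continuous_intros continuous_on_dsq)

lemma Dsum_nonneg [simp]:"0<=Dsum N th"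
 unfolding Dsum_def by (intro sum_nonneg) auto

lemma Dsum_mono:"N<=N' ==> Dsum N th<=Dsum N' th"
 unfolding Dsum_def by (intro sum_mono2) auto

lemma Dsum_minus:"Dsum N (- th) = Dsum N th"
 by (simp add:Dsum_def dsq_def)

definition tilt_const ::"real => real" where
 "tilt_const R = exp (- (6 * L * R))/harnack R"

text \<open>Along a three-step path the harmonic functions telescope to the ratio at its two ends,
  so each path weight changes by at least the factor \<open>tilt_const R\<close>; a hexagon has two
  paths, hence the square.\<close>

lemma dsq_ptilt:
 assumes R:"abs xi<=R"
 shows "(tilt_const R)^2 * dsq n th<=elliptic_functional.dsq mu (ptilt N xi) f n th"
proof -
 interpret T: elliptic_functional B mu "ptilt N xi" "tilt_eps R" f L by (rule ptilt_elliptic[OF R])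
 have R0:"0<=R" using R by linarith
 have hp:"0 < harnack R" using harnack_ge_1[OF R0] by simp
 have c0:"0<=tilt_const R" unfolding tilt_const_def using hp by simp
 have wt:"tilt_const R * wt n x y z w<=T.wt n x y z w"
 if x:"x : space (B n)" and y:"y : space (B (Suc n))" and z:"z : space (B (Suc2 n))"
 and w:"w : space (B (Suc3 n))" for x y z w
 proof -
 have hx:"hfun N xi n x<=exp (L * R)*(exp (L * R)*(exp (L * R)*(harnack R * hfun N xi (Suc3 n) w)))"
 by (intro hfun_mono_step[OF R] x hfun_harnack[OF R] w)
 also have "... = exp (3*(L * R)) * harnack R * hfun N xi (Suc3 n) w"
 by (simp add:mult.assoc[symmetric] flip: exp_add)
 finally have r:"1/(exp (3*(L * R)) * harnack R)<=hfun N xi (Suc3 n) w/hfun N xi n x"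
 using hfun_pos[OF x,of N xi] hp by (simp add:field_simps)
 have e:"exp (- (L * R)) * exp (- (L * R)) * exp (- (L * R))<=wexp N xi n x y * wexp N xi (Suc n) y z * wexp N xi (Suc2 n) z w"
 using wexp_bounds[OF R] wexp_bounds(3)[OF R,THEN less_imp_le] by (intro mult_mono) auto
 have "tilt_const R = exp (- (L * R)) * exp (- (L * R)) * exp (- (L * R))*(1/(exp (3*(L * R)) * harnack R))"
 unfolding tilt_const_def by (simp add:exp_minus field_simps flip: exp_add)
 also have "...<=wexp N xi n x y * wexp N xi (Suc n) y z * wexp N xi (Suc2 n) z w*(hfun N xi (Suc3 n) w/hfun N xi n x)"
 using hp by (intro mult_mono[OF e r] mult_nonneg_nonneg less_imp_le[OF wexp_bounds(3)[OF R]]) auto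
 finally have "tilt_const R * wt n x y z w<=wexp N xi n x y * wexp N xi (Suc n) y z * wexp N xi (Suc2 n) z w*(hfun N xi (Suc3 n) w/hfun N xi n x) * wt n x y z w"
 by (intro mult_right_mono) auto
 also have "... = T.wt n x y z w"
 unfolding T.wt_def wt_def ptilt_def using x y z w hfun_pos[OF y,of N xi] hfun_pos[OF z,of N xi] by simp
 finally show ?thesis .
 qed
 have "(tilt_const R)^2 * dsq n th = (LINT h|hexM n. (tilt_const R)^2*(hexw n h*(2-2 * cos (th * balance n h))))"
 unfolding dsq_def by simp
 also have "...<=T.dsq n th"
 unfolding T.dsq_def
 proof (rule integral_mono[OF integrable_mult_right[OF integrable_dsq] T.integrable_dsq])
 fix h assume "h : space (hexM n)"
 then obtain x w y z y' z' where h:"h = ((x,w),(y,z),(y',z'))"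
 and sp:"x : space (B n)" "w : space (B (Suc3 n))" "y : space (B (Suc n))" "z : space (B (Suc2 n))"
 "y' : space (B (Suc n))" "z' : space (B (Suc2 n))"
 by (auto simp:hexM_def mid_def space_pair_measure)
 have "(tilt_const R * wt n x y z w)*(tilt_const R * wt n x y' z' w)<=T.wt n x y z w * T.wt n x y' z' w"
 using c0 by (intro mult_mono wt sp) auto
 hence "(tilt_const R)^2 * hexw n h<=T.hexw n h"
 by (simp add:h hexw_def T.hexw_def power2_eq_square mult_ac)
 hence "((tilt_const R)^2 * hexw n h)*(2-2 * cos (th * balance n h))<=T.hexw n h*(2-2 * cos (th * balance n h))"
 using one_minus_cos_nonneg by (intro mult_right_mono) auto
 thus "(tilt_const R)^2*(hexw n h*(2-2 * cos (th * balance n h)))<=T.hexw n h*(2-2 * cos (th * balance n h))"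
 by (simp add:mult.assoc)
 qed
 finally show ?thesis .
qed

text \<open>A real shift of the parameter is absorbed into the kernels: the factors
  \<open>exp (xi * f n x y)\<close> combine with the harmonic functions, which telescope. Thus
  \<open>W\<close> at \<open>xi+ze\<close> is \<open>hfun\<close> times the tilted chain's
  \<open>W\<close> at \<open>ze\<close>.\<close>

lemma W_ptilt:
 fixes ze ::"'b::{real_normed_field,banach,second_countable_topology}"
 assumes R:"abs xi<=R"
 shows "n<=N ==> x : space (B n) ==>
 W (N-n) n (of_real xi+ze) x = of_real (hfun N xi n x) * elliptic_functional.W mu (ptilt N xi) f (N-n) n ze x"
proof (induction "N-n" arbitrary: n x)
 interpret T: elliptic_functional B mu "ptilt N xi" "tilt_eps R" f L by (rule ptilt_elliptic[OF R])
 case 0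
 have N:"N-n = 0" using 0 by simp
 show ?case unfolding hfun_def N by simp
next
 interpret T: elliptic_functional B mu "ptilt N xi" "tilt_eps R" f L by (rule ptilt_elliptic[OF R])
 case (Suc k)
 note x = Suc.prems(2)
 note [measurable] = x
 have N:"N-n = Suc (N-Suc n)" "n < N" and k:"k = N-Suc n" using Suc.hyps(2) by auto
 have "of_real (hfun N xi n x) * T.W (N-n) n ze x
 = of_real (hfun N xi n x)*(LINT y|mu (Suc n). ptilt N xi n x y *\<^sub>R (exp (ze * of_real (f n x y)) * T.W (N-Suc n) (Suc n) ze y))"
 unfolding N(1) using x by (simp add:T.integral_K)
 also have "... = (LINT y|mu (Suc n). of_real (hfun N xi n x)*(ptilt N xi n x y *\<^sub>R (exp (ze * of_real (f n x y)) * T.W (N-Suc n) (Suc n) ze y)))"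
 by (simp only: integral_mult_right_zero)
 also have "... = (LINT y|mu (Suc n). p n x y *\<^sub>R (exp ((of_real xi+ze) * of_real (f n x y)) * W (N-Suc n) (Suc n) (of_real xi+ze) y))"
 proof (intro LINT_cong)
 fix y assume "y : space (mu (Suc n))"
 hence y:"y : space (B (Suc n))" by simp
 have IH:"W (N-Suc n) (Suc n) (of_real xi+ze) y = of_real (hfun N xi (Suc n) y) * T.W (N-Suc n) (Suc n) ze y"
 using N y by (intro Suc.hyps(1)[OF k]) auto
 have ex:"exp ((of_real xi+ze) * of_real (f n x y)) = of_real (exp (xi * f n x y)) * exp (ze * of_real (f n x y))"
 by (simp add:distrib_right exp_add flip: exp_of_real)
 show "of_real (hfun N xi n x)*(ptilt N xi n x y *\<^sub>R (exp (ze * of_real (f n x y)) * T.W (N-Suc n) (Suc n) ze y))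
 = p n x y *\<^sub>R (exp ((of_real xi+ze) * of_real (f n x y)) * W (N-Suc n) (Suc n) (of_real xi+ze) y)"
 unfolding IH ex using x y N(2) hfun_pos[OF x,of N xi]
 by (simp add:ptilt_def wexp_def scaleR_conv_of_real)
 qed
 also have "... = W (N-n) n (of_real xi+ze) x"
 unfolding N(1) using x by (simp add:integral_K)
 finally show ?case by (rule sym)
qed

lemma norm_W_tilt_le:
 assumes R:"abs xi<=R" and x:"x : space (B 0)"
 shows "cmod (W N 0 (of_real xi+\<i> * of_real th) x)
<=W N 0 xi x * exp (- ((tilt_eps R)^2/24*(tilt_const R)^2) * Dsum N th)"
proof -
 interpret T: elliptic_functional B mu "ptilt N xi" "tilt_eps R" f L by (rule ptilt_elliptic[OF R])
 have "(tilt_const R)^2 * Dsum N th<=T.Dsum N th"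
 unfolding Dsum_def T.Dsum_def sum_distrib_left by (intro sum_mono dsq_ptilt R)
 hence "(tilt_eps R)^2/24*((tilt_const R)^2 * Dsum N th)<=(tilt_eps R)^2/24 * T.Dsum N th"
 by (intro mult_left_mono) auto
 hence "exp (- ((tilt_eps R)^2/24) * T.Dsum N th)<=exp (- ((tilt_eps R)^2/24*(tilt_const R)^2) * Dsum N th)"
 by (simp add:mult_ac)
 hence *:"cmod (T.W N 0 (\<i> * of_real th) x)<=exp (- ((tilt_eps R)^2/24*(tilt_const R)^2) * Dsum N th)"
 using T.norm_W_le_exp_Dsum[OF x,of N th] by linarith
 have "W N 0 (of_real xi+\<i> * of_real th) x = of_real (hfun N xi 0 x) * T.W N 0 (\<i> * of_real th) x"
 using W_ptilt[OF R,of 0 N x "\<i> * of_real th"] x by simp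
 hence "cmod (W N 0 (of_real xi+\<i> * of_real th) x) = hfun N xi 0 x * cmod (T.W N 0 (\<i> * of_real th) x)"
 using hfun_pos[OF x,of N xi] by (simp add:norm_mult)
 also have "...<=hfun N xi 0 x * exp (- ((tilt_eps R)^2/24*(tilt_const R)^2) * Dsum N th)"
 using * hfun_pos[OF x,of N xi] by (intro mult_left_mono) auto
 finally show ?thesis by (simp add:hfun_def)
qed

definition tiltW ::"nat => real => complex => 'a => complex" where
 "tiltW N xi ze x = W N 0 (of_real xi+ze) x/of_real (W N 0 xi x)"

lemma tiltW_relative_oscillation:
 assumes R:"abs xi<=R" and be:"0 < be" "be<=tilt_eps R/4"
 and ze:"exp (2 * L * norm ze)-1<=tilt_eps R * be/6"
 and x:"x : space (B 0)" and x':"x' : space (B 0)"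
 shows "tiltW N xi ze x ~= 0" "cmod (tiltW N xi ze x-tiltW N xi ze x')<=be * cmod (tiltW N xi ze x')"
proof -
 interpret T: elliptic_functional B mu "ptilt N xi" "tilt_eps R" f L by (rule ptilt_elliptic[OF R])
 have eq:"tiltW N xi ze x = T.W N 0 ze x" if "x : space (B 0)" for x
 using W_ptilt[OF R,of 0 N x ze] that hfun_pos[OF that,of N xi] by (simp add:tiltW_def hfun_def)
 show "tiltW N xi ze x ~= 0" "cmod (tiltW N xi ze x-tiltW N xi ze x')<=be * cmod (tiltW N xi ze x')"
 unfolding eq[OF x] eq[OF x'] using T.W_relative_oscillation[OF be ze x x',of N] by auto
qed

end

section \<open>Arguments of complex means\<close>

text \<open>\<open>Arg\<close> is continuous off the nonpositive real axis and constant on the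
  negative one, so it is a sum of two measurable pieces.\<close>

lemma borel_measurable_Arg [measurable]:"Arg : bm borel"
proof -
 have S:"closed (\<real>\<^sub>\<le>\<^sub>0 :: complex set)" by (rule closed_nonpos_Reals_complex)
 hence [measurable]:"(\<real>\<^sub>\<le>\<^sub>0 :: complex set) : sets borel" by simp
 have "(%z. indicator (- \<real>\<^sub>\<le>\<^sub>0) z *\<^sub>R Arg z) : bm borel"
 by (rule borel_measurable_continuous_on_indicator)
 (auto intro!:continuous_at_imp_continuous_on continuous_at_Arg)
 hence "(%z. indicator (- \<real>\<^sub>\<le>\<^sub>0) z *\<^sub>R Arg z+indicator (\<real>\<^sub>\<le>\<^sub>0 - {0}) z * pi) : bm borel"
 by measurable
 also have "(%z. indicator (- \<real>\<^sub>\<le>\<^sub>0) z *\<^sub>R Arg z+indicator (\<real>\<^sub>\<le>\<^sub>0 - {0}) z * pi) = Arg"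
 proof
 fix z :: complex
 show "indicator (- \<real>\<^sub>\<le>\<^sub>0) z *\<^sub>R Arg z+indicator (\<real>\<^sub>\<le>\<^sub>0 - {0}) z * pi = Arg z"
 proof (cases "z : \<real>\<^sub>\<le>\<^sub>0 & z ~= 0")
 case True
 then obtain r where "z = of_real r" "r<=0" by (auto elim: nonpos_Reals_cases)
 with True have "Arg z = pi" using Arg_of_real[of r] by auto
 with True show ?thesis by simp
 qed (auto simp:indicator_def Arg_zero)
 qed
 finally show ?thesis .
qed

lemma cis_Arg_mult_norm:"of_real (cmod z) * cis (Arg z) = z"
 by (cases "z = 0") (simp_all add:cis_Arg complex_sgn_def scaleR_conv_of_real)

text \<open>Passing from two independent unimodular variables to the directions of their means costs a factor 4:
 if the angle \<open>ph\<close> between the directions is acute,shrinking the means only helps,otherwise both sides are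
 comparable to \<open>q q'\<close>.\<close>

lemma direction_of_mean:
 fixes A A' :: complex
 assumes "cmod A<=q" "cmod A'<=q'"
 shows "q * q'*(2-2 * cos (s+Arg A-Arg A'))<=2*(2 * q * q'-2 * Re (cis s * A * cnj A'))"
proof -
 let ?c = "cos (s+Arg A-Arg A')"
 have "cis s * A * cnj A' = cis s*(of_real (cmod A) * cis (Arg A)) * cnj (of_real (cmod A') * cis (Arg A'))"
 by (simp only: cis_Arg_mult_norm)
 also have "... = of_real (cmod A * cmod A') * cis (s+Arg A-Arg A')"
 proof -
 have "cis (s+Arg A-Arg A') = cis s * cis (Arg A) * cis (- Arg A')" by (simp add:cis_mult)
 thus ?thesis by (simp add:cis_cnj)
 qed
 finally have Re:"Re (cis s * A * cnj A') = cmod A * cmod A'*?c" by simp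
 have q:"0<=q" "0<=q'" using assms norm_ge_zero order_trans by blast+
 have AA:"cmod A * cmod A'<=q * q'" "0<=cmod A * cmod A'" using assms q by (auto intro:mult_mono)
 show ?thesis
 proof (cases "0<=?c")
 case True
 hence "cmod A * cmod A'*?c<=q * q'*?c" using AA by (intro mult_right_mono) auto
 moreover have "q * q'*?c<=q * q'*1" using q by (intro mult_left_mono) auto
 ultimately show ?thesis unfolding Re by (simp add:algebra_simps)
 next
 case False
 hence "cmod A * cmod A'*?c<=0" using AA(2) by (intro mult_nonneg_nonpos) auto
 moreover have "q * q'*(- 1)<=q * q'*?c" using q by (intro mult_left_mono) auto
 ultimately show ?thesis unfolding Re by (simp add:algebra_simps)
 qed
qed

text \<open>A positive combination of vectors in the sector of half-angle \<open>a<=pi/2\<close>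
  stays in it. If the argument exceeded \<open>a\<close>, rotating by \<open>- a\<close> would make
  the imaginary part of the mean positive, though every rotated summand has a nonpositive one;
  similarly on the other side.\<close>

lemma abs_Arg_integral_le:
 fixes g s ::"'x => real"
 assumes i:"integrable rh (%y. of_real (g y) * cis (s y))"
 and g:"!!y. y : space rh ==> 0<=g y" and s:"!!y. y : space rh ==> abs (s y)<=a"
 and a:"0 < a" "2 * a<=pi"
 shows "abs (Arg (LINT y|rh. of_real (g y) * cis (s y)))<=a"
proof (cases "(LINT y|rh. of_real (g y) * cis (s y)) = 0")
 case True
 thus ?thesis using a by (simp add:Arg_zero)
next
 case False
 let ?A = "LINT y|rh. complex_of_real (g y) * cis (s y)"
 have r:"0 < cmod ?A" using False by simp
 have Im:"cmod ?A * sin (Arg ?A+b) = (LINT y|rh. g y * sin (s y+b))" for b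
 proof -
 have "cmod ?A * sin (Arg ?A+b) = Im ((of_real (cmod ?A) * cis (Arg ?A)) * cis b)"
 by (simp add:sin_add distrib_left mult_ac)
 also have "... = Im (?A * cis b)" by (simp only: cis_Arg_mult_norm)
 also have "... = Im (LINT y|rh. (of_real (g y) * cis (s y)) * cis b)" by simp
 also have "... = (LINT y|rh. Im ((of_real (g y) * cis (s y)) * cis b))"
 by (rule integral_Im[symmetric]) (intro integrable_mult_left i)
 also have "... = (LINT y|rh. g y * sin (s y+b))"
 by (intro LINT_cong) (simp add:sin_add algebra_simps)
 finally show ?thesis .
 qed
 have "Arg ?A<=a"
 proof (rule ccontr)
 assume "\<not> Arg ?A<=a"
 hence "0 < sin (Arg ?A+- a)" using a Arg_le_pi[of ?A] by (intro sin_gt_zero) auto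
 moreover have "0<=(LINT y|rh. - (g y * sin (s y+- a)))"
 proof (rule LINT_nonneg)
 fix y assume y:"y : space rh"
 have "0<=sin (a-s y)" using s[OF y] a by (intro sin_ge_zero) auto
 hence "sin (s y+- a)<=0" using sin_minus[of "a-s y"] by simp
 hence "g y * sin (s y+- a)<=0" using g[OF y] by (intro mult_nonneg_nonpos)
 thus "0<=- (g y * sin (s y+- a))" by simp
 qed
 ultimately show False using mult_pos_pos[OF r,of "sin (Arg ?A+- a)"] unfolding Im by simp
 qed
 moreover have "- a<=Arg ?A"
 proof (rule ccontr)
 assume n:"\<not> - a<=Arg ?A"
 have "0 < sin (- (Arg ?A+a))" using n a mpi_less_Arg[of ?A] by (intro sin_gt_zero) auto
 hence "sin (Arg ?A+a) < 0" using sin_minus[of "Arg ?A+a"] by linarith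
 moreover have "0<=(LINT y|rh. g y * sin (s y+a))"
 proof (rule LINT_nonneg)
 fix y assume y:"y : space rh"
 have "0<=sin (s y+a)" using s[OF y] a by (intro sin_ge_zero) auto
 thus "0<=g y * sin (s y+a)" using g[OF y] by simp
 qed
 ultimately show False using mult_pos_neg[OF r,of "sin (Arg ?A+a)"] unfolding Im by simp
 qed
 ultimately show ?thesis by simp
qed

lemma integral_scaled_diff_Re:
 fixes v ::"'x => complex"
 assumes "integrable rh g" "integrable rh v"
 shows "(LINT y|rh. w*(a * g y-2 * Re (v y))) = w*(a*(LINT y|rh. g y)-2 * Re (LINT y|rh. v y))"
 using assms(1) integrable_Re[OF assms(2)] integral_Re[OF assms(2)] by simp

section \<open>Gradient potentials from a reference pair\<close>

context elliptic_functional
begin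

definition bridge ::"nat => real => 'a => 'a => complex" where
 "bridge n th o1 x = (LINT y|mu (Suc n). of_real (p n o1 y * p (Suc n) y x) * cis (th*(f n o1 y+f (Suc n) y x)))"

text \<open>The candidate gradient potential at \<open>x\<close> is the average phase picked up between a reference point
 two steps earlier and \<open>x\<close>.\<close>

definition pot ::"nat => real => 'a => 'a => real" where
 "pot n th o1 x = Arg (bridge n th o1 x)/th"

text \<open>The balance of the hexagon from \<open>o1\<close> to \<open>z\<close> through
  \<open>y,x\<close> and through \<open>o2,y'\<close>, with the phase of \<open>o1,y,x\<close> and
  that of \<open>o2,y',z\<close> replaced by their mean directions. So \<open>f\<close> at
  \<open>x,z\<close> is a gradient, plus the constant \<open>f n o1 o2\<close>, plus this
  error.\<close>

definition residual ::"nat => real => 'a => 'a => 'a => 'a => real" where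
 "residual n th o1 o2 x z = f (Suc2 n) x z+pot n th o1 x-pot (Suc n) th o2 z-f n o1 o2"

definition grad_err ::"nat => real => 'a => 'a => ennreal" where
 "grad_err n th o1 o2 = (NN x|mu (Suc2 n). NN z|mu (Suc3 n). ennreal (p (Suc2 n) x z*(2-2 * cos (th * residual n th o1 o2 x z))))"

lemma bridge_measurable [measurable (raw)]:
 assumes [measurable]:"g : M \<rightarrow>\<^sub>M B n" "h : M \<rightarrow>\<^sub>M B (Suc2 n)"
 shows "(%om. bridge n th (g om) (h om)) : bm M"
proof -
 interpret prob_space "mu (Suc n)" by (rule prob_mu)
 show ?thesis unfolding bridge_def cis_conv_exp by measurable
qed

lemma pot_measurable [measurable (raw)]:
 assumes [measurable]:"g : M \<rightarrow>\<^sub>M B n" "h : M \<rightarrow>\<^sub>M B (Suc2 n)"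
 shows "(%om. pot n th (g om) (h om)) : bm M"
 unfolding pot_def by measurable

lemma residual_measurable [measurable (raw)]:
 assumes [measurable]:"a : M \<rightarrow>\<^sub>M B n" "b : M \<rightarrow>\<^sub>M B (Suc n)" "c : M \<rightarrow>\<^sub>M B (Suc2 n)"
 "d : M \<rightarrow>\<^sub>M B (Suc3 n)"
 shows "(%om. residual n th (a om) (b om) (c om) (d om)) : bm M"
 unfolding residual_def by measurable

lemma abs_pot_le:"th > 0 ==> abs (pot n th o1 x)<=pi/th"
 using Arg_bounded[of "bridge n th o1 x"] unfolding pot_def
 by (auto simp:abs_le_iff divide_simps)

lemma integrable_bridge:
 assumes o1 [measurable]:"o1 : space (B n)" and x [measurable]:"x : space (B (Suc2 n))"
 shows "integrable (mu (Suc n)) (%y. complex_of_real (p n o1 y * p (Suc n) y x) * cis (th*(f n o1 y+f (Suc n) y x)))"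
 and "integrable (mu (Suc n)) (%y. p n o1 y * p (Suc n) y x)"
proof -
 have pp:"norm (p n o1 y * p (Suc n) y x)<=(1/ep)*(1/ep)" for y
 unfolding norm_mult using eps by (intro mult_mono) (auto simp:p_le)
 thus "integrable (mu (Suc n)) (%y. p n o1 y * p (Suc n) y x)"
 by (intro integrable_mu[where C = "(1/ep)*(1/ep)"]) auto
 have "norm (complex_of_real (p n o1 y * p (Suc n) y x) * cis (th*(f n o1 y+f (Suc n) y x)))<=(1/ep)*(1/ep)" for y
 using pp[of y] by (simp add:norm_mult)
 thus "integrable (mu (Suc n)) (%y. complex_of_real (p n o1 y * p (Suc n) y x) * cis (th*(f n o1 y+f (Suc n) y x)))"
 by (intro integrable_mu[where C = "(1/ep)*(1/ep)"]) (auto simp:cis_conv_exp)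
qed

text \<open>At small angles all phases lie within \<open>2 * L * th\<close> of 0, hence so does the
  direction of their mean; dividing by \<open>th\<close> gives a bound that does not blow up as
  \<open>th\<close> tends to 0.\<close>

lemma abs_pot_le_small:
 assumes th:"0 < th" "6 * L * th<=1" and o1:"o1 : space (B n)" and x:"x : space (B (Suc2 n))"
 shows "abs (pot n th o1 x)<=2 * L"
proof -
 have "abs (Arg (bridge n th o1 x))<=2 * L * th"
 unfolding bridge_def
 proof (rule abs_Arg_integral_le[OF integrable_bridge(1)[OF o1 x]])
 fix y
 have "abs th * abs (f n o1 y+f (Suc n) y x)<=th*(2 * L)"
 using th f_bound[of n o1 y] f_bound[of "Suc n" y x] by (intro mult_mono) auto
 thus "abs (th*(f n o1 y+f (Suc n) y x))<=2 * L * th" by (simp add:abs_mult mult_ac)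
 show "2*(2 * L * th)<=pi" using th pi_gt3 by simp
 qed (use th L_pos in auto)
 thus ?thesis using th unfolding pot_def by (simp add:abs_divide divide_simps)
qed

lemma norm_bridge_le:
 assumes o1:"o1 : space (B n)" and x:"x : space (B (Suc2 n))"
 shows "cmod (bridge n th o1 x)<=(LINT y|mu (Suc n). p n o1 y * p (Suc n) y x)"
 unfolding bridge_def
 using integral_norm_bound[of "mu (Suc n)" "%y. of_real (p n o1 y * p (Suc n) y x) * cis (th*(f n o1 y+f (Suc n) y x))"]
 by (simp add:norm_mult)

abbreviation hexterm ::"nat => real => 'a => 'a => 'a => 'a => 'a => 'a => real" where
 "hexterm n th o1 z y x o2 y' \<equiv> hexw n ((o1,z),(y,x),(o2,y'))*(2-2 * cos (th * balance n ((o1,z),(y,x),(o2,y'))))"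

text \<open>Integrating out \<open>y\<close> and \<open>y'\<close> separately replaces the two
  phases by the complex means \<open>bridge\<close>, and \<open>direction_of_mean\<close> passes
  from these means to their directions. The normalisations of the two means are at least
  \<open>ep\<close> each by two-step ellipticity, whence \<open>2/ep^2\<close>.\<close>

lemma residual_le_hexterm:
 assumes o1:"o1 : space (B n)" and o2:"o2 : space (B (Suc n))"
 and x:"x : space (B (Suc2 n))" and z:"z : space (B (Suc3 n))" and th:"th ~= 0"
 shows "ennreal (p n o1 o2) * ennreal (p (Suc2 n) x z*(2-2 * cos (th * residual n th o1 o2 x z)))
<=ennreal (2/ep^2)*(NN y|mu (Suc n). NN y'|mu (Suc2 n). ennreal (hexterm n th o1 z y x o2 y'))"
proof -
 note [measurable] = o1 o2 x z
 interpret M1: prob_space "mu (Suc n)" by (rule prob_mu)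
 interpret M2: prob_space "mu (Suc2 n)" by (rule prob_mu)
 let ?g = "%y. p n o1 y * p (Suc n) y x" and ?g' = "%y. p (Suc n) o2 y * p (Suc2 n) y z"
 let ?u = "%y. cis (th*(f n o1 y+f (Suc n) y x))" and ?u' = "%y. cis (th*(f (Suc n) o2 y+f (Suc2 n) y z))"
 let ?q = "LINT y|mu (Suc n). ?g y" and ?q' = "LINT y|mu (Suc2 n). ?g' y"
 let ?A = "bridge n th o1 x" and ?A' = "bridge (Suc n) th o2 z"
 let ?s = "th*(f (Suc2 n) x z-f n o1 o2)"
 let ?w = "p n o1 o2 * p (Suc2 n) x z"
 note iA = integrable_bridge[OF o1 x] and iA' = integrable_bridge[OF o2 z]
 have hexeq:"hexterm n th o1 z y x o2 y' = ?w*(2*?g y*?g' y'-2 * Re (cis ?s*(?g y*?u y) * cnj (?g' y'*?u' y')))" for y y'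
 proof -
 have "Re (cis ?s*(?g y*?u y) * cnj (?g' y'*?u' y')) = ?g y*?g' y' * Re (cis ?s*?u y * cnj (?u' y'))"
 by (simp del: times_complex.simps cis.sel add:algebra_simps) (simp add:algebra_simps)
 also have "cis ?s*?u y * cnj (?u' y') = cis (th * balance n ((o1,z),(y,x),(o2,y')))"
 by (simp add:cis_mult cis_cnj balance_def path_sum_def algebra_simps)
 finally show ?thesis by (simp add:hexw_def wt_def algebra_simps)
 qed
 have inner:"(LINT y'|mu (Suc2 n). hexterm n th o1 z y x o2 y')
 = ?w*((2*?q')*?g y-2 * Re (cis ?s*(?g y*?u y) * cnj ?A'))" for y
 proof -
 have i:"integrable (mu (Suc2 n)) (%y'. cis ?s*(?g y*?u y) * cnj (?g' y'*?u' y'))"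
 by (intro integrable_mult_right LINT_integrable_cnj iA')
 have v:"(LINT y'|mu (Suc2 n). cis ?s*(?g y*?u y) * cnj (?g' y'*?u' y')) = cis ?s*(?g y*?u y) * cnj ?A'"
 unfolding integral_mult_right_zero bridge_def by (subst LINT_cnj) (rule refl)
 show ?thesis unfolding hexeq integral_scaled_diff_Re[OF iA'(2) i] v by (simp only: mult_ac)
 qed
 have outer:"(LINT y|mu (Suc n). ?w*((2*?q')*?g y-2 * Re (cis ?s*(?g y*?u y) * cnj ?A')))
 = ?w*(2*?q*?q'-2 * Re (cis ?s*?A * cnj ?A'))"
 proof -
 have i:"integrable (mu (Suc n)) (%y. cis ?s*(?g y*?u y) * cnj ?A')"
 by (intro integrable_mult_right integrable_mult_left iA)
 have v:"(LINT y|mu (Suc n). cis ?s*(?g y*?u y) * cnj ?A') = cis ?s*?A * cnj ?A'"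
 unfolding integral_mult_left_zero integral_mult_right_zero bridge_def ..
 show ?thesis unfolding integral_scaled_diff_Re[OF iA(2) i] v by (simp only: mult_ac)
 qed
 have nn:"0<=hexterm n th o1 z y x o2 y'" for y y'
 using one_minus_cos_nonneg by (intro mult_nonneg_nonneg) auto
 have bd:"abs (hexterm n th o1 z y x o2 y')<=(1/ep ^ 3)^2*4" for y y'
 unfolding abs_mult using hexw_le one_minus_cos_nonneg one_minus_cos_le by (intro mult_mono) auto
 have meas:"(%(y,y'). hexterm n th o1 z y x o2 y') : bm (B (Suc n) \<Otimes>\<^sub>M B (Suc2 n))"
 unfolding hexw_def balance_def fst_conv snd_conv by measurable
 have meas1:"(%y'. hexterm n th o1 z y x o2 y') : bm (B (Suc2 n))" if "y : space (B (Suc n))" for y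
 using measurable_compose[OF measurable_Pair1'[OF that] meas] by simp
 have I:"(NN y|mu (Suc n). NN y'|mu (Suc2 n). ennreal (hexterm n th o1 z y x o2 y'))
 = ennreal (?w*(2*?q*?q'-2 * Re (cis ?s*?A * cnj ?A')))"
 proof -
 have "(NN y'|mu (Suc2 n). ennreal (hexterm n th o1 z y x o2 y')) = ennreal (LINT y'|mu (Suc2 n). hexterm n th o1 z y x o2 y')"
 if "y : space (B (Suc n))" for y
 using meas1[OF that] bd nn by (intro nn_integral_eq_integral integrable_mu) auto
 hence "(NN y|mu (Suc n). NN y'|mu (Suc2 n). ennreal (hexterm n th o1 z y x o2 y'))
 = (NN y|mu (Suc n). ennreal (LINT y'|mu (Suc2 n). hexterm n th o1 z y x o2 y'))"
 by (intro nn_integral_cong) auto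
 also have "... = ennreal (LINT y|mu (Suc n). (LINT y'|mu (Suc2 n). hexterm n th o1 z y x o2 y'))"
 proof (rule nn_integral_eq_integral)
 show "integrable (mu (Suc n)) (%y. LINT y'|mu (Suc2 n). hexterm n th o1 z y x o2 y')"
 proof (rule integrable_mu)
 show "(%y. LINT y'|mu (Suc2 n). hexterm n th o1 z y x o2 y') : bm (B (Suc n))"
 using meas by (intro M2.borel_measurable_lebesgue_integral) (simp cong: measurable_cong_sets)
 show "norm (LINT y'|mu (Suc2 n). hexterm n th o1 z y x o2 y')<=(1/ep ^ 3)^2*4" for y
 using bd by (intro M2.norm_integral_le_bound) auto
 qed
 qed (use nn in \<open>auto intro!:LINT_nonneg\<close>)
 finally show ?thesis unfolding inner outer .
 qed
 have q:"ep<=?q" "ep<=?q'" using two_step[OF o1 x] two_step[OF o2 z] by auto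
 have qq:"ep^2<=?q*?q'" unfolding power2_eq_square using q eps by (intro mult_mono) auto
 \<comment> \<open>By the choice of \<open>pot\<close> the scaled residual is exactly the angle of
   \<open>direction_of_mean\<close>.\<close>
 have ang:"th * residual n th o1 o2 x z = ?s+Arg ?A-Arg ?A'"
 using th by (simp add:residual_def pot_def algebra_simps)
 define c where "c = 2-2 * cos (th * residual n th o1 o2 x z)"
 define X where "X = 2*?q*?q'-2 * Re (cis ?s*?A * cnj ?A')"
 have c:"0<=c" unfolding c_def by (rule one_minus_cos_nonneg)
 have "ep^2 * c<=?q*?q' * c"
 using qq c by (rule mult_right_mono)
 also have "...<=2 * X"
 unfolding c_def X_def ang by (rule direction_of_mean[OF norm_bridge_le[OF o1 x] norm_bridge_le[OF o2 z]])
 finally have "c<=2/ep^2 * X"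
 using eps by (simp add:field_simps)
 hence "?w * c<=?w*(2/ep^2 * X)"
 by (intro mult_left_mono) auto
 hence "ennreal (p n o1 o2*(p (Suc2 n) x z * c))<=ennreal (2/ep^2*(?w * X))"
 by (intro ennreal_leI) (simp only: mult_ac)
 also have "... = ennreal (2/ep^2) * ennreal (?w * X)"
 by (rule ennreal_mult') simp
 also have "ennreal (p n o1 o2*(p (Suc2 n) x z * c)) = ennreal (p n o1 o2) * ennreal (p (Suc2 n) x z * c)"
 by (rule ennreal_mult') simp
 finally show ?thesis unfolding I X_def[symmetric] c_def .
qed

end

section \<open>Integration over all hexagons\<close>

context elliptic_functional
begin

lemma nn_integral_mu_swap:
 assumes [measurable]:"case_prod g : bm (B i \<Otimes>\<^sub>M B j)"
 shows "(NN a|mu i. NN b|mu j. g a b) = (NN b|mu j. NN a|mu i. g a b)"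
proof -
 interpret pair_sigma_finite "mu j" "mu i" unfolding pair_sigma_finite_def by (simp add:sigma_finite_mu)
 show ?thesis by (rule Fubini') measurable
qed

text \<open>As an \<open>ennreal\<close> value the integrand is amenable to Tonelli, so the six
  integrations can be permuted without integrability proofs.\<close>

definition hexK ::"nat => real => 'a => 'a => 'a => 'a => 'a => 'a => ennreal" where
 "hexK n th o1 z y x o2 y' = ennreal (hexterm n th o1 z y x o2 y')"

lemma hexK_measurable [measurable (raw)]:
 assumes [measurable]:"a : M \<rightarrow>\<^sub>M B n" "b : M \<rightarrow>\<^sub>M B (Suc3 n)" "c : M \<rightarrow>\<^sub>M B (Suc n)"
 "d : M \<rightarrow>\<^sub>M B (Suc2 n)" "e : M \<rightarrow>\<^sub>M B (Suc n)" "g : M \<rightarrow>\<^sub>M B (Suc2 n)"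
 shows "(%om. hexK n th (a om) (b om) (c om) (d om) (e om) (g om)) : bm M"
 unfolding hexK_def hexw_def balance_def fst_conv snd_conv by measurable

lemma nn_integral_hexK:
 "(NN o1|mu n. NN z|mu (Suc3 n). NN y|mu (Suc n). NN x|mu (Suc2 n). NN o2|mu (Suc n). NN y'|mu (Suc2 n). hexK n th o1 z y x o2 y') = ennreal (dsq n th)"
proof -
 interpret M: prob_space "mu m" for m by (rule prob_mu)
 interpret m: prob_space "mid n" by (rule prob_mid)
 interpret mm: prob_space "mid n \<Otimes>\<^sub>M mid n" by (intro prob_pair prob_mid)
 let ?H = "%h. ennreal (hexw n h*(2-2 * cos (th * balance n h)))"
 have [measurable]:"?H : bm (hexM n)" by measurable
 hence Hm:"?H : bm ((mu n \<Otimes>\<^sub>M mu (Suc3 n)) \<Otimes>\<^sub>M (mid n \<Otimes>\<^sub>M mid n))"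
 by (simp add:hexM_def)
 have "ennreal (dsq n th) = (NN h|hexM n. ?H h)"
 unfolding dsq_def using integrable_dsq one_minus_cos_nonneg
 by (intro nn_integral_eq_integral[symmetric]) auto
 also have "... = (NN e|(mu n \<Otimes>\<^sub>M mu (Suc3 n)). NN m|(mid n \<Otimes>\<^sub>M mid n). ?H (e,m))"
 unfolding hexM_def by (rule mm.nn_integral_fst[OF Hm,symmetric])
 also have "... = (NN o1|mu n. NN z|mu (Suc3 n). NN m|(mid n \<Otimes>\<^sub>M mid n). ?H ((o1,z),m))"
 by (rule M.nn_integral_fst[symmetric]) (rule mm.borel_measurable_nn_integral_fst[OF Hm])
 also have "... = (NN o1|mu n. NN z|mu (Suc3 n). NN y|mu (Suc n). NN x|mu (Suc2 n). NN o2|mu (Suc n). NN y'|mu (Suc2 n). hexK n th o1 z y x o2 y')"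
 proof (intro nn_integral_cong)
 fix o1 z assume "o1 : space (mu n)" "z : space (mu (Suc3 n))"
 hence [measurable]:"o1 : space (B n)" "z : space (B (Suc3 n))" by auto
 have H:"?H ((o1,z),m) = hexK n th o1 z (fst (fst m)) (snd (fst m)) (fst (snd m)) (snd (snd m))" for m
 by (simp add:hexK_def)
 have "(NN m|(mid n \<Otimes>\<^sub>M mid n). ?H ((o1,z),m))
 = (NN m1|mid n. NN m2|mid n. hexK n th o1 z (fst m1) (snd m1) (fst m2) (snd m2))"
 proof -
 have "(%m. hexK n th o1 z (fst (fst m)) (snd (fst m)) (fst (snd m)) (snd (snd m))) : bm (mid n \<Otimes>\<^sub>M mid n)"
 by measurable
 from m.nn_integral_fst[OF this] show ?thesis unfolding H by simp
 qed
 also have "... = (NN y|mu (Suc n). NN x|mu (Suc2 n). NN m2|mid n. hexK n th o1 z y x (fst m2) (snd m2))"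
 proof -
 have "(%m1. NN m2|mid n. hexK n th o1 z (fst m1) (snd m1) (fst m2) (snd m2)) : bm (mu (Suc n) \<Otimes>\<^sub>M mu (Suc2 n))"
 by measurable
 from M.nn_integral_fst[OF this] show ?thesis by (simp add:mid_def)
 qed
 also have "... = (NN y|mu (Suc n). NN x|mu (Suc2 n). NN o2|mu (Suc n). NN y'|mu (Suc2 n). hexK n th o1 z y x o2 y')"
 proof (intro nn_integral_cong)
 fix y x assume "y : space (mu (Suc n))" "x : space (mu (Suc2 n))"
 hence [measurable]:"y : space (B (Suc n))" "x : space (B (Suc2 n))" by auto
 have "(%m2. hexK n th o1 z y x (fst m2) (snd m2)) : bm (mu (Suc n) \<Otimes>\<^sub>M mu (Suc2 n))"
 by measurable
 from M.nn_integral_fst[OF this]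
 show "(NN m2|mid n. hexK n th o1 z y x (fst m2) (snd m2)) = (NN o2|mu (Suc n). NN y'|mu (Suc2 n). hexK n th o1 z y x o2 y')"
 by (simp add:mid_def)
 qed
 finally show "(NN m|(mid n \<Otimes>\<^sub>M mid n). ?H ((o1,z),m)) = ..." .
 qed
 finally show ?thesis by (rule sym)
qed

text \<open>The pair \<open>o1,o2\<close> is moved to the outermost integrals, because it is the
  pair that will be fixed as a reference.\<close>

lemma nn_integral_hexK_reorder:
 "(NN o1|mu n. NN o2|mu (Suc n). NN x|mu (Suc2 n). NN z|mu (Suc3 n). NN y|mu (Suc n). NN y'|mu (Suc2 n). hexK n th o1 z y x o2 y') = ennreal (dsq n th)"
proof -
 interpret M: prob_space "mu m" for m by (rule prob_mu)
 let ?M1 = "mu (Suc n)" and ?M2 = "mu (Suc2 n)" and ?M3 = "mu (Suc3 n)"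
 have eq:"(NN o2|?M1. NN x|?M2. NN z|?M3. NN y|?M1. NN y'|?M2. hexK n th o1 z y x o2 y')
 = (NN z|?M3. NN y|?M1. NN x|?M2. NN o2|?M1. NN y'|?M2. hexK n th o1 z y x o2 y')"
 if "o1 : space (mu n)" for o1
 proof -
 from that have [measurable]:"o1 : space (B n)" by simp
 let ?G = "%z y x o2 y'. hexK n th o1 z y x o2 y'"
 have "(NN z|?M3. NN y|?M1. NN x|?M2. NN o2|?M1. NN y'|?M2. ?G z y x o2 y')
 = (NN z|?M3. NN y|?M1. NN o2|?M1. NN x|?M2. NN y'|?M2. ?G z y x o2 y')"
 proof (intro nn_integral_cong nn_integral_mu_swap)
 fix z y assume "z : space ?M3" "y : space ?M1"
 hence [measurable]:"z : space (B (Suc3 n))" "y : space (B (Suc n))" by auto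
 show "(%(x,o2). NN y'|?M2. ?G z y x o2 y') : bm (B (Suc2 n) \<Otimes>\<^sub>M B (Suc n))" by measurable
 qed
 also have "... = (NN z|?M3. NN o2|?M1. NN y|?M1. NN x|?M2. NN y'|?M2. ?G z y x o2 y')"
 proof (rule nn_integral_cong,rule nn_integral_mu_swap)
 fix z assume "z : space ?M3"
 hence [measurable]:"z : space (B (Suc3 n))" by auto
 show "(%(y,o2). NN x|?M2. NN y'|?M2. ?G z y x o2 y') : bm (B (Suc n) \<Otimes>\<^sub>M B (Suc n))" by measurable
 qed
 also have "... = (NN o2|?M1. NN z|?M3. NN y|?M1. NN x|?M2. NN y'|?M2. ?G z y x o2 y')"
 by (rule nn_integral_mu_swap) measurable
 also have "... = (NN o2|?M1. NN z|?M3. NN x|?M2. NN y|?M1. NN y'|?M2. ?G z y x o2 y')"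
 proof (intro nn_integral_cong nn_integral_mu_swap)
 fix o2 z assume "o2 : space ?M1" "z : space ?M3"
 hence [measurable]:"z : space (B (Suc3 n))" "o2 : space (B (Suc n))" by auto
 show "(%(y,x). NN y'|?M2. ?G z y x o2 y') : bm (B (Suc n) \<Otimes>\<^sub>M B (Suc2 n))" by measurable
 qed
 also have "... = (NN o2|?M1. NN x|?M2. NN z|?M3. NN y|?M1. NN y'|?M2. ?G z y x o2 y')"
 proof (intro nn_integral_cong nn_integral_mu_swap)
 fix o2 assume "o2 : space ?M1"
 hence [measurable]:"o2 : space (B (Suc n))" by auto
 show "(%(z,x). NN y|?M1. NN y'|?M2. ?G z y x o2 y') : bm (B (Suc3 n) \<Otimes>\<^sub>M B (Suc2 n))" by measurable
 qed
 finally show ?thesis by (rule sym)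
 qed
 show ?thesis unfolding nn_integral_hexK[symmetric] by (rule nn_integral_cong) (rule eq)
qed

lemma grad_err_measurable [measurable]:
 "case_prod (grad_err n th) : bm (B n \<Otimes>\<^sub>M B (Suc n))"
proof -
 interpret M: prob_space "mu m" for m by (rule prob_mu)
 show ?thesis unfolding grad_err_def[abs_def] by measurable
qed

text \<open>Averaged over the reference pair the gradient error is controlled by \<open>dsq\<close>;
  a favourable pair is selected later.\<close>

lemma nn_integral_grad_err_le:
 assumes th:"th ~= 0"
 shows "(NN o1|mu n. NN o2|mu (Suc n). ennreal (p n o1 o2) * grad_err n th o1 o2)
<=ennreal (2/ep^2) * ennreal (dsq n th)"
proof -
 interpret M: prob_space "mu m" for m by (rule prob_mu)
 let ?M1 = "mu (Suc n)" and ?M2 = "mu (Suc2 n)" and ?M3 = "mu (Suc3 n)"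
 let ?c = "ennreal (2/ep^2)"
 let ?I = "%o1 o2 x z. NN y|?M1. NN y'|?M2. hexK n th o1 z y x o2 y'"
 have "(NN o1|mu n. NN o2|?M1. ennreal (p n o1 o2) * grad_err n th o1 o2)
<=(NN o1|mu n. NN o2|?M1. ?c*(NN x|?M2. NN z|?M3. ?I o1 o2 x z))"
 proof (intro nn_integral_mono)
 fix o1 o2 assume "o1 : space (mu n)" "o2 : space ?M1"
 hence o12 [measurable]:"o1 : space (B n)" "o2 : space (B (Suc n))" by auto
 have "ennreal (p n o1 o2) * grad_err n th o1 o2
 = (NN x|?M2. ennreal (p n o1 o2)*(NN z|?M3. ennreal (p (Suc2 n) x z*(2-2 * cos (th * residual n th o1 o2 x z)))))"
 unfolding grad_err_def by (rule nn_integral_cmult[symmetric]) measurable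
 also have "... = (NN x|?M2. NN z|?M3. ennreal (p n o1 o2) * ennreal (p (Suc2 n) x z*(2-2 * cos (th * residual n th o1 o2 x z))))"
 proof (intro nn_integral_cong nn_integral_cmult[symmetric])
 fix x assume "x : space ?M2"
 hence [measurable]:"x : space (B (Suc2 n))" by simp
 show "(%z. ennreal (p (Suc2 n) x z*(2-2 * cos (th * residual n th o1 o2 x z)))) : bm ?M3" by measurable
 qed
 also have "...<=(NN x|?M2. NN z|?M3. ?c*?I o1 o2 x z)"
 using residual_le_hexterm[OF o12 _ _ th,folded hexK_def] by (intro nn_integral_mono) auto
 also have "... = (NN x|?M2. ?c*(NN z|?M3. ?I o1 o2 x z))"
 proof (intro nn_integral_cong nn_integral_cmult)
 fix x assume "x : space ?M2"
 hence [measurable]:"x : space (B (Suc2 n))" by simp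
 show "(%z. ?I o1 o2 x z) : bm ?M3" by measurable
 qed
 also have "... = ?c*(NN x|?M2. NN z|?M3. ?I o1 o2 x z)"
 by (intro nn_integral_cmult) measurable
 finally show "ennreal (p n o1 o2) * grad_err n th o1 o2<=..." .
 qed
 also have "... = (NN o1|mu n. ?c*(NN o2|?M1. NN x|?M2. NN z|?M3. ?I o1 o2 x z))"
 proof (intro nn_integral_cong nn_integral_cmult)
 fix o1 assume "o1 : space (mu n)"
 hence [measurable]:"o1 : space (B n)" by simp
 show "(%o2. NN x|?M2. NN z|?M3. ?I o1 o2 x z) : bm ?M1" by measurable
 qed
 also have "... = ?c * ennreal (dsq n th)"
 unfolding nn_integral_hexK_reorder[symmetric] by (intro nn_integral_cmult) measurable
 finally show ?thesis .
qed

end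

section \<open>The chain as a stochastic process\<close>

text \<open>The Markov property is one identity between integrals of functions of the past and the
  next state. It carries the same information as the conditional distributions, is easy to use under
  integrals and passes directly to tilted measures. The law of \<open>X 0\<close> is left
  free.\<close>

locale elliptic_process = elliptic_functional B mu p ep f L+prob_space M
 for B mu ::"nat => 'a measure" and p ep f L and M ::"'w measure" +
 fixes F ::"nat => 'w measure" and X ::"nat => 'w => 'a"
 assumes subalg:"!!n. subalgebra M (F n)"
 and F_mono:"!!n. (%x. x) : F (Suc n) \<rightarrow>\<^sub>M F n"
 and X_F:"!!i n. i<=n ==> X i : F n \<rightarrow>\<^sub>M B i"
 and markov:"!!n Ps. Ps : bm (F n \<Otimes>\<^sub>M B (Suc n)) ==>
 (NN om|M. Ps (om,X (Suc n) om)) = (NN om|M. (NN y|K n (X n om). (Ps (om,y) :: ennreal)))"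
begin

lemma F_id [measurable]:"(%x. x) : M \<rightarrow>\<^sub>M F n"
 using subalg[of n] by (auto simp:subalgebra_def measurable_def)

lemma space_F:"space (F n) = space M"
 using subalg[of n] by (simp add:subalgebra_def)

lemma X_M [measurable]:"X n : M \<rightarrow>\<^sub>M B n"
 using measurable_compose[OF F_id X_F[of n n]] by simp

lemma X_Fn [measurable]:"X n : F n \<rightarrow>\<^sub>M B n"
 by (rule X_F) simp

lemma X_space [simp]:"om : space M ==> X n om : space (B n)"
 using measurable_space[OF X_M] .

definition S ::"nat => 'w => real" where
 "S n om = (\<Sum>m<n. f m (X m om) (X (Suc m) om))"

lemma S_F:"n<=m ==> S n : bm (F m)"
 unfolding S_def[abs_def] by (intro borel_measurable_sum f_measurable X_F) auto

lemma S_Fn [measurable]:"S n : bm (F n)"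
 by (rule S_F) simp

lemma S_M [measurable]:"S n : bm M"
 using measurable_compose[OF F_id S_Fn] by simp

lemma abs_S_le:"abs (S n om)<=real n * L"
proof -
 have "abs (S n om)<=(\<Sum>m<n. abs (f m (X m om) (X (Suc m) om)))" unfolding S_def by (rule sum_abs)
 also have "...<=(\<Sum>m<n. L)" by (intro sum_mono f_bound)
 finally show ?thesis by simp
qed

lemma S_Suc:"S (Suc n) om = S n om+f n (X n om) (X (Suc n) om)"
 by (simp add:S_def)

text \<open>Adding the bound \<open>C\<close> makes the integrand nonnegative, which reduces the
  claim to the \<open>ennreal\<close> identity of the locale.\<close>

lemma markov_real:
 fixes Ps ::"'w \<times> 'a => real"
 assumes [measurable]:"Ps : bm (F n \<Otimes>\<^sub>M B (Suc n))"
 and bd:"!!om y. om : space M ==> y : space (B (Suc n)) ==> abs (Ps (om,y))<=C"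
 shows "(LINT om|M. Ps (om,X (Suc n) om)) = (LINT om|M. (LINT y|K n (X n om). Ps (om,y)))"
proof -
 let ?k = "%om. LINT y|K n (X n om). Ps (om,y)" and ?u = "%om. Ps (om,X (Suc n) om)"
 have bd':"0<=Ps (om,y)+C" if "om : space M" "y : space (B (Suc n))" for om y
 using bd[OF that] by linarith
 have m1 [measurable]:"?u : bm M" by measurable
 have sec:"(%y. Ps (om,y)) : bm (B (Suc n))" if "om : space M" for om
 using measurable_compose[OF measurable_Pair1' assms(1)] that by (simp add:space_F)
 have iK:"integrable (K n (X n om)) (%y. Ps (om,y))" if "om : space M" for om
 using sec[OF that] bd[OF that] that by (intro integrable_K[where C = C]) auto
 have i1:"integrable M ?u"
 by (rule integrable_const_bound[where B = C]) (use bd in auto)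
 have m2:"?k : bm (F n)"
 by measurable
 hence m2' [measurable]:"?k : bm M"
 using measurable_compose[OF F_id] by blast
 have bK:"abs (?k om)<=C" if "om : space M" for om
 using norm_integral_K_le[of "X n om" n "%y. Ps (om,y)" C] bd[OF that] that by simp
 have bK':"0<=?k om+C" if "om : space M" for om
 using bK[OF that] by linarith
 have i2:"integrable M ?k"
 by (rule integrable_const_bound[where B = C]) (use bK in auto)
 have "ennreal (LINT om|M. ?u om+C) = (NN om|M. ennreal (?u om+C))"
 using i1 bd' by (intro nn_integral_eq_integral[symmetric]) auto
 also have "... = (NN om|M. (NN y|K n (X n om). ennreal (Ps (om,y)+C)))"
 using markov[of "%z. ennreal (Ps z+C)" n] by simp
 also have "... = (NN om|M. ennreal (?k om+C))"
 proof (intro nn_integral_cong)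
 fix om assume om:"om : space M"
 interpret P: prob_space "K n (X n om)" using om by (intro prob_K) simp
 have "(NN y|K n (X n om). ennreal (Ps (om,y)+C)) = ennreal (LINT y|K n (X n om). Ps (om,y)+C)"
 using iK[OF om] bd'[OF om] by (intro nn_integral_eq_integral) auto
 also have "(LINT y|K n (X n om). Ps (om,y)+C) = ?k om+C"
 using iK[OF om] P.prob_space by simp
 finally show "(NN y|K n (X n om). ennreal (Ps (om,y)+C)) = ennreal (?k om+C)" .
 qed
 also have "... = ennreal (LINT om|M. ?k om+C)"
 proof (rule nn_integral_eq_integral)
 show "AE om in M. 0<=?k om+C"
 using bK' by (intro AE_I2) auto
 qed (use i2 in auto)
 finally have e:"ennreal (LINT om|M. ?u om+C) = ennreal (LINT om|M. ?k om+C)" .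
 have "0<=(LINT om|M. ?u om+C)"
 using bd' by (intro LINT_nonneg) auto
 moreover have "0<=(LINT om|M. ?k om+C)"
 using bK' by (intro LINT_nonneg) auto
 ultimately have "(LINT om|M. ?u om+C) = (LINT om|M. ?k om+C)"
 using e by (simp add:ennreal_inj)
 thus ?thesis using i1 i2 by (simp add:prob_space)
qed

lemma markov_complex:
 fixes Ps ::"'w \<times> 'a => complex"
 assumes m [measurable]:"Ps : bm (F n \<Otimes>\<^sub>M B (Suc n))"
 and bd:"!!om y. om : space M ==> y : space (B (Suc n)) ==> cmod (Ps (om,y))<=C"
 shows "(LINT om|M. Ps (om,X (Suc n) om)) = (LINT om|M. (LINT y|K n (X n om). Ps (om,y)))"
proof -
 let ?k = "%om. LINT y|K n (X n om). Ps (om,y)" and ?u = "%om. Ps (om,X (Suc n) om)"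
 have m1 [measurable]:"?u : bm M" by measurable
 have sec:"(%y. Ps (om,y)) : bm (B (Suc n))" if "om : space M" for om
 using measurable_compose[OF measurable_Pair1' assms(1)] that by (simp add:space_F)
 have iK:"integrable (K n (X n om)) (%y. Ps (om,y))" if "om : space M" for om
 using sec[OF that] bd[OF that] that by (intro integrable_K[where C = C]) auto
 have i1:"integrable M ?u"
 by (rule integrable_const_bound[where B = C]) (use bd in auto)
 have m2:"?k : bm (F n)"
 by measurable
 hence m2' [measurable]:"?k : bm M"
 using measurable_compose[OF F_id] by blast
 have bK:"cmod (?k om)<=C" if "om : space M" for om
 using norm_integral_K_le[of "X n om" n "%y. Ps (om,y)" C] bd[OF that] that by simp
 have i2:"integrable M ?k"
 by (rule integrable_const_bound[where B = C]) (use bK in auto)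
 have R:"(LINT om|M. h (?u om)) = (LINT om|M. (LINT y|K n (X n om). h (Ps (om,y))))"
 if "h = Re \<or> h = Im" for h
 proof -
 have "(LINT om|M. (h \<circ> Ps) (om,X (Suc n) om)) = (LINT om|M. (LINT y|K n (X n om). (h \<circ> Ps) (om,y)))"
 proof (rule markov_real)
 show "h \<circ> Ps : bm (F n \<Otimes>\<^sub>M B (Suc n))" using that m by (auto simp:comp_def)
 show "abs ((h \<circ> Ps) (om,y))<=C" if "om : space M" "y : space (B (Suc n))" for om y
 using bd[OF that] \<open>h = Re \<or> h = Im\<close> abs_Re_le_cmod abs_Im_le_cmod order_trans by fastforce
 qed
 thus ?thesis by simp
 qed
 show ?thesis
 proof (rule complex_eqI)
 have "Re (LINT om|M. ?u om) = (LINT om|M. (LINT y|K n (X n om). Re (Ps (om,y))))"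
 unfolding integral_Re[OF i1,symmetric] by (rule R) simp
 also have "... = (LINT om|M. Re (?k om))"
 by (intro LINT_cong integral_Re iK)
 also have "... = Re (LINT om|M. ?k om)" by (rule integral_Re[OF i2])
 finally show "Re (LINT om|M. ?u om) = Re (LINT om|M. ?k om)" .
 have "Im (LINT om|M. ?u om) = (LINT om|M. (LINT y|K n (X n om). Im (Ps (om,y))))"
 unfolding integral_Im[OF i1,symmetric] by (rule R) simp
 also have "... = (LINT om|M. Im (?k om))"
 by (intro LINT_cong integral_Im iK)
 also have "... = Im (LINT om|M. ?k om)" by (rule integral_Im[OF i2])
 finally show "Im (LINT om|M. ?u om) = Im (LINT om|M. ?k om)" .
 qed
qed

text \<open>The increments are integrated out one at a time from the last; each use of the Markov
  property turns one of them into a step of the recursion for \<open>W\<close>.\<close>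

lemma expectation_exp_S:
 fixes w :: complex
 shows "(LINT om|M. exp (w * of_real (S N om))) = (LINT om|M. W N 0 w (X 0 om))"
proof -
 have "n<=N ==> (LINT om|M. exp (w * of_real (S N om))) = (LINT om|M. exp (w * of_real (S n om)) * W (N-n) n w (X n om))" for n
 proof (induction "N-n" arbitrary: n)
 case 0
 hence "n = N" by simp
 thus ?case by simp
 next
 case (Suc k)
 hence n:"N-n = Suc (N-Suc n)" and k:"k = N-Suc n" "Suc n<=N" by auto
 let ?Ps = "%(om,y). exp (w * of_real (S n om))*(exp (w * of_real (f n (X n om) y)) * W (N-Suc n) (Suc n) w y)"
 have "(LINT om|M. exp (w * of_real (S N om))) = (LINT om|M. ?Ps (om,X (Suc n) om))"
 unfolding Suc.hyps(1)[OF k]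
 by (intro LINT_cong) (simp add:S_Suc distrib_left exp_add)
 also have "... = (LINT om|M. (LINT y|K n (X n om). ?Ps (om,y)))"
 proof (rule markov_complex)
 show "?Ps : bm (F n \<Otimes>\<^sub>M B (Suc n))" by measurable
 fix om y assume "y : space (B (Suc n))"
 moreover have "cmod (exp (w * of_real (S n om)))<=exp (cmod w*(real n * L))"
 proof -
 have "cmod (exp (w * of_real (S n om)))<=exp (cmod (w * of_real (S n om)))" by (rule norm_exp)
 also have "...<=exp (cmod w*(real n * L))"
 using abs_S_le[of n om] by (auto simp:norm_mult intro:mult_left_mono)
 finally show ?thesis .
 qed
 ultimately show "cmod (?Ps (om,y))<=exp (cmod w*(real n * L))*(exp (cmod w * L) * exp (norm w * L) ^ (N-Suc n))"
 unfolding prod.case norm_mult by (intro mult_mono norm_exp_f_le norm_W_le) auto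
 qed
 also have "... = (LINT om|M. exp (w * of_real (S n om)) * W (N-n) n w (X n om))"
 unfolding n by simp
 finally show ?case .
 qed
 from this[of 0] show ?thesis by (simp add:S_def)
qed

text \<open>Whatever the initial law, from the first step on the state has density at most
  \<open>1/ep\<close> with respect to \<open>mu\<close>.\<close>

lemma nn_integral_X_Suc_le:
 assumes [measurable]:"u : bm (B (Suc n))"
 shows "(NN om|M. u (X (Suc n) om))<=ennreal (1/ep)*(NN y|mu (Suc n). u y)"
proof -
 have "(NN om|M. u (X (Suc n) om)) = (NN om|M. (NN y|K n (X n om). u y))"
 using markov[of "%z. u (snd z)" n] by simp
 also have "...<=(NN om|M. ennreal (1/ep)*(NN y|mu (Suc n). u y))"
 proof (rule nn_integral_mono)
 fix om assume "om : space M"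
 hence "X n om : space (B n)" by simp
 hence "(NN y|K n (X n om). u y) = (NN y|mu (Suc n). ennreal (p n (X n om) y) * u y)"
 by (rule nn_integral_K) measurable
 also have "...<=(NN y|mu (Suc n). ennreal (1/ep) * u y)"
 by (intro nn_integral_mono mult_right_mono ennreal_leI p_le) auto
 also have "... = ennreal (1/ep)*(NN y|mu (Suc n). u y)"
 by (rule nn_integral_cmult) measurable
 finally show "(NN y|K n (X n om). u y)<=ennreal (1/ep)*(NN y|mu (Suc n). u y)" .
 qed
 also have "... = ennreal (1/ep)*(NN y|mu (Suc n). u y)"
 by (simp add:emeasure_space_1)
 finally show ?thesis .
qed

lemma nn_integral_pair_le:
 assumes u [measurable]:"case_prod u : bm (B (Suc n) \<Otimes>\<^sub>M B (Suc2 n))"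
 shows "(NN om|M. u (X (Suc n) om) (X (Suc2 n) om))
<=ennreal (1/ep)*(NN x|mu (Suc n). (NN y|mu (Suc2 n). ennreal (p (Suc n) x y) * u x y))"
proof -
 interpret Mu: prob_space "mu m" for m by (rule prob_mu)
 have "(NN om|M. u (X (Suc n) om) (X (Suc2 n) om)) = (NN om|M. (NN y|K (Suc n) (X (Suc n) om). u (X (Suc n) om) y))"
 using markov[of "%z. u (X (Suc n) (fst z)) (snd z)" "Suc n"] by simp
 also have "... = (NN om|M. (NN y|mu (Suc2 n). ennreal (p (Suc n) (X (Suc n) om) y) * u (X (Suc n) om) y))"
 proof (intro nn_integral_cong nn_integral_K)
 fix om assume "om : space M"
 thus x:"X (Suc n) om : space (B (Suc n))" by simp
 show "u (X (Suc n) om) : bm (B (Suc2 n))"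
 using measurable_compose[OF measurable_Pair1'[OF x] u] by simp
 qed
 also have "...<=ennreal (1/ep)*(NN x|mu (Suc n). (NN y|mu (Suc2 n). ennreal (p (Suc n) x y) * u x y))"
 by (rule nn_integral_X_Suc_le) measurable
 finally show ?thesis .
qed

end

section \<open>Change of measure\<close>

context elliptic_process
begin

lemma S_min_Suc:"exp (xi * S (min (Suc n) N) om) = exp (xi * S (min n N) om) * wexp N xi n (X n om) (X (Suc n) om)"
 by (cases "n < N") (simp_all add:wexp_def S_Suc distrib_left exp_add)

text \<open>States that the conditional expectation of \<open>exp (xi * S N)\<close> given the past
  at \<open>m\<close> is the weight collected so far times the harmonic function, in integrated form
  against a past-measurable \<open>G\<close>. Proved backwards from \<open>N\<close> with
  \<open>hfun_rec\<close>.\<close>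

lemma nn_integral_tilt:
 "G : bm (F m) ==>
 (NN om|M. ennreal (exp (xi * S N om)) * G om)
 = (NN om|M. ennreal (exp (xi * S (min m N) om) * hfun N xi m (X m om)) * G om)"
proof (induction "N-m" arbitrary: m G)
 case 0
 hence "N<=m" by simp
 thus ?case by (simp add:hfun_def)
next
 case (Suc k)
 note [measurable] = Suc.prems
 have k:"k = N-Suc m" using Suc.hyps(2) by simp
 have GF:"G : bm (F (Suc m))" using measurable_compose[OF F_mono Suc.prems] .
 have S_meas [measurable]:"S (min m N) : bm (F m)" by (rule S_F) simp
 let ?Ps = "%(om,y). ennreal (exp (xi * S (min m N) om)*(wexp N xi m (X m om) y * hfun N xi (Suc m) y)) * G om"
 have "(NN om|M. ennreal (exp (xi * S N om)) * G om) = (NN om|M. ?Ps (om,X (Suc m) om))"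
 unfolding Suc.hyps(1)[OF k GF] S_min_Suc by (simp add:mult.assoc)
 also have "... = (NN om|M. (NN y|K m (X m om). ?Ps (om,y)))"
 by (rule markov) measurable
 also have "... = (NN om|M. ennreal (exp (xi * S (min m N) om) * hfun N xi m (X m om)) * G om)"
 proof (rule nn_integral_cong)
 fix om assume "om : space M"
 hence x [measurable]:"X m om : space (B m)" by simp
 have "(NN y|K m (X m om). ?Ps (om,y))
 = (NN y|K m (X m om). ennreal (exp (xi * S (min m N) om)) * ennreal (wexp N xi m (X m om) y * hfun N xi (Suc m) y)) * G om"
 by (subst nn_integral_multc[symmetric]) (simp_all add:ennreal_mult')
 also have "... = ennreal (exp (xi * S (min m N) om))*(NN y|K m (X m om). ennreal (wexp N xi m (X m om) y * hfun N xi (Suc m) y)) * G om"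
 by (subst nn_integral_cmult) simp_all
 also have "(NN y|K m (X m om). ennreal (wexp N xi m (X m om) y * hfun N xi (Suc m) y)) = ennreal (hfun N xi m (X m om))"
 unfolding hfun_rec[OF x]
 proof (rule nn_integral_eq_integral[OF integrable_wexp_hfun[OF x]],rule AE_I2)
 fix y assume "y : space (K m (X m om))"
 thus "0<=wexp N xi m (X m om) y * hfun N xi (Suc m) y"
 using hfun_pos[of y "Suc m" N xi] wexp_bounds(3)[of xi "abs xi"] by (simp add:less_imp_le)
 qed
 finally show "(NN y|K m (X m om). ?Ps (om,y)) = ennreal (exp (xi * S (min m N) om) * hfun N xi m (X m om)) * G om"
 by (simp add:ennreal_mult')
 qed
 finally show ?case .
qed

definition Z ::"nat => real => real" where
 "Z N xi = (LINT om|M. exp (xi * S N om))"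

definition Mtilt ::"nat => real => 'w measure" where
 "Mtilt N xi = density M (%om. ennreal (exp (xi * S N om)/Z N xi))"

lemma exp_S_bounds:
 "exp (xi * S N om)<=exp (abs xi*(real N * L))" "exp (- (abs xi*(real N * L)))<=exp (xi * S N om)"
proof -
 have "abs (xi * S N om)<=abs xi*(real N * L)" unfolding abs_mult by (intro mult_left_mono abs_S_le) auto
 thus "exp (xi * S N om)<=exp (abs xi*(real N * L))" "exp (- (abs xi*(real N * L)))<=exp (xi * S N om)"
 by (auto simp:abs_le_iff)
qed

lemma integrable_exp_S:"integrable M (%om. exp (xi * S N om))"
proof (rule integrable_const_bound)
 show "AE om in M. norm (exp (xi * S N om))<=exp (abs xi*(real N * L))"
 unfolding real_norm_def abs_exp_cancel by (intro AE_I2 exp_S_bounds)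
qed measurable

lemma Z_pos:"0 < Z N xi"
proof -
 have "(LINT om|M. exp (- (abs xi*(real N * L))))<=Z N xi"
 unfolding Z_def by (intro integral_mono integrable_exp_S exp_S_bounds) auto
 thus ?thesis using prob_space by (simp add:less_le_trans[OF exp_gt_zero])
qed

lemma sets_Mtilt [measurable_cong,simp]:"sets (Mtilt N xi) = sets M" and space_Mtilt [simp]:"space (Mtilt N xi) = space M"
 by (simp_all add:Mtilt_def)

lemma nn_integral_Mtilt:
 assumes [measurable]:"u : bm M"
 shows "(NN om|Mtilt N xi. u om) = ennreal (1/Z N xi)*(NN om|M. ennreal (exp (xi * S N om)) * u om)"
proof -
 have "(NN om|Mtilt N xi. u om) = (NN om|M. ennreal (exp (xi * S N om)/Z N xi) * u om)"
 unfolding Mtilt_def by (rule nn_integral_density) measurable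
 also have "... = (NN om|M. ennreal (1/Z N xi)*(ennreal (exp (xi * S N om)) * u om))"
 using Z_pos[of N xi] by (intro nn_integral_cong) (simp add:mult.assoc[symmetric] flip: ennreal_mult')
 also have "... = ennreal (1/Z N xi)*(NN om|M. ennreal (exp (xi * S N om)) * u om)"
 by (rule nn_integral_cmult) measurable
 finally show ?thesis .
qed

lemma integral_Mtilt:
 fixes u ::"'w => 'b::{banach,second_countable_topology}"
 assumes [measurable]:"u : bm M"
 shows "(LINT om|Mtilt N xi. u om) = (1/Z N xi) *\<^sub>R (LINT om|M. exp (xi * S N om) *\<^sub>R u om)"
proof -
 have "(LINT om|Mtilt N xi. u om) = (LINT om|M. (exp (xi * S N om)/Z N xi) *\<^sub>R u om)"
 unfolding Mtilt_def using Z_pos[of N xi] by (intro integral_density) auto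
 also have "... = (LINT om|M. (1/Z N xi) *\<^sub>R (exp (xi * S N om) *\<^sub>R u om))"
 by (intro LINT_cong) simp
 finally show ?thesis unfolding integral_scaleR_right .
qed

lemma prob_space_Mtilt:"prob_space (Mtilt N xi)"
proof (rule prob_spaceI)
 have "emeasure (Mtilt N xi) (space (Mtilt N xi)) = (NN om|Mtilt N xi. 1)" by simp
 also have "... = ennreal (1/Z N xi)*(NN om|M. ennreal (exp (xi * S N om)))"
 by (subst nn_integral_Mtilt) auto
 also have "(NN om|M. ennreal (exp (xi * S N om))) = ennreal (Z N xi)"
 unfolding Z_def by (intro nn_integral_eq_integral integrable_exp_S) auto
 also have "ennreal (1/Z N xi) * ennreal (Z N xi) = 1"
 using Z_pos[of N xi] by (simp flip: ennreal_mult')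
 finally show "emeasure (Mtilt N xi) (space (Mtilt N xi)) = 1" .
qed

text \<open>Under the exponentially reweighted measure the same coordinates, with the same
  filtration, form a Markov chain with the Doob transformed kernels; process estimates such as the
  second-moment bound thereby hold for tilted laws.\<close>

lemma Mtilt_process:
 assumes R:"abs xi<=R"
 shows "elliptic_process B mu (ptilt N xi) (tilt_eps R) f L (Mtilt N xi) F X"
proof -
 interpret T: elliptic_functional B mu "ptilt N xi" "tilt_eps R" f L by (rule ptilt_elliptic[OF R])
 have mk:"(NN om|Mtilt N xi. Ps (om,X (Suc n) om)) = (NN om|Mtilt N xi. (NN y|T.K n (X n om). Ps (om,y)))"
 if Ps [measurable]:"Ps : bm (F n \<Otimes>\<^sub>M B (Suc n))" for n and Ps ::"'w \<times> 'a => ennreal"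
 proof -
 have S_meas [measurable]:"S (min n N) : bm (F n)" by (rule S_F) simp
 have GF:"(%om. Ps (om,X (Suc n) om)) : bm (F (Suc n))"
 proof -
 have "(%om. (om,X (Suc n) om)) : F (Suc n) \<rightarrow>\<^sub>M F n \<Otimes>\<^sub>M B (Suc n)"
 by (intro measurable_Pair F_mono X_Fn)
 from measurable_compose[OF this Ps] show ?thesis .
 qed
 have GM:"(%om. Ps (om,X (Suc n) om)) : bm M" by measurable
 have G2:"(%om. NN y|T.K n (X n om). Ps (om,y)) : bm (F n)" by measurable
 hence G2M:"(%om. NN y|T.K n (X n om). Ps (om,y)) : bm M"
 using measurable_compose[OF F_id] by blast
 let ?e = "%om. exp (xi * S (min n N) om)"
 let ?w = "%om y. wexp N xi n (X n om) y * hfun N xi (Suc n) y"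
 let ?P = "%(om,y). ennreal (?e om*?w om y) * Ps (om,y)"
 have "(NN om|M. ennreal (exp (xi * S N om)) * Ps (om,X (Suc n) om))
 = (NN om|M. ennreal (exp (xi * S (min (Suc n) N) om) * hfun N xi (Suc n) (X (Suc n) om)) * Ps (om,X (Suc n) om))"
 by (rule nn_integral_tilt[OF GF])
 also have "... = (NN om|M. ?P (om,X (Suc n) om))"
 unfolding S_min_Suc by (simp add:mult.assoc)
 also have "... = (NN om|M. (NN y|K n (X n om). ?P (om,y)))"
 by (rule markov) measurable
 also have "... = (NN om|M. ennreal (?e om * hfun N xi n (X n om))*(NN y|T.K n (X n om). Ps (om,y)))"
 proof (rule nn_integral_cong)
 fix om assume om:"om : space M"
 hence x [measurable]:"X n om : space (B n)" by simp
 have [measurable]:"(%y. Ps (om,y)) : bm (B (Suc n))"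
 using measurable_compose[OF measurable_Pair1' Ps] om by (simp add:space_F)
 have hp:"0 < hfun N xi n (X n om)" by (rule hfun_pos[OF x])
 have "(NN y|K n (X n om). ennreal (?e om*?w om y) * Ps (om,y))
 = (NN y|mu (Suc n). ennreal (p n (X n om) y)*(ennreal (?e om*?w om y) * Ps (om,y)))"
 by (rule nn_integral_K[OF x]) measurable
 also have "... = (NN y|mu (Suc n). ennreal (?e om * hfun N xi n (X n om))*(ennreal (ptilt N xi n (X n om) y) * Ps (om,y)))"
 proof (rule nn_integral_cong)
 fix y assume "y : space (mu (Suc n))"
 hence y:"y : space (B (Suc n))" by simp
 have eq:"p n (X n om) y*(?e om*?w om y) = (?e om * hfun N xi n (X n om)) * ptilt N xi n (X n om) y"
 using hp x y by (simp add:ptilt_def)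
 show "ennreal (p n (X n om) y)*(ennreal (?e om*?w om y) * Ps (om,y))
 = ennreal (?e om * hfun N xi n (X n om))*(ennreal (ptilt N xi n (X n om) y) * Ps (om,y))"
 unfolding mult.assoc[symmetric,of "ennreal _" "ennreal _" "Ps _"]
 using arg_cong[OF eq,of ennreal] hp by (simp only: ennreal_mult' p_nonneg mult_nonneg_nonneg exp_ge_zero less_imp_le)
 qed
 also have "... = ennreal (?e om * hfun N xi n (X n om))*(NN y|mu (Suc n). ennreal (ptilt N xi n (X n om) y) * Ps (om,y))"
 by (rule nn_integral_cmult) measurable
 also have "(NN y|mu (Suc n). ennreal (ptilt N xi n (X n om) y) * Ps (om,y)) = (NN y|T.K n (X n om). Ps (om,y))"
 by (rule T.nn_integral_K[symmetric,OF x]) measurable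
 finally show "(NN y|K n (X n om). ?P (om,y))
 = ennreal (?e om * hfun N xi n (X n om))*(NN y|T.K n (X n om). Ps (om,y))" by simp
 qed
 also have "... = (NN om|M. ennreal (exp (xi * S N om))*(NN y|T.K n (X n om). Ps (om,y)))"
 by (rule nn_integral_tilt[OF G2,symmetric])
 finally show ?thesis unfolding nn_integral_Mtilt[OF GM] nn_integral_Mtilt[OF G2M] by simp
 qed
 show ?thesis
 unfolding elliptic_process_def elliptic_process_axioms_def
 proof (intro conjI allI impI)
 show "elliptic_functional B mu (ptilt N xi) (tilt_eps R) f L" by (rule ptilt_elliptic[OF R])
 show "prob_space (Mtilt N xi)" by (rule prob_space_Mtilt)
 show "subalgebra (Mtilt N xi) (F n)" for n using subalg[of n] by (simp add:subalgebra_def)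
 show "(%x. x) : F (Suc n) \<rightarrow>\<^sub>M F n" for n by (rule F_mono)
 show "X i : F n \<rightarrow>\<^sub>M B i" if "i<=n" for i n using that by (rule X_F)
 qed (rule mk)
qed

end

section \<open>Second moments of sums along the chain\<close>

text \<open>The left side is the squared mean plus the variance of \<open>u\<close>, and the
  variance is at most the second moment about any point \<open>t\<close>.\<close>

lemma (in prob_space) second_moment_shift_le:
 fixes u ::"'a => real"
 assumes u:"integrable M u" "integrable M (%x. (u x)^2)"
 shows "(LINT x|M. (G+u x)^2)<=(G+(LINT x|M. u x))^2+(LINT x|M. (u x-t)^2)"
proof -
 let ?m = "LINT x|M. u x"
 have 1:"(LINT x|M. (G+u x)^2) = G^2+2 * G*?m+(LINT x|M. (u x)^2)"
 proof -
 have "(LINT x|M. (G+u x)^2) = (LINT x|M. G^2+(2 * G) * u x+(u x)^2)"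
 by (intro LINT_cong) (simp add:power2_sum)
 thus ?thesis using u by (simp add:prob_space)
 qed
 have 2:"(LINT x|M. (u x-t)^2) = (LINT x|M. (u x)^2)-2 * t*?m+t^2"
 proof -
 have "(LINT x|M. (u x-t)^2) = (LINT x|M. (u x)^2-(2 * t) * u x+t^2)"
 by (intro LINT_cong) (simp add:power2_diff)
 thus ?thesis using u by (simp add:prob_space)
 qed
 have "2 * t*?m<=?m^2+t^2" using sum_squares_bound[of ?m t] by (simp only: mult_ac)
 moreover have "(G+?m)^2 = G^2+?m^2+2 * G*?m" by (rule power2_sum)
 ultimately show ?thesis unfolding 1 2 by linarith
qed

lemma (in prob_space) integral_square_le:
 fixes u ::"'a => real"
 assumes "integrable M u" "integrable M (%x. (u x)^2)"
 shows "(LINT x|M. u x)^2<=(LINT x|M. (u x)^2)"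
 using variance_eq[OF assms] variance_positive[of u] by simp

context elliptic_kernels
begin

lemma abs_integral_K_le:
 fixes u ::"'a => real"
 assumes x:"x : space (B n)" and u [measurable]:"u : bm (B (Suc n))"
 and C:"!!y. y : space (B (Suc n)) ==> abs (u y)<=C"
 shows "abs (LINT y|K n x. u y)<=(1/ep)*(LINT y|mu (Suc n). abs (u y))"
proof -
 note [measurable] = x
 have i:"integrable (mu (Suc n)) (%y. abs (u y))" using C by (intro integrable_mu) auto
 have "abs (LINT y|K n x. u y) = abs (LINT y|mu (Suc n). p n x y * u y)" by (simp add:integral_K[OF x])
 also have "...<=(LINT y|mu (Suc n). abs (p n x y * u y))" by (rule integral_abs_bound)
 also have "...<=(LINT y|mu (Suc n). (1/ep) * abs (u y))"
 by (rule integral_mono_AE') (use i eps in \<open>auto simp:abs_mult intro!:AE_I2 mult_right_mono[OF p_le,simplified]\<close>)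
 finally show ?thesis by simp
qed

text \<open>A bound for the oscillation of the expected remaining sum: the next two increments enter
  directly, everything later through the Doeblin factor \<open>1-ep\<close>. It is a geometric
  convolution of \<open>a\<close> in steps of two.\<close>

fun osc_seq ::"(nat => real) => nat => nat => real" where
 "osc_seq a 0 n = 0"
| "osc_seq a (Suc 0) n = 0"
| "osc_seq a (Suc2 k) n = (2/ep)*(a (Suc n)+a (Suc2 n))+(1-ep) * osc_seq a k (Suc2 n)"

text \<open>Convexity of the square: \<open>s+(1-ep) * t\<close> is the average of
  \<open>s/ep\<close> and \<open>t\<close> with weights \<open>ep\<close> and
  \<open>1-ep\<close>.\<close>

lemma osc_seq_step:
 "(osc_seq a (Suc k) n)^2<=((2/ep)*(a (Suc n)+a (Suc2 n)))^2/ep+(1-ep)*(osc_seq a (k-1) (Suc2 n))^2"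
proof (cases k)
 case 0
 thus ?thesis using eps by simp
next
 case (Suc j)
 have conv:"(s+(1-ep) * t)^2<=s^2/ep+(1-ep) * t^2" for s t :: real
 proof -
 have "s^2/ep+(1-ep) * t^2-(s+(1-ep) * t)^2 = (1-ep)/ep*(s-ep * t)^2"
 using eps by (simp add:field_simps power2_eq_square)
 moreover have "0<=(1-ep)/ep*(s-ep * t)^2" using eps by simp
 ultimately show ?thesis by linarith
 qed
 show ?thesis unfolding Suc osc_seq.simps by (simp only: diff_Suc_1 conv)
qed

text \<open>A geometric convolution is bounded in the square-summable norm. The extra multiple of
  two squares on the left strengthens the induction; two are carried along because the recursion
  jumps by two.\<close>

lemma osc_seq_sum:
 "(\<Sum>j<k. (osc_seq a (k-j) (n+j))^2)+(1-ep)/ep*((osc_seq a k n)^2+(osc_seq a (k-1) (Suc n))^2)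
<=(1/ep^2)*(\<Sum>j<k. ((2/ep)*(a (n+Suc j)+a (n+Suc2 j)))^2)"
proof (induction k arbitrary: n)
 case (Suc k)
 let ?E = "%k n. (osc_seq a k n)^2" and ?s = "%n. ((2/ep)*(a (Suc n)+a (Suc2 n)))^2"
 let ?Z = "\<Sum>j<k. ?E (k-j) (Suc n+j)"
 have Z:"(\<Sum>j<Suc k. ?E (Suc k-j) (n+j)) = ?E (Suc k) n+?Z"
 by (subst sum.lessThan_Suc_shift) simp
 have s:"(\<Sum>j<Suc k. ((2/ep)*(a (n+Suc j)+a (n+Suc2 j)))^2)
 = ?s n+(\<Sum>j<k. ((2/ep)*(a (Suc n+Suc j)+a (Suc n+Suc2 j)))^2)"
 by (subst sum.lessThan_Suc_shift) simp
 have "(1/ep)*?E (Suc k) n<=(1/ep)*(?s n/ep+(1-ep)*?E (k-1) (Suc2 n))"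
 using eps by (intro mult_left_mono osc_seq_step) auto
 also have "... = ?s n/ep^2+(1-ep)/ep*?E (k-1) (Suc2 n)"
 proof -
 have "(1/ep)*(s/ep+(1-ep) * e) = s/ep^2+(1-ep)/ep * e" for s e :: real
 by (simp add:distrib_left power2_eq_square)
 thus ?thesis .
 qed
 finally have E:"(1/ep)*?E (Suc k) n<=?s n/ep^2+(1-ep)/ep*?E (k-1) (Suc2 n)" .
 have e1:"?E (Suc k) n+(1-ep)/ep*?E (Suc k) n = (1/ep)*?E (Suc k) n"
 using eps by (simp add:field_simps)
 show ?case
 unfolding Z s using E e1 Suc.IH[of "Suc n"] by (simp add:distrib_left)
qed simp

definition cmean ::"(nat => 'a => 'a => real) => nat => 'a => real" where
 "cmean H n x = (LINT y|K n x. H n x y)"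

primrec future ::"(nat => 'a => 'a => real) => nat => nat => 'a => real" where
 "future H 0 = (%n x. 0)"
| "future H (Suc k) = (%n x. LINT y|K n x. H n x y+future H k (Suc n) y)"

definition mass1 ::"(nat => 'a => 'a => real) => nat => real" where
 "mass1 H n = (LINT x|mu n. abs (cmean H n x))"

definition mass2 ::"(nat => 'a => 'a => real) => nat => real" where
 "mass2 H n = (LINT x|mu n. (LINT y|K n x. (H n x y)^2))"

end

locale bounded_increments = elliptic_kernels B mu p ep for B mu ::"nat => 'a measure" and p ep +
 fixes H ::"nat => 'a => 'a => real" and C :: real and N :: nat
 assumes H_meas0:"!!n. (%(x,y). H n x y) : bm (B n \<Otimes>\<^sub>M B (Suc n))"
 and H_bound:"!!n x y. x : space (B n) ==> y : space (B (Suc n)) ==> abs (H n x y)<=C"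
 and C_nonneg:"0<=C"
 and H_zero:"!!n x y. N<=n ==> H n x y = 0"
begin

lemma H_measurable [measurable (raw)]:
 "g : M \<rightarrow>\<^sub>M B n ==> h : M \<rightarrow>\<^sub>M B (Suc n) ==> (%om. H n (g om) (h om)) : bm M"
 using measurable_compose[OF measurable_Pair H_meas0,of g M n h] by simp

lemma cmean_measurable [measurable]:"cmean H n : bm (B n)"
 unfolding cmean_def[abs_def] by measurable

lemma future_measurable [measurable]:"future H k n : bm (B n)"
 by (induction k arbitrary: n) simp_all

lemma abs_cmean_le:"x : space (B n) ==> abs (cmean H n x)<=C"
 unfolding cmean_def using norm_integral_K_le[of x n "H n x" C] H_bound by simp

lemma abs_future_le:"x : space (B n) ==> abs (future H k n x)<=real k * C"
proof (induction k arbitrary: n x)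
 case (Suc k)
 have "norm (LINT y|K n x. H n x y+future H k (Suc n) y)<=real (Suc k) * C"
 proof (rule norm_integral_K_le[OF Suc.prems])
 fix y assume y:"y : space (B (Suc n))"
 show "norm (H n x y+future H k (Suc n) y)<=real (Suc k) * C"
 using H_bound[OF Suc.prems y] Suc.IH[OF y] by (simp add:algebra_simps)
 qed
 thus ?case by simp
qed simp

lemma integrable_H:
 assumes x:"x : space (B n)"
 shows "integrable (K n x) (H n x)" "integrable (K n x) (%y. (H n x y)^2)" "integrable (K n x) (future H k (Suc n))"
 "integrable (K n x) (cmean H (Suc n))" "integrable (K n x) (%y. (cmean H (Suc n) y)^2)"
proof -
 note [measurable] = x
 have "H n x : bm (B (Suc n))" by measurable
 thus "integrable (K n x) (H n x)" using H_bound[OF x] by (intro integrable_K[OF x]) auto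
 show "integrable (K n x) (%y. (H n x y)^2)"
 by (intro integrable_K[OF x,where C = "C^2"]) (use H_bound[OF x] in \<open>auto simp:abs_le_square_iff[symmetric] C_nonneg\<close>)
 show "integrable (K n x) (future H k (Suc n))" using abs_future_le by (intro integrable_K[OF x]) auto
 show "integrable (K n x) (cmean H (Suc n))" using abs_cmean_le by (intro integrable_K[OF x]) auto
 show "integrable (K n x) (%y. (cmean H (Suc n) y)^2)"
 by (intro integrable_K[OF x,where C = "C^2"]) (use abs_cmean_le in \<open>auto simp:abs_le_square_iff[symmetric] C_nonneg\<close>)
qed

lemma integrable_cmean:"integrable (mu n) (cmean H n)" "integrable (mu n) (%x. (cmean H n x)^2)"
 "integrable (mu n) (%x. LINT y|K n x. (H n x y)^2)"
proof -
 show "integrable (mu n) (cmean H n)" using abs_cmean_le by (intro integrable_mu) auto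
 show "integrable (mu n) (%x. (cmean H n x)^2)"
 by (intro integrable_mu[where C = "C^2"]) (use abs_cmean_le in \<open>auto simp:abs_le_square_iff[symmetric] C_nonneg\<close>)
 have "norm (LINT y|K n x. (H n x y)^2)<=C^2" if x:"x : space (B n)" for x
 by (intro norm_integral_K_le x) (use H_bound[OF x] in \<open>auto simp:abs_le_square_iff[symmetric] C_nonneg\<close>)
 thus "integrable (mu n) (%x. LINT y|K n x. (H n x y)^2)" by (intro integrable_mu[where C = "C^2"]) auto
qed

lemma cmean_square_le:"x : space (B n) ==> (cmean H n x)^2<=(LINT y|K n x. (H n x y)^2)"
 unfolding cmean_def by (rule prob_space.integral_square_le[OF prob_K]) (auto intro:integrable_H)

lemma integral_cmean_square_le:"(LINT x|mu n. (cmean H n x)^2)<=mass2 H n"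
 unfolding mass2_def using cmean_square_le integrable_cmean by (intro integral_mono) auto

lemma mass1_square_le:"(mass1 H n)^2<=mass2 H n"
proof -
 have "(mass1 H n)^2<=(LINT x|mu n. (abs (cmean H n x))\<^sup>2)"
 unfolding mass1_def using integrable_cmean[of n] by (intro prob_space.integral_square_le[OF prob_mu]) auto
 thus ?thesis using integral_cmean_square_le[of n] by simp
qed

lemma mass_nonneg [simp]:"0<=mass1 H n" "0<=mass2 H n"
 unfolding mass1_def mass2_def by (auto intro!:LINT_nonneg)

lemma mass2_zero:"N<=n ==> mass2 H n = 0"
 by (simp add:mass2_def H_zero)

lemma future_Suc:
 assumes x:"x : space (B n)"
 shows "future H (Suc k) n x = cmean H n x+(LINT y|K n x. future H k (Suc n) y)"
 using integrable_H(1)[OF x] integrable_H(3)[OF x,of k] by (simp add:cmean_def)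

text \<open>The increment at time \<open>n\<close> itself is subtracted because its mean given the
  state at \<open>n\<close> need not be small at every state. The later ones are averaged over a
  transition, which has density at most \<open>1/ep\<close>, so they are controlled by integrals
  over \<open>mu\<close>. By \<open>N<=n+k\<close> the horizon contains all nonzero
  increments.\<close>

lemma future_oscillation:
 "N<=n+k ==> x : space (B n) ==> x' : space (B n) ==>
 abs ((future H k n x-cmean H n x)-(future H k n x'-cmean H n x'))<=osc_seq (mass1 H) k n"
proof (induction k arbitrary: n x x' rule: induct_nat_012)
 case 0
 thus ?case by (simp add:cmean_def H_zero)
next
 case 1
 thus ?case by (simp add:cmean_def)
next
 case (ge2 k)
 let ?g = "%z. future H k (Suc2 n) z-cmean H (Suc2 n) z"
 let ?A = "%x. LINT y|K n x. cmean H (Suc n) y" and ?B = "%x. LINT y|K n x. LINT z|K (Suc n) y. cmean H (Suc2 n) z"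
 and ?G = "%x. LINT y|K n x. LINT z|K (Suc n) y. ?g z"
 have g_bd:"abs (?g z)<=real k * C+C" if "z : space (B (Suc2 n))" for z
 using abs_future_le[OF that,of k] abs_cmean_le[OF that] by linarith
 have decomp:"future H (Suc2 k) n x-cmean H n x = ?A x+(?B x+?G x)" if x:"x : space (B n)" for x
 proof -
 have iB:"integrable (K n x) (%y. LINT z|K (Suc n) y. cmean H (Suc2 n) z)"
 using abs_cmean_le by (intro integrable_K[OF x,where C = C] norm_integral_K_le) auto
 have iG:"integrable (K n x) (%y. LINT z|K (Suc n) y. ?g z)"
 using g_bd by (intro integrable_K[OF x,where C = "real k * C+C"] norm_integral_K_le) auto
 have "(LINT y|K n x. future H (Suc k) (Suc n) y)
 = (LINT y|K n x. cmean H (Suc n) y+((LINT z|K (Suc n) y. cmean H (Suc2 n) z)+(LINT z|K (Suc n) y. ?g z)))"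
 proof (intro LINT_cong)
 fix y assume "y : space (K n x)"
 hence y:"y : space (B (Suc n))" by simp
 show "future H (Suc k) (Suc n) y = cmean H (Suc n) y+((LINT z|K (Suc n) y. cmean H (Suc2 n) z)+(LINT z|K (Suc n) y. ?g z))"
 unfolding future_Suc[OF y] using integrable_H(3,4)[OF y] by simp
 qed
 also have "... = ?A x+(?B x+?G x)"
 using integrable_H(4)[OF x] iB iG by (simp del: LINT_diff)
 finally show ?thesis unfolding future_Suc[OF x] by simp
 qed
 have A:"abs (?A x)<=(1/ep) * mass1 H (Suc n)" if "x : space (B n)" for x
 unfolding mass1_def by (rule abs_integral_K_le[OF that _ abs_cmean_le]) measurable
 have B:"abs (?B x)<=(1/ep) * mass1 H (Suc2 n)" if x:"x : space (B n)" for x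
 proof -
 have "abs (LINT z|K (Suc n) y. cmean H (Suc2 n) z)<=(1/ep) * mass1 H (Suc2 n)" if "y : space (B (Suc n))" for y
 unfolding mass1_def by (rule abs_integral_K_le[OF that _ abs_cmean_le]) measurable
 hence "norm (?B x)<=(1/ep) * mass1 H (Suc2 n)" by (intro norm_integral_K_le[OF x]) (simp only: real_norm_def)
 thus ?thesis by simp
 qed
 have G:"norm (?G x-?G x')<=(1-ep) * osc_seq (mass1 H) k (Suc2 n)"
 using ge2(1)[of "Suc2 n"] ge2.prems(1) by (intro doeblin_contraction ge2.prems(2,3)) auto
 have "abs ((?A x+(?B x+?G x))-(?A x'+(?B x'+?G x')))<=(abs (?A x)+abs (?A x'))+(abs (?B x)+abs (?B x'))+norm (?G x-?G x')"
 by simp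
 also have "...<=osc_seq (mass1 H) (Suc2 k) n"
 using A[OF ge2.prems(2)] A[OF ge2.prems(3)] B[OF ge2.prems(2)] B[OF ge2.prems(3)] G by (simp add:distrib_left)
 finally show ?case unfolding decomp[OF ge2.prems(2)] decomp[OF ge2.prems(3)] .
qed

lemma sum_osc_seq_le:
 "(\<Sum>j<k. (osc_seq (mass1 H) (k-j) (n+j))^2)<=(16/ep ^ 4)*(\<Sum>m<N. mass2 H m)"
proof -
 let ?a = "mass1 H" and ?b = "mass2 H"
 have sum_b:"(\<Sum>j<k. ?b (n+Suc j))<=(\<Sum>m<N. ?b m)" for n k
 proof -
 have "(\<Sum>j<k. ?b (n+Suc j)) = (\<Sum>m\<in>(%j. n+Suc j) ` {..<k}. ?b m)"
 by (subst sum.reindex) (auto simp:inj_on_def)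
 also have "... = (\<Sum>m\<in>(%j. n+Suc j) ` {..<k} \<inter> {..<N}. ?b m)"
 by (rule sum.mono_neutral_right) (auto simp:not_less intro!:mass2_zero)
 also have "...<=(\<Sum>m<N. ?b m)" by (rule sum_mono2) auto
 finally show ?thesis .
 qed
 have "(\<Sum>j<k. (osc_seq ?a (k-j) (n+j))^2)<=(1/ep^2)*(\<Sum>j<k. ((2/ep)*(?a (n+Suc j)+?a (n+Suc2 j)))^2)"
 proof -
 have "0<=(1-ep)/ep*((osc_seq ?a k n)^2+(osc_seq ?a (k-1) (Suc n))^2)" using eps by simp
 thus ?thesis using osc_seq_sum[where a = ?a and k = k and n = n] by linarith
 qed
 also have "...<=(1/ep^2)*(\<Sum>j<k. (8/ep^2)*(?b (n+Suc j)+?b (Suc n+Suc j)))"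
 proof (intro mult_left_mono sum_mono)
 fix j
 have "(?a (n+Suc j)+?a (n+Suc2 j))^2<=2*(?a (n+Suc j))^2+2*(?a (n+Suc2 j))^2"
 using sum_squares_bound[of "?a (n+Suc j)" "?a (n+Suc2 j)"] unfolding power2_sum by linarith
 also have "...<=2*?b (n+Suc j)+2*?b (n+Suc2 j)"
 using mass1_square_le[of "n+Suc j"] mass1_square_le[of "n+Suc2 j"] by linarith
 finally have "(2/ep)^2*(?a (n+Suc j)+?a (n+Suc2 j))^2<=(2/ep)^2*(2*?b (n+Suc j)+2*?b (n+Suc2 j))"
 by (rule mult_left_mono) simp
 thus "((2/ep)*(?a (n+Suc j)+?a (n+Suc2 j)))^2<=(8/ep^2)*(?b (n+Suc j)+?b (Suc n+Suc j))"
 unfolding power_mult_distrib by (simp add:power_divide add_divide_distrib)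
 qed simp
 also have "... = (8/ep ^ 4)*((\<Sum>j<k. ?b (n+Suc j))+(\<Sum>j<k. ?b (Suc n+Suc j)))"
 unfolding sum_distrib_left[symmetric] sum.distrib by (simp flip: power_add)
 also have "...<=(8/ep ^ 4)*((\<Sum>m<N. ?b m)+(\<Sum>m<N. ?b m))"
 using eps by (intro mult_left_mono add_mono sum_b) auto
 finally show ?thesis by simp
qed

end

context elliptic_process
begin

lemma expectation_X_Suc_le:
 assumes u [measurable]:"u : bm (B (Suc n))"
 and bd:"!!y. y : space (B (Suc n)) ==> 0<=u y" "!!y. y : space (B (Suc n)) ==> u y<=C"
 shows "(LINT om|M. u (X (Suc n) om))<=(1/ep)*(LINT y|mu (Suc n). u y)"
proof -
 have "(LINT om|M. u (X (Suc n) om)) = (LINT om|M. (LINT y|K n (X n om). u y))"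
 proof -
 have m:"(%z. u (snd z)) : bm (F n \<Otimes>\<^sub>M B (Suc n))" by measurable
 have "(LINT om|M. (%z. u (snd z)) (om,X (Suc n) om)) = (LINT om|M. (LINT y|K n (X n om). (%z. u (snd z)) (om,y)))"
 proof (rule markov_real[OF m])
 show "abs ((%z. u (snd z)) (om,y))<=C" if "y : space (B (Suc n))" for om :: 'w and y
 unfolding snd_conv using bd[OF that] by linarith
 qed
 thus ?thesis unfolding snd_conv .
 qed
 also have "...<=(LINT om|M. (1/ep)*(LINT y|mu (Suc n). u y))"
 proof (rule integral_mono_AE')
 have le:"abs (LINT y|K n (X n om). u y)<=(1/ep)*(LINT y|mu (Suc n). u y)" if "om : space M" for om
 proof -
 have "abs (LINT y|K n (X n om). u y)<=(1/ep)*(LINT y|mu (Suc n). abs (u y))"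
 by (rule abs_integral_K_le[where C = C]) (use bd that in auto)
 also have "(LINT y|mu (Suc n). abs (u y)) = (LINT y|mu (Suc n). u y)"
 by (intro LINT_cong) (use bd in auto)
 finally show ?thesis .
 qed
 show "AE om in M. (LINT y|K n (X n om). u y)<=(1/ep)*(LINT y|mu (Suc n). u y)"
 by (intro AE_I2 abs_le_D1[OF le])
 show "AE om in M. 0<=(1/ep)*(LINT y|mu (Suc n). u y)"
 using bd eps by (intro AE_I2 mult_nonneg_nonneg LINT_nonneg) auto
 qed simp
 also have "... = (1/ep)*(LINT y|mu (Suc n). u y)" using prob_space by simp
 finally show ?thesis .
qed

text \<open>A martingale-type argument: \<open>J n\<close> is the second moment of the sum so far
  plus the expected rest. One step adds at most a conditional variance, bounded by the squares of
  the increment, of the next conditional mean and of the oscillation of the rest. The increment at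
  time 0 has to vanish because the law of \<open>X 0\<close> is arbitrary, whereas later states have
  density at most \<open>1/ep\<close>.\<close>

lemma second_moment_bound:
 fixes H ::"nat => 'a => 'a => real"
 assumes H_meas0:"!!n. (%(x,y). H n x y) : bm (B n \<Otimes>\<^sub>M B (Suc n))"
 and H_bound:"!!n x y. x : space (B n) ==> y : space (B (Suc n)) ==> abs (H n x y)<=C"
 and C_nonneg:"0<=C"
 and H_zero:"!!n x y. N<=n ==> H n x y = 0"
 and H_0:"!!x y. H 0 x y = 0"
 shows "\<exists>c. (LINT om|M. ((\<Sum>n<N. H n (X n om) (X (Suc n) om))-c)^2)<=(56/ep ^ 4)*(\<Sum>m<N. mass2 H m)"
proof (cases N)
 case 0
 thus ?thesis by (intro exI[of _ 0]) simp
next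
 case (Suc N')
 interpret I: bounded_increments B mu p ep H C N
 by unfold_locales (fact H_meas0 H_bound C_nonneg H_zero)+
 note H_m = I.H_measurable
 note cmean_bd = I.abs_cmean_le and future_bd = I.abs_future_le
 note iH = I.integrable_H
 let ?g = "%k n z. future H k n z-cmean H n z"
 let ?b = "mass2 H" and ?ta = "osc_seq (mass1 H)"
 have "\<exists>x. x : space (B n)" for n using prob_space.not_empty[OF prob_mu[of n]] by auto
 then obtain x0 where x0:"!!n. x0 n : space (B n)" by metis
 define T where "T n om = (\<Sum>m<n. H m (X m om) (X (Suc m) om))" for n om
 have T_F [measurable]:"T n : bm (F n)" for n
 unfolding T_def[abs_def] by (intro borel_measurable_sum H_m X_F) auto
 have T_M [measurable]:"T n : bm M" for n
 using measurable_compose[OF F_id T_F] by simp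
 have T_bd:"abs (T n om)<=real n * C" if "om : space M" for n om
 proof -
 have "abs (T n om)<=(\<Sum>m<n. abs (H m (X m om) (X (Suc m) om)))" unfolding T_def by (rule sum_abs)
 also have "...<=(\<Sum>m<n. C)" using that by (intro sum_mono H_bound) auto
 finally show ?thesis by simp
 qed
 \<comment> \<open>The centre is the expected sum of the increments after time 1 for a chain at a
   fixed state of time 1. Any state will do, since the oscillation over states is under
   control.\<close>
 define c where "c = ?g N' 1 (x0 1)"
 let ?V = "%n om. T n om-c+future H (N-n) n (X n om)"
 define J where "J n = (LINT om|M. (?V n om)^2)" for n
 define q where "q j = (3/ep)*(?b (Suc j)+?b (Suc2 j))+3*(?ta (N'-Suc j) (Suc2 j))^2" for j
 define ph where "ph n x = (LINT y|K n x. (H n x y)^2)" for n x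
 have ph_m [measurable]:"ph n : bm (B n)" for n unfolding ph_def[abs_def] by measurable
 have ph_bd:"0<=ph n x" "ph n x<=C^2" if "x : space (B n)" for n x
 proof -
 show "0<=ph n x" unfolding ph_def by simp
 have "norm (ph n x)<=C^2" unfolding ph_def
 by (intro norm_integral_K_le that) (use H_bound[OF that] C_nonneg in \<open>auto simp:abs_le_square_iff[symmetric]\<close>)
 thus "ph n x<=C^2" by simp
 qed
 have Eph:"(LINT om|M. ph (Suc n) (X (Suc n) om))<=(1/ep)*?b (Suc n)" for n
 using expectation_X_Suc_le[OF ph_m ph_bd] unfolding mass2_def ph_def by blast
 have sq3:"(a+b+d)^2<=3*(a^2+b^2+d^2)" for a b d :: real
 proof -
 have "0<=(a-b)^2+(a-d)^2+(b-d)^2" by simp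
 thus ?thesis by (simp add:power2_eq_square algebra_simps)
 qed
 have int_M:"integrable M u" if "u : bm M" "!!om. om : space M ==> abs (u om)<=A" for u ::"'w => real" and A
 by (rule integrable_const_bound[where B = A]) (use that in auto)
 have step:"J (Suc2 j)<=J (Suc j)+q j" if j:"j < N'" for j
 proof -
 define n where "n = Suc j"
 define k where "k = N-Suc n"
 have Nn:"N-n = Suc k" using j Suc by (simp add:n_def k_def)
 have k':"k = N'-Suc j" using Suc by (simp add:n_def k_def)
 have Nk:"N<=Suc n+k" by (simp add:k_def)
 let ?u = "%x y. H n x y+future H k (Suc n) y"
 \<comment> \<open>Centring at the value for a fixed next state splits \<open>?u x y-?t\<close> into
   the increment, its successor's conditional mean and an oscillation bounded by
   \<open>osc_seq\<close>.\<close>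
 let ?t = "?g k (Suc n) (x0 (Suc n))"
 let ?Ps = "%(om,y). ((T n om-c)+?u (X n om) y)^2"
 define A where "A = real n * C+abs c+(C+real k * C)"
 have u_bd:"abs (?u x y)<=C+real k * C" if "x : space (B n)" "y : space (B (Suc n))" for x y
 using H_bound[OF that] future_bd[OF that(2),of k] by linarith
 have A0:"0<=A" unfolding A_def using C_nonneg by simp
 have Ps_bd:"abs (?Ps (om,y))<=A^2" if "om : space M" "y : space (B (Suc n))" for om y
 proof -
 have "abs ((T n om-c)+?u (X n om) y)<=A"
 unfolding A_def using T_bd[OF that(1),of n] u_bd[of "X n om" y] that by simp
 thus ?thesis using A0 by (simp add:abs_le_square_iff[symmetric])
 qed
 have iu:"integrable (K n x) (?u x)" "integrable (K n x) (%y. (?u x y)^2)" if x:"x : space (B n)" for x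
 proof -
 note [measurable] = x
 show "integrable (K n x) (?u x)" using u_bd[OF x] by (intro integrable_K[OF x]) auto
 have "norm ((?u x y)^2)<=(C+real k * C)^2" if y:"y : space (B (Suc n))" for y
 using u_bd[OF x y] C_nonneg by (simp add:abs_le_square_iff[symmetric])
 thus "integrable (K n x) (%y. (?u x y)^2)" by (intro integrable_K[OF x]) auto
 qed
 have var:"(LINT y|K n x. (?u x y-?t)^2)<=3 * ph n x+((3/ep)*?b (Suc n)+3*(?ta k (Suc n))^2)"
 if x:"x : space (B n)" for x
 proof -
 interpret P: prob_space "K n x" by (rule prob_K[OF x])
 have "(LINT y|K n x. (?u x y-?t)^2)<=(LINT y|K n x. 3*((H n x y)^2+(cmean H (Suc n) y)^2+(?ta k (Suc n))^2))"
 proof (rule integral_mono_AE')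
 show "integrable (K n x) (%y. 3*((H n x y)^2+(cmean H (Suc n) y)^2+(?ta k (Suc n))^2))"
 using iH(2,5)[OF x] by auto
 show "AE y in K n x. (?u x y-?t)^2<=3*((H n x y)^2+(cmean H (Suc n) y)^2+(?ta k (Suc n))^2)"
 proof (rule AE_I2)
 fix y assume "y : space (K n x)"
 hence y:"y : space (B (Suc n))" by simp
 have osc:"abs (?g k (Suc n) y-?t)<=?ta k (Suc n)"
 using I.future_oscillation[OF Nk y x0] .
 have "?u x y-?t = H n x y+cmean H (Suc n) y+(?g k (Suc n) y-?t)" by simp
 hence "(?u x y-?t)^2<=3*((H n x y)^2+(cmean H (Suc n) y)^2+(?g k (Suc n) y-?t)^2)"
 by (simp only: sq3)
 also have "(?g k (Suc n) y-?t)^2<=(?ta k (Suc n))^2"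
 using power_mono[OF osc,of 2] by simp
 finally show "(?u x y-?t)^2<=3*((H n x y)^2+(cmean H (Suc n) y)^2+(?ta k (Suc n))^2)" by simp
 qed
 qed simp
 also have "... = 3 * ph n x+(3*(LINT y|K n x. (cmean H (Suc n) y)^2)+3*(?ta k (Suc n))^2)"
 unfolding ph_def using iH(2,5)[OF x] P.prob_space by (simp add:algebra_simps)
 also have "(LINT y|K n x. (cmean H (Suc n) y)^2)<=(1/ep)*?b (Suc n)"
 proof -
 have "abs (LINT y|K n x. (cmean H (Suc n) y)^2)<=(1/ep)*(LINT y|mu (Suc n). abs ((cmean H (Suc n) y)^2))"
 by (rule abs_integral_K_le[OF x,where C = "C^2"])
 (use cmean_bd C_nonneg in \<open>auto simp:abs_le_square_iff[symmetric]\<close>)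
 also have "...<=(1/ep)*?b (Suc n)"
 using I.integral_cmean_square_le[of "Suc n"] eps by (intro mult_left_mono) auto
 finally show ?thesis by simp
 qed
 finally show ?thesis by (simp add:algebra_simps)
 qed
 have "J (Suc n) = (LINT om|M. ?Ps (om,X (Suc n) om))"
 unfolding J_def k_def[symmetric] by (intro LINT_cong) (simp add:T_def algebra_simps)
 also have "... = (LINT om|M. (LINT y|K n (X n om). ?Ps (om,y)))"
 proof (rule markov_real)
 show "?Ps : bm (F n \<Otimes>\<^sub>M B (Suc n))" by measurable
 show "abs (?Ps (om,y))<=A^2" if "om : space M" "y : space (B (Suc n))" for om y
 by (rule Ps_bd[OF that])
 qed
 also have "...<=(LINT om|M. (?V n om)^2
 +(3 * ph n (X n om)+((3/ep)*?b (Suc n)+3*(?ta k (Suc n))^2)))"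
 proof (rule integral_mono_AE')
 have i1:"integrable M (%om. (?V n om)^2)"
 proof (rule int_M)
 fix om assume om:"om : space M"
 have "abs (?V n om)<=real n * C+abs c+real (N-n) * C"
 using T_bd[OF om,of n] future_bd[OF X_space[OF om],of "N-n" n] by linarith
 from power_mono[OF this,of 2]
 show "abs ((?V n om)^2)<=(real n * C+abs c+real (N-n) * C)^2" by simp
 qed measurable
 moreover have "integrable M (%om. ph n (X n om))"
 by (rule int_M[of _ "C^2"]) (use ph_bd in auto)
 ultimately show "integrable M (%om. (?V n om)^2
 +(3 * ph n (X n om)+((3/ep)*?b (Suc n)+3*(?ta k (Suc n))^2)))" by auto
 show "AE om in M. (LINT y|K n (X n om). ?Ps (om,y))<=(?V n om)^2
 +(3 * ph n (X n om)+((3/ep)*?b (Suc n)+3*(?ta k (Suc n))^2))"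
 proof (rule AE_I2)
 fix om assume om:"om : space M"
 hence x:"X n om : space (B n)" by simp
 interpret P: prob_space "K n (X n om)" by (rule prob_K[OF x])
 have "(LINT y|K n (X n om). ?Ps (om,y))<=(?V n om)^2+(LINT y|K n (X n om). (?u (X n om) y-?t)^2)"
 unfolding Nn prod.case future.simps by (rule P.second_moment_shift_le[OF iu[OF x]])
 thus "(LINT y|K n (X n om). ?Ps (om,y))<=(?V n om)^2
 +(3 * ph n (X n om)+((3/ep)*?b (Suc n)+3*(?ta k (Suc n))^2))"
 using var[OF x] by linarith
 qed
 have "0<=?b (Suc n)" by (rule I.mass_nonneg(2))
 thus "AE om in M. 0<=(?V n om)^2
 +(3 * ph n (X n om)+((3/ep)*?b (Suc n)+3*(?ta k (Suc n))^2))"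
 using ph_bd(1) eps by (intro AE_I2 add_nonneg_nonneg mult_nonneg_nonneg) auto
 qed
 also have "... = J n+(3*(LINT om|M. ph n (X n om))+((3/ep)*?b (Suc n)+3*(?ta k (Suc n))^2))"
 proof -
 have i1:"integrable M (%om. (?V n om)^2)"
 proof (rule int_M)
 fix om assume om:"om : space M"
 have "abs (?V n om)<=real n * C+abs c+real (N-n) * C"
 using T_bd[OF om,of n] future_bd[OF X_space[OF om],of "N-n" n] by linarith
 from power_mono[OF this,of 2]
 show "abs ((?V n om)^2)<=(real n * C+abs c+real (N-n) * C)^2" by simp
 qed measurable
 moreover have "integrable M (%om. ph n (X n om))"
 by (rule int_M[of _ "C^2"]) (use ph_bd in auto)
 ultimately show ?thesis unfolding J_def using prob_space
 by (subst LINT_add,simp,simp) (subst LINT_add,simp,simp,simp)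
 qed
 also have "...<=J n+(3*((1/ep)*?b n)+((3/ep)*?b (Suc n)+3*(?ta k (Suc n))^2))"
 using Eph[of j] by (simp add:n_def)
 also have "... = J (Suc j)+q j"
 unfolding q_def k' n_def by (simp add:algebra_simps)
 finally show ?thesis by (simp add:n_def)
 qed
 have "J (Suc i)<=J 1+(\<Sum>j<i. q j)" if "i<=N'" for i
 using that
 proof (induction i)
 case (Suc i)
 thus ?case using step[of i] by simp
 qed simp
 from this[of N'] have "J N<=J 1+(\<Sum>j<N'. q j)" using Suc by simp
 moreover have "J 1<=(2/ep)*?b 1+2*(?ta N' 1)^2"
 proof -
 have "J 1<=(LINT om|M. 2 * ph 1 (X 1 om)+2*(?ta N' 1)^2)"
 unfolding J_def
 proof (rule integral_mono_AE')
 have "integrable M (%om. ph 1 (X 1 om))"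
 by (rule int_M[of _ "C^2"]) (use ph_bd in auto)
 thus "integrable M (%om. 2 * ph 1 (X 1 om)+2*(?ta N' 1)^2)" by auto
 show "AE om in M. (T 1 om-c+future H (N-1) 1 (X 1 om))^2<=2 * ph 1 (X 1 om)+2*(?ta N' 1)^2"
 proof (rule AE_I2)
 fix om assume om:"om : space M"
 let ?a = "cmean H 1 (X 1 om)" and ?d = "?g N' 1 (X 1 om)-?g N' 1 (x0 1)"
 have "abs ?d<=?ta N' 1"
 using I.future_oscillation[of 1 N' "X 1 om" "x0 1"] om x0 Suc by simp
 from power_mono[OF this,of 2] have d:"?d^2<=(?ta N' 1)^2" by simp
 have a:"?a^2<=ph 1 (X 1 om)" unfolding ph_def by (rule I.cmean_square_le) (use om in simp)
 have "T 1 om-c+future H (N-1) 1 (X 1 om) = ?a+?d"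
 by (simp add:T_def H_0 c_def Suc)
 hence "(T 1 om-c+future H (N-1) 1 (X 1 om))^2 = (?a+?d)^2" by simp
 also have "...<=2*?a^2+2*?d^2"
 using sum_squares_bound[of ?a ?d] unfolding power2_sum by linarith
 finally show "(T 1 om-c+future H (N-1) 1 (X 1 om))^2<=2 * ph 1 (X 1 om)+2*(?ta N' 1)^2"
 using a d by linarith
 qed
 qed (use ph_bd in \<open>auto intro!:AE_I2\<close>)
 also have "... = 2*(LINT om|M. ph 1 (X 1 om))+2*(?ta N' 1)^2"
 proof -
 have "integrable M (%om. ph 1 (X 1 om))"
 by (rule int_M[of _ "C^2"]) (use ph_bd in auto)
 thus ?thesis using prob_space by simp
 qed
 also have "...<=(2/ep)*?b 1+2*(?ta N' 1)^2" using Eph[of 0] by simp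
 finally show ?thesis .
 qed
 moreover have "J N = (LINT om|M. ((\<Sum>n<N. H n (X n om) (X (Suc n) om))-c)^2)"
 unfolding J_def T_def by simp
 moreover have "(2/ep)*?b 1+2*(?ta N' 1)^2+(\<Sum>j<N'. q j)<=(56/ep ^ 4)*(\<Sum>m<N. ?b m)"
 proof -
 let ?S = "\<Sum>m<N. ?b m"
 have b0:"0<=?b m" for m by (rule I.mass_nonneg(2))
 have zero:"?b m = 0" if "N<=m" for m using I.mass2_zero[OF that] .
 have b1:"?b 1<=?S"
 proof (cases "1 < N")
 case True
 thus ?thesis using b0 by (intro member_le_sum) auto
 next
 case False
 thus ?thesis using zero[of 1] b0 by (simp add:sum_nonneg)
 qed
 have s1:"(\<Sum>j<N'. ?b (Suc j))<=?S"
 unfolding Suc sum.lessThan_Suc_shift using b0[of 0] by simp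
 have s2:"(\<Sum>j<N'. ?b (Suc2 j))<=?S"
 proof -
 have "(\<Sum>j<N'. ?b (Suc2 j))<=(\<Sum>j<Suc N'. ?b (Suc j))"
 unfolding sum.lessThan_Suc_shift using b0[of 1] by simp
 also have "... = (\<Sum>j<N'. ?b (Suc j))" using zero[of "Suc N'"] Suc by simp
 finally show ?thesis using s1 by linarith
 qed
 have osc:"(?ta N' 1)^2+(\<Sum>j<N'. (?ta (N'-Suc j) (Suc2 j))^2)<=(16/ep ^ 4)*?S"
 proof -
 have "(\<Sum>j<Suc N'. (?ta (N'-j) (1+j))^2) = (?ta N' 1)^2+(\<Sum>j<N'. (?ta (N'-Suc j) (Suc2 j))^2)"
 by (subst sum.lessThan_Suc_shift) simp
 moreover have "(\<Sum>j<Suc N'. (?ta (N'-j) (1+j))^2) = (\<Sum>j<N'. (?ta (N'-j) (1+j))^2)" by simp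
 ultimately show ?thesis using I.sum_osc_seq_le[of N' 1] by simp
 qed
 have "(\<Sum>j<N'. q j) = (3/ep)*((\<Sum>j<N'. ?b (Suc j))+(\<Sum>j<N'. ?b (Suc2 j)))+3*(\<Sum>j<N'. (?ta (N'-Suc j) (Suc2 j))^2)"
 unfolding q_def sum.distrib sum_distrib_left by (simp add:sum.distrib distrib_left sum_distrib_left)
 also have "(3/ep)*((\<Sum>j<N'. ?b (Suc j))+(\<Sum>j<N'. ?b (Suc2 j)))<=(3/ep)*(?S+?S)"
 using eps by (intro mult_left_mono add_mono s1 s2) auto
 finally have Q:"(\<Sum>j<N'. q j)<=(6/ep)*?S+3*(\<Sum>j<N'. (?ta (N'-Suc j) (Suc2 j))^2)" by simp
 have B1:"(2/ep)*?b 1<=(2/ep)*?S" using eps b1 by (intro mult_left_mono) auto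
 \<comment> \<open>The constant 56 is \<open>8+48\<close>: the increments contribute
   \<open>8/ep\<close>, the oscillations three times \<open>16/ep ^ 4\<close>, and
   \<open>1/ep\<close> is at most \<open>1/ep ^ 4\<close>.\<close>
 have "(2/ep)*?b 1+2*(?ta N' 1)^2+(\<Sum>j<N'. q j)
<=(2/ep)*?S+(6/ep)*?S+3*((?ta N' 1)^2+(\<Sum>j<N'. (?ta (N'-Suc j) (Suc2 j))^2))"
 using Q B1 zero_le_power2[of "?ta N' 1"] unfolding distrib_left by linarith
 also have "...<=(2/ep)*?S+(6/ep)*?S+3*((16/ep ^ 4)*?S)"
 using osc by (intro add_left_mono mult_left_mono) auto
 also have "... = (8/ep)*?S+(48/ep ^ 4)*?S" by (simp add:add_divide_distrib[symmetric])
 also have "(8/ep)*?S<=(8/ep ^ 4)*?S"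
 proof (intro mult_right_mono divide_left_mono)
 show "ep ^ 4<=ep" using eps power_decreasing[of 1 4 ep] by simp
 qed (use eps b0 in \<open>auto intro:sum_nonneg\<close>)
 finally show ?thesis by (simp add:add_divide_distrib[symmetric] distrib_right[symmetric])
 qed
 ultimately show ?thesis by (intro exI[of _ c]) linarith
qed

end

section \<open>Reference paths and approximation by gradients\<close>

lemma (in prob_space) exists_le_nn_integral:
 assumes u:"u : bm M" and le:"(NN om|M. u om)<=c" and c:"c < \<infinity>"
 shows "\<exists>om\<in>space M. u om<=c"
proof (rule ccontr)
 assume "\<not> ?thesis"
 hence gt:"c < u om" if "om : space M" for om using that by (auto simp:not_le)
 have "(NN om|M. c) < (NN om|M. u om)"
 proof (rule nn_integral_less[OF _ u])
 show "(NN om|M. c) ~= \<infinity>" using c by (simp add:emeasure_space_1)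
 show "AE om in M. c<=u om" using gt by (intro AE_I2 less_imp_le) auto
 show "\<not> (AE om in M. u om<=c)"
 proof
 assume "AE om in M. u om<=c"
 hence "AE om in M. False" using AE_space by eventually_elim (use gt in \<open>auto simp:not_le[symmetric]\<close>)
 thus False by simp
 qed
 qed simp
 thus False using le by (simp add:emeasure_space_1)
qed

text \<open>The sharper quadratic bound applies to the half angle, and the half-angle formula shows
  that halving the angle does not increase the chord on this range.\<close>

lemma chord_sq_lower_pi:"abs t<=pi ==> t^2/4<=2-2 * cos t" for t :: real
proof -
 assume t:"abs t<=pi"
 have "pi < 4" using pi_less_4 .
 hence 1:"(t/2)^2/2<=2-2 * cos (t/2)" using t by (intro chord_sq_lower) auto
 have c:"0<=cos (t/2)" "cos (t/2)<=1" using t by (auto intro!:cos_ge_zero)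
 have "cos t = 2*(cos (t/2))^2-1" using cos_double_cos[of "t/2"] by simp
 moreover have "(cos (t/2))^2<=cos (t/2)"
 using c mult_left_le[of "cos (t/2)" "cos (t/2)"] by (simp add:power2_eq_square)
 ultimately show ?thesis using 1 by (simp add:power_divide)
qed

lemma (in bounded_increments) ennreal_mass2:
 "ennreal (mass2 H n) = (NN x|mu n. NN y|mu (Suc n). ennreal (p n x y*(H n x y)^2))"
proof -
 have "ennreal (mass2 H n) = (NN x|mu n. ennreal (LINT y|K n x. (H n x y)^2))"
 unfolding mass2_def by (rule nn_integral_eq_integral[symmetric,OF integrable_cmean(3)]) auto
 also have "... = (NN x|mu n. NN y|mu (Suc n). ennreal (p n x y*(H n x y)^2))"
 proof (rule nn_integral_cong)
 fix x assume "x : space (mu n)"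
 hence x [measurable]:"x : space (B n)" by simp
 have "ennreal (LINT y|K n x. (H n x y)^2) = (NN y|K n x. ennreal ((H n x y)^2))"
 by (rule nn_integral_eq_integral[symmetric,OF integrable_H(2)[OF x]]) auto
 also have "... = (NN y|mu (Suc n). ennreal (p n x y) * ennreal ((H n x y)^2))"
 by (rule nn_integral_K[OF x]) measurable
 finally show "ennreal (LINT y|K n x. (H n x y)^2) = (NN y|mu (Suc n). ennreal (p n x y*(H n x y)^2))"
 by (simp add:ennreal_mult')
 qed
 finally show ?thesis .
qed

context elliptic_process
begin

lemma nn_integral_grad_err_X_le:
 assumes th:"th ~= 0"
 shows "(NN om|M. grad_err (Suc n) th (X (Suc n) om) (X (Suc2 n) om))<=ennreal (2/ep ^ 3 * dsq (Suc n) th)"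
proof -
 have "(NN om|M. grad_err (Suc n) th (X (Suc n) om) (X (Suc2 n) om))
<=ennreal (1/ep)*(NN x|mu (Suc n). (NN y|mu (Suc2 n). ennreal (p (Suc n) x y) * grad_err (Suc n) th x y))"
 by (rule nn_integral_pair_le) measurable
 also have "...<=ennreal (1/ep)*(ennreal (2/ep^2) * ennreal (dsq (Suc n) th))"
 by (intro mult_left_mono nn_integral_grad_err_le th) auto
 also have "... = ennreal (1/ep*(2/ep^2 * dsq (Suc n) th))"
 using eps by (simp only: ennreal_mult' divide_nonneg_nonneg zero_le_one less_imp_le zero_le_numeral zero_le_power2)
 also have "1/ep*(2/ep^2 * dsq (Suc n) th) = 2/ep ^ 3 * dsq (Suc n) th"
 by (simp add:power2_eq_square power3_eq_cube)
 finally show ?thesis .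
qed

lemma grad_err_X_measurable [measurable]:
 "(%om. grad_err n th (X n om) (X (Suc n) om)) : bm M"
 using measurable_compose[OF measurable_Pair grad_err_measurable,of "X n" M n "X (Suc n)" th] by simp

text \<open>First-moment method: the reference path is a sampled trajectory of the chain whose total
  gradient error does not exceed the expected one.\<close>

lemma reference_path_finite:
 assumes th:"th ~= 0"
 obtains r where "!!n. r n : space (B n)"
 "(\<Sum>n\<in>{3..N-3}. grad_err n th (r n) (r (Suc n)))<=ennreal (2/ep ^ 3 * Dsum N th)"
proof -
 have "(NN om|M. (\<Sum>n\<in>{3..N-3}. grad_err n th (X n om) (X (Suc n) om)))
 = (\<Sum>n\<in>{3..N-3}. NN om|M. grad_err n th (X n om) (X (Suc n) om))"
 by (rule nn_integral_sum) measurable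
 also have "...<=(\<Sum>n\<in>{3..N-3}. ennreal (2/ep ^ 3 * dsq n th))"
 proof (rule sum_mono)
 fix n assume "n : {3..N-3}"
 then obtain m where "n = Suc m" by (cases n) auto
 thus "(NN om|M. grad_err n th (X n om) (X (Suc n) om))<=ennreal (2/ep ^ 3 * dsq n th)"
 using nn_integral_grad_err_X_le[OF th] by simp
 qed
 also have "... = ennreal (2/ep ^ 3 * Dsum N th)"
 unfolding Dsum_def sum_distrib_left using eps by (intro sum_ennreal) auto
 finally have "\<exists>om\<in>space M. (\<Sum>n\<in>{3..N-3}. grad_err n th (X n om) (X (Suc n) om))<=ennreal (2/ep ^ 3 * Dsum N th)"
 by (intro exists_le_nn_integral) auto
 then obtain om where "om : space M" "(\<Sum>n\<in>{3..N-3}. grad_err n th (X n om) (X (Suc n) om))<=ennreal (2/ep ^ 3 * Dsum N th)" by auto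
 thus ?thesis by (intro that[of "%n. X n om"]) auto
qed

text \<open>When \<open>Dsum\<close> is bounded the expectation of the whole series of errors is
  finite, so a single trajectory serves all \<open>N\<close> at once. This is what makes the
  lattice-valued functional built from it independent of \<open>N\<close>.\<close>

lemma reference_path_infinite:
 assumes th:"th ~= 0" and D:"!!N. Dsum N th<=C"
 obtains r where "!!n. r n : space (B n)"
 "!!N. (\<Sum>n\<in>{3..N-3}. grad_err n th (r n) (r (Suc n)))<=ennreal (2/ep ^ 3 * C)"
proof -
 let ?e = "%n om. grad_err (3+n) th (X (3+n) om) (X (Suc (3+n)) om)"
 have fin:"(\<Sum>n<k. ennreal (2/ep ^ 3 * dsq (3+n) th))<=ennreal (2/ep ^ 3 * C)" for k
 proof -
 have "(\<Sum>n<k. dsq (3+n) th) = Dsum (k+5) th"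
 unfolding Dsum_def
 by (rule sum.reindex_bij_witness[where i = "%n. n-3" and j = "%n. 3+n"]) auto
 hence "(\<Sum>n<k. 2/ep ^ 3 * dsq (3+n) th)<=2/ep ^ 3 * C"
 unfolding sum_distrib_left[symmetric] using D[of "k+5"] eps by (intro mult_left_mono) auto
 thus ?thesis using eps by (subst sum_ennreal) (auto intro:ennreal_leI)
 qed
 have "(NN om|M. (\<Sum>n. ?e n om)) = (\<Sum>n. NN om|M. ?e n om)"
 by (rule nn_integral_suminf) measurable
 also have "...<=(\<Sum>n. ennreal (2/ep ^ 3 * dsq (3+n) th))"
 proof (rule suminf_le)
 show "(NN om|M. ?e n om)<=ennreal (2/ep ^ 3 * dsq (3+n) th)" for n
 using nn_integral_grad_err_X_le[OF th,of "2+n"] by (simp add:numeral_3_eq_3)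
 qed auto
 also have "...<=ennreal (2/ep ^ 3 * C)"
 by (rule suminf_le_const[OF _ fin]) auto
 finally have le:"(NN om|M. (\<Sum>n. ?e n om))<=ennreal (2/ep ^ 3 * C)" .
 have "(%om. \<Sum>n. ?e n om) : bm M" by measurable
 from exists_le_nn_integral[OF this le]
 have "\<exists>om\<in>space M. (\<Sum>n. ?e n om)<=ennreal (2/ep ^ 3 * C)" by simp
 then obtain om where om:"om : space M" "(\<Sum>n. ?e n om)<=ennreal (2/ep ^ 3 * C)" by auto
 show ?thesis
 proof (rule that[of "%n. X n om"])
 fix N
 have "(\<Sum>n\<in>{3..N-3}. grad_err n th (X n om) (X (Suc n) om)) = (\<Sum>n<N-5. ?e n om)"
 by (rule sum.reindex_bij_witness[where j = "%n. n-3" and i = "%n. 3+n"]) auto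
 also have "...<=(\<Sum>n. ?e n om)" by (rule sum_le_suminf) auto
 finally show "(\<Sum>n\<in>{3..N-3}. grad_err n th (X n om) (X (Suc n) om))<=ennreal (2/ep ^ 3 * C)"
 using om(2) by (rule order_trans)
 qed (use om in auto)
qed

text \<open>The factors: 2 from squaring a sum of two terms, 56 over the fourth power of the tilted
  ellipticity from \<open>second_moment_bound\<close>, the comparison of \<open>ptilt\<close> with
  \<open>p\<close>, and \<open>4/th^2\<close> from bounding an angle of at most \<open>pi\<close> by
  its chord.\<close>

definition var_const ::"real => real => real" where
 "var_const R th = 2*(56/(tilt_eps R) ^ 4)*(exp (2 * L * R) * harnack R*(4/th^2))"

text \<open>Along a reference path \<open>r\<close>,\<open>f m\<close> is a coboundary plus a constant plus \<open>g m\<close> plus a remainder of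
 small second moment.  The correction \<open>g\<close> is \<open>0\<close> for small \<open>th\<close> and the nearest multiple of
 \<open>2 \<pi>/th\<close> in general.\<close>

lemma second_moment_remainder:
 assumes R:"abs xi<=R" and th:"0 < th" and r:"!!n. r n : space (B n)"
 and G:"(\<Sum>n\<in>{3..N-3}. grad_err n th (r n) (r (Suc n)))<=ennreal G" "0<=G"
 and g_meas:"!!n. (%(x,y). g n x y) : bm (B n \<Otimes>\<^sub>M B (Suc n))"
 and g0:"!!n x y. n < 5 ==> g n x y = 0"
 and g:"!!n x y. 3<=n ==> x : space (B (Suc2 n)) ==> y : space (B (Suc3 n)) ==>
 abs (th*(residual n th (r n) (r (Suc n)) x y-g (Suc2 n) x y))<=pi \<and>
 cos (th*(residual n th (r n) (r (Suc n)) x y-g (Suc2 n) x y)) = cos (th * residual n th (r n) (r (Suc n)) x y)"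
 and P:"!!n x. x : space (B (Suc2 n)) ==> abs (pot n th (r n) x)<=Pb"
 shows "\<exists>c. (LINT om|Mtilt N xi. ((\<Sum>m<N. f m (X m om) (X (Suc m) om)-g m (X m om) (X (Suc m) om))-c)^2)
<=var_const R th * G+2*(5 * L+2 * Pb)^2"
proof -
 interpret T: elliptic_process B mu "ptilt N xi" "tilt_eps R" f L "Mtilt N xi" F X by (rule Mtilt_process[OF R])
 have R0:"0<=R" using R by linarith
 have hp:"0 < harnack R" using harnack_ge_1[OF R0] by simp
 let ?cp = "exp (2 * L * R) * harnack R"
 \<comment> \<open>The increment at time \<open>m\<close> is compared with the reference pair at
   times \<open>m-2\<close> and \<open>m-1\<close>. Errors are summed over hexagons from index 3 on,
   hence \<open>5<=m\<close>; this also makes the increment at time 0 vanish.\<close>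
 define H where "H m x y = (if 5<=m & m < N then residual (m-2) th (r (m-2)) (r (m-1)) x y-g m x y else 0)" for m x y
 have H_eq:"H (Suc2 n) x y = (if 3<=n & Suc2 n < N then residual n th (r n) (r (Suc n)) x y-g (Suc2 n) x y else 0)" for n x y
 by (simp add:H_def)
 have [measurable]:"r n : space (B n)" for n by (rule r)
 have H_meas:"(%(x,y). H m x y) : bm (B m \<Otimes>\<^sub>M B (Suc m))" for m
 proof (cases "5<=m")
 case True
 define n where "n = m-2"
 have m:"m = Suc2 n" using True unfolding n_def by arith
 have [measurable]:"(%z. g (Suc2 n) (fst z) (snd z)) : bm (B (Suc2 n) \<Otimes>\<^sub>M B (Suc3 n))"
 using g_meas[of "Suc2 n"] by (simp add:split_beta')
 show ?thesis unfolding m H_eq by measurable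
 next
 case False
 thus ?thesis by (simp add:H_def)
 qed
 have H_bound:"abs (H m x y)<=pi/th" if "x : space (B m)" "y : space (B (Suc m))" for m x y
 proof (cases "5<=m & m < N")
 case True
 define n where "n = m-2"
 have m:"m = Suc2 n" using True unfolding n_def by arith
 have n:"3<=n" "Suc2 n < N" using True m by arith+
 have "abs (th * H m x y)<=pi" using g[of n x y] that n unfolding m H_eq by simp
 thus ?thesis using th by (simp add:abs_mult field_simps)
 next
 case False
 hence "H m x y = 0" by (auto simp:H_def)
 thus ?thesis using th by simp
 qed
 interpret I: bounded_increments B mu "ptilt N xi" "tilt_eps R" H "pi/th" N
 by unfold_locales (use H_meas H_bound th in \<open>auto simp:H_def\<close>)
 have mass:"ennreal (T.mass2 H (Suc2 n))<=ennreal (?cp*(4/th^2)) * grad_err n th (r n) (r (Suc n))"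
 if n:"3<=n" "Suc2 n < N" for n
 proof -
 interpret M3: prob_space "mu (Suc3 n)" by (rule prob_mu)
 have "ennreal (T.mass2 H (Suc2 n))<=(NN x|mu (Suc2 n). NN y|mu (Suc3 n). ennreal (?cp*(4/th^2)) *
 ennreal (p (Suc2 n) x y*(2-2 * cos (th * residual n th (r n) (r (Suc n)) x y))))"
 unfolding I.ennreal_mass2
 proof (intro nn_integral_mono)
 fix x y assume "x : space (mu (Suc2 n))" "y : space (mu (Suc3 n))"
 hence xy:"x : space (B (Suc2 n))" "y : space (B (Suc3 n))" by auto
 let ?H = "H (Suc2 n) x y" and ?c = "2-2 * cos (th * residual n th (r n) (r (Suc n)) x y)"
 have "(th*?H)^2/4<=?c"
 using g[OF n(1) xy] chord_sq_lower_pi[of "th*?H"] n by (simp add:H_eq)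
 hence Hsq:"?H^2<=(4/th^2)*?c" using th by (simp add:field_simps)
 have "ptilt N xi (Suc2 n) x y*?H^2<=(?cp * p (Suc2 n) x y)*((4/th^2)*?c)"
 using hp by (intro mult_mono ptilt_le_p[OF R] Hsq) auto
 hence "ennreal (ptilt N xi (Suc2 n) x y*?H^2)<=ennreal ((?cp*(4/th^2))*(p (Suc2 n) x y*?c))"
 by (intro ennreal_leI) (simp only: mult_ac)
 also have "... = ennreal (?cp*(4/th^2)) * ennreal (p (Suc2 n) x y*?c)"
 using hp by (intro ennreal_mult') auto
 finally show "ennreal (ptilt N xi (Suc2 n) x y*?H^2)<=..." .
 qed
 also have "... = ennreal (?cp*(4/th^2)) * grad_err n th (r n) (r (Suc n))"
 unfolding grad_err_def
 proof (subst nn_integral_cmult[symmetric])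
 show "(%x. NN z|mu (Suc3 n). ennreal (p (Suc2 n) x z*(2-2 * cos (th * residual n th (r n) (r (Suc n)) x z)))) : bm (mu (Suc2 n))"
 by measurable
 next
 show "(NN x|mu (Suc2 n). NN y|mu (Suc3 n). ennreal (?cp*(4/th^2)) *
 ennreal (p (Suc2 n) x y*(2-2 * cos (th * residual n th (r n) (r (Suc n)) x y))))
 = (NN x|mu (Suc2 n). ennreal (?cp*(4/th^2))*(NN y|mu (Suc3 n).
 ennreal (p (Suc2 n) x y*(2-2 * cos (th * residual n th (r n) (r (Suc n)) x y)))))"
 proof (intro nn_integral_cong nn_integral_cmult)
 fix x assume "x : space (mu (Suc2 n))"
 hence [measurable]:"x : space (B (Suc2 n))" by simp
 show "(%y. ennreal (p (Suc2 n) x y*(2-2 * cos (th * residual n th (r n) (r (Suc n)) x y)))) : bm (mu (Suc3 n))"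
 by measurable
 qed
 qed
 finally show ?thesis .
 qed
 have mass_zero:"T.mass2 H m = 0" if "\<not> (5<=m & m < N)" for m
 proof -
 have "H m x y = 0" for x y unfolding H_def using that by (rule if_not_P)
 thus ?thesis by (simp add:T.mass2_def)
 qed
 have "ennreal (\<Sum>m<N. T.mass2 H m) = (\<Sum>m<N. ennreal (T.mass2 H m))"
 by (rule sum_ennreal[symmetric]) simp
 also have "... = (\<Sum>m\<in>{5..<N}. ennreal (T.mass2 H m))"
 by (rule sum.mono_neutral_right) (auto simp:mass_zero)
 also have "...<=(\<Sum>m\<in>{5..<N}. ennreal (?cp*(4/th^2)) * grad_err (m-2) th (r (m-2)) (r (m-1)))"
 proof (rule sum_mono)
 fix m assume "m : {5..<N}"
 hence "3<=m-2" "Suc (Suc (m-2)) < N" "Suc (Suc (m-2)) = m" "Suc (m-2) = m-1" by auto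
 thus "ennreal (T.mass2 H m)<=ennreal (?cp*(4/th^2)) * grad_err (m-2) th (r (m-2)) (r (m-1))"
 using mass[of "m-2"] by simp
 qed
 also have "... = ennreal (?cp*(4/th^2))*(\<Sum>m\<in>{5..<N}. grad_err (m-2) th (r (m-2)) (r (m-1)))"
 by (rule sum_distrib_left[symmetric])
 also have "(\<Sum>m\<in>{5..<N}. grad_err (m-2) th (r (m-2)) (r (m-1))) = (\<Sum>n\<in>{3..N-3}. grad_err n th (r n) (r (Suc n)))"
 by (rule sum.reindex_bij_witness[where j = "%m. m-2" and i = "%n. n+2"]) (auto simp:Suc_diff_Suc numeral_2_eq_2)
 also have "ennreal (?cp*(4/th^2))*...<=ennreal (?cp*(4/th^2)) * ennreal G"
 by (intro mult_left_mono G) auto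
 also have "... = ennreal (?cp*(4/th^2) * G)"
 using hp by (intro ennreal_mult'[symmetric]) auto
 finally have sum_mass:"(\<Sum>m<N. T.mass2 H m)<=?cp*(4/th^2) * G"
 using hp G(2) by (subst (asm) ennreal_le_iff) (auto intro!:mult_nonneg_nonneg)
 obtain c where c:"(LINT om|Mtilt N xi. ((\<Sum>m<N. H m (X m om) (X (Suc m) om))-c)^2)<=(56/(tilt_eps R) ^ 4)*(\<Sum>m<N. T.mass2 H m)"
 using T.second_moment_bound[of H "pi/th" N] H_meas H_bound th by (auto simp:H_def)
 define k where "k = (\<Sum>m\<in>{5..<N}. f (m-2) (r (m-2)) (r (m-1)))"
 define Q where "Q om = (\<Sum>m<N. f m (X m om) (X (Suc m) om)-g m (X m om) (X (Suc m) om))" for om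
 define HS where "HS om = (\<Sum>m<N. H m (X m om) (X (Suc m) om))" for om
 have Pb:"0<=Pb"
 proof -
 obtain x where "x : space (B 2)" using prob_space.not_empty[OF prob_mu[of 2]] by auto
 thus ?thesis using P[of x 0] by (simp add:numeral_2_eq_2)
 qed
 \<comment> \<open>The gradient terms telescope to the potentials at both ends, each at most
   \<open>Pb\<close>; the sum of \<open>f\<close> along the reference path is the constant
   \<open>k\<close>, and the first five increments cost \<open>5 * L\<close>.\<close>
 have close:"abs (Q om-HS om-k)<=5 * L+2 * Pb" if om:"om : space M" for om
 proof -
 let ?P = "%m. pot (m-2) th (r (m-2)) (X m om)"
 have small:"abs (\<Sum>m<j. f m (X m om) (X (Suc m) om))<=real j * L" for j using abs_S_le[of j om] by (simp add:S_def)
 show ?thesis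
 proof (cases "N < 5")
 case True
 have "HS om = 0" unfolding HS_def H_def using True by (intro sum.neutral) auto
 moreover have "k = 0" unfolding k_def using True by simp
 moreover have "Q om = (\<Sum>m<N. f m (X m om) (X (Suc m) om))"
 unfolding Q_def using True g0 by (intro sum.cong) auto
 moreover have "real N * L<=5 * L" using True L_pos by (intro mult_right_mono) auto
 ultimately show ?thesis using small[of N] Pb by simp
 next
 case False
 have split:"(\<Sum>m<N. h m) = (\<Sum>m<5. h m)+(\<Sum>m\<in>{5..<N}. h m)" for h ::"nat => real"
 using False by (subst sum.union_disjoint[symmetric]) (auto intro!:sum.cong)
 have Hm:"H m (X m om) (X (Suc m) om) = f m (X m om) (X (Suc m) om)+?P m-?P (Suc m)-f (m-2) (r (m-2)) (r (m-1))-g m (X m om) (X (Suc m) om)"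
 if "m : {5..<N}" for m
 proof -
 define n where "n = m-2"
 have m:"m = Suc2 n" and n:"3<=n" "Suc2 n < N" using that by (auto simp:n_def)
 show ?thesis unfolding m H_eq using n by (simp add:residual_def)
 qed
 have "HS om = (\<Sum>m\<in>{5..<N}. H m (X m om) (X (Suc m) om))"
 unfolding HS_def split by (simp add:H_def)
 also have "... = (\<Sum>m\<in>{5..<N}. (f m (X m om) (X (Suc m) om)-g m (X m om) (X (Suc m) om))-(?P (Suc m)-?P m)-f (m-2) (r (m-2)) (r (m-1)))"
 by (intro sum.cong refl) (simp add:Hm)
 also have "... = (\<Sum>m\<in>{5..<N}. f m (X m om) (X (Suc m) om)-g m (X m om) (X (Suc m) om))-(\<Sum>m\<in>{5..<N}. ?P (Suc m)-?P m)-k"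
 unfolding k_def sum_subtractf ..
 also have "(\<Sum>m\<in>{5..<N}. ?P (Suc m)-?P m) = ?P N-?P 5"
 using False by (intro sum_Suc_diff') simp
 finally have HS:"HS om = (\<Sum>m\<in>{5..<N}. f m (X m om) (X (Suc m) om)-g m (X m om) (X (Suc m) om))-(?P N-?P 5)-k" .
 have "Q om = (\<Sum>m<5. f m (X m om) (X (Suc m) om))+(\<Sum>m\<in>{5..<N}. f m (X m om) (X (Suc m) om)-g m (X m om) (X (Suc m) om))"
 unfolding Q_def split using g0 by (intro arg_cong2[where f = "(+)"] sum.cong) auto
 hence eq:"Q om-HS om-k = (\<Sum>m<5. f m (X m om) (X (Suc m) om))+?P N-?P 5" using HS by simp
 have "abs (?P m)<=Pb" if "2<=m" for m
 proof -
 have "Suc (Suc (m-2)) = m" using that by simp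
 thus ?thesis using P[of "X m om" "m-2"] om by simp
 qed
 from this[of N] this[of 5] have "abs (?P N)<=Pb" "abs (?P 5)<=Pb" using False by auto
 thus ?thesis unfolding eq using small[of 5] by simp
 qed
 qed
 have g_m:"(%om. g m (X m om) (X (Suc m) om)) : bm M" for m
 using measurable_compose[OF measurable_Pair g_meas,of "X m" M m "X (Suc m)"] by simp
 have Q_m [measurable]:"Q : bm M" unfolding Q_def[abs_def] using g_m by measurable
 have HS_m [measurable]:"HS : bm M" unfolding HS_def[abs_def]
 by (intro borel_measurable_sum I.H_measurable) measurable
 have HS_bd:"abs (HS om)<=real N*(pi/th)" if "om : space M" for om
 proof -
 have "abs (HS om)<=(\<Sum>m<N. abs (H m (X m om) (X (Suc m) om)))" unfolding HS_def by (rule sum_abs)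
 also have "...<=(\<Sum>m<N. pi/th)" using that by (intro sum_mono H_bound) auto
 finally show ?thesis by simp
 qed
 have iHS:"integrable (Mtilt N xi) (%om. (HS om-c)^2)"
 proof (rule T.integrable_const_bound)
 show "AE om in Mtilt N xi. norm ((HS om-c)^2)<=(real N*(pi/th)+abs c)^2"
 proof (rule AE_I2)
 fix om assume "om : space (Mtilt N xi)"
 hence "abs (HS om-c)<=real N*(pi/th)+abs c" using HS_bd[of om] by simp
 from power_mono[OF this,of 2] show "norm ((HS om-c)^2)<=(real N*(pi/th)+abs c)^2" by simp
 qed
 qed measurable
 have "(LINT om|Mtilt N xi. (Q om-(c+k))^2)<=(LINT om|Mtilt N xi. 2*(HS om-c)^2+2*(5 * L+2 * Pb)^2)"
 proof (rule integral_mono_AE')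
 show "integrable (Mtilt N xi) (%om. 2*(HS om-c)^2+2*(5 * L+2 * Pb)^2)" using iHS by auto
 show "AE om in Mtilt N xi. (Q om-(c+k))^2<=2*(HS om-c)^2+2*(5 * L+2 * Pb)^2"
 proof (rule AE_I2)
 fix om assume "om : space (Mtilt N xi)"
 hence "abs (Q om-HS om-k)<=5 * L+2 * Pb" using close by simp
 from power_mono[OF this,of 2] have d:"(Q om-HS om-k)^2<=(5 * L+2 * Pb)^2" by simp
 have "(Q om-(c+k))^2 = ((HS om-c)+(Q om-HS om-k))^2" by (simp add:algebra_simps)
 also have "...<=2*(HS om-c)^2+2*(Q om-HS om-k)^2"
 using sum_squares_bound[of "HS om-c" "Q om-HS om-k"] unfolding power2_sum[of "HS om-c"] by linarith
 finally show "(Q om-(c+k))^2<=2*(HS om-c)^2+2*(5 * L+2 * Pb)^2" using d by linarith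
 qed
 qed auto
 also have "... = 2*(LINT om|Mtilt N xi. (HS om-c)^2)+2*(5 * L+2 * Pb)^2"
 using iHS T.prob_space by simp
 also have "...<=2*((56/(tilt_eps R) ^ 4)*(?cp*(4/th^2) * G))+2*(5 * L+2 * Pb)^2"
 proof -
 have "(LINT om|Mtilt N xi. (HS om-c)^2)<=(56/(tilt_eps R) ^ 4)*(?cp*(4/th^2) * G)"
 using c unfolding HS_def[symmetric]
 by (rule order_trans) (intro mult_left_mono sum_mass,simp)
 thus ?thesis by simp
 qed
 also have "... = var_const R th * G+2*(5 * L+2 * Pb)^2" by (simp add:var_const_def)
 finally show ?thesis unfolding Q_def by blast
qed

end

section \<open>Tilted variances and characteristic functions\<close>

lemma (in prob_space) variance_le_second_moment:
 fixes u ::"'a => real"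
 assumes u:"integrable M u" "integrable M (%x. (u x)^2)"
 shows "variance u<=(LINT x|M. (u x-c)^2)"
proof -
 have "(LINT x|M. (u x-c)^2) = (LINT x|M. (u x)^2-(2 * c) * u x+c^2)"
 by (intro LINT_cong) (simp add:power2_diff)
 also have "... = (LINT x|M. (u x)^2)-2 * c * expectation u+c^2" using u by (simp add:prob_space)
 finally have e:"(LINT x|M. (u x-c)^2) = (LINT x|M. (u x)^2)-2 * c * expectation u+c^2" .
 have v:"variance u = (LINT x|M. (u x)^2)-(expectation u)^2" by (rule variance_eq[OF u])
 have "0<=(expectation u-c)^2" by simp
 also have "(expectation u-c)^2 = (expectation u)^2-2 * c * expectation u+c^2" by (simp add:power2_diff)
 finally show ?thesis unfolding e v by simp
qed

text \<open>Centring only rotates the characteristic function, and the real part of the centred one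
  is a mean of cosines, each at least \<open>1-t^2/2\<close>.\<close>

lemma (in prob_space) norm_char_ge:
 assumes S [measurable]:"S : bm M" and bd:"!!om. om : space M ==> abs (S om)<=C"
 shows "1-th^2 * variance S/2<=cmod (LINT om|M. exp (\<i> * of_real th * of_real (S om)))"
proof -
 let ?m = "expectation S"
 have iS:"integrable M S" by (rule integrable_const_bound[where B = C]) (use bd in auto)
 have i2:"integrable M (%om. (S om)^2)"
 proof (rule integrable_const_bound)
 show "AE om in M. norm ((S om)^2)<=C^2"
 proof (rule AE_I2)
 fix om assume "om : space M"
 from power_mono[OF bd[OF this],of 2] show "norm ((S om)^2)<=C^2" by simp
 qed
 qed measurable
 have iv:"integrable M (%om. (S om-?m)^2)"
 proof -
 have "integrable M (%om. (S om)^2+?m^2-2 * S om*?m)" using iS i2 by auto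
 thus ?thesis by (simp add:power2_diff)
 qed
 have ie:"integrable M (%om. cis (th*(S om-?m)))"
 by (rule integrable_const_bound[where B = 1]) (auto simp:cis_conv_exp)
 have "1-th^2 * variance S/2 = (LINT om|M. 1-th^2/2*(S om-?m)^2)"
 using iv prob_space by simp
 also have "...<=(LINT om|M. Re (cis (th*(S om-?m))))"
 proof (rule integral_mono)
 show "integrable M (%om. Re (cis (th*(S om-?m))))" using ie by (rule integrable_Re)
 show "1-th^2/2*(S om-?m)^2<=Re (cis (th*(S om-?m)))" for om
 using chord_sq_upper[of "th*(S om-?m)"] by (simp add:power_mult_distrib)
 qed (use iv in auto)
 also have "... = Re (LINT om|M. cis (th*(S om-?m)))" by (rule integral_Re[OF ie])
 also have "...<=cmod (LINT om|M. cis (th*(S om-?m)))" by (rule complex_Re_le_cmod)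
 also have "(LINT om|M. cis (th*(S om-?m))) = (LINT om|M. cis (- th*?m) * exp (\<i> * of_real th * of_real (S om)))"
 proof (intro LINT_cong)
 fix om
 have "cis (th*(S om-?m)) = cis (- th*?m) * cis (th * S om)" by (simp add:cis_mult algebra_simps)
 thus "cis (th*(S om-?m)) = cis (- th*?m) * exp (\<i> * of_real th * of_real (S om))"
 by (simp add:cis_conv_exp mult.assoc)
 qed
 also have "cmod ... = cmod (LINT om|M. exp (\<i> * of_real th * of_real (S om)))"
 unfolding integral_mult_right_zero norm_mult by simp
 finally show ?thesis .
qed

lemma (in elliptic_functional) W_of_real:
 "W k n (of_real xi :: complex) x = of_real (W k n xi x)"
proof (induction k arbitrary: n x)
 case (Suc k)
 have "W (Suc k) n (of_real xi :: complex) x = (LINT y|K n x. of_real (exp (xi * f n x y) * W k (Suc n) xi y))"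
 by (simp add:Suc.IH flip: exp_of_real)
 also have "... = of_real (LINT y|K n x. exp (xi * f n x y) * W k (Suc n) xi y)" by (rule integral_complex_of_real)
 finally show ?case by simp
qed simp

context elliptic_process
begin

lemma Z_eq_integral_W:"Z N xi = (LINT om|M. W N 0 xi (X 0 om))"
proof -
 have "complex_of_real (Z N xi) = (LINT om|M. exp (of_real xi * of_real (S N om)))"
 unfolding Z_def by (simp flip: integral_complex_of_real exp_of_real)
 also have "... = of_real (LINT om|M. W N 0 xi (X 0 om))"
 unfolding expectation_exp_S W_of_real by (rule integral_complex_of_real)
 finally show ?thesis by (simp only: of_real_eq_iff)
qed

lemma integrable_W:"integrable M (%om. W N 0 w (X 0 om))"
 for w ::"'b::{real_normed_field,banach,second_countable_topology}"
 by (rule integrable_const_bound[where B = "exp (norm w * L) ^ N"]) (auto intro!:norm_W_le)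

lemma W_pos:"x : space (B 0) ==> 0 < W N 0 (xi::real) x"
 using hfun_pos[of x 0 N xi] by (simp add:hfun_def)

lemma Z_harnack:
 assumes R:"abs xi<=R" and x:"x : space (B 0)"
 shows "W N 0 xi x<=harnack R * Z N xi" "Z N xi<=harnack R * W N 0 xi x"
proof -
 have "(LINT om|M. W N 0 xi x)<=(LINT om|M. harnack R * W N 0 xi (X 0 om))"
 using hfun_harnack[OF R x,of _ N] integrable_W by (intro integral_mono) (auto simp:hfun_def)
 thus "W N 0 xi x<=harnack R * Z N xi" using prob_space by (simp add:Z_eq_integral_W)
 have "Z N xi<=(LINT om|M. harnack R * W N 0 xi x)"
 unfolding Z_eq_integral_W
 using hfun_harnack[OF R _ x,of _ N] integrable_W by (intro integral_mono) (auto simp:hfun_def)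
 thus "Z N xi<=harnack R * W N 0 xi x" using prob_space by simp
qed

text \<open>For small tilts the initial law and any starting point give nearly the same moment
  generating function, uniformly in \<open>N\<close>; hence the limit 1 of \<open>rho\<close> at
  0.\<close>

lemma W_close_to_Z:
 assumes be:"0 < be" "be<=ep/4" and xi:"exp (2 * L * abs xi)-1<=ep * be/6" and x:"x : space (B 0)"
 shows "abs (Z N xi-W N 0 xi x)<=be * W N 0 xi x"
proof -
 have "Z N xi-W N 0 xi x = (LINT om|M. W N 0 xi (X 0 om)-W N 0 xi x)"
 unfolding Z_eq_integral_W using integrable_W[of N xi] prob_space by simp
 also have "norm ...<=be * W N 0 xi x"
 proof (rule norm_integral_le_bound)
 fix om assume "om : space M"
 hence "norm (W N 0 xi (X 0 om)-W N 0 xi x)<=be * norm (W N 0 xi x)"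
 using W_relative_oscillation[OF be,of xi "X 0 om" 0 x N] xi x by simp
 thus "norm (W N 0 xi (X 0 om)-W N 0 xi x)<=be * W N 0 xi x"
 using W_pos[OF x,of N xi] by simp
 qed
 finally show ?thesis by simp
qed

definition Zc ::"nat => complex => complex" where
 "Zc N w = (LINT om|M. exp (w * of_real (S N om)))"

lemma Zc_of_real:"Zc N (of_real xi) = of_real (Z N xi)"
 unfolding Zc_def Z_def by (simp flip: integral_complex_of_real exp_of_real)

text \<open>The characteristic function from a point and that of the initial law agree near 0 up to
  a small relative error. It lets the expansion for the initial law serve every starting point and
  keeps \<open>Zc\<close> away from 0.\<close>

lemma tiltW_close_to_Zc:
 assumes R:"abs xi<=R" and be:"0 < be" "be<=tilt_eps R/4"
 and ze:"exp (2 * L * norm ze)-1<=tilt_eps R * be/6" and x:"x : space (B 0)"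
 shows "cmod (Zc N (of_real xi+ze)/of_real (Z N xi)-tiltW N xi ze x)<=be * cmod (tiltW N xi ze x)"
proof -
 let ?w = "%om. W N 0 xi (X 0 om)" and ?t = "%om. tiltW N xi ze (X 0 om)" and ?c = "tiltW N xi ze x"
 have eq:"W N 0 (of_real xi+ze) (X 0 om) = of_real (?w om)*?t om" if "om : space M" for om
 using W_pos[of "X 0 om" N xi] that by (simp add:tiltW_def)
 have Zc:"Zc N (of_real xi+ze) = (LINT om|M. of_real (?w om)*?t om)"
 unfolding Zc_def expectation_exp_S by (intro LINT_cong eq)
 have i1:"integrable M (%om. of_real (?w om)*?t om)"
 proof -
 have "integrable M (%om. W N 0 (of_real xi+ze) (X 0 om))" by (rule integrable_W)
 moreover have "integrable M (%om. W N 0 (of_real xi+ze) (X 0 om)) = integrable M (%om. of_real (?w om)*?t om)"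
 by (intro LINT_integrable_cong refl eq)
 ultimately show ?thesis by (simp only:)
 qed
 have i2:"integrable M (%om. of_real (?w om)*?c)"
 using integrable_W[of N xi] by (intro integrable_mult_left integrable_of_real)
 have "Zc N (of_real xi+ze)-of_real (Z N xi)*?c = (LINT om|M. of_real (?w om)*(?t om-?c))"
 proof -
 have "of_real (Z N xi)*?c = (LINT om|M. of_real (?w om)*?c)"
 unfolding Z_eq_integral_W integral_mult_left_zero by (simp flip: integral_complex_of_real)
 thus ?thesis unfolding Zc right_diff_distrib using i1 i2 by simp
 qed
 hence "cmod (Zc N (of_real xi+ze)-of_real (Z N xi)*?c)<=(LINT om|M. cmod (of_real (?w om)*(?t om-?c)))"
 by (simp only: integral_norm_bound)
 also have "...<=(LINT om|M. ?w om*(be * cmod ?c))"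
 proof (rule integral_mono_AE')
 show "integrable M (%om. ?w om*(be * cmod ?c))" using integrable_W[of N xi] by auto
 have le:"cmod (of_real (?w om)*(?t om-?c))<=?w om*(be * cmod ?c)" if "om : space M" for om
 using tiltW_relative_oscillation(2)[OF R be ze X_space[OF that] x,of N] W_pos[OF X_space[OF that],of N xi]
 by (simp add:norm_mult)
 show "AE om in M. cmod (of_real (?w om)*(?t om-?c))<=?w om*(be * cmod ?c)"
 using le by (intro AE_I2)
 show "AE om in M. 0<=?w om*(be * cmod ?c)"
 by (intro AE_I2 order_trans[OF norm_ge_zero le])
 qed
 also have "... = Z N xi*(be * cmod ?c)" by (simp add:Z_eq_integral_W)
 finally have le:"cmod (Zc N (of_real xi+ze)-of_real (Z N xi)*?c)<=Z N xi*(be * cmod ?c)" .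
 have "Zc N (of_real xi+ze)/of_real (Z N xi)-?c = (Zc N (of_real xi+ze)-of_real (Z N xi)*?c)/of_real (Z N xi)"
 using Z_pos[of N xi] by (simp add:diff_divide_distrib)
 hence "cmod (Zc N (of_real xi+ze)/of_real (Z N xi)-?c) = cmod (Zc N (of_real xi+ze)-of_real (Z N xi)*?c)/abs (Z N xi)"
 by (simp only: norm_divide norm_of_real)
 moreover have "...<=be * cmod ?c"
 using Z_pos[of N xi] le by (simp add:pos_divide_le_eq mult_ac)
 ultimately show ?thesis by (simp only:)
qed

definition decay ::"real => real" where
 "decay R = (tilt_eps R)^2/24*(tilt_const R)^2"

lemma decay_pos:"0<=R ==> 0 < decay R"
 using harnack_ge_1[of R] eps by (simp add:decay_def tilt_eps_def tilt_const_def)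

lemma norm_Zc_le:
 assumes R:"abs xi<=R"
 shows "cmod (Zc N (of_real xi+\<i> * of_real th))<=Z N xi * exp (- decay R * Dsum N th)"
proof -
 have "cmod (Zc N (of_real xi+\<i> * of_real th))<=(LINT om|M. cmod (W N 0 (of_real xi+\<i> * of_real th) (X 0 om)))"
 unfolding Zc_def expectation_exp_S by (rule integral_norm_bound)
 also have "...<=(LINT om|M. W N 0 xi (X 0 om) * exp (- decay R * Dsum N th))"
 using norm_W_tilt_le[OF R] integrable_W[of N xi] integrable_norm[OF integrable_W[of N "of_real xi+\<i> * of_real th"]]
 by (intro integral_mono) (auto simp:decay_def)
 also have "... = Z N xi * exp (- decay R * Dsum N th)" by (simp add:Z_eq_integral_W)
 finally show ?thesis .
qed

definition kappa2 ::"nat => real => real" where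
 "kappa2 N xi = prob_space.variance (Mtilt N xi) (S N)"

lemma integrable_Mtilt_bounded:
 fixes u ::"'w => 'b::{banach,second_countable_topology}"
 assumes "u : bm M" "!!om. om : space M ==> norm (u om)<=C"
 shows "integrable (Mtilt N xi) u"
proof -
 interpret T: prob_space "Mtilt N xi" by (rule prob_space_Mtilt)
 show ?thesis by (rule T.integrable_const_bound[where B = C]) (use assms in auto)
qed

lemma integrable_S_Mtilt:"integrable (Mtilt N xi) (S N)" "integrable (Mtilt N xi) (%om. (S N om)^2)"
proof -
 show "integrable (Mtilt N xi) (S N)" using abs_S_le by (intro integrable_Mtilt_bounded) auto
 have "norm ((S N om)^2)<=(real N * L)^2" for om using power_mono[OF abs_S_le[of N om],of 2] by simp
 thus "integrable (Mtilt N xi) (%om. (S N om)^2)" by (intro integrable_Mtilt_bounded) auto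
qed

text \<open>At a small angle the residuals are at most \<open>6 * L\<close>, so no rounding is
  necessary and the correction is 0. The remainder is then the sum itself, and \<open>9 * L\<close>
  is \<open>5 * L+2*(2 * L)\<close>.\<close>

lemma kappa2_upper:
 assumes R:"abs xi<=R" and th:"0 < th" "6 * L * th<=1"
 shows "kappa2 N xi<=var_const R th*(2/ep ^ 3 * Dsum N th)+2*(9 * L)^2"
proof -
 obtain r where r:"!!n. r n : space (B n)"
 and G:"(\<Sum>n\<in>{3..N-3}. grad_err n th (r n) (r (Suc n)))<=ennreal (2/ep ^ 3 * Dsum N th)"
 using reference_path_finite[of th N] th by auto
 have res:"abs (th*(residual n th (r n) (r (Suc n)) x y-0))<=pi"
 if "x : space (B (Suc2 n))" "y : space (B (Suc3 n))" for n x y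
 proof -
 have "abs (residual n th (r n) (r (Suc n)) x y)<=6 * L"
 unfolding residual_def
 using f_bound[of "Suc2 n" x y] f_bound[of n "r n" "r (Suc n)"]
 abs_pot_le_small[OF th r[of n] that(1)] abs_pot_le_small[OF th r[of "Suc n"] that(2)] by linarith
 hence "th * abs (residual n th (r n) (r (Suc n)) x y)<=th*(6 * L)" using th by (intro mult_left_mono) auto
 also have "...<=1" using th by (simp add:mult_ac)
 finally show ?thesis using th pi_gt3 by (simp add:abs_mult)
 qed
 obtain c where "(LINT om|Mtilt N xi. ((\<Sum>m<N. f m (X m om) (X (Suc m) om)-0)-c)^2)
<=var_const R th*(2/ep ^ 3 * Dsum N th)+2*(5 * L+2*(2 * L))^2"
 using second_moment_remainder[OF R th(1) r G,of "%_ _ _. 0" "2 * L"] eps res abs_pot_le_small[OF th r] by auto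
 hence c:"(LINT om|Mtilt N xi. (S N om-c)^2)<=var_const R th*(2/ep ^ 3 * Dsum N th)+2*(9 * L)^2"
 by (simp add:S_def)
 thus ?thesis
 unfolding kappa2_def
 using prob_space.variance_le_second_moment[OF prob_space_Mtilt integrable_S_Mtilt,of N xi c] by linarith
qed

lemma integral_exp_Mtilt:
 "(LINT om|Mtilt N xi. exp (w * of_real (S N om))) = Zc N (of_real xi+w)/of_real (Z N xi)"
proof -
 have "(LINT om|Mtilt N xi. exp (w * of_real (S N om))) = (1/Z N xi) *\<^sub>R (LINT om|M. exp (xi * S N om) *\<^sub>R exp (w * of_real (S N om)))"
 by (rule integral_Mtilt) measurable
 also have "(LINT om|M. exp (xi * S N om) *\<^sub>R exp (w * of_real (S N om))) = Zc N (of_real xi+w)"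
 unfolding Zc_def
 proof (intro LINT_cong)
 fix om
 have "of_real (exp (xi * S N om)) = exp (complex_of_real xi * of_real (S N om))"
 by (metis exp_of_real of_real_mult)
 thus "exp (xi * S N om) *\<^sub>R exp (w * of_real (S N om)) = exp ((of_real xi+w) * of_real (S N om))"
 by (simp only: scaleR_conv_of_real distrib_right exp_add)
 qed
 finally show ?thesis by (simp add:scaleR_conv_of_real)
qed

text \<open>A small variance would keep the characteristic function near 1, whereas the contraction
  makes it small. Comparing both bounds at a sufficiently small angle \<open>s\<close> gives the
  claim.\<close>

lemma kappa2_lower:
 assumes R:"abs xi<=R" and th:"0 < th" "6 * L * th<=1"
 shows "decay R/(2 * th^2) * Dsum N th<=kappa2 N xi"
proof -
 interpret T: prob_space "Mtilt N xi" by (rule prob_space_Mtilt)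
 have R0:"0<=R" using R by linarith
 define a where "a = decay R * Dsum N th/(2 * th^2)"
 have a:"0<=a" unfolding a_def using decay_pos[OF R0] by simp
 \<comment> \<open>The choice ensures \<open>a * s^2<=1\<close>, where \<open>exp (- t)\<close> lies
   below \<open>1-t/2\<close>, and \<open>s<=th\<close>, so that \<open>Dsum_scale\<close>
   applies.\<close>
 define s where "s = min th (1/sqrt (a+1))"
 have s:"0 < s" "s<=th" using th a by (auto simp:s_def)
 have "s^2<=(1/sqrt (a+1))^2" using s by (intro power_mono) (auto simp:s_def)
 hence as1:"a * s^2<=1"
 proof -
 assume le:"s^2<=(1/sqrt (a+1))^2"
 have "a * s^2<=a*(1/(a+1))" using le a by (intro mult_left_mono) (simp_all add:power_divide)
 also have "...<=1" using a by (simp add:field_simps)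
 finally show ?thesis .
 qed
 have "1-s^2 * kappa2 N xi/2<=cmod (LINT om|Mtilt N xi. exp (\<i> * of_real s * of_real (S N om)))"
 unfolding kappa2_def by (rule T.norm_char_ge[where C = "real N * L"]) (use abs_S_le in auto)
 also have "... = cmod (Zc N (of_real xi+\<i> * of_real s))/Z N xi"
 unfolding integral_exp_Mtilt using Z_pos[of N xi] by (simp add:norm_divide)
 also have "...<=exp (- decay R * Dsum N s)"
 using norm_Zc_le[OF R,of N s] Z_pos[of N xi] by (simp add:field_simps)
 also have "...<=exp (- (a * s^2))"
 proof -
 have "(s/th)^2/2 * Dsum N th<=Dsum N s" using s by (intro Dsum_scale th) auto
 hence "decay R*((s/th)^2/2 * Dsum N th)<=decay R * Dsum N s"
 using decay_pos[OF R0] by (intro mult_left_mono) auto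
 thus ?thesis unfolding a_def by (simp add:power_divide mult_ac)
 qed
 also have "exp (- (a * s^2))<=1-a * s^2/2"
 proof -
 have "exp (- t)<=1-t/2" if "0<=t" "t<=1" for t :: real
 proof -
 have "1/exp t<=1/(1+t)" using that exp_ge_add_one_self[of t] by (intro divide_left_mono) auto
 also have "1/(1+t)<=1-t/2"
 proof -
 have "t * t<=t" using that mult_left_le[of t t] by simp
 thus ?thesis using that by (simp add:field_simps)
 qed
 finally show ?thesis by (simp add:exp_minus inverse_eq_divide)
 qed
 from this[of "a * s^2"] show ?thesis using as1 a by simp
 qed
 finally have "s^2 * a<=s^2 * kappa2 N xi" by (simp add:algebra_simps)
 hence "a<=kappa2 N xi" using s by simp
 thus ?thesis by (simp add:a_def)
qed

text \<open>If \<open>Dsum N th\<close> stays bounded, the residuals along one infinite reference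
  path are, in mean square, close to multiples of \<open>2 pi/th\<close>. Rounding them gives
  \<open>g\<close>, which does not depend on \<open>N\<close>; the sum of \<open>f-g\<close> has
  bounded second moments about suitable centres, which is the source of center-tightness.\<close>

lemma lattice_decomposition:
 assumes th:"0 < th" and D:"!!N. Dsum N th<=C"
 obtains g c C' where "!!n. (%(x,y). g n x y) : bm (B n \<Otimes>\<^sub>M B (Suc n))"
 "!!n x y. \<exists>k::int. g n x y = 2 * pi/th * of_int k" "!!n x y. abs (g n x y)<=2 * L+3 * pi/th"
 "!!N. (LINT om|M. ((\<Sum>m<N. f m (X m om) (X (Suc m) om)-g m (X m om) (X (Suc m) om))-c N)^2)<=C'"
proof -
 obtain r where r:"!!n. r n : space (B n)"
 and G:"!!N. (\<Sum>n\<in>{3..N-3}. grad_err n th (r n) (r (Suc n)))<=ennreal (2/ep ^ 3 * C)"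
 using reference_path_infinite[OF less_imp_neq[OF th,symmetric] D] by blast
 have [measurable]:"r n : space (B n)" for n by (rule r)
 define u where "u n x y = residual (n-2) th (r (n-2)) (r (n-1)) x y" for n x y
 \<comment> \<open>The floor with the shift \<open>1/2\<close> rounds \<open>th * u n x y\<close> to
   the nearest multiple of \<open>2 pi\<close>, so the rounding error is at most \<open>pi\<close>
   and has the same cosine.\<close>
 define g where "g n x y = (if 5<=n then 2 * pi/th * of_int \<lfloor>th * u n x y/(2 * pi)+1/2\<rfloor> else 0)" for n x y
 have C0:"0<=C" using D[of 0] Dsum_nonneg order_trans by blast
 have g_meas:"(%(x,y). g n x y) : bm (B n \<Otimes>\<^sub>M B (Suc n))" for n
 proof (cases "5<=n")
 case True
 define k where "k = n-2"
 have n:"n = Suc2 k" using True unfolding k_def by arith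
 have "g n x y = 2 * pi/th * of_int \<lfloor>th * residual k th (r k) (r (Suc k)) x y/(2 * pi)+1/2\<rfloor>" for x y
 unfolding g_def u_def using True by (simp add:n)
 thus ?thesis unfolding n by simp
 next
 case False
 thus ?thesis by (simp add:g_def)
 qed
 have rnd:"abs (th*(w-2 * pi/th * of_int \<lfloor>th * w/(2 * pi)+1/2\<rfloor>))<=pi"
 "cos (th*(w-2 * pi/th * of_int \<lfloor>th * w/(2 * pi)+1/2\<rfloor>)) = cos (th * w)" for w
 proof -
 define k where "k = \<lfloor>th * w/(2 * pi)+1/2\<rfloor>"
 have eq:"th*(w-2 * pi/th * of_int k) = th * w-2 * pi * of_int k" using th by (simp add:algebra_simps)
 have "of_int k<=th * w/(2 * pi)+1/2" "th * w/(2 * pi)+1/2 < of_int k+1"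
 unfolding k_def by linarith+
 hence "2 * pi * of_int k<=th * w+pi" "th * w+pi < 2 * pi*(of_int k+1)"
 by (auto simp:field_simps)
 thus "abs (th*(w-2 * pi/th * of_int \<lfloor>th * w/(2 * pi)+1/2\<rfloor>))<=pi"
 unfolding k_def[symmetric] eq by (simp add:abs_le_iff algebra_simps)
 show "cos (th*(w-2 * pi/th * of_int \<lfloor>th * w/(2 * pi)+1/2\<rfloor>)) = cos (th * w)"
 unfolding k_def[symmetric] eq unfolding cos_diff cos_int_2pin sin_int_2pin by simp
 qed
 have bound:"\<exists>c. (LINT om|M. ((\<Sum>m<N. f m (X m om) (X (Suc m) om)-g m (X m om) (X (Suc m) om))-c)^2)
<=var_const 0 th*(2/ep ^ 3 * C)+2*(5 * L+2*(pi/th))^2" for N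
 proof -
 \<comment> \<open>The tilted estimate at tilt 0, where the tilted measure is \<open>M\<close>
   itself.\<close>
 have "\<exists>c. (LINT om|Mtilt N 0. ((\<Sum>m<N. f m (X m om) (X (Suc m) om)-g m (X m om) (X (Suc m) om))-c)^2)
<=var_const 0 th*(2/ep ^ 3 * C)+2*(5 * L+2*(pi/th))^2"
 proof (rule second_moment_remainder[OF _ th r G])
 show "abs (th*(residual n th (r n) (r (Suc n)) x y-g (Suc2 n) x y))<=pi \<and>
 cos (th*(residual n th (r n) (r (Suc n)) x y-g (Suc2 n) x y)) = cos (th * residual n th (r n) (r (Suc n)) x y)"
 if "3<=n" for n x y
 using rnd[of "residual n th (r n) (r (Suc n)) x y"] that by (simp add:g_def u_def)
 show "abs (pot n th (r n) x)<=pi/th" for n x by (rule abs_pot_le[OF th])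
 qed (use g_meas C0 eps in \<open>auto simp:g_def\<close>)
 moreover have "(LINT om|Mtilt N 0. u om) = (LINT om|M. u om)" for u ::"'w => real"
 proof -
 have "Mtilt N 0 = M" unfolding Mtilt_def by (simp add:Z_def prob_space density_1)
 thus ?thesis by simp
 qed
 ultimately show ?thesis by simp
 qed
 hence "\<forall>N. \<exists>c. (LINT om|M. ((\<Sum>m<N. f m (X m om) (X (Suc m) om)-g m (X m om) (X (Suc m) om))-c)^2)
<=var_const 0 th*(2/ep ^ 3 * C)+2*(5 * L+2*(pi/th))^2" by blast
 from choice[OF this] obtain c where c:"!!N. (LINT om|M. ((\<Sum>m<N. f m (X m om) (X (Suc m) om)-g m (X m om) (X (Suc m) om))-c N)^2)
<=var_const 0 th*(2/ep ^ 3 * C)+2*(5 * L+2*(pi/th))^2" by blast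
 have "\<exists>k::int. g n x y = 2 * pi/th * of_int k" for n x y
 proof (cases "5<=n")
 case True
 thus ?thesis unfolding g_def by auto
 next
 case False
 thus ?thesis by (intro exI[of _ 0]) (simp add:g_def)
 qed
 moreover have "abs (g n x y)<=2 * L+3 * pi/th" for n x y
 proof (cases "5<=n")
 case True
 define k where "k = n-2"
 have n:"Suc2 k = n" using True unfolding k_def by arith
 have k:"n-1 = Suc k" using True unfolding k_def by arith
 have "abs (u n x y)<=L+pi/th+pi/th+L"
 unfolding u_def k k_def[symmetric] residual_def n
 using f_bound[of n x y] f_bound[of k "r k" "r (Suc k)"] abs_pot_le[OF th,of k "r k" x] abs_pot_le[OF th,of "Suc k" "r (Suc k)" y]
 unfolding abs_le_iff by linarith
 moreover have "abs (u n x y-g n x y)<=pi/th"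
 using rnd(1)[of "u n x y"] th True by (simp add:g_def abs_mult le_divide_eq mult.commute)
 moreover have "3 * pi/th = 3*(pi/th)" by simp
 ultimately show ?thesis unfolding abs_le_iff by linarith
 next
 case False
 thus ?thesis using L_pos th by (simp add:g_def)
 qed
 ultimately show ?thesis using that[OF g_meas _ _ c] by blast
qed

end

section \<open>Logarithms of nonvanishing holomorphic functions\<close>

text \<open>A one-sided bound on the real part bounds the modulus: the Moebius image
  \<open>h\<close> maps the disc into the unit disc and fixes 0, so the Schwarz lemma gives
  \<open>cmod (h w)<=1/2\<close> on the half disc; solving for \<open>g\<close> gives the
  claim.\<close>

lemma Borel_Caratheodory_half:
 assumes r:"0 < r" and hol:"g holomorphic_on ball 0 r" and g0:"g 0 = 0"
 and A:"0 < A" and Re:"!!z. norm z < r ==> Re (g z)<=A" and z:"norm z<=r/2"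
 shows "cmod (g z)<=4 * A"
proof -
 \<comment> \<open>With \<open>4 * A\<close> instead of the customary \<open>2 * A\<close> the
   values of \<open>h\<close> lie strictly inside the unit disc.\<close>
 define h where "h w = g (of_real r * w)/(of_real (4 * A)-g (of_real r * w))" for w :: complex
 have nz:"of_real (4 * A)-g (of_real r * w) ~= 0" if "norm w < 1" for w :: complex
 proof
 assume "of_real (4 * A)-g (of_real r * w) = 0"
 hence "g (of_real r * w) = of_real (4 * A)" by simp
 hence "Re (g (of_real r * w)) = 4 * A" by (simp only: Re_complex_of_real)
 moreover have "Re (g (of_real r * w))<=A" using that r by (intro Re) (simp add:norm_mult)
 ultimately show False using A by simp
 qed
 have hol_h:"h holomorphic_on ball 0 1"
 unfolding h_def using nz r
 by (intro holomorphic_intros holomorphic_on_compose_gen[OF _ hol,unfolded comp_def])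
 (auto simp:norm_mult)
 have h_less:"norm (h w) < 1" if w:"norm w < 1" for w
 proof -
 have ReA:"Re (g (of_real r * w))<=A" using w r by (intro Re) (simp add:norm_mult)
 have "(cmod (of_real (4 * A)-g (of_real r * w)))^2-(cmod (g (of_real r * w)))^2 = 16 * A^2-8 * A * Re (g (of_real r * w))"
 unfolding cmod_power2 by (simp add:power2_eq_square algebra_simps)
 moreover have "8 * A * Re (g (of_real r * w))<=8 * A * A" using ReA A by (intro mult_left_mono) auto
 moreover have "0 < A^2" using A by simp
 ultimately have "(cmod (g (of_real r * w)))^2 < (cmod (of_real (4 * A)-g (of_real r * w)))^2" by (simp add:power2_eq_square)
 hence "cmod (g (of_real r * w)) < cmod (of_real (4 * A)-g (of_real r * w))" by (rule power2_less_imp_less) simp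
 thus ?thesis unfolding h_def norm_divide by (simp add:divide_less_eq)
 qed
 define w where "w = z/of_real r"
 have w:"norm w<=1/2" using z r by (simp add:w_def norm_divide field_simps)
 have hw:"norm (h w)<=1/2"
 using Schwarz_Lemma(1)[OF hol_h _ h_less,of w] w g0 by (simp add:h_def)
 have gz:"g z = of_real (4 * A) * h w-h w * g z"
 proof -
 have "of_real r * w = z" using r by (simp add:w_def)
 hence "h w*(of_real (4 * A)-g z) = g z" using nz[of w] w unfolding h_def by simp
 thus ?thesis by (simp add:algebra_simps)
 qed
 have "cmod (g z)<=cmod (of_real (4 * A) * h w)+cmod (h w * g z)"
 by (subst gz) (rule norm_triangle_ineq4)
 also have "... = 4 * A * cmod (h w)+cmod (h w) * cmod (g z)" using A by (simp add:norm_mult)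
 also have "...<=4 * A*(1/2)+(1/2) * cmod (g z)"
 using hw A by (intro add_mono mult_left_mono mult_right_mono) auto
 finally show ?thesis by simp
qed

text \<open>The modulus bound on \<open>G\<close> bounds the real part of its logarithm, so the
  previous lemma and Cauchy's inequality control the third derivative.\<close>

lemma holomorphic_log_third_order:
 fixes G ::"complex => complex"
 assumes r:"0 < r" and hol:"G holomorphic_on ball 0 r" and nz:"!!z. norm z < r ==> G z ~= 0"
 and G0:"G 0 = 1" and A:"0 < A" and le:"!!z. norm z < r ==> cmod (G z)<=exp A"
 obtains g where "g holomorphic_on ball 0 r" "!!z. norm z < r ==> exp (g z) = G z" "g 0 = 0"
 "!!z. norm z<=r/4 ==> cmod ((deriv ^^ 3) g z)<=1536 * A/r ^ 3"
proof -
 obtain g0 where g0:"g0 holomorphic_on ball 0 r" "!!z. z : ball 0 r ==> exp (g0 z) = G z"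
 using holomorphic_logarithm_exists[of "ball 0 r" G 0] hol nz r by (auto simp:dist_norm)
 define g where "g z = g0 z-g0 0" for z
 have holg:"g holomorphic_on ball 0 r" unfolding g_def by (intro holomorphic_intros g0)
 have eg:"exp (g z) = G z" if "norm z < r" for z
 using g0(2)[of z] g0(2)[of 0] that r G0 by (simp add:g_def exp_diff)
 have g_0:"g 0 = 0" by (simp add:g_def)
 have Re:"Re (g z)<=A" if "norm z < r" for z
 proof -
 have "exp (Re (g z))<=exp A" using le[OF that] eg[OF that] by (metis norm_exp_eq_Re)
 thus ?thesis by simp
 qed
 have bd:"cmod (g z)<=4 * A" if "norm z<=r/2" for z
 by (rule Borel_Caratheodory_half[OF r holg g_0 A Re that])
 have third:"cmod ((deriv ^^ 3) g z)<=1536 * A/r ^ 3" if z:"norm z<=r/4" for z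
 proof -
 have near:"norm w<=r/2" if "norm (z-w)<=r/4" for w
 using z that norm_triangle_sub[of w z] by (simp add:norm_minus_commute)
 \<comment> \<open>Circles of radius \<open>r/4\<close> around points of norm at most
   \<open>r/4\<close> stay where \<open>g\<close> is bounded by \<open>4 * A\<close>; the constant
   is \<open>6 * 4 * 64\<close>.\<close>
 have "cmod ((deriv ^^ 3) g z)<=(fact 3)*(4 * A)/(r/4) ^ 3"
 proof (rule Cauchy_inequality)
 show "g holomorphic_on ball z (r/4)"
 proof (rule holomorphic_on_subset[OF holg],rule subsetI)
 fix w assume "w : ball z (r/4)"
 thus "w : ball 0 r" using near[of w] r by (simp add:dist_norm)
 qed
 have "continuous_on (ball 0 r) g" by (rule holomorphic_on_imp_continuous_on[OF holg])
 thus "continuous_on (cball z (r/4)) g"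
 proof (rule continuous_on_subset,intro subsetI)
 fix w assume "w : cball z (r/4)"
 thus "w : ball 0 r" using near[of w] r by (simp add:dist_norm)
 qed
 show "norm (g w)<=4 * A" if "norm (z-w) = r/4" for w
 using that by (intro bd near) simp
 qed (use r in simp)
 also have "... = 1536 * A/r ^ 3" by (simp add:fact_numeral power_divide)
 finally show ?thesis .
 qed
 show ?thesis by (rule that[OF holg eg g_0 third])
qed

lemma holomorphic_third_order_bounds:
 fixes g ::"complex => complex"
 assumes r:"0 < r" and hol:"g holomorphic_on ball 0 r"
 and B:"!!z. norm z<=r/4 ==> cmod ((deriv ^^ 3) g z)<=B" and z:"norm z<=r/4"
 shows "cmod (g z-(g 0+deriv g 0 * z+deriv (deriv g) 0 * z^2/2))<=B * cmod z ^ 3"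
 and "cmod (deriv (deriv g) z-deriv (deriv g) 0)<=B * cmod z"
proof -
 have d:"((deriv ^^ i) g has_field_derivative (deriv ^^ Suc i) g w) (at w within T)" if "norm w<=r/4" for i w T
 proof -
 have "(deriv ^^ i) g holomorphic_on ball 0 r" by (intro holomorphic_intros hol) auto
 thus ?thesis using that r by (auto intro!:holomorphic_derivI[of _ "ball 0 r"])
 qed
 have mem:"(0::complex) : cball 0 (r/4)" "z : cball 0 (r/4)" using r z by auto
 have "cmod ((deriv ^^ 0) g z-(\<Sum>i\<le>2. (deriv ^^ i) g 0*(z-0) ^ i/fact i))<=B * cmod (z-0) ^ Suc 2/fact 2"
 by (rule complex_Taylor[where S = "cball 0 (r/4)"]) (use d B mem in \<open>auto simp:numeral_3_eq_3 numeral_2_eq_2\<close>)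
 also have "(\<Sum>i\<le>2. (deriv ^^ i) g 0*(z-0) ^ i/fact i) = g 0+deriv g 0 * z+deriv (deriv g) 0 * z^2/2"
 by (simp add:numeral_2_eq_2)
 also have "B * cmod (z-0) ^ Suc 2/fact 2<=B * cmod z ^ 3"
 proof -
 have "0<=B" using B[of 0] r norm_ge_zero order_trans by (metis norm_zero divide_nonneg_pos less_imp_le zero_less_numeral)
 thus ?thesis by (simp add:numeral_3_eq_3 numeral_2_eq_2)
 qed
 finally show "cmod (g z-(g 0+deriv g 0 * z+deriv (deriv g) 0 * z^2/2))<=B * cmod z ^ 3" by simp
 have "cmod ((deriv ^^ 2) g z-(deriv ^^ 2) g 0)<=B * cmod (z-0)"
 by (rule field_differentiable_bound[where S = "cball 0 (r/4)" and f' = "(deriv ^^ 3) g"])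
 (use d[of _ 2] B mem in \<open>auto simp:numeral_3_eq_3 numeral_2_eq_2\<close>)
 thus "cmod (deriv (deriv g) z-deriv (deriv g) 0)<=B * cmod z" by (simp add:numeral_2_eq_2)
qed

text \<open>Differentiation under the integral by a quadratic Taylor estimate of the exponential.
  The weight \<open>u\<close> allows the result to be iterated.\<close>

lemma (in prob_space) has_field_derivative_mgf:
 fixes u ::"'a => complex" and S ::"'a => real"
 assumes u [measurable]:"u : bm M" and S [measurable]:"S : bm M"
 and ub:"!!x. x : space M ==> cmod (u x)<=D" and Sb:"!!x. x : space M ==> abs (S x)<=C"
 shows "((%w. LINT x|M. u x * exp (w * of_real (S x))) has_field_derivative
 (LINT x|M. u x * of_real (S x) * exp (w * of_real (S x)))) (at w)"
proof -
 obtain x0 where x0:"x0 : space M" using not_empty by auto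
 have D:"0<=D" and C:"0<=C" using ub[OF x0] Sb[OF x0] norm_ge_zero[of "u x0"] by linarith+
 have eb:"cmod (exp (w * of_real (S x)))<=exp (cmod w * C)" if "x : space M" for w x
 proof -
 have "cmod (exp (w * of_real (S x)))<=exp (cmod (w * of_real (S x)))" by (rule norm_exp)
 also have "...<=exp (cmod w * C)" using Sb[OF that] by (auto simp:norm_mult intro:mult_left_mono)
 finally show ?thesis .
 qed
 have i0:"integrable M (%x. u x * exp (w * of_real (S x)))" for w
 proof (rule integrable_const_bound)
 show "AE x in M. norm (u x * exp (w * of_real (S x)))<=D * exp (cmod w * C)"
 unfolding norm_mult using ub eb D by (intro AE_I2 mult_mono) auto
 qed measurable
 have i1:"integrable M (%x. u x * of_real (S x) * exp (w * of_real (S x)))" for w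
 proof (rule integrable_const_bound)
 show "AE x in M. norm (u x * of_real (S x) * exp (w * of_real (S x)))<=D * C * exp (cmod w * C)"
 unfolding norm_mult using ub eb D C Sb by (intro AE_I2 mult_mono) auto
 qed measurable
 let ?f = "%w. LINT x|M. u x * exp (w * of_real (S x))" and ?d = "LINT x|M. u x * of_real (S x) * exp (w * of_real (S x))"
 define B where "B = D * exp (cmod w * C)*(exp C * C^2)"
 have est:"cmod ((?f (w+h)-?f w)/h-?d)<=B * cmod h" if h:"h ~= 0" "cmod h<=1" for h
 proof -
 have "?f (w+h)-?f w-h*?d = (LINT x|M. u x * exp (w * of_real (S x))*(exp (h * of_real (S x))-1-h * of_real (S x)))"
 proof -
 have "?f (w+h)-?f w-h*?d = (LINT x|M. u x * exp ((w+h) * of_real (S x))-u x * exp (w * of_real (S x))-h*(u x * of_real (S x) * exp (w * of_real (S x))))"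
 using i0[of "w+h"] i0[of w] i1[of w] by simp
 also have "... = (LINT x|M. u x * exp (w * of_real (S x))*(exp (h * of_real (S x))-1-h * of_real (S x)))"
 by (intro LINT_cong) (simp add:distrib_right exp_add algebra_simps)
 finally show ?thesis .
 qed
 also have "cmod ...<=B*(cmod h)^2"
 proof (rule norm_integral_le_bound)
 fix x assume x:"x : space M"
 let ?z = "h * of_real (S x)"
 have zC:"cmod ?z<=cmod h * C" using Sb[OF x] by (auto simp:norm_mult intro:mult_left_mono)
 also have "...<=1 * C" using h C by (intro mult_right_mono) auto
 finally have zC1:"cmod ?z<=C" by simp
 have "cmod (exp ?z-(\<Sum>k\<le>1. ?z ^ k/fact k))<=exp (abs (Re ?z)) * cmod ?z ^ Suc 1/fact 1"
 by (rule Taylor_exp)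
 also have "(\<Sum>k\<le>1. ?z ^ k/fact k) = 1+?z" by simp
 also have "exp (abs (Re ?z)) * cmod ?z ^ Suc 1/fact 1<=exp C*(cmod h * C) ^ 2"
 using zC zC1 abs_Re_le_cmod[of ?z] unfolding fact_1 div_by_1 Suc_1 by (intro mult_mono power_mono) auto
 finally have "cmod (exp ?z-1-?z)<=exp C*(cmod h * C)^2" by (simp add:diff_diff_eq)
 hence "cmod (u x) * cmod (exp (w * of_real (S x))) * cmod (exp ?z-1-?z)<=D * exp (cmod w * C)*(exp C*(cmod h * C)^2)"
 using ub[OF x] eb[OF x,of w] D by (intro mult_mono) auto
 thus "cmod (u x * exp (w * of_real (S x))*(exp ?z-1-?z))<=B*(cmod h)^2"
 unfolding norm_mult B_def by (simp add:power_mult_distrib mult_ac)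
 qed
 finally have "cmod (?f (w+h)-?f w-h*?d)<=B*(cmod h)^2" .
 moreover have "(?f (w+h)-?f w)/h-?d = (?f (w+h)-?f w-h*?d)/h"
 using h by (simp add:diff_divide_distrib)
 ultimately show ?thesis using h by (simp add:norm_divide divide_le_eq power2_eq_square mult_ac)
 qed
 have "((%h. (?f (w+h)-?f w)/h-?d) \<longlongrightarrow> 0) (at 0)"
 proof (rule Lim_null_comparison)
 show "\<forall>\<^sub>F h in at 0. norm ((?f (w+h)-?f w)/h-?d)<=B * cmod h"
 unfolding eventually_at by (intro exI[of _ 1]) (auto intro:est)
 show "((%h. B * cmod h) \<longlongrightarrow> 0) (at 0)" by (intro tendsto_eq_intros refl) auto
 qed
 thus ?thesis unfolding DERIV_def by (simp add:LIM_zero_iff)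
qed

section \<open>From characteristic functions to local limits\<close>

lemma integrable_exp_neg_square:
 assumes c:"0 < c"
 shows "integrable lborel (%x::real. exp (- c * x^2))"
proof -
 let ?s = "1/sqrt (2 * c)"
 have s:"0 < ?s" using c by simp
 have "integrable lborel (%x. sqrt (2 * pi*?s^2) * normal_density 0 ?s x)"
 using s by (intro integrable_mult_right integrable_normal_density)
 also have "(%x. sqrt (2 * pi*?s^2) * normal_density 0 ?s x) = (%x. exp (- c * x^2))"
 proof
 fix x :: real
 have "sqrt (2 * pi*?s^2) ~= 0" using s by simp
 moreover have "(x-0)^2/(2*?s^2) = c * x^2" using c by (simp add:power_divide)
 ultimately show "sqrt (2 * pi*?s^2) * normal_density 0 ?s x = exp (- c * x^2)"
 unfolding normal_density_def minus_divide_left[symmetric] by simp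
 qed
 finally show ?thesis .
qed

lemma integral_exp_neg_half_square:"(LINT x|lborel. complex_of_real (exp (- x\<^sup>2/2))) = sqrt (2 * pi)"
proof -
 have "(LINT x|lborel. exp (- x\<^sup>2/2)) = (LINT x|lborel. sqrt (2 * pi) * normal_density 0 1 x)"
 by (intro LINT_cong) (simp add:normal_density_def)
 also have "... = sqrt (2 * pi)" using integral_normal_density[of 1 0] by simp
 finally show ?thesis by (simp only: integral_complex_of_real)
qed

text \<open>Abstract input of a local limit theorem: Gaussian convergence at scale
  \<open>1/sg n\<close> and quadratic decay on a fixed neighbourhood of 0. Negligibility of the
  remaining angles is assumed separately, since the lattice case has it on a bounded range
  only.\<close>

locale local_char_limit =
 fixes ph ::"nat => real => complex" and sg ::"nat => real" and de c :: real
 assumes phi_meas [measurable]:"!!n. ph n : bm borel"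
 and phi_le:"!!n th. cmod (ph n th)<=1"
 and sigma_pos:"!!n. 0 < sg n" and sigma_top:"filterlim sg at_top sequentially"
 and delta:"0 < de" and c:"0 < c"
 and central:"!!t. (%n. ph n (t/sg n)) ----> of_real (exp (- t\<^sup>2/2))"
 and near:"\<forall>\<^sub>F n in sequentially. \<forall>th. abs th<=de --> cmod (ph n th)<=exp (- c*(sg n * th)^2)"
begin

text \<open>Within \<open>de\<close> of 0 the substitution \<open>th = t/sg n\<close> and dominated
  convergence produce the Gaussian integral times \<open>h 0\<close>; outside, \<open>far\<close>
  makes the integral vanish after multiplication by \<open>sg n\<close>.\<close>

lemma limit_integral:
 fixes h ::"real => complex"
 assumes far:"(%n. sg n*(LINT th|lborel. indicator ({-T..T} - {-de..de}) th * cmod (ph n th))) ----> 0"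
 and h [measurable]:"h : bm borel" and hb:"!!th. cmod (h th)<=Ch"
 and h0:"!!th. T < abs th ==> h th = 0" and cont:"isCont h 0"
 shows "(%n. sg n*(LINT th|lborel. h th * ph n th)) ----> sqrt (2 * pi) * h 0"
proof -
 have Ch:"0<=Ch" using hb[of 0] norm_ge_zero order_trans by blast
 define I where "I n = (LINT th|lborel. indicator {-de..de} th *\<^sub>R (h th * ph n th))" for n
 define J where "J n = (LINT th|lborel. indicator ({-T..T} - {-de..de}) th *\<^sub>R (h th * ph n th))" for n
 have bd:"cmod (h th * ph n th)<=Ch" for th n
 unfolding norm_mult using mult_mono[OF hb[of th] phi_le[of n th]] Ch by simp
 have int:"integrable lborel (%th. indicator A th *\<^sub>R (h th * ph n th))"
 if A:"A : sets borel" "A \<subseteq> {-B..B}" for A B n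
 proof (rule integrableI_bounded_set_indicator)
 have "emeasure lborel A<=emeasure lborel {-B..B}" using A by (intro emeasure_mono) auto
 also have "... < \<infinity>" by (simp add:emeasure_lborel_Icc_eq)
 finally show "emeasure lborel A < \<infinity>" .
 show "AE th in lborel. th : A --> norm (h th * ph n th)<=Ch" using bd by auto
 qed (use A in auto)
 have split:"(LINT th|lborel. h th * ph n th) = I n+J n" for n
 proof -
 have "(LINT th|lborel. h th * ph n th)
 = (LINT th|lborel. indicator {-de..de} th *\<^sub>R (h th * ph n th)+indicator ({-T..T} - {-de..de}) th *\<^sub>R (h th * ph n th))"
 using h0 by (intro LINT_cong) (auto simp:indicator_def)
 also have "... = I n+J n"
 unfolding I_def J_def
 by (rule LINT_add[OF int[of _ de] int[of _ T]]) auto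
 finally show ?thesis .
 qed
 have J0:"(%n. sg n * J n) ----> 0"
 proof (rule Lim_null_comparison)
 show "(%n. Ch*(sg n*(LINT th|lborel. indicator ({-T..T} - {-de..de}) th * cmod (ph n th)))) ----> 0"
 using tendsto_mult_right_zero[OF far] .
 have "cmod (J n)<=Ch*(LINT th|lborel. indicator ({-T..T} - {-de..de}) th * cmod (ph n th))" for n
 proof -
 let ?A = "{-T..T} - {-de..de}"
 have i:"integrable lborel (%th. indicator ?A th * cmod (ph n th))"
 proof -
 have "integrable lborel (%th. indicator ?A th *\<^sub>R cmod (ph n th))"
 proof (rule integrableI_bounded_set_indicator[where B = 1])
 have "emeasure lborel ?A<=emeasure lborel {-T..T}" by (intro emeasure_mono) auto
 also have "... < \<infinity>" by (simp add:emeasure_lborel_Icc_eq)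
 finally show "emeasure lborel ?A < \<infinity>" .
 qed (use phi_le in auto)
 thus ?thesis by simp
 qed
 have "cmod (J n)<=(LINT th|lborel. cmod (indicator ?A th *\<^sub>R (h th * ph n th)))"
 unfolding J_def by (rule integral_norm_bound)
 also have "...<=(LINT th|lborel. Ch*(indicator ?A th * cmod (ph n th)))"
 proof (rule integral_mono)
 show "integrable lborel (%th. cmod (indicator ?A th *\<^sub>R (h th * ph n th)))"
 by (intro integrable_norm int[of _ T]) auto
 show "cmod (indicator ?A th *\<^sub>R (h th * ph n th))<=Ch*(indicator ?A th * cmod (ph n th))" for th
 using mult_right_mono[OF hb[of th],of "cmod (ph n th)"] by (auto simp:norm_mult indicator_def)
 qed (use i in auto)
 finally show ?thesis by simp
 qed
 thus "\<forall>\<^sub>F n in sequentially. norm (sg n * J n)<=Ch*(sg n*(LINT th|lborel. indicator ({-T..T} - {-de..de}) th * cmod (ph n th)))"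
 using sigma_pos by (intro always_eventually allI) (simp add:norm_mult less_imp_le mult.left_commute)
 qed
 have I_eq:"sg n * I n = (LINT t|lborel. indicator {-de..de} (t/sg n) *\<^sub>R (h (t/sg n) * ph n (t/sg n)))" for n
 unfolding I_def
 using sigma_pos[of n] by (subst lborel_integral_real_affine[of "1/sg n" _ 0]) (auto simp:scaleR_conv_of_real)
 obtain n0 where n0:"!!n th. n0<=n ==> abs th<=de ==> cmod (ph n th)<=exp (- c*(sg n * th)^2)"
 using near unfolding eventually_sequentially by blast
 have inv0:"(%n. t/sg n) ----> 0" for t
 using sigma_top by (intro real_tendsto_divide_at_top[OF tendsto_const])
 have "(%n. LINT t|lborel. indicator {-de..de} (t/sg (n+n0)) *\<^sub>R (h (t/sg (n+n0)) * ph (n+n0) (t/sg (n+n0))))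
 ----> (LINT t|lborel. h 0 * of_real (exp (- t\<^sup>2/2)))"
 proof (rule integral_dominated_convergence[where w = "%t. Ch * exp (- c * t^2)"])
 show "integrable lborel (%t. Ch * exp (- c * t^2))" using integrable_exp_neg_square[OF c] by simp
 show "AE t in lborel. (%n. indicator {-de..de} (t/sg (n+n0)) *\<^sub>R (h (t/sg (n+n0)) * ph (n+n0) (t/sg (n+n0))))
 ----> h 0 * of_real (exp (- t\<^sup>2/2))"
 proof (rule AE_I2)
 fix t
 have "(%n. h (t/sg n) * ph n (t/sg n)) ----> h 0 * of_real (exp (- t\<^sup>2/2))"
 by (intro tendsto_mult central isCont_tendsto_compose[OF cont inv0])
 moreover have "\<forall>\<^sub>F n in sequentially. h (t/sg n) * ph n (t/sg n) = indicator {-de..de} (t/sg n) *\<^sub>R (h (t/sg n) * ph n (t/sg n))"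
 proof -
 have "\<forall>\<^sub>F n in sequentially. dist (t/sg n) 0 < de" using inv0 delta by (rule tendstoD)
 thus ?thesis
 proof eventually_elim
 case (elim n)
 hence "t/sg n : {-de..de}"
 unfolding dist_real_def diff_0_right abs_less_iff atLeastAtMost_iff minus_le_iff[of de] by (meson less_imp_le)
 thus ?case by simp
 qed
 qed
 ultimately have "(%n. indicator {-de..de} (t/sg n) *\<^sub>R (h (t/sg n) * ph n (t/sg n))) ----> h 0 * of_real (exp (- t\<^sup>2/2))"
 by (rule Lim_transform_eventually)
 thus "(%n. indicator {-de..de} (t/sg (n+n0)) *\<^sub>R (h (t/sg (n+n0)) * ph (n+n0) (t/sg (n+n0))))
 ----> h 0 * of_real (exp (- t\<^sup>2/2))" by (rule LIMSEQ_ignore_initial_segment)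
 qed
 show "AE t in lborel. norm (indicator {-de..de} (t/sg (n+n0)) *\<^sub>R (h (t/sg (n+n0)) * ph (n+n0) (t/sg (n+n0))))<=Ch * exp (- c * t^2)" for n
 proof (rule AE_I2)
 fix t
 show "norm (indicator {-de..de} (t/sg (n+n0)) *\<^sub>R (h (t/sg (n+n0)) * ph (n+n0) (t/sg (n+n0))))<=Ch * exp (- c * t^2)"
 proof (cases "t/sg (n+n0) : {-de..de}")
 case True
 hence "abs (t/sg (n+n0))<=de" by (simp only: atLeastAtMost_iff abs_le_iff minus_le_iff)
 hence "cmod (ph (n+n0) (t/sg (n+n0)))<=exp (- c * t^2)"
 using n0[of "n+n0" "t/sg (n+n0)"] sigma_pos[of "n+n0"] by simp
 hence "cmod (h (t/sg (n+n0))) * cmod (ph (n+n0) (t/sg (n+n0)))<=Ch * exp (- c * t^2)"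
 using hb Ch by (intro mult_mono) auto
 with True show ?thesis by (simp add:norm_mult)
 next
 case False
 thus ?thesis using Ch by simp
 qed
 qed
 qed measurable
 also have "(LINT t|lborel. h 0 * of_real (exp (- t\<^sup>2/2))) = sqrt (2 * pi) * h 0"
 using integral_exp_neg_half_square by (simp only: integral_mult_right_zero mult.commute)
 finally have "(%n. sg (n+n0) * I (n+n0)) ----> sqrt (2 * pi) * h 0" unfolding I_eq .
 hence "(%n. sg n * I n) ----> sqrt (2 * pi) * h 0" by (rule LIMSEQ_offset)
 from tendsto_add[OF this J0] show ?thesis by (simp add:split distrib_left)
qed

end

section \<open>Fejer kernels and limits over intervals and lattices\<close>

definition tri ::"real => real" where
 "tri th = max 0 (1-abs th)"

definition fejer ::"real => real" where
 "fejer x = (sinc (x/2))^2"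

lemma tri_measurable [measurable]:"tri : bm borel"
 unfolding tri_def[abs_def] by measurable

lemma tri_bounds:"0<=tri th" "tri th<=1" "1<=abs th ==> tri th = 0"
 by (auto simp:tri_def)

lemma isCont_tri:"isCont tri x"
 unfolding tri_def[abs_def] by (intro continuous_intros)

lemma integrable_tri:"integrable lborel tri"
proof -
 have "integrable lborel (%x. indicator {-1..1::real} x *\<^sub>R tri x)"
 by (rule integrableI_bounded_set_indicator[where B = 1]) (auto simp:tri_bounds emeasure_lborel_Icc_eq)
 also have "(%x. indicator {-1..1::real} x *\<^sub>R tri x) = tri"
 by (auto simp:fun_eq_iff indicator_def tri_def)
 finally show ?thesis .
qed

lemma isCont_fejer:"isCont fejer x"
 unfolding fejer_def[abs_def] by (intro continuous_intros isCont_o2[OF _ isCont_sinc]) auto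

lemma fejer_measurable [measurable]:"fejer : bm borel"
 by (intro borel_measurable_continuous_onI continuous_at_imp_continuous_on ballI isCont_fejer)

lemma fejer_nonneg [simp]:"0<=fejer x"
 by (simp add:fejer_def)

lemma fejer_le:"fejer x<=1" "x^2 * fejer x<=4"
proof -
 have "abs (sinc t)<=1" for t
 proof (cases "t = 0")
 case False
 thus ?thesis using abs_sin_x_le_abs_x[of t] by (simp add:divide_le_eq)
 qed simp
 from power_mono[OF this[of "x/2"],of 2] show "fejer x<=1" by (simp add:fejer_def)
 show "x^2 * fejer x<=4"
 proof (cases "x = 0")
 case False
 hence "x^2 * fejer x = 4*(sin (x/2))^2" by (simp add:fejer_def power_divide)
 also have "...<=4*1" using abs_sin_le_one[of "x/2"] by (intro mult_left_mono) (simp_all add:abs_square_le_1)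
 finally show ?thesis by simp
 qed simp
qed

lemma fejer_pos:"abs x < 2 * pi ==> 0 < fejer x"
proof -
 assume x:"abs x < 2 * pi"
 show ?thesis
 proof (cases "x = 0")
 case False
 have "sin (x/2) ~= 0"
 proof (cases "0 < x")
 case True
 hence "0 < sin (x/2)" using x by (intro sin_gt_zero) auto
 thus ?thesis by simp
 next
 case n: False
 hence "0 < sin (- x/2)" using x False by (intro sin_gt_zero) auto
 thus ?thesis by simp
 qed
 thus ?thesis using False by (simp add:fejer_def)
 qed (simp add:fejer_def)
qed

lemma integrable_fejer:"integrable lborel fejer"
proof -
 have "set_integrable lborel (einterval (-\<infinity>) \<infinity>) (%x. inverse (1+x^2))"
 by (rule integrable_inverse_1_plus_square)
 hence "integrable lborel (%x::real. 5 * inverse (1+x^2))"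
 by (simp add:set_integrable_def einterval_eq)
 thus ?thesis
 proof (rule LINT_integrable_bound)
 show "AE x in lborel. norm (fejer x)<=norm (5 * inverse (1+x^2))"
 proof (rule AE_I2)
 fix x :: real
 have "(1+x^2) * fejer x<=5" using fejer_le[of x] by (simp add:distrib_right)
 moreover have p:"0 < 1+x^2" using zero_le_power2[of x] by linarith
 ultimately have "fejer x<=5 * inverse (1+x^2)" by (simp add:field_simps)
 thus "norm (fejer x)<=norm (5 * inverse (1+x^2))" using p by simp
 qed
 qed simp
qed

lemma tri_transform:"(LINT th|lborel. of_real (tri th) * iexp (th * x)) = of_real (fejer x)"
proof -
 let ?l = "%th. indicator {-1..0} th *\<^sub>R (of_real (1+th) * iexp (th * x))"
 let ?r = "%th. indicator {0..1} th *\<^sub>R (of_real (1-th) * iexp (th * x))"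
 have int:"integrable lborel ?l" "integrable lborel ?r"
 by (rule borel_integrable_compact; (intro continuous_intros)?; simp)+
 have "(LINT th|lborel. of_real (tri th) * iexp (th * x)) = (LINT th|lborel. ?l th+?r th)"
 proof (rule integral_cong_AE)
 show "AE th in lborel. of_real (tri th) * iexp (th * x) = ?l th+?r th"
 using AE_lborel_singleton[of 0] by eventually_elim (auto simp:tri_def indicator_def max_def)
 qed measurable
 also have "... = (LINT th|lborel. ?l th)+(LINT th|lborel. ?r th)"
 using int by (rule LINT_add)
 also have "(LINT th|lborel. ?l th) = (LINT th|lborel. ?l (0+- 1 * th))"
 by (subst lborel_integral_real_affine[of "- 1" _ 0]) auto
 also have "...+(LINT th|lborel. ?r th) = (LINT th|lborel. ?l (0+- 1 * th)+?r th)"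
 using int(2) lborel_integrable_real_affine[OF int(1),of "- 1" 0] by (intro LINT_add[symmetric]) auto
 also have "... = (LINT th|lborel. of_real ((2*(1-th) * cos (th * x)) * indicator {0..1} th))"
 proof (intro LINT_cong)
 fix th
 show "?l (0+- 1 * th)+?r th = of_real ((2*(1-th) * cos (th * x)) * indicator {0..1} th)"
 proof (cases "th : {0..1}")
 case True
 hence m:"0+- 1 * th : {-1..0}" by auto
 have "iexp ((0+- 1 * th) * x) = cis (- (th * x))" "iexp (th * x) = cis (th * x)"
 by (simp_all add:cis_conv_exp)
 thus ?thesis using True m by (auto simp:complex_eq_iff algebra_simps)
 next
 case False
 hence "0+- 1 * th \<notin> {-1..0}" by auto
 thus ?thesis using False by simp
 qed
 qed
 also have "... = of_real (LINT th|lborel. (2*(1-th) * cos (th * x)) * indicator {0..1} th)"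
 by (rule integral_complex_of_real)
 also have "(LINT th|lborel. (2*(1-th) * cos (th * x)) * indicator {0..1} th) = fejer x"
 proof (cases "x = 0")
 case True
 have "(LINT th|lborel. (2*(1-th) * cos (th * x)) * indicator {0..1} th) = (2*1-1^2)-(2*0-0^2)"
 by (rule integral_FTC_Icc_real[where F = "%th. 2 * th-th\<^sup>2"])
 (auto simp:True intro!:derivative_eq_intros continuous_intros)
 thus ?thesis using True by (simp add:fejer_def)
 next
 case False
 have "(LINT th|lborel. (2*(1-th) * cos (th * x)) * indicator {0..1} th)
 = (2*(1-1) * sin (1 * x)/x-2 * cos (1 * x)/x^2)-(2*(1-0) * sin (0 * x)/x-2 * cos (0 * x)/x^2)"
 by (rule integral_FTC_Icc_real[where F = "%th. 2*(1-th) * sin (th * x)/x-2 * cos (th * x)/x^2"])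
 (use False in \<open>auto intro!:derivative_eq_intros continuous_intros simp:field_simps power2_eq_square\<close>)
 also have "... = 2*(1-cos x)/x^2" using False by (simp add:field_simps)
 also have "... = fejer x"
 proof -
 have "cos x = 1-2*(sin (x/2))^2" using cos_double_sin[of "x/2"] by simp
 thus ?thesis using False by (simp add:fejer_def power_divide)
 qed
 finally show ?thesis .
 qed
 finally show ?thesis .
qed

text \<open>The Fourier transform of the Fejer kernel has compact support, so Fejer averages involve
  the characteristic function on a bounded set of angles only. No decay at infinity is required of
  it.\<close>

lemma (in real_distribution) integral_fejer_char:
 assumes a:"0 < a"
 shows "(LINT x|M. of_real (fejer (a * x)) * iexp (s * x)) = (LINT th|lborel. of_real (tri ((th-s)/a)/a) * char M th)"
proof -
 interpret pair_sigma_finite lborel M ..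
 define g where "g z = of_real (tri ((fst z-s)/a)/a) * iexp (fst z * snd z)" for z
 have gm [measurable]:"g : bm (lborel \<Otimes>\<^sub>M M)"
 unfolding g_def[abs_def] by measurable
 have ti:"integrable lborel (%th. tri ((th-s)/a)/a)"
 using lborel_integrable_real_affine[OF integrable_tri,of "1/a" "- s/a"] a
 by (simp add:diff_divide_distrib)
 have "integrable (lborel \<Otimes>\<^sub>M M) g"
 proof (rule Fubini_integrable[OF gm])
 show "integrable lborel (%x. LINT y|M. norm (g (x,y)))"
 proof -
 have "norm (g (x,y)) = tri ((x-s)/a)/a" for x y
 using a by (simp add:g_def norm_mult norm_divide tri_bounds del: of_real_mult)
 thus ?thesis using ti using prob_space by simp
 qed
 show "AE x in lborel. integrable M (%y. g (x,y))"
 by (simp add:g_def integrable_iexp)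
 qed
 hence "(LINT x|M. (LINT th|lborel. g (th,x))) = (LINT th|lborel. (LINT x|M. g (th,x)))"
 by (intro Fubini_integral) (simp add:case_prod_unfold)
 also have "... = (LINT th|lborel. of_real (tri ((th-s)/a)/a) * char M th)"
 by (simp only: g_def fst_conv snd_conv char_def integral_mult_right_zero)
 finally have eq:"(LINT x|M. (LINT th|lborel. g (th,x))) = (LINT th|lborel. of_real (tri ((th-s)/a)/a) * char M th)" .
 have "(LINT th|lborel. g (th,x)) = of_real (fejer (a * x)) * iexp (s * x)" for x
 proof -
 have "(LINT th|lborel. g (th,x)) = a *\<^sub>R (LINT t|lborel. g (s+a * t,x))"
 using a by (subst lborel_integral_real_affine[of a _ s]) auto
 also have "(LINT t|lborel. g (s+a * t,x)) = (LINT t|lborel. (iexp (s * x)/a)*(of_real (tri t) * iexp (t*(a * x))))"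
 using a by (intro LINT_cong) (simp add:g_def exp_add[symmetric] algebra_simps)
 also have "... = (iexp (s * x)/a) * of_real (fejer (a * x))"
 by (simp only: integral_mult_right_zero tri_transform)
 finally show ?thesis using a by (simp add:scaleR_conv_of_real)
 qed
 with eq show ?thesis by simp
qed

locale char_laws = local_char_limit "%n. char (D n)" sg de c
 for D ::"nat => real measure" and sg de c +
 assumes D:"!!n. real_distribution (D n)"
begin

lemma fejer_limit:
 assumes far:"(%n. sg n*(LINT th|lborel. indicator ({-(abs s+a)..abs s+a} - {-de..de}) th * cmod (char (D n) th))) ----> 0"
 and a:"0 < a"
 shows "(%n. sg n*(LINT x|D n. of_real (fejer (a * x)) * iexp (s * x))) ----> of_real (sqrt (2 * pi)*(tri (s/a)/a))"
proof -
 have "(%n. sg n*(LINT th|lborel. of_real (tri ((th-s)/a)/a) * char (D n) th)) ----> of_real (sqrt (2 * pi)) * of_real (tri ((0-s)/a)/a)"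
 proof (rule limit_integral[OF far])
 show "cmod (of_real (tri ((th-s)/a)/a))<=1/a" for th
 using a by (simp add:tri_bounds divide_right_mono norm_divide)
 show "of_real (tri ((th-s)/a)/a) = (0 :: complex)" if "abs s+a < abs th" for th
 proof -
 have "a<=abs (th-s)" using that by linarith
 thus ?thesis using a by (simp add:tri_bounds)
 qed
 show "isCont (%th. of_real (tri ((th-s)/a)/a) :: complex) 0"
 using a by (intro continuous_intros isCont_o2[OF _ isCont_tri]) auto
 qed measurable
 also have "tri ((0-s)/a) = tri (s/a)" by (simp add:tri_def)
 finally show ?thesis using real_distribution.integral_fejer_char[OF D a] by simp
qed

end

text \<open>Fourier inversion for the Fejer kernel, obtained by computing one limit in two ways: for
  normal laws with standard deviation \<open>Suc n\<close>, \<open>fejer_limit\<close> gives the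
  triangle function, while the flattening densities give the integral against Lebesgue
  measure.\<close>

lemma fejer_transform:
 assumes a:"0 < a"
 shows "integrable lborel (%x. fejer (a * x))"
 and "(LINT x|lborel. of_real (fejer (a * x)) * iexp (s * x)) = of_real (2 * pi/a * tri (s/a))"
proof -
 let ?h = "%x. complex_of_real (fejer (a * x)) * iexp (s * x)"
 show fi:"integrable lborel (%x. fejer (a * x))"
 using lborel_integrable_real_affine[OF integrable_fejer,of a 0] a by simp
 define sg where "sg n = real (Suc n)" for n
 define D where "D n = distr std_normal_distribution borel (%x. sg n * x)" for n
 have s0:"0 < sg n" for n by (simp add:sg_def)
 interpret Z: real_distribution std_normal_distribution by (rule real_dist_normal_dist)
 have RD:"real_distribution (D n)" for n
 unfolding D_def by (intro Z.real_distribution_distr) auto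
 have ch:"char (D n) th = of_real (exp (- ((sg n * th)^2)/2))" for n th
 proof -
 have "char (D n) th = (LINT x|std_normal_distribution. iexp (th*(sg n * x)))"
 unfolding char_def D_def by (subst integral_distr) auto
 also have "... = char std_normal_distribution (sg n * th)"
 unfolding char_def by (simp only: mult_ac)
 finally show ?thesis by (simp add:char_std_normal_distribution)
 qed
 have top:"filterlim sg at_top sequentially"
 unfolding sg_def by (rule filterlim_compose[OF filterlim_real_sequentially filterlim_Suc])
 interpret char_laws D sg "abs s+a" "1/2"
 proof (intro char_laws.intro local_char_limit.intro char_laws_axioms.intro)
 show "char (D n) : bm borel" "cmod (char (D n) th)<=1" for n th
 using real_distribution.char_measurable[OF RD] real_distribution.cmod_char_le_1[OF RD] by auto
 show "(%n. char (D n) (t/sg n)) ----> of_real (exp (- t\<^sup>2/2))" for t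
 using s0 by (simp add:ch less_imp_neq[symmetric])
 show "real_distribution (D n)" for n by (rule RD)
 qed (use s0 a top in \<open>auto simp:ch\<close>)
 have "(%n. sg n*(LINT x|D n. ?h x)) ----> of_real (sqrt (2 * pi)*(tri (s/a)/a))"
 by (rule fejer_limit) (use a in auto)
 also have "(%n. sg n*(LINT x|D n. ?h x))
 = (%n. (LINT x|lborel. of_real (std_normal_density (x/sg n))*?h x))"
 proof
 fix n
 have "(LINT x|D n. ?h x)
 = (LINT x|std_normal_distribution. of_real (fejer (a*(sg n * x))) * iexp (s*(sg n * x)))"
 unfolding D_def by (subst integral_distr) auto
 also have "... = (LINT x|lborel. std_normal_density x *\<^sub>R (of_real (fejer (a*(sg n * x))) * iexp (s*(sg n * x))))"
 by (rule integral_density) auto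
 finally show "sg n*(LINT x|D n. ?h x)
 = (LINT x|lborel. of_real (std_normal_density (x/sg n))*?h x)"
 using s0[of n] by (subst lborel_integral_real_affine[of "sg n" _ 0]) (auto simp:scaleR_conv_of_real)
 qed
 finally have 1:"(%n. LINT x|lborel. of_real (std_normal_density (x/sg n))*?h x)
 ----> of_real (sqrt (2 * pi)*(tri (s/a)/a))" .
 have "(%n. LINT x|lborel. of_real (std_normal_density (x/sg n))*?h x)
 ----> (LINT x|lborel. of_real (1/sqrt (2 * pi))*?h x)"
 proof (rule integral_dominated_convergence[where w = "%x. (1/sqrt (2 * pi)) * fejer (a * x)"])
 show "integrable lborel (%x. (1/sqrt (2 * pi)) * fejer (a * x))" using fi by (rule integrable_mult_right)
 show "AE x in lborel. (%n. of_real (std_normal_density (x/sg n))*?h x)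
 ----> of_real (1/sqrt (2 * pi))*?h x"
 proof (intro AE_I2 tendsto_mult tendsto_const tendsto_of_real)
 fix x
 have "(%n. x/sg n) ----> 0" by (intro real_tendsto_divide_at_top[OF tendsto_const top])
 moreover have "isCont std_normal_density 0"
 unfolding std_normal_density_def by (intro continuous_intros) auto
 ultimately have "(%n. std_normal_density (x/sg n)) ----> std_normal_density 0"
 by (rule isCont_tendsto_compose[rotated])
 moreover have "std_normal_density 0 = 1/sqrt (2 * pi)" by (simp add:std_normal_density_def)
 ultimately show "(%n. std_normal_density (x/sg n)) ----> 1/sqrt (2 * pi)"
 by (simp only:)
 qed
 show "AE x in lborel. norm (of_real (std_normal_density (x/sg n))*?h x)<=(1/sqrt (2 * pi)) * fejer (a * x)" for n
 proof (rule AE_I2)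
 fix x
 have "std_normal_density (x/sg n)<=1/sqrt (2 * pi)"
 unfolding std_normal_density_def by (rule mult_left_le) auto
 from mult_right_mono[OF this,of "fejer (a * x)"]
 show "norm (of_real (std_normal_density (x/sg n))*?h x)<=(1/sqrt (2 * pi)) * fejer (a * x)"
 by (simp add:norm_mult)
 qed
 qed measurable
 from LIMSEQ_unique[OF this 1]
 have e:"of_real (1/sqrt (2 * pi))*(LINT x|lborel. ?h x) = of_real (sqrt (2 * pi)*(tri (s/a)/a))"
 by (simp only: integral_mult_right_zero)
 define J where "J = (LINT x|lborel. ?h x)"
 have "J = of_real (sqrt (2 * pi))*(of_real (1/sqrt (2 * pi)) * J)" by (simp add:of_real_mult[symmetric] del: of_real_mult)
 also have "... = of_real (sqrt (2 * pi)*(sqrt (2 * pi)*(tri (s/a)/a)))"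
 unfolding e[folded J_def] by simp
 also have "sqrt (2 * pi)*(sqrt (2 * pi)*(tri (s/a)/a)) = 2 * pi/a * tri (s/a)"
 by (simp add:mult.assoc[symmetric])
 finally show "(LINT x|lborel. ?h x) = of_real (2 * pi/a * tri (s/a))" unfolding J_def .
qed

lemma fejer_mass:
 assumes "0 < a"
 shows "(LINT x|lborel. fejer (a * x)) = 2 * pi/a"
proof -
 have "of_real (LINT x|lborel. fejer (a * x)) = (LINT x|lborel. of_real (fejer (a * x)) * iexp (0 * x))"
 by (simp only: mult_zero_left of_real_0 mult_zero_right exp_zero mult_1_right integral_complex_of_real)
 also have "... = complex_of_real (2 * pi/a)"
 unfolding fejer_transform(2)[OF assms] by (simp add:tri_def)
 finally show ?thesis by (simp only: of_real_eq_iff)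
qed

lemma real_distribution_density:
 assumes "sets N = sets borel" "g : bm N" "!!x. 0<=g x" "integrable N g" "(LINT x|N. g x) = 1"
 shows "real_distribution (density N (%x. ennreal (g x)))"
proof -
 have sp:"space N = UNIV" using sets_eq_imp_space_eq[OF assms(1)] by simp
 have "emeasure (density N (%x. ennreal (g x))) (space N) = (NN x|N. ennreal (g x))"
 using assms(2) by (subst emeasure_density) (auto intro!:nn_integral_cong)
 also have "... = 1" using assms by (subst nn_integral_eq_integral) auto
 finally have "prob_space (density N (%x. ennreal (g x)))" by (intro prob_spaceI) simp
 thus ?thesis
 using assms(1) sp by (simp add:real_distribution_def real_distribution_axioms_def)
qed

text \<open>The measures \<open>sg n\<close> times \<open>D n\<close> approach a multiple of
  Lebesgue measure, which has infinite mass. Weighting by the Fejer kernel and normalising gives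
  probability measures; their characteristic functions converge by \<open>fejer_limit\<close>, so
  Levy's theorem yields weak convergence.\<close>

lemma (in char_laws) fejer_weighted_limit:
 assumes far:"!!T. (%n. sg n*(LINT th|lborel. indicator ({-T..T} - {-de..de}) th * cmod (char (D n) th))) ----> 0"
 and a:"0 < a" and g [measurable]:"g : bm borel" and gb:"!!x. abs (g x)<=C"
 and disc:"finite {x. \<not> isCont g x}"
 shows "(%n. sg n*(LINT x|D n. fejer (a * x) * g x)) ----> (LINT x|lborel. fejer (a * x) * g x)/sqrt (2 * pi)"
proof -
 interpret D: real_distribution "D n" for n by (rule D)
 have int:"integrable (D n) (%x. fejer (a * x))" for n
 by (rule D.integrable_const_bound[where B = 1]) (simp_all add:fejer_le)
 define m where "m n = (LINT x|D n. fejer (a * x))" for n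
 have mlim:"(%n. sg n * m n) ----> sqrt (2 * pi)/a"
 proof -
 have "(%n. sg n*(LINT x|D n. of_real (fejer (a * x)) * iexp (0 * x))) ----> complex_of_real (sqrt (2 * pi)*(tri (0/a)/a))"
 by (rule fejer_limit[OF far a])
 also have "(%n. sg n*(LINT x|D n. of_real (fejer (a * x)) * iexp (0 * x))) = (%n. complex_of_real (sg n * m n))"
 unfolding m_def by (simp only: mult_zero_left of_real_0 mult_zero_right exp_zero mult_1_right integral_complex_of_real of_real_mult)
 finally have "(%n. Re (complex_of_real (sg n * m n))) ----> Re (complex_of_real (sqrt (2 * pi)*(tri (0/a)/a)))"
 by (rule tendsto_Re)
 moreover have "tri (0/a) = 1" by (simp add:tri_def)
 ultimately show ?thesis by (simp only: Re_complex_of_real times_divide_eq_right mult_1_right)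
 qed
 have "\<forall>\<^sub>F n in sequentially. 0 < sg n * m n"
 using a by (intro order_tendstoD(1)[OF mlim]) auto
 then obtain n0 where n0:"!!n. n0<=n ==> 0 < m n"
 unfolding eventually_sequentially using sigma_pos by (meson zero_less_mult_pos)
 define E where "E n = density (D (n+n0)) (%x. ennreal (fejer (a * x)/m (n+n0)))" for n
 define E' where "E' = density lborel (%x. ennreal (fejer (a * x)/(2 * pi/a)))"
 have mp:"0 < m (n+n0)" for n by (rule n0) simp
 have RE:"real_distribution (E n)" for n
 unfolding E_def using int mp[of n]
 by (intro real_distribution_density) (auto simp:m_def)
 have RE':"real_distribution E'"
 unfolding E'_def using fejer_transform(1)[OF a] fejer_mass[OF a] a
 by (intro real_distribution_density) auto
 have intE:"integral\<^sup>L (E n) h = (LINT x|D (n+n0). fejer (a * x) *\<^sub>R h x) /\<^sub>R m (n+n0)"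
 if [measurable]:"h : bm borel" for h ::"real => 'b :: {banach,second_countable_topology}" and n
 proof -
 have "integral\<^sup>L (E n) h = (LINT x|D (n+n0). (fejer (a * x)/m (n+n0)) *\<^sub>R h x)"
 unfolding E_def using mp[of n] by (intro integral_density) auto
 also have "... = (LINT x|D (n+n0). (1/m (n+n0)) *\<^sub>R (fejer (a * x) *\<^sub>R h x))"
 by simp
 also have "... = (1/m (n+n0)) *\<^sub>R (LINT x|D (n+n0). fejer (a * x) *\<^sub>R h x)"
 by (rule integral_scaleR_right)
 finally show ?thesis by (simp add:inverse_eq_divide)
 qed
 have intE':"integral\<^sup>L E' h = (LINT x|lborel. fejer (a * x) *\<^sub>R h x) /\<^sub>R (2 * pi/a)"
 if [measurable]:"h : bm borel" for h ::"real => 'b :: {banach,second_countable_topology}"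
 proof -
 have "integral\<^sup>L E' h = (LINT x|lborel. (fejer (a * x)/(2 * pi/a)) *\<^sub>R h x)"
 unfolding E'_def using a by (intro integral_density) auto
 also have "... = (LINT x|lborel. (1/(2 * pi/a)) *\<^sub>R (fejer (a * x) *\<^sub>R h x))"
 by (simp add:mult.commute)
 also have "... = (1/(2 * pi/a)) *\<^sub>R (LINT x|lborel. fejer (a * x) *\<^sub>R h x)"
 by (rule integral_scaleR_right)
 finally show ?thesis by (simp add:inverse_eq_divide)
 qed
 have ml':"(%n. sg (n+n0) * m (n+n0)) ----> sqrt (2 * pi)/a"
 using mlim by (rule LIMSEQ_ignore_initial_segment)
 have weak:"weak_conv_m E E'"
 proof (rule levy_continuity[OF RE RE'])
 fix s
 define J where "J n = (LINT x|D n. fejer (a * x) *\<^sub>R iexp (s * x))" for n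
 have "(%n. sg n * J n) ----> of_real (sqrt (2 * pi)*(tri (s/a)/a))"
 using fejer_limit[OF far a,of s] unfolding J_def scaleR_conv_of_real .
 hence "(%n. sg (n+n0) * J (n+n0)) ----> of_real (sqrt (2 * pi)*(tri (s/a)/a))"
 by (rule LIMSEQ_ignore_initial_segment)
 hence "(%n. (sg (n+n0) * J (n+n0))/of_real (sg (n+n0) * m (n+n0))) ---->
 of_real (sqrt (2 * pi)*(tri (s/a)/a))/of_real (sqrt (2 * pi)/a)"
 using a by (intro tendsto_divide tendsto_of_real ml') auto
 also have "(%n. (sg (n+n0) * J (n+n0))/of_real (sg (n+n0) * m (n+n0))) = (%n. char (E n) s)"
 proof
 fix n
 show "(sg (n+n0) * J (n+n0))/of_real (sg (n+n0) * m (n+n0)) = char (E n) s"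
 proof -
 have "char (E n) s = J (n+n0) /\<^sub>R m (n+n0)"
 unfolding char_def J_def by (rule intE) measurable
 thus ?thesis using sigma_pos[of "n+n0"] mp[of n] by (simp add:scaleR_conv_of_real field_simps)
 qed
 qed
 also have "of_real (sqrt (2 * pi)*(tri (s/a)/a))/of_real (sqrt (2 * pi)/a) = char E' s"
 proof -
 have "char E' s = of_real (2 * pi/a * tri (s/a)) /\<^sub>R (2 * pi/a)"
 unfolding char_def by (subst intE') (auto simp only: scaleR_conv_of_real fejer_transform(2)[OF a] intro!:borel_measurable_continuous_onI continuous_intros)
 thus ?thesis using a by (simp add:scaleR_conv_of_real)
 qed
 finally show "(%n. char (E n) s) ----> char E' s" .
 qed
 have null:"emeasure E' {x. \<not> isCont g x} = 0"
 proof -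
 have N:"{x. \<not> isCont g x} : null_sets lborel" using disc by (rule finite_imp_null_set_lborel)
 hence "{x. \<not> isCont g x} : null_sets E'"
 unfolding E'_def by (subst null_sets_density_iff) (auto intro:AE_I' elim!: AE_mp[OF AE_not_in[OF N]])
 thus ?thesis by auto
 qed
 have "(%n. integral\<^sup>L (E n) g) ----> integral\<^sup>L E' g"
 by (rule weak_conv_imp_bdd_ae_continuous_conv[OF RE RE' weak null,where B = C]) (use gb in auto)
 hence "(%n. (sg (n+n0) * m (n+n0)) * integral\<^sup>L (E n) g) ----> (sqrt (2 * pi)/a) * integral\<^sup>L E' g"
 by (intro tendsto_mult ml')
 also have "(%n. (sg (n+n0) * m (n+n0)) * integral\<^sup>L (E n) g) = (%n. sg (n+n0)*(LINT x|D (n+n0). fejer (a * x) * g x))"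
 proof
 fix n
 show "(sg (n+n0) * m (n+n0)) * integral\<^sup>L (E n) g = sg (n+n0)*(LINT x|D (n+n0). fejer (a * x) * g x)"
 using mp[of n] by (subst intE) auto
 qed
 also have "(sqrt (2 * pi)/a) * integral\<^sup>L E' g = (LINT x|lborel. fejer (a * x) * g x)/sqrt (2 * pi)"
 proof -
 define I where "I = (LINT x|lborel. fejer (a * x) * g x)"
 have "integral\<^sup>L E' g = I/(2 * pi/a)"
 by (subst intE') (auto simp:I_def)
 moreover have "sqrt (2 * pi)/a*(I/(2 * pi/a)) = I*(sqrt (2 * pi)/(2 * pi))" using a by simp
 moreover have "sqrt (2 * pi)/(2 * pi) = 1/sqrt (2 * pi)"
 using real_div_sqrt[of "2 * pi"] by (simp add:field_simps)
 ultimately show ?thesis unfolding I_def[symmetric] by simp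
 qed
 finally show ?thesis by (rule LIMSEQ_offset)
qed

text \<open>The Fejer kernel is dilated until it is positive on a compact interval around
  \<open>{u<..<v}\<close>; the weighted limit then applies to the integrand divided by the kernel,
  discontinuous at most at \<open>u\<close> and \<open>v\<close>.\<close>

lemma (in char_laws) interval_limit:
 assumes far:"!!T. (%n. sg n*(LINT th|lborel. indicator ({-T..T} - {-de..de}) th * cmod (char (D n) th))) ----> 0"
 shows "(%n. sg n*(LINT x|D n. indicator {u<..<v} x * exp (- x * xi))) ----> (LINT x|lborel. indicator {u<..<v} x * exp (- x * xi))/sqrt (2 * pi)"
proof -
 define B where "B = abs u+abs v+1"
 define a where "a = 1/B"
 have B:"0 < B" and a:"0 < a" by (simp_all add:B_def a_def)
 have fp:"0 < fejer (a * x)" if "x : {-B..B}" for x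
 proof (rule fejer_pos)
 have "abs x<=B" using that by auto
 hence "abs (a * x)<=1" using B by (simp add:a_def abs_mult)
 thus "abs (a * x) < 2 * pi" using pi_gt3 by linarith
 qed
 define q where "q x = exp (- x * xi)/fejer (a * x)" for x
 have qc:"isCont q x" if "x : {-B..B}" for x
 unfolding q_def[abs_def] using fp[OF that] by (intro continuous_intros isCont_o2[OF _ isCont_fejer]) auto
 hence "continuous_on {-B..B} q" by (intro continuous_at_imp_continuous_on) auto
 hence "bounded (q ` {-B..B})" by (intro compact_imp_bounded compact_continuous_image) auto
 then obtain C where "\<forall>y\<in>q ` {-B..B}. norm y<=C" unfolding bounded_iff by blast
 hence C:"abs (q x)<=C" if "x : {-B..B}" for x using that by auto
 define g where "g x = indicator {u<..<v} x * q x" for x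
 have sub:"{u<..<v} \<subseteq> {-B..B}" unfolding B_def by auto
 have gm:"g : bm borel" unfolding g_def[abs_def] q_def[abs_def] by measurable
 have fg:"fejer (a * x) * g x = indicator {u<..<v} x * exp (- x * xi)" for x
 using fp[of x] sub by (auto simp:g_def q_def indicator_def)
 have "(%n. sg n*(LINT x|D n. fejer (a * x) * g x)) ----> (LINT x|lborel. fejer (a * x) * g x)/sqrt (2 * pi)"
 proof (rule fejer_weighted_limit[OF far a gm])
 show "abs (g x)<=max C 0" for x
 using C[of x] sub by (auto simp:g_def indicator_def)
 have "isCont g x" if x:"x ~= u" "x ~= v" for x
 proof (cases "x : {u<..<v}")
 case True
 have "\<forall>\<^sub>F y in nhds x. y : {u<..<v}" using True by (intro eventually_nhds_in_open) auto
 hence "\<forall>\<^sub>F y in nhds x. g y = q y" by eventually_elim (simp add:g_def)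
 thus ?thesis using qc True sub by (subst isCont_cong[where g = q]) auto
 next
 case False
 have "\<forall>\<^sub>F y in nhds x. y : - {u..v}" using False x by (intro eventually_nhds_in_open) auto
 hence "\<forall>\<^sub>F y in nhds x. g y = 0" by eventually_elim (auto simp:g_def)
 thus ?thesis by (subst isCont_cong[where g = "%_. 0"]) auto
 qed
 hence "{x. \<not> isCont g x} \<subseteq> {u,v}" by blast
 thus "finite {x. \<not> isCont g x}" by (rule finite_subset) simp
 qed
 thus ?thesis by (simp only: fg)
qed

text \<open>Integer-valued laws are recovered by Fourier inversion over one period, so angles up to
  \<open>pi\<close> suffice.\<close>

lemma (in char_laws) lattice_limit:
 assumes far:"(%n. sg n*(LINT th|lborel. indicator ({-pi..pi} - {-de..de}) th * cmod (char (D n) th))) ----> 0"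
 and lat:"!!n. AE x in D n. x : \<int>"
 shows "(%n. sg n * measure (D n) {of_int k}) ----> 1/sqrt (2 * pi)"
proof -
 interpret D: real_distribution "D n" for n by (rule D)
 let ?I = "indicator {-pi..pi} :: real => real"
 have ex:"(LINT th|lborel. ?I th *\<^sub>R iexp (th * of_int m)) = of_real (2 * pi) * of_bool (m = 0)" for m :: int
 proof (cases "m = 0")
 case False
 have d:"((%th. iexp (th * of_int m)/(\<i> * of_int m)) has_vector_derivative iexp (th * of_int m)) (at th within {-pi..pi})" for th
 proof -
 have "((%z. exp (\<i>*(z * of_int m))/(\<i> * of_int m)) has_field_derivative exp (\<i>*(of_real th * of_int m))) (at (of_real th))"
 using False by (auto intro!:derivative_eq_intros simp:field_simps)
 from has_vector_derivative_real_field[OF this] show ?thesis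
 by (simp add:has_vector_derivative_at_within)
 qed
 have "(LINT th|lborel. ?I th *\<^sub>R iexp (th * of_int m)) = iexp (pi * of_int m)/(\<i> * of_int m)-iexp (- pi * of_int m)/(\<i> * of_int m)"
 by (rule integral_FTC_Icc) (use d in \<open>auto intro!:continuous_intros\<close>)
 also have "iexp (pi * of_int m) = iexp (- pi * of_int m)"
 proof -
 have "iexp (pi * of_int m) = iexp (- pi * of_int m) * exp (2 * of_int m * pi*\<i>)"
 unfolding exp_add[symmetric] by (rule arg_cong[of _ _ exp]) (simp add:algebra_simps)
 moreover have "exp (2 * of_int m * pi*\<i>) = 1" by (rule exp_integer_2pi) simp
 ultimately show ?thesis by (simp only: mult_1_right)
 qed
 finally show ?thesis using False by simp
 next
 case True
 have "(LINT th|lborel. ?I th *\<^sub>R (1 :: complex)) = of_real (2 * pi)"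
 by (simp add:scaleR_conv_of_real)
 thus ?thesis using True by simp
 qed
 have main:"(LINT th|lborel. of_real (?I th) * iexp (- th * of_int k) * char (D n) th) = of_real (2 * pi * measure (D n) {of_int k})" for n
 proof -
 interpret pair_sigma_finite lborel "D n" ..
 define g where "g z = ?I (fst z) *\<^sub>R iexp (fst z*(snd z-of_int k))" for z ::"real \<times> real"
 have gm [measurable]:"g : bm (lborel \<Otimes>\<^sub>M D n)"
 unfolding g_def[abs_def] by measurable
 have gi:"(LINT x|D n. g (th,x)) = of_real (?I th) * iexp (- th * of_int k) * char (D n) th" for th
 proof -
 have "g (th,x) = of_real (?I th) * iexp (- th * of_int k) * iexp (th * x)" for x
 proof -
 have "iexp (th*(x-of_int k)) = iexp (- th * of_int k) * iexp (th * x)"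
 by (simp add:exp_add[symmetric] algebra_simps)
 thus ?thesis by (simp add:g_def scaleR_conv_of_real)
 qed
 thus ?thesis by (simp only: char_def integral_mult_right_zero)
 qed
 have "integrable (lborel \<Otimes>\<^sub>M D n) g"
 proof (rule Fubini_integrable[OF gm])
 have ng:"norm (g (x,y)) = ?I x" for x y by (simp add:g_def del: of_real_mult of_real_diff)
 show "integrable lborel (%x. LINT y|D n. norm (g (x,y)))"
 unfolding ng using D.prob_space[of n] by (simp add:emeasure_lborel_Icc_eq)
 show "AE x in lborel. integrable (D n) (%y. g (x,y))"
 by (intro AE_I2 D.integrable_const_bound[where B = 1]) (auto simp:ng indicator_def)
 qed
 hence "(LINT th|lborel. (LINT x|D n. g (th,x))) = (LINT x|D n. (LINT th|lborel. g (th,x)))"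
 by (intro Fubini_integral[symmetric]) (simp add:case_prod_unfold)
 also have "... = (LINT x|D n. of_real (2 * pi * indicator {of_int k} x))"
 proof (rule integral_cong_AE)
 show "AE x in D n. (LINT th|lborel. g (th,x)) = of_real (2 * pi * indicator {of_int k} x)"
 using lat[of n]
 proof eventually_elim
 case (elim x)
 then obtain j where j:"x = of_int j" by (auto elim: Ints_cases)
 have "(LINT th|lborel. g (th,x)) = (LINT th|lborel. ?I th *\<^sub>R iexp (th * of_int (j-k)))"
 by (simp add:g_def j)
 also note ex
 finally show ?case by (simp add:j indicator_def)
 qed
 qed measurable
 also have "... = of_real (2 * pi * measure (D n) {of_int k})"
 by (simp only: integral_complex_of_real integral_mult_right_zero) simp
 finally show ?thesis unfolding gi .
 qed
 have "(%n. sg n*(LINT th|lborel. of_real (?I th) * iexp (- th * of_int k) * char (D n) th)) ---->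
 of_real (sqrt (2 * pi))*(of_real (?I 0) * iexp (- 0 * of_int k))"
 proof (rule limit_integral[OF far])
 show "cmod (of_real (?I th) * iexp (- th * of_int k))<=1" for th
 by (simp add:norm_mult indicator_def del: of_real_mult)
 have "\<forall>\<^sub>F th in nhds (0::real). th : {-pi<..<pi}" by (intro eventually_nhds_in_open) auto
 hence "\<forall>\<^sub>F th in nhds 0. of_real (?I th) * iexp (- th * of_int k) = iexp (- th * of_int k)"
 by eventually_elim simp
 thus "isCont (%th. of_real (?I th) * iexp (- th * of_int k)) 0"
 by (subst isCont_cong[where g = "%th. iexp (- th * of_int k)"]) (auto intro!:continuous_intros)
 qed (auto simp:indicator_def)
 also have "(%n. sg n*(LINT th|lborel. of_real (?I th) * iexp (- th * of_int k) * char (D n) th))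
 = (%n. complex_of_real (sg n*(2 * pi * measure (D n) {of_int k})))"
 unfolding main by (simp only: of_real_mult)
 finally have "(%n. Re (complex_of_real (sg n*(2 * pi * measure (D n) {of_int k})))) ----> Re (of_real (sqrt (2 * pi))*(of_real (?I 0) * iexp (- 0 * of_int k)))"
 by (rule tendsto_Re)
 hence "(%n. 2 * pi*(sg n * measure (D n) {of_int k})) ----> sqrt (2 * pi)"
 by (simp add:mult.left_commute)
 hence "(%n. 2 * pi*(sg n * measure (D n) {of_int k})/(2 * pi)) ----> sqrt (2 * pi)/(2 * pi)"
 by (intro tendsto_divide tendsto_const) auto
 moreover have "sqrt (2 * pi)/(2 * pi) = 1/sqrt (2 * pi)"
 using real_div_sqrt[of "2 * pi"] by (simp add:field_simps)
 ultimately show ?thesis by simp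
qed

section \<open>Limits along varying tilts\<close>

text \<open>The tilts \<open>xi N\<close> need not converge. Pointwise convergence together with a
  common Lipschitz constant is uniform on a compact interval, by a finite net.\<close>

lemma lipschitz_parameter_limit:
 fixes A ::"nat => real => real"
 assumes A0:"!!xi. (%n. A n xi) ----> 0" and R:"!!n. abs (x n)<=R"
 and lip:"!!n xi xi'. abs xi<=R ==> abs xi'<=R ==> abs (A n xi-A n xi')<=L * abs (xi-xi')"
 shows "(%n. A n (x n)) ----> 0"
proof (rule tendstoI)
 fix e :: real
 assume e:"0 < e"
 define l where "l = abs L+1"
 define d where "d = e/(2 * l)"
 have l:"0 < l" and d:"0 < d" using e by (simp_all add:d_def l_def)
 obtain k where k:"finite k" "k \<subseteq> {-R..R}" "{-R..R} \<subseteq> (\<Union>xi\<in>k. ball xi d)"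
 using compact_imp_seq_compact[OF compact_Icc,THEN seq_compact_imp_totally_bounded] d by meson
 have "\<forall>\<^sub>F n in sequentially. \<forall>xi\<in>k. abs (A n xi) < e/2"
 using tendstoD[OF A0,of "e/2"] e by (intro eventually_ball_finite[OF k(1)]) simp
 thus "\<forall>\<^sub>F n in sequentially. dist (A n (x n)) 0 < e"
 proof eventually_elim
 case (elim n)
 have xn:"abs (x n)<=R" by (rule R)
 hence "x n : {-R..R}" by auto
 then obtain xi where xi:"xi : k" "abs (xi-x n) < d" using k(3) by (auto simp:dist_real_def)
 have "xi : {-R..R}" using xi(1) k(2) by (rule subsetD[rotated])
 hence "abs xi<=R" by auto
 from lip[OF xn this,of n] have "abs (A n (x n)-A n xi)<=L * abs (x n-xi)" .
 also have "...<=l * d" using xi(2) d by (intro mult_mono) (auto simp:l_def)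
 also have "... = e/2" using l by (simp add:d_def)
 finally have "abs (A n (x n)-A n xi)<=e/2" .
 moreover have "abs (A n xi) < e/2" using elim xi(1) by (rule bspec)
 ultimately show ?case unfolding dist_real_def by linarith
 qed
qed

lemma exp_lipschitz_parameter:
 fixes x :: real
 assumes "abs x<=B" "abs xi<=R" "abs xi'<=R"
 shows "abs (exp (- x * xi)-exp (- x * xi'))<=B * exp (B * R) * abs (xi-xi')"
proof -
 have "norm (exp (- x * xi)-exp (- x * xi'))<=B * exp (B * R) * norm (xi-xi')"
 proof (rule field_differentiable_bound[where S = "{-R..R}"])
 show "((%xi. exp (- x * xi)) has_field_derivative (exp (- x * t)*(- x))) (at t within {-R..R})" for t
 by (auto intro!:derivative_eq_intros)
 show "norm (exp (- x * t)*(- x))<=B * exp (B * R)" if "t : {-R..R}" for t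
 proof -
 have "- x * t<=abs x * abs t" by (simp add:abs_mult[symmetric] del: abs_mult)
 also have "...<=B * R" using assms(1) that by (intro mult_mono) auto
 finally have "abs x * exp (- x * t)<=B * exp (B * R)" using assms(1) by (intro mult_mono) auto
 thus ?thesis by (simp add:abs_mult mult.commute)
 qed
 qed (use assms in auto)
 thus ?thesis by simp
qed

lemma (in char_laws) interval_limit_varying:
 assumes far:"!!T. (%n. sg n*(LINT th|lborel. indicator ({-T..T} - {-de..de}) th * cmod (char (D n) th))) ----> 0"
 and R:"!!n. abs (xi n)<=R"
 shows "(%n. sg n*(LINT x|D n. indicator {u<..<v} x * exp (- x * xi n))
 - (LINT x|lborel. indicator {u<..<v} x * exp (- x * xi n))/sqrt (2 * pi)) ----> 0"
proof -
 interpret D: real_distribution "D n" for n by (rule D)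
 define E where "E mu t = (LINT x|mu. indicator {u<..<v} x * exp (- x * t))" for mu ::"real measure" and t
 define B where "B = abs u+abs v"
 have bB:"abs x<=B" if "x : {u<..<v}" for x using that by (auto simp:B_def)
 have lipE:"abs (E mu t-E mu t')<=B * exp (B * R) * abs (t-t') * E mu 0"
 if S:"sets mu = sets borel" and fin:"emeasure mu {u<..<v} < \<infinity>" and t:"abs t<=R" "abs t'<=R" for mu t t'
 proof -
 note [measurable_cong] = S
 have i:"integrable mu (%x. indicator {u<..<v} x *\<^sub>R h x)"
 if [measurable]:"h : bm borel" and hb:"!!x. x : {u<..<v} ==> abs (h x)<=C" for h ::"real => real" and C
 using fin hb by (intro integrableI_bounded_set_indicator[where B = C]) auto
 have ie:"integrable mu (%x. indicator {u<..<v} x * exp (- x * s))" if "abs s<=R" for s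
 proof -
 have "exp (- x * s)<=exp (B * R)" if x:"x : {u<..<v}" for x
 proof -
 have "- x * s<=abs x * abs s" by (simp add:abs_mult[symmetric] del: abs_mult)
 also have "...<=B * R" using bB[OF x] \<open>abs s<=R\<close> by (intro mult_mono) auto
 finally show ?thesis by simp
 qed
 thus ?thesis using i[of "%x. exp (- x * s)" "exp (B * R)"] by simp
 qed
 have "abs (E mu t-E mu t') = abs (LINT x|mu. indicator {u<..<v} x * exp (- x * t)-indicator {u<..<v} x * exp (- x * t'))"
 unfolding E_def using ie t by simp
 also have "...<=(LINT x|mu. abs (indicator {u<..<v} x * exp (- x * t)-indicator {u<..<v} x * exp (- x * t')))"
 by (rule integral_abs_bound)
 also have "...<=(LINT x|mu. B * exp (B * R) * abs (t-t')*(indicator {u<..<v} x * exp (- x*0)))"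
 proof (rule integral_mono)
 show "integrable mu (%x. abs (indicator {u<..<v} x * exp (- x * t)-indicator {u<..<v} x * exp (- x * t')))"
 using ie t by (intro integrable_abs LINT_integrable_diff) auto
 show "integrable mu (%x. B * exp (B * R) * abs (t-t')*(indicator {u<..<v} x * exp (- x*0)))"
 using i[of "%_. 1" 1] by (intro integrable_mult_right) simp
 show "abs (indicator {u<..<v} x * exp (- x * t)-indicator {u<..<v} x * exp (- x * t'))<=B * exp (B * R) * abs (t-t')*(indicator {u<..<v} x * exp (- x*0))" for x
 using exp_lipschitz_parameter[OF bB t,of x] by (cases "x : {u<..<v}") simp_all
 qed
 also have "... = B * exp (B * R) * abs (t-t') * E mu 0"
 unfolding E_def by (rule integral_mult_right_zero)
 finally show ?thesis .
 qed
 have lim:"(%n. sg n * E (D n) t) ----> E lborel t/sqrt (2 * pi)" for t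
 unfolding E_def by (rule interval_limit[OF far])
 obtain C where C:"!!n. abs (sg n * E (D n) 0)<=C"
 using convergent_imp_Bseq[OF convergentI[OF lim[of 0]]] unfolding Bseq_def by auto
 define c where "c = B * exp (B * R)"
 have c0:"0<=c" by (simp add:c_def B_def)
 show ?thesis unfolding E_def[symmetric]
 proof (rule lipschitz_parameter_limit[where A = "%n t. sg n * E (D n) t-E lborel t/sqrt (2 * pi)" and R = R and L = "c * C+c * E lborel 0"])
 show "(%n. sg n * E (D n) t-E lborel t/sqrt (2 * pi)) ----> 0" for t
 using tendsto_diff[OF lim[of t] tendsto_const,of "E lborel t/sqrt (2 * pi)"] by simp
 fix n t t'
 assume t:"abs t<=R" "abs t'<=R"
 have 1:"abs (E (D n) t-E (D n) t')<=c * abs (t-t') * E (D n) 0"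
 unfolding c_def by (rule lipE[OF _ _ t]) (auto simp:D.emeasure_eq_measure)
 have 2:"abs (E lborel t-E lborel t')<=c * abs (t-t') * E lborel 0"
 unfolding c_def by (rule lipE[OF _ _ t]) (use emeasure_lborel_box_finite[of u v] in auto)
 have "abs (sg n*(E (D n) t-E (D n) t'))<=sg n*(c * abs (t-t') * E (D n) 0)"
 using 1 sigma_pos[of n] by (simp add:abs_mult)
 also have "... = c * abs (t-t')*(sg n * E (D n) 0)" by simp
 also have "...<=c * abs (t-t') * C" using C[of n] c0 by (intro mult_left_mono) auto
 finally have 3:"abs (sg n*(E (D n) t-E (D n) t'))<=c * C * abs (t-t')" by (simp add:mult_ac)
 have "1<=sqrt (2 * pi)" using pi_gt3 by simp
 hence "abs ((E lborel t-E lborel t')/sqrt (2 * pi))<=abs (E lborel t-E lborel t')"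
 using mult_left_mono[of 1 "sqrt (2 * pi)" "abs (E lborel t-E lborel t')"] by (simp add:abs_divide divide_le_eq del: real_sqrt_ge_1_iff)
 with 2 3 show "abs ((sg n * E (D n) t-E lborel t/sqrt (2 * pi))-(sg n * E (D n) t'-E lborel t'/sqrt (2 * pi)))
<=(c * C+c * E lborel 0) * abs (t-t')"
 by (simp add:diff_divide_distrib algebra_simps)
 qed (rule R)
qed

section \<open>Logarithmic moment generating function of a bounded variable\<close>

locale bounded_variable = prob_space M for M ::"'w measure" +
 fixes S ::"'w => real" and C :: real
 assumes S_meas [measurable]:"S : bm M" and S_bound:"!!om. om : space M ==> abs (S om)<=C"
begin

definition weighted_mgf ::"nat => real => real" where
 "weighted_mgf k t = (LINT om|M. S om ^ k * exp (t * S om))"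

definition tilted_mean ::"real => real" where
 "tilted_mean t = weighted_mgf 1 t/weighted_mgf 0 t"

definition tilted_variance ::"real => real" where
 "tilted_variance t = weighted_mgf 2 t/weighted_mgf 0 t-(tilted_mean t)^2"

definition cmgf ::"complex => complex" where
 "cmgf w = (LINT om|M. exp (w * of_real (S om)))"

lemma S_pow_le:"om : space M ==> abs (S om ^ k)<=C ^ k"
 unfolding power_abs by (intro power_mono S_bound) auto

lemma exp_S_ge:"om : space M ==> exp (- abs t * C)<=exp (t * S om)"
 and exp_S_le:"om : space M ==> exp (t * S om)<=exp (abs t * C)"
proof -
 assume om:"om : space M"
 have "abs (t * S om)<=abs t * C" unfolding abs_mult using S_bound[OF om] by (intro mult_left_mono) auto
 thus "exp (- abs t * C)<=exp (t * S om)" "exp (t * S om)<=exp (abs t * C)" by (auto simp:abs_le_iff)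
qed

lemma integrable_weighted:"integrable M (%om. S om ^ k * exp (t * S om))"
proof (rule integrable_const_bound)
 show "AE om in M. norm (S om ^ k * exp (t * S om))<=C ^ k * exp (abs t * C)"
 proof (rule AE_I2)
 fix om assume om:"om : space M"
 have "abs (S om ^ k) * exp (t * S om)<=C ^ k * exp (abs t * C)"
 using S_pow_le[OF om,of k] exp_S_le[OF om] by (intro mult_mono) auto
 thus "norm (S om ^ k * exp (t * S om))<=C ^ k * exp (abs t * C)" by (simp add:abs_mult)
 qed
qed measurable

lemma has_real_derivative_weighted_mgf:"(weighted_mgf k has_real_derivative weighted_mgf (Suc k) t) (at t)"
proof -
 have *:"(LINT om|M. of_real (S om ^ j) * exp (of_real t * of_real (S om))) = complex_of_real (weighted_mgf j t)" for j t
 unfolding weighted_mgf_def by (simp only: integral_complex_of_real[symmetric] of_real_mult exp_of_real[symmetric])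
 have "((%w. LINT om|M. of_real (S om ^ k) * exp (w * of_real (S om))) has_field_derivative
 (LINT om|M. of_real (S om ^ k) * of_real (S om) * exp (of_real t * of_real (S om)))) (at (complex_of_real t))"
 using S_pow_le by (intro has_field_derivative_mgf[where D = "C ^ k" and C = C]) (auto simp:S_bound simp del: of_real_power)
 from has_vector_derivative_real_field[OF this,of UNIV]
 have "((%t. complex_of_real (weighted_mgf k t)) has_vector_derivative of_real (weighted_mgf (Suc k) t)) (at t)"
 unfolding *[symmetric] by (simp only: power_Suc2 of_real_mult)
 from bounded_linear.has_vector_derivative[OF bounded_linear_Re this]
 show ?thesis by (simp add:has_real_derivative_iff_has_vector_derivative)
qed

lemma weighted_mgf_0_pos:"0 < weighted_mgf 0 t"
proof -
 have "(LINT om|M. exp (- abs t * C))<=weighted_mgf 0 t"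
 unfolding weighted_mgf_def using exp_S_ge integrable_weighted[of 0 t] by (intro integral_mono) auto
 thus ?thesis using prob_space by (simp add:less_le_trans[OF exp_gt_zero])
qed

lemma has_real_derivative_ln_mgf:"((%t. ln (weighted_mgf 0 t)) has_real_derivative tilted_mean t) (at t)"
 using weighted_mgf_0_pos[of t]
 by (auto intro!:derivative_eq_intros has_real_derivative_weighted_mgf simp:tilted_mean_def)

lemma has_real_derivative_tilted_mean:"(tilted_mean has_real_derivative tilted_variance t) (at t)"
proof -
 note d = has_real_derivative_weighted_mgf[of _ t]
 have nz:"weighted_mgf 0 t ~= 0" using weighted_mgf_0_pos[of t] by simp
 from DERIV_divide[OF d[of 1] d[of 0] nz]
 show ?thesis using nz unfolding tilted_mean_def[abs_def] tilted_variance_def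
 by (simp add:numeral_2_eq_2 diff_divide_distrib power2_eq_square)
qed

lemma tilted_variance_eq:
 "tilted_variance t = (LINT om|M. (S om-tilted_mean t)^2 * exp (t * S om))/weighted_mgf 0 t"
proof -
 define m where "m = tilted_mean t"
 have "(S om-m)^2 * exp (t * S om) = S om ^ 2 * exp (t * S om)-2 * m*(S om ^ 1 * exp (t * S om))+m^2*(S om ^ 0 * exp (t * S om))" for om
 by (simp add:power2_eq_square algebra_simps)
 hence "(LINT om|M. (S om-m)^2 * exp (t * S om)) = weighted_mgf 2 t-2 * m * weighted_mgf 1 t+m^2 * weighted_mgf 0 t"
 unfolding weighted_mgf_def using integrable_weighted
 by (simp only: integral_mult_right_zero LINT_add LINT_diff
 LINT_integrable_diff integrable_mult_right)
 moreover have "weighted_mgf 1 t = m * weighted_mgf 0 t"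
 using weighted_mgf_0_pos[of t] by (simp add:m_def tilted_mean_def)
 ultimately show ?thesis using weighted_mgf_0_pos[of t]
 unfolding tilted_variance_def m_def[symmetric] by (simp add:field_simps power2_eq_square)
qed

text \<open>The tilting density is bounded below by a positive constant, so it cannot destroy a
  positive variance.\<close>

lemma tilted_variance_pos:
 assumes "0 < variance S"
 shows "0 < tilted_variance t"
proof -
 define m where "m = tilted_mean t"
 have iS:"integrable M (%om. S om ^ k)" for k using integrable_weighted[of k 0] by simp
 have iq:"integrable M (%om. (S om-m)^2)"
 proof -
 have "integrable M (%om. S om ^ 2-2 * m * S om ^ 1+m^2)"
 by (intro LINT_integrable_add LINT_integrable_diff integrable_mult_right iS) simp
 thus ?thesis by (simp add:power2_diff algebra_simps)
 qed
 have "integrable M (%om. S om ^ 2 * exp (t * S om)-2 * m*(S om ^ 1 * exp (t * S om))+m^2*(S om ^ 0 * exp (t * S om)))"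
 using integrable_weighted by (intro LINT_integrable_add LINT_integrable_diff integrable_mult_right)
 also have "(%om. S om ^ 2 * exp (t * S om)-2 * m*(S om ^ 1 * exp (t * S om))+m^2*(S om ^ 0 * exp (t * S om))) = (%om. (S om-m)^2 * exp (t * S om))"
 by (simp add:power2_eq_square algebra_simps)
 finally have ie:"integrable M (%om. (S om-m)^2 * exp (t * S om))" .
 have "0 < exp (- abs t * C) * variance S" using assms by simp
 also have "...<=exp (- abs t * C)*(LINT om|M. (S om-m)^2)"
 using iS[of 1] iS[of 2] by (intro mult_left_mono variance_le_second_moment) auto
 also have "... = (LINT om|M. exp (- abs t * C)*(S om-m)^2)" by (simp only: integral_mult_right_zero)
 also have "...<=(LINT om|M. (S om-m)^2 * exp (t * S om))"
 proof (rule integral_mono[OF integrable_mult_right[OF iq] ie])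
 fix om assume "om : space M"
 from mult_left_mono[OF exp_S_ge[OF this,of t],of "(S om-m)^2"]
 show "exp (- abs t * C)*(S om-m)^2<=(S om-m)^2 * exp (t * S om)" by (simp add:mult.commute)
 qed
 finally show ?thesis
 unfolding tilted_variance_eq m_def[symmetric] using weighted_mgf_0_pos by simp
qed

lemma tilted_variance_0:"tilted_variance 0 = variance S" and tilted_mean_0:"tilted_mean 0 = expectation S"
proof -
 have w:"weighted_mgf 0 0 = 1" by (simp add:weighted_mgf_def prob_space)
 show m:"tilted_mean 0 = expectation S" by (simp add:tilted_mean_def w) (simp add:weighted_mgf_def)
 show "tilted_variance 0 = variance S" by (simp add:tilted_variance_eq m w)
qed

lemma ln_mgf_quadratic:
 assumes K:"!!s. abs s<=r ==> tilted_variance (xi+s)<=K" and s:"abs s<=r"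
 shows "ln (weighted_mgf 0 (xi+s))-ln (weighted_mgf 0 xi)-s * tilted_mean xi<=K * s^2/2"
proof (cases "s = 0")
 case False
 define df where "df m = (if m = 0 then (%t. ln (weighted_mgf 0 t)) else if m = 1 then tilted_mean else tilted_variance)" for m :: nat
 have "\<exists>t. (if xi+s < xi then xi+s < t & t < xi else xi < t & t < xi+s) \<and>
 ln (weighted_mgf 0 (xi+s)) = (\<Sum>m<2. df m xi/fact m*(xi+s-xi) ^ m)+df 2 t/fact 2*(xi+s-xi) ^ 2"
 proof (rule Taylor[where a = "xi-r" and b = "xi+r"])
 show "\<forall>m t. m < 2 & xi-r<=t & t<=xi+r --> (df m has_real_derivative df (Suc m) t) (at t)"
 using has_real_derivative_ln_mgf has_real_derivative_tilted_mean by (auto simp:df_def less_2_cases_iff)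
 qed (use s False in \<open>auto simp:df_def\<close>)
 then obtain t where t:"if xi+s < xi then xi+s < t & t < xi else xi < t & t < xi+s"
 and e:"ln (weighted_mgf 0 (xi+s)) = ln (weighted_mgf 0 xi)+tilted_mean xi * s+tilted_variance t/2 * s^2"
 by (auto simp:df_def numeral_2_eq_2)
 have "abs (t-xi)<=r" using t s by (auto split: if_splits)
 from K[OF this] have "tilted_variance t/2 * s^2<=K/2 * s^2" by (intro mult_right_mono) auto
 thus ?thesis using e by (simp add:mult.commute)
qed simp

lemma has_field_derivative_cmgf:"(cmgf has_field_derivative (LINT om|M. of_real (S om) * exp (w * of_real (S om)))) (at w)"
 using has_field_derivative_mgf[of "%_. 1" S 1 C w] S_bound unfolding cmgf_def[abs_def] by simp

lemma cmgf_of_real:"cmgf (of_real t) = of_real (weighted_mgf 0 t)"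
 "(LINT om|M. of_real (S om) * exp (of_real t * of_real (S om))) = complex_of_real (weighted_mgf 1 t)"
 unfolding cmgf_def weighted_mgf_def power_0 power_one_right mult_1
 by (simp_all only: integral_complex_of_real[symmetric] of_real_mult exp_of_real[symmetric])

lemma norm_cmgf_le:"cmod (cmgf w)<=weighted_mgf 0 (Re w)"
proof -
 have "cmod (cmgf w)<=(LINT om|M. cmod (exp (w * of_real (S om))))" unfolding cmgf_def by (rule integral_norm_bound)
 thus ?thesis by (simp add:weighted_mgf_def)
qed

text \<open>The centred quotient \<open>G\<close> is at most \<open>exp (K * r^2/2)\<close> on the
  disc, because the complex generating function is dominated by the real one at
  \<open>Re ze\<close>, where the second derivative of the logarithm is at most \<open>K\<close>.
  The third-order error is therefore linear in \<open>K\<close>, that is, of the order of the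
  variance; this makes it negligible at scale one over the standard deviation.\<close>

lemma log_mgf_expansion:
 assumes r:"0 < r" and K0:"0 < K" and K:"!!s. abs s<=r ==> tilted_variance (xi+s)<=K"
 and nz:"!!ze. cmod ze < r ==> cmgf (of_real xi+ze) ~= 0"
 obtains g where "!!ze. cmod ze < r ==> exp (g ze) = cmgf (of_real xi+ze)/of_real (weighted_mgf 0 xi) * exp (- ze * of_real (tilted_mean xi))"
 "!!ze. cmod ze<=r/4 ==> cmod (g ze-of_real (tilted_variance xi) * ze^2/2)<=768 * K/r * cmod ze ^ 3"
 "!!s. abs s<=r/4 ==> abs (tilted_variance (xi+s)-tilted_variance xi)<=768 * K/r * abs s"
proof -
 define m where "m = tilted_mean xi"
 define E where "E = weighted_mgf 0 xi"
 define G where "G ze = cmgf (of_real xi+ze)/of_real E * exp (- ze * of_real m)" for ze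
 define C1 where "C1 w = (LINT om|M. of_real (S om) * exp (w * of_real (S om)))" for w :: complex
 have E:"0 < E" by (simp add:E_def weighted_mgf_0_pos)
 have dG:"(G has_field_derivative (C1 (of_real xi+ze)-of_real m * cmgf (of_real xi+ze))/of_real E * exp (- ze * of_real m)) (at ze)" for ze
 proof -
 have "((%ze. cmgf (of_real xi+ze)) has_field_derivative C1 (of_real xi+ze)*(0+1)) (at ze)"
 by (rule DERIV_chain2[OF has_field_derivative_cmgf[folded C1_def] DERIV_add[OF DERIV_const DERIV_ident]])
 thus ?thesis unfolding G_def[abs_def] using E
 by (auto intro!:derivative_eq_intros simp:field_simps)
 qed
 have A:"cmod (G ze)<=exp (K * r^2/2)" if ze:"cmod ze < r" for ze
 proof -
 let ?s = "Re ze"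
 have s:"abs ?s<=r" using abs_Re_le_cmod[of ze] ze by linarith
 have "cmod (G ze)<=weighted_mgf 0 (xi+?s)/E * exp (- ?s * m)"
 using norm_cmgf_le[of "of_real xi+ze"] E by (simp add:G_def norm_mult norm_divide divide_right_mono)
 also have "... = exp (ln (weighted_mgf 0 (xi+?s))-ln E-?s * m)"
 using E weighted_mgf_0_pos[of "xi+?s"] by (simp add:exp_diff exp_minus divide_inverse)
 also have "...<=exp (K*?s^2/2)"
 using ln_mgf_quadratic[of r xi K ?s] K s by (simp add:E_def m_def)
 also have "...<=exp (K * r^2/2)"
 using K0 s r by (auto intro!:mult_left_mono power_mono simp:abs_le_square_iff[symmetric])
 finally show ?thesis .
 qed
 have hG:"G holomorphic_on ball 0 r" using dG by (auto simp:holomorphic_on_open)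
 have nzG:"G z ~= 0" if "norm z < r" for z using nz[OF that] E by (simp add:G_def)
 have G0:"G 0 = 1" using E by (simp add:G_def cmgf_of_real E_def)
 have K':"0 < K * r^2/2" using K0 r by simp
 have "\<exists>g. g holomorphic_on ball 0 r & (\<forall>z. norm z < r --> exp (g z) = G z) & g 0 = 0 \<and>
 (\<forall>z. norm z<=r/4 --> cmod ((deriv ^^ 3) g z)<=1536*(K * r^2/2)/r ^ 3)"
 by (rule holomorphic_log_third_order[OF r hG nzG G0 K' A]) (assumption | blast)+
 then obtain g where holg:"g holomorphic_on ball 0 r" and eg:"!!z. norm z < r ==> exp (g z) = G z" and g0:"g 0 = 0"
 and g3:"!!z. norm z<=r/4 ==> cmod ((deriv ^^ 3) g z)<=1536*(K * r^2/2)/r ^ 3" by blast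
 have B:"1536*(K * r^2/2)/r ^ 3 = 768 * K/r" using r by (simp add:power3_eq_cube power2_eq_square)
 have dg:"(g has_field_derivative deriv g z) (at z)" "(deriv g has_field_derivative deriv (deriv g) z) (at z)" if "norm z < r" for z
 using that holg by (auto intro!:holomorphic_derivI[of _ "ball 0 r"] holomorphic_intros)
 have dg_eq:"deriv g z = C1 (of_real xi+z)/cmgf (of_real xi+z)-of_real m" if z:"norm z < r" for z
 proof -
 have "((%z. exp (g z)) has_field_derivative exp (g z) * deriv g z) (at z)"
 by (rule DERIV_chain2[OF DERIV_exp dg(1)[OF z]])
 hence "(G has_field_derivative exp (g z) * deriv g z) (at z)"
 by (rule has_field_derivative_transform_within_open[where S = "ball 0 r"]) (use z eg in auto)
 from DERIV_unique[OF this dG] have "G z * deriv g z = (C1 (of_real xi+z)-of_real m * cmgf (of_real xi+z))/of_real E * exp (- z * of_real m)"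
 by (simp only: eg[OF z])
 hence "cmgf (of_real xi+z) * deriv g z*(exp (- z * of_real m)/of_real E)
 = (C1 (of_real xi+z)-of_real m * cmgf (of_real xi+z))*(exp (- z * of_real m)/of_real E)"
 by (simp add:G_def mult_ac)
 hence "cmgf (of_real xi+z) * deriv g z = C1 (of_real xi+z)-of_real m * cmgf (of_real xi+z)"
 using E by (simp only: mult_cancel_right) simp
 thus ?thesis using nz[OF z] by (simp add:field_simps)
 qed
 have real_z:"norm (complex_of_real s) < r" if "abs s < r" for s using that by simp
 have dg_real:"deriv g (of_real s) = of_real (tilted_mean (xi+s)-m)" if "abs s < r" for s
 unfolding dg_eq[OF real_z[OF that]] C1_def of_real_add[symmetric] cmgf_of_real by (simp add:tilted_mean_def)
 have d2g:"deriv (deriv g) (of_real s) = of_real (tilted_variance (xi+s))" if s:"abs s < r" for s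
 proof -
 have 1:"((%s. deriv g (of_real s)) has_vector_derivative deriv (deriv g) (of_real s)) (at s)"
 by (rule has_vector_derivative_real_field[OF dg(2)[OF real_z[OF s]]])
 have "((%s. tilted_mean (xi+s)-m) has_real_derivative tilted_variance (xi+s)) (at s)"
 using DERIV_chain2[OF has_real_derivative_tilted_mean DERIV_add[OF DERIV_const DERIV_ident],of xi s]
 by (auto intro!:derivative_eq_intros)
 hence "((%s. complex_of_real (tilted_mean (xi+s)-m)) has_vector_derivative of_real (tilted_variance (xi+s))) (at s)"
 by (intro has_vector_derivative_of_real) (simp add:has_real_derivative_iff_has_vector_derivative)
 hence 2:"((%s. deriv g (of_real s)) has_vector_derivative of_real (tilted_variance (xi+s))) (at s)"
 by (rule has_vector_derivative_transform_within_open[where S = "{-r<..<r}"]) (use s dg_real in auto)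
 show ?thesis using vector_derivative_unique_at[OF 1 2] .
 qed
 note bounds = holomorphic_third_order_bounds[OF r holg g3,unfolded B]
 have z0:"deriv g 0 = 0" "deriv (deriv g) 0 = of_real (tilted_variance xi)"
 using dg_real[of 0] d2g[of 0] r by (simp_all add:m_def)
 show ?thesis
 proof (rule that)
 show "exp (g ze) = cmgf (of_real xi+ze)/of_real (weighted_mgf 0 xi) * exp (- ze * of_real (tilted_mean xi))" if "cmod ze < r" for ze
 using eg[OF that] by (simp add:G_def E_def m_def)
 show "cmod (g ze-of_real (tilted_variance xi) * ze^2/2)<=768 * K/r * cmod ze ^ 3" if "cmod ze<=r/4" for ze
 using bounds(1)[of ze] that by (simp add:g0 z0)
 show "abs (tilted_variance (xi+s)-tilted_variance xi)<=768 * K/r * abs s" if s:"abs s<=r/4" for s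
 proof -
 have s':"abs s < r" using s r by linarith
 have "cmod (deriv (deriv g) (of_real s)-deriv (deriv g) 0)<=768 * K/r * cmod (of_real s)"
 by (rule bounds(2)) (use s in auto)
 thus ?thesis unfolding d2g[OF s'] z0 norm_of_real of_real_diff[symmetric] .
 qed
 qed
qed

end

section \<open>Decay away from angle 0\<close>

lemma gaussian_integral:
 assumes b:"0 < b"
 shows "(LINT x|lborel. exp (- b*(x-m)^2)) = sqrt (pi/b)"
proof -
 let ?s = "1/sqrt (2 * b)"
 have s:"0 < ?s" using b by simp
 have "exp (- b*(x-m)^2) = sqrt (pi/b) * normal_density m ?s x" for x
 proof -
 have "2 * pi*?s^2 = pi/b" using b by (simp add:power_divide)
 moreover have "(x-m)^2/(2*?s^2) = b*(x-m)^2" using b by (simp add:power_divide)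
 moreover have "sqrt (pi/b) ~= 0" using b by simp
 ultimately show ?thesis unfolding normal_density_def minus_divide_left[symmetric] by simp
 qed
 thus ?thesis using integral_normal_density[OF s,of m] by simp
qed

lemma integrable_gaussian:
 assumes b:"0 < b"
 shows "integrable lborel (%x. exp (- b*(x-m)^2) :: real)"
proof (rule ccontr)
 assume "\<not> ?thesis"
 hence "(LINT x|lborel. exp (- b*(x-m)^2)) = 0" by (rule not_integrable_integral_eq)
 thus False using gaussian_integral[OF b,of m] b by simp
qed

context elliptic_functional
begin

text \<open>Dini's argument: continuous functions that increase in \<open>N\<close> and diverge at
  each point of a compact set diverge uniformly on it.\<close>

lemma Dsum_uniform:
 assumes I:"compact I" and inf:"!!th. th : I ==> filterlim (%N. Dsum N th) at_top sequentially"
 shows "\<exists>n. \<forall>N\<ge>n. \<forall>th\<in>I. b < Dsum N th"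
proof -
 define U where "U N = {th. b < Dsum N th}" for N
 have op:"open (U N)" for N
 unfolding U_def using continuous_on_Dsum[of UNIV N] by (intro open_Collect_less continuous_on_const) auto
 have cov:"I \<subseteq> (\<Union>N\<in>UNIV. U N)"
 proof
 fix th assume "th : I"
 hence "\<forall>\<^sub>F N in sequentially. b < Dsum N th" using inf by (simp add:filterlim_at_top_dense)
 then obtain N where "b < Dsum N th" by (auto simp:eventually_sequentially)
 thus "th : (\<Union>N\<in>UNIV. U N)" by (auto simp:U_def)
 qed
 obtain J where J:"finite J" "I \<subseteq> (\<Union>N\<in>J. U N)"
 using compactE_image[OF I,of UNIV U] op cov by metis
 show ?thesis
 proof (intro exI allI impI ballI)
 fix N th assume N:"Max (insert 0 J)<=N" and "th : I"
 then obtain j where j:"j : J" "b < Dsum j th" using J by (auto simp:U_def)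
 have "j<=N" using Max_ge[of "insert 0 J" j] J(1) j(1) N by simp
 thus "b < Dsum N th" using j(2) Dsum_mono[of j N th] by linarith
 qed
qed

text \<open>Around the minimum \<open>t\<close> on a short interval, near-subadditivity and
  \<open>Dsum_scale\<close> make \<open>Dsum\<close> grow quadratically at a rate given by
  \<open>Dsum N th0\<close>. The Gaussian integral is of order one over the square root of
  \<open>Dsum N th0\<close>, just what the factor \<open>sg N\<close> consumes, and
  \<open>exp (- c * A/3)\<close> remains.\<close>

lemma interval_exp_Dsum_le:
 assumes c:"0 < c" and th:"0 < th0" "6 * L * th0<=1" and D:"0 < Dsum N th0"
 and A:"!!th. th : {al..al+th0} ==> A<=Dsum N th"
 shows "(LINT th|lborel. indicator {al..al+th0} th * exp (- c * Dsum N th))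
<=exp (- c * A/3) * sqrt (12 * pi * th0^2/(c * Dsum N th0))"
proof -
 define I where "I = {al..al+th0}"
 define b where "b = c * Dsum N th0/(12 * th0^2)"
 have b:"0 < b" using c th D by (simp add:b_def)
 obtain t where t:"t : I" "!!th. th : I ==> Dsum N t<=Dsum N th"
 using continuous_attains_inf[of I "Dsum N"] continuous_on_Dsum[of I N] th by (auto simp:I_def)
 have le:"indicator I th * exp (- c * Dsum N th)<=exp (- c * A/3) * exp (- b*(th-t)^2)" for th
 proof (cases "th : I")
 case True
 have h:"abs (th-t)<=th0" using True t(1) by (auto simp:I_def)
 have "((th-t)/th0)^2/2 * Dsum N th0<=Dsum N (th-t)"
 by (rule Dsum_scale[OF th(2,1) h])
 also have "...<=2 * Dsum N th+2 * Dsum N t" using Dsum_add[of N "th-t" t] by simp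
 finally have "((th-t)/th0)^2/2 * Dsum N th0<=2 * Dsum N th+2 * Dsum N t" .
 moreover have "A<=Dsum N t" "Dsum N t<=Dsum N th" using A t True by (auto simp:I_def)
 \<comment> \<open>\<open>Dsum\<close> at the point is at least \<open>A\<close> and at least a
   quarter of the quadratic term; the weights \<open>1/3\<close> and \<open>2/3\<close> combine both
   bounds.\<close>
 ultimately have "A/3+((th-t)/th0)^2/2 * Dsum N th0/6<=Dsum N th" by linarith
 from mult_left_mono[OF this,of c] c
 have "c * A/3+c*(((th-t)/th0)^2/2 * Dsum N th0/6)<=c * Dsum N th" by (simp add:distrib_left)
 also have "c*(((th-t)/th0)^2/2 * Dsum N th0/6) = b*(th-t)^2" by (simp add:b_def power_divide)
 finally show ?thesis using True by (simp add:exp_add[symmetric])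
 qed simp
 have int:"integrable lborel (%th. exp (- c * A/3) * exp (- b*(th-t)^2))"
 using integrable_gaussian[OF b] by (rule integrable_mult_right)
 have "(LINT th|lborel. indicator I th * exp (- c * Dsum N th))<=(LINT th|lborel. exp (- c * A/3) * exp (- b*(th-t)^2))"
 using le by (intro integral_mono_AE' int AE_I2) (auto simp:indicator_def)
 also have "... = exp (- c * A/3) * sqrt (pi/b)" by (simp only: integral_mult_right_zero gaussian_integral[OF b])
 also have "pi/b = 12 * pi * th0^2/(c * Dsum N th0)" using c D th by (simp add:b_def)
 finally show ?thesis unfolding I_def .
qed

lemma integrable_interval_exp_Dsum:"integrable lborel (%th. indicator {u..v} th * exp (- c * Dsum N th))"
 using borel_integrable_compact[of "{u..v}" "%th. exp (- c * Dsum N th)"] continuous_on_Dsum[of "{u..v}" N]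
 by (simp add:continuous_intros)

lemma interval_exp_Dsum_limit:
 assumes c:"0 < c" and th:"0 < th0" "6 * L * th0<=1"
 and sg:"\<forall>\<^sub>F N in sequentially. 0 < Dsum N th0 & 0<=sg N & sg N<=C * sqrt (Dsum N th0)"
 and inf:"!!th. th : {al..al+th0} ==> filterlim (%N. Dsum N th) at_top sequentially"
 shows "(%N. sg N*(LINT th|lborel. indicator {al..al+th0} th * exp (- c * Dsum N th))) ----> 0"
proof (rule tendstoI)
 fix e :: real assume e:"0 < e"
 define k where "k = abs C * sqrt (12 * pi * th0^2/c)+1"
 have k:"0 < k" using c by (simp add:k_def add_nonneg_pos)
 \<comment> \<open>Chosen so that \<open>exp (- c * A/3)\<close> equals \<open>e/k\<close>.\<close>
 define A where "A = 3/c * ln (k/e)"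
 obtain n where n:"!!N th. n<=N ==> th : {al..al+th0} ==> A < Dsum N th"
 using Dsum_uniform[of "{al..al+th0}" A] inf by blast
 from sg eventually_ge_at_top[of n]
 show "\<forall>\<^sub>F N in sequentially. dist (sg N*(LINT th|lborel. indicator {al..al+th0} th * exp (- c * Dsum N th))) 0 < e"
 proof eventually_elim
 case (elim N)
 define J where "J = (LINT th|lborel. indicator {al..al+th0} th * exp (- c * Dsum N th))"
 have J0:"0<=J" unfolding J_def by (intro integral_nonneg_AE AE_I2) auto
 define q where "q = 12 * pi * th0^2/c"
 have "J<=exp (- c * A/3) * sqrt (12 * pi * th0^2/(c * Dsum N th0))"
 unfolding J_def using n[of N] elim by (intro interval_exp_Dsum_le[OF c th]) (auto intro:less_imp_le)
 also have "exp (- c * A/3) = e/k" using c k e by (simp add:A_def exp_minus)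
 also have "12 * pi * th0^2/(c * Dsum N th0) = q/Dsum N th0" by (simp add:q_def)
 finally have J:"J<=e/k*(sqrt q/sqrt (Dsum N th0))" by (simp only: real_sqrt_divide)
 have "sg N * J<=(abs C * sqrt (Dsum N th0))*(e/k*(sqrt q/sqrt (Dsum N th0)))"
 proof (rule mult_mono[OF _ J _ J0])
 have "C * sqrt (Dsum N th0)<=abs C * sqrt (Dsum N th0)" by (intro mult_right_mono) auto
 thus "sg N<=abs C * sqrt (Dsum N th0)" using elim by linarith
 qed auto
 also have "... = e/k*(abs C * sqrt q)" using elim by simp
 also have "... < e/k * k" using e k by (intro mult_strict_left_mono) (auto simp:k_def q_def)
 also have "... = e" using k by simp
 finally show ?case using elim J0 unfolding J_def[symmetric] by (simp add:dist_real_def abs_mult)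
 qed
qed

text \<open>A finite cover by intervals of length \<open>th0\<close>. They may stick out of
  \<open>{-T..T}\<close>, so divergence is required up to \<open>T+th0\<close>.\<close>

lemma far_limit:
 assumes c:"0 < c" and th:"0 < th0" "6 * L * th0<=1"
 and sg:"\<forall>\<^sub>F N in sequentially. 0 < Dsum N th0 & 0<=sg N & sg N<=C * sqrt (Dsum N th0)"
 and inf:"!!th. th0<=abs th ==> abs th<=T+th0 ==> filterlim (%N. Dsum N th) at_top sequentially"
 shows "(%N. sg N*(LINT th|lborel. indicator ({-T..T} - {-th0..th0}) th * exp (- c * Dsum N th))) ----> 0"
proof (rule tendsto_sandwich[where f = "%_. 0"])
 define I where "I j = {of_int j * th0..of_int j * th0+th0}" for j :: int
 \<comment> \<open>The intervals for \<open>- 1\<close> and \<open>0\<close> make up the removed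
   neighbourhood of 0 and are left out; all others keep distance \<open>th0\<close> from 0.\<close>
 define J where "J = {j. I j \<inter> ({-T..T} - {-th0..th0}) ~= {} & j ~= -1 & j ~= 0}"
 have finJ:"finite J"
 proof (rule finite_subset)
 show "J \<subseteq> {\<lfloor>- T/th0\<rfloor> - 1..\<lceil>T/th0\<rceil>}"
 proof
 fix j assume "j : J"
 then obtain t where t:"of_int j * th0<=t" "t<=of_int j * th0+th0" "- T<=t" "t<=T" by (auto simp:J_def I_def)
 have "of_int j<=T/th0" using t th by (simp add:le_divide_eq)
 moreover have "- T/th0<=of_int j+1" 
 proof -
 have "- T<=(of_int j+1) * th0" using t by (simp add:distrib_right)
 thus ?thesis using th(1) by (simp only: pos_divide_le_eq)
 qed
 ultimately show "j : {\<lfloor>- T/th0\<rfloor> - 1..\<lceil>T/th0\<rceil>}" by simp linarith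
 qed
 qed simp
 define h where "h N j = (LINT th|lborel. indicator (I j) th * exp (- c * Dsum N th))" for N j
 have "(%N. \<Sum>j\<in>J. sg N * h N j) ----> (\<Sum>j\<in>J. 0)"
 proof (rule tendsto_sum)
 fix j assume j:"j : J"
 show "(%N. sg N * h N j) ----> 0"
 unfolding h_def I_def
 proof (rule interval_exp_Dsum_limit[OF c th sg])
 fix th assume "th : {of_int j * th0..of_int j * th0+th0}"
 hence t:"of_int j * th0<=th" "th<=of_int j * th0+th0" by auto
 obtain s where "s : I j" "s : {-T..T}" using j unfolding J_def by blast
 hence s:"of_int j * th0<=s" "s<=of_int j * th0+th0" "abs s<=T" by (auto simp:I_def)
 have u:"abs th<=T+th0" using s t by linarith
 have "th0<=abs th"
 proof (cases "1<=j")
 case True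
 hence "1 * th0<=of_int j * th0" using th by (intro mult_right_mono) auto
 thus ?thesis using t by linarith
 next
 case False
 hence "j<=-2" using j by (auto simp:J_def)
 hence "real_of_int j * th0<=(-2) * th0" using th by (intro mult_right_mono) auto
 thus ?thesis using t by linarith
 qed
 thus "filterlim (%N. Dsum N th) at_top sequentially" using u by (rule inf)
 qed
 qed
 thus "(%N. \<Sum>j\<in>J. sg N * h N j) ----> 0" by simp
 have le:"(LINT th|lborel. indicator ({-T..T} - {-th0..th0}) th * exp (- c * Dsum N th))<=(\<Sum>j\<in>J. h N j)" for N
 proof -
 have "(LINT th|lborel. indicator ({-T..T} - {-th0..th0}) th * exp (- c * Dsum N th))
<=(LINT th|lborel. (\<Sum>j\<in>J. indicator (I j) th * exp (- c * Dsum N th)))"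
 proof (rule integral_mono_AE')
 show "integrable lborel (%th. \<Sum>j\<in>J. indicator (I j) th * exp (- c * Dsum N th))"
 unfolding I_def by (intro LINT_integrable_sum integrable_interval_exp_Dsum)
 show "AE th in lborel. indicator ({-T..T} - {-th0..th0}) th * exp (- c * Dsum N th)<=(\<Sum>j\<in>J. indicator (I j) th * exp (- c * Dsum N th))"
 proof (rule AE_I2)
 fix th
 show "indicator ({-T..T} - {-th0..th0}) th * exp (- c * Dsum N th)<=(\<Sum>j\<in>J. indicator (I j) th * exp (- c * Dsum N th))"
 proof (cases "th : {-T..T} - {-th0..th0}")
 case True
 define j where "j = \<lfloor>th/th0\<rfloor>"
 have fl:"of_int j<=th/th0" "th/th0<=of_int j+1" unfolding j_def by linarith+
 hence Ij:"th : I j" using th by (simp add:I_def le_divide_eq divide_le_eq distrib_right)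
 have "j ~= - 1" "j ~= 0" using Ij True by (auto simp:I_def)
 hence j:"j : J" using Ij True unfolding J_def by blast
 have "indicator (I j) th * exp (- c * Dsum N th)<=(\<Sum>j\<in>J. indicator (I j) th * exp (- c * Dsum N th))"
 by (rule member_le_sum[OF j _ finJ]) auto
 thus ?thesis using True Ij by simp
 qed (auto intro:sum_nonneg)
 qed
 qed (auto intro!:sum_nonneg)
 also have "... = (\<Sum>j\<in>J. h N j)"
 unfolding h_def I_def by (intro LINT_sum integrable_interval_exp_Dsum)
 finally show ?thesis .
 qed
 show "\<forall>\<^sub>F N in sequentially. sg N*(LINT th|lborel. indicator ({-T..T} - {-th0..th0}) th * exp (- c * Dsum N th))<=(\<Sum>j\<in>J. sg N * h N j)"
 using sg unfolding sum_distrib_left[symmetric] by eventually_elim (intro mult_left_mono le,simp)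
 show "\<forall>\<^sub>F N in sequentially. 0<=sg N*(LINT th|lborel. indicator ({-T..T} - {-th0..th0}) th * exp (- c * Dsum N th))"
 using sg by eventually_elim (auto intro!:mult_nonneg_nonneg integral_nonneg_AE)
qed (rule tendsto_const)

end

section \<open>Expansions uniform in the tilt and in time\<close>

context elliptic_process
begin

lemma bounded_variable_S:"bounded_variable M (S N) (real N * L)"
 by (intro bounded_variable.intro bounded_variable_axioms.intro prob_space_axioms abs_S_le) measurable

definition tmean ::"nat => real => real" where
 "tmean N = bounded_variable.tilted_mean M (S N)"

lemma Z_eq_weighted_mgf:"Z N = bounded_variable.weighted_mgf M (S N) 0"
 and Zc_eq_cmgf:"Zc N = bounded_variable.cmgf M (S N)"
 by (simp_all add:fun_eq_iff Z_def Zc_def bounded_variable.weighted_mgf_def[OF bounded_variable_S] bounded_variable.cmgf_def[OF bounded_variable_S])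

lemma kappa2_eq_tilted_variance:"kappa2 N = bounded_variable.tilted_variance M (S N)"
proof
 fix xi
 interpret S: bounded_variable M "S N" "real N * L" by (rule bounded_variable_S)
 have Z:"S.weighted_mgf 0 xi = Z N xi" by (simp add:Z_eq_weighted_mgf)
 have m:"(LINT om|Mtilt N xi. S N om) = S.tilted_mean xi"
 unfolding S.tilted_mean_def Z by (subst integral_Mtilt) (simp_all add:S.weighted_mgf_def mult.commute)
 show "kappa2 N xi = S.tilted_variance xi"
 unfolding kappa2_def m S.tilted_variance_eq Z by (subst integral_Mtilt) (simp_all add:mult.commute)
qed

text \<open>\<open>Dsum\<close> at one small angle serves as a common yardstick: the variances of
  all tilts in \<open>{-R..R}\<close> are comparable to it, hence to each other.\<close>

lemma kappa2_comparison:
 assumes R:"0<=R" and th:"0 < th" "6 * L * th<=1"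
 obtains c1 c2 where "0 < c1" "0 < c2"
 "!!N xi. abs xi<=R ==> c1 * Dsum N th<=kappa2 N xi & kappa2 N xi<=c2*(Dsum N th+1)"
proof (rule that)
 define v where "v = abs (var_const R th*(2/ep ^ 3))"
 show "0 < decay R/(2 * th^2)" using decay_pos[OF R] th by simp
 define l where "l = 2*(9 * L)^2"
 have l:"0 < l" using L_pos by (simp add:l_def)
 show "0 < v+l" using l by (intro add_nonneg_pos) (auto simp:v_def)
 fix N xi assume xi:"abs xi<=R"
 have "var_const R th*(2/ep ^ 3 * Dsum N th)<=v * Dsum N th"
 unfolding mult.assoc[symmetric] v_def by (intro mult_right_mono abs_ge_self Dsum_nonneg)
 moreover have "0<=v" "0<=l * Dsum N th" using l by (simp_all add:v_def)
 ultimately have "kappa2 N xi<=v * Dsum N th+l+v+l * Dsum N th"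
 using kappa2_upper[OF xi th,of N,folded l_def] by linarith
 hence "kappa2 N xi<=(v+l)*(Dsum N th+1)" by (simp add:algebra_simps)
 thus "decay R/(2 * th^2) * Dsum N th<=kappa2 N xi & kappa2 N xi<=(v+l)*(Dsum N th+1)"
 using kappa2_lower[OF xi th] by blast
qed

lemma exp_radius:
 assumes e:"0 < e"
 obtains r where "0 < r" "r<=1" "!!s. abs s<=r ==> exp (2 * L * abs s)-1<=e"
proof (rule that)
 define r where "r = min 1 (ln (1+e)/(2 * L))"
 show "0 < r" "r<=1" using e L_pos by (auto simp:r_def)
 fix s assume "abs s<=r"
 hence "2 * L * abs s<=ln (1+e)" using L_pos by (simp add:r_def le_divide_eq mult.commute)
 hence "exp (2 * L * abs s)<=exp (ln (1+e))" by (simp only: exp_le_cancel_iff)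
 thus "exp (2 * L * abs s)-1<=e" using e by simp
qed

lemma tilt_eps_pos:"0<=R ==> 0 < tilt_eps R" "0<=R ==> tilt_eps R < 1"
proof -
 assume "0<=R"
 then interpret T: elliptic_functional B mu "ptilt 0 0" "tilt_eps R" f L by (intro ptilt_elliptic) simp
 show "0 < tilt_eps R" "tilt_eps R < 1" by (rule T.eps)+
qed

text \<open>The radius does not depend on \<open>N\<close>, because \<open>Zc\<close> has no zeros
  there. Only the existence of a logarithm \<open>w\<close> at each point is recorded, so no branch
  has to be carried along.\<close>

lemma log_mgf_expansion_uniform:
 assumes R:"0<=R" and th:"0 < th" "6 * L * th<=1"
 obtains r C where "0 < r" "0 < C"
 "!!N xi ze. abs xi<=R ==> cmod ze<=r ==> \<exists>w. exp w = Zc N (of_real xi+ze)/of_real (Z N xi) * exp (- ze * of_real (tmean N xi)) \<and>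
 cmod (w-of_real (kappa2 N xi) * ze^2/2)<=C*(Dsum N th+1) * cmod ze ^ 3"
 "!!N xi s. abs xi<=R ==> abs s<=r ==> abs (kappa2 N (xi+s)-kappa2 N xi)<=C*(Dsum N th+1) * abs s"
proof -
 define be where "be = tilt_eps R/4"
 note te = tilt_eps_pos[OF R]
 have be:"0 < be" "be<=tilt_eps R/4" "be < 1" using te by (auto simp:be_def)
 obtain r where r:"0 < r" "r<=1" "!!s. abs s<=r ==> exp (2 * L * abs s)-1<=tilt_eps R * be/6"
 using exp_radius[of "tilt_eps R * be/6"] te be by auto
 obtain c2 where c2:"0 < c2" "!!N xi. abs xi<=R+1 ==> kappa2 N xi<=c2*(Dsum N th+1)"
 using kappa2_comparison[of "R+1" th] R th by (metis add_nonneg_nonneg zero_le_one)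
 obtain om where om:"om : space M" using not_empty by blast
 \<comment> \<open>A zero would make the relative distance to the nonzero \<open>tiltW\<close> at
   some starting state equal to 1, but it is at most \<open>be < 1\<close>.\<close>
 have nz:"Zc N (of_real xi+ze) ~= 0" if xi:"abs xi<=R" and ze:"cmod ze < r" for N xi ze
 proof
 assume "Zc N (of_real xi+ze) = 0"
 moreover have "exp (2 * L * cmod ze)-1<=tilt_eps R * be/6" using r(3)[of "cmod ze"] ze by simp
 ultimately have "cmod (tiltW N xi ze (X 0 om))<=be * cmod (tiltW N xi ze (X 0 om))" "tiltW N xi ze (X 0 om) ~= 0"
 using tiltW_close_to_Zc[OF xi be(1,2) _ X_space[OF om],of ze N] tiltW_relative_oscillation(1)[OF xi be(1,2) _ X_space[OF om] X_space[OF om],of ze N]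
 by auto
 thus False using be(3) by simp
 qed
 define C where "C = 768 * c2/r"
 have main:"\<exists>g. (\<forall>ze. cmod ze < r --> exp (g ze) = Zc N (of_real xi+ze)/of_real (Z N xi) * exp (- ze * of_real (tmean N xi))) \<and>
 (\<forall>ze. cmod ze<=r/4 --> cmod (g ze-of_real (kappa2 N xi) * ze^2/2)<=C*(Dsum N th+1) * cmod ze ^ 3) \<and>
 (\<forall>s. abs s<=r/4 --> abs (kappa2 N (xi+s)-kappa2 N xi)<=C*(Dsum N th+1) * abs s)" if xi:"abs xi<=R" for N xi
 proof -
 interpret S: bounded_variable M "S N" "real N * L" by (rule bounded_variable_S)
 have K:"0 < c2*(Dsum N th+1)" using c2(1) Dsum_nonneg[of N th] by (intro mult_pos_pos) linarith+
 have up:"S.tilted_variance (xi+s)<=c2*(Dsum N th+1)" if "abs s<=r" for s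
 using c2(2)[of "xi+s" N] xi that r(2) by (simp add:kappa2_eq_tilted_variance)
 have e:"768*(c2*(Dsum N th+1))/r = C*(Dsum N th+1)" by (simp add:C_def)
 show ?thesis
 by (rule S.log_mgf_expansion[OF r(1) K up nz[OF xi,unfolded Zc_eq_cmgf],unfolded e])
 (auto simp:Zc_eq_cmgf Z_eq_weighted_mgf kappa2_eq_tilted_variance tmean_def)
 qed
 show ?thesis
 proof (rule that[of "r/4" C])
 show "0 < r/4" "0 < C" using r c2 by (auto simp:C_def)
 show "\<exists>w. exp w = Zc N (of_real xi+ze)/of_real (Z N xi) * exp (- ze * of_real (tmean N xi)) \<and>
 cmod (w-of_real (kappa2 N xi) * ze^2/2)<=C*(Dsum N th+1) * cmod ze ^ 3"
 if "abs xi<=R" "cmod ze<=r/4" for N xi ze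
 proof -
 have "cmod ze < r" using that r by linarith
 with main[OF that(1),of N] that(2) show ?thesis by blast
 qed
 show "abs (kappa2 N (xi+s)-kappa2 N xi)<=C*(Dsum N th+1) * abs s" if "abs xi<=R" "abs s<=r/4" for N xi s
 using main[OF that(1),of N] that(2) by blast
 qed
qed

end

section \<open>Local limit theorem for the tilted chain\<close>

text \<open>\<open>D N\<close> is the tilted law of the sum started at \<open>x\<close>, specified
  only through its characteristic function since that process lives on another space. Centring and
  scaling come from the initial law, so they are the same for all \<open>x\<close>.\<close>

locale tilted_laws = elliptic_process +
 fixes R th0 :: real and xi ::"nat => real" and x :: 'a and D ::"nat => real measure"
 assumes xi:"!!N. abs (xi N)<=R" and theta0:"0 < th0" "6 * L * th0<=1" and x:"x : space (B 0)"
 and top:"filterlim (%N. Dsum N th0) at_top sequentially"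
 and D:"!!N. real_distribution (D N)"
 and char_D:"!!N th. char (D N) th = tiltW N (xi N) (\<i> * of_real th) x * exp (- (\<i> * of_real th) * of_real (tmean N (xi N)))"
begin

definition sg ::"nat => real" where "sg N = sqrt (kappa2 N (xi N))"

lemma R_nonneg:"0<=R"
 using xi[of 0] by linarith

lemma norm_char_le:"cmod (char (D N) th)<=exp (- decay R * Dsum N th)"
proof -
 have w:"0 < W N 0 (xi N) x" by (rule W_pos[OF x])
 have "cmod (char (D N) th) = cmod (W N 0 (of_real (xi N)+\<i> * of_real th) x)/W N 0 (xi N) x"
 using w by (simp add:char_D tiltW_def norm_mult norm_divide)
 also have "...<=exp (- decay R * Dsum N th)"
 using norm_W_tilt_le[OF xi x,of N N th] w by (simp add:decay_def pos_divide_le_eq mult.commute)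
 finally show ?thesis .
qed

lemma comparison:
 obtains c1 c2 where "0 < c1" "0 < c2"
 "!!N. 1<=Dsum N th0 ==> sqrt (c1 * Dsum N th0)<=sg N & sg N<=sqrt (c2 * Dsum N th0) & (sg N)^2 = kappa2 N (xi N) & 0 < sg N"
proof -
 obtain c1 c2 where c:"0 < c1" "0 < c2"
 "!!N xi. abs xi<=R ==> c1 * Dsum N th0<=kappa2 N xi & kappa2 N xi<=c2*(Dsum N th0+1)"
 using kappa2_comparison[OF R_nonneg theta0] by metis
 show ?thesis
 proof (rule that[of c1 "2 * c2"])
 fix N assume D1:"1<=Dsum N th0"
 have le:"c1 * Dsum N th0<=kappa2 N (xi N)" "kappa2 N (xi N)<=c2*(Dsum N th0+1)" using c(3)[OF xi[of N],of N] by auto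
 have "c2*(Dsum N th0+1)<=c2*(2 * Dsum N th0)" using D1 c(2) by (intro mult_left_mono) auto
 moreover have "0 < c1 * Dsum N th0" using c(1) D1 by (intro mult_pos_pos) auto
 ultimately show "sqrt (c1 * Dsum N th0)<=sg N & sg N<=sqrt (2 * c2 * Dsum N th0) & (sg N)^2 = kappa2 N (xi N) & 0 < sg N"
 using le by (simp add:sg_def)
 qed (use c in auto)
qed

lemma sigma_top:"filterlim sg at_top sequentially"
proof -
 obtain c1 c2 where c:"0 < c1" "!!N. 1<=Dsum N th0 ==> sqrt (c1 * Dsum N th0)<=sg N"
 using comparison by metis
 have "filterlim (%N. sqrt (c1 * Dsum N th0)) at_top sequentially"
 using c(1) top by (intro filterlim_compose[OF sqrt_at_top] filterlim_tendsto_pos_mult_at_top[OF tendsto_const]) auto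
 moreover have "\<forall>\<^sub>F N in sequentially. sqrt (c1 * Dsum N th0)<=sg N"
 using top[unfolded filterlim_at_top,rule_format,of 1] by eventually_elim (rule c(2))
 ultimately show ?thesis by (rule filterlim_at_top_mono)
qed

lemma char_central_limit:"(%N. char (D N) (t/sg N)) ----> of_real (exp (- t\<^sup>2/2))"
proof -
 obtain r C where r:"0 < r" "0 < C" and ex:"!!N xi ze. abs xi<=R ==> cmod ze<=r ==>
 \<exists>w. exp w = Zc N (of_real xi+ze)/of_real (Z N xi) * exp (- ze * of_real (tmean N xi)) \<and>
 cmod (w-of_real (kappa2 N xi) * ze^2/2)<=C*(Dsum N th0+1) * cmod ze ^ 3"
 using log_mgf_expansion_uniform[OF R_nonneg theta0] by metis
 obtain c1 c2 where c:"0 < c1" "0 < c2" "!!N. 1<=Dsum N th0 ==> sqrt (c1 * Dsum N th0)<=sg N & sg N<=sqrt (c2 * Dsum N th0) & (sg N)^2 = kappa2 N (xi N) & 0 < sg N"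
 using comparison by metis
 define ze where "ze N = \<i> * of_real (t/sg N)" for N
 define A where "A N = Zc N (of_real (xi N)+ze N)/of_real (Z N (xi N)) * exp (- ze N * of_real (tmean N (xi N)))" for N
 have ns:"cmod (ze N) = abs t/sg N" if "0 < sg N" for N using that by (simp add:ze_def norm_mult norm_divide)
 have small:"\<forall>\<^sub>F N in sequentially. cmod (ze N)<=e" if "0 < e" for e
 proof -
 have "(%N. t/sg N) ----> 0" by (intro real_tendsto_divide_at_top[OF tendsto_const] sigma_top)
 from tendstoD[OF this that] show ?thesis by eventually_elim (simp add:ze_def norm_mult norm_divide less_imp_le)
 qed
 have D1:"\<forall>\<^sub>F N in sequentially. 1<=Dsum N th0" using top[unfolded filterlim_at_top,rule_format,of 1] .
 define w where "w N = (SOME w. exp w = A N & cmod (w-of_real (kappa2 N (xi N))*(ze N)^2/2)<=C*(Dsum N th0+1) * cmod (ze N) ^ 3)" for N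
 have w:"exp (w N) = A N & cmod (w N-of_real (kappa2 N (xi N))*(ze N)^2/2)<=C*(Dsum N th0+1) * cmod (ze N) ^ 3"
 if "cmod (ze N)<=r" for N
 unfolding w_def A_def by (rule someI_ex[OF ex[OF xi that]])
 have wlim:"w ----> of_real (- t\<^sup>2/2)"
 proof -
 have "(%N. w N-of_real (- t\<^sup>2/2)) ----> 0"
 proof (rule Lim_null_comparison)
 show "(%N. 2 * C/c1 * abs t ^ 3/sg N) ----> 0"
 by (intro real_tendsto_divide_at_top[OF tendsto_const] sigma_top)
 show "\<forall>\<^sub>F N in sequentially. norm (w N-of_real (- t\<^sup>2/2))<=2 * C/c1 * abs t ^ 3/sg N"
 using D1 small[OF r(1)]
 proof eventually_elim
 case (elim N)
 note cN = c(3)[OF elim(1)]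
 have s:"0 < sg N" "(sg N)^2 = kappa2 N (xi N)" using cN by auto
 have "(ze N)^2 = of_real (- (t/sg N)\<^sup>2)"
 unfolding ze_def power_mult_distrib by (simp only: power2_i of_real_minus of_real_power mult_minus1)
 hence q:"of_real (kappa2 N (xi N))*(ze N)^2/2 = complex_of_real (- t\<^sup>2/2)"
 using s(1) unfolding s(2)[symmetric] by (simp add:power_divide)
 have "(sqrt (c1 * Dsum N th0))^2<=(sg N)^2" using cN c(1) elim by (intro power_mono) auto
 hence Ds:"c1 * Dsum N th0<=(sg N)^2" using c(1) elim by simp
 have "norm (w N-of_real (- t\<^sup>2/2))<=C*(Dsum N th0+1) * cmod (ze N) ^ 3"
 using w[OF elim(2)] unfolding q by blast
 also have "...<=C*(2*((sg N)^2/c1)) * cmod (ze N) ^ 3"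
 proof (intro mult_right_mono mult_left_mono)
 have "Dsum N th0<=(sg N)^2/c1" using Ds c(1) by (simp add:le_divide_eq mult.commute)
 thus "Dsum N th0+1<=2*((sg N)^2/c1)" using elim(1) by linarith
 qed (use r in auto)
 also have "... = 2 * C/c1 * abs t ^ 3/sg N"
 using s(1) c(1) unfolding ns[OF s(1)] by (simp add:power2_eq_square power3_eq_cube)
 finally show ?case .
 qed
 qed
 thus ?thesis by (simp only: LIM_zero_iff)
 qed
 have "(%N. exp (w N)) ----> exp (of_real (- t\<^sup>2/2))" by (intro tendsto_exp wlim)
 moreover have "\<forall>\<^sub>F N in sequentially. exp (w N) = A N" using small[OF r(1)] by eventually_elim (simp add:w)
 ultimately have A:"A ----> of_real (exp (- t\<^sup>2/2))"
 unfolding exp_of_real by (rule Lim_transform_eventually)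
 \<comment> \<open>\<open>A\<close> is the characteristic function for the initial law. At angles
   tending to 0 the oscillation bound \<open>be\<close> may be taken arbitrarily small, which
   transfers the limit to the point \<open>x\<close>.\<close>
 have "(%N. A N-char (D N) (t/sg N)) ----> 0"
 proof (rule tendstoI)
 fix e :: real assume e:"0 < e"
 define be where "be = min (e/2) (tilt_eps R/4)"
 have te:"0 < tilt_eps R" by (rule tilt_eps_pos[OF R_nonneg])
 have be:"0 < be" "be<=tilt_eps R/4" "be < e" using e te by (auto simp:be_def min_def)
 obtain rh where rh:"0 < rh" "!!s. abs s<=rh ==> exp (2 * L * abs s)-1<=tilt_eps R * be/6"
 using exp_radius[of "tilt_eps R * be/6"] te be by auto
 show "\<forall>\<^sub>F N in sequentially. dist (A N-char (D N) (t/sg N)) 0 < e"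
 using small[OF rh(1)]
 proof eventually_elim
 case (elim N)
 define u where "u = exp (- ze N * of_real (tmean N (xi N)))"
 have nu:"cmod u = 1" by (simp add:u_def ze_def)
 have ch:"char (D N) (t/sg N) = tiltW N (xi N) (ze N) x * u" by (simp add:char_D u_def ze_def)
 have "cmod (char (D N) (t/sg N))<=1" by (rule real_distribution.cmod_char_le_1[OF D])
 hence n1:"cmod (tiltW N (xi N) (ze N) x)<=1" unfolding ch by (simp add:norm_mult nu)
 have "cmod (A N-char (D N) (t/sg N)) = cmod (Zc N (of_real (xi N)+ze N)/of_real (Z N (xi N))-tiltW N (xi N) (ze N) x)"
 unfolding ch A_def u_def[symmetric] left_diff_distrib[symmetric] by (simp add:norm_mult nu)
 also have "...<=be * cmod (tiltW N (xi N) (ze N) x)"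
 using rh(2)[of "cmod (ze N)"] elim by (intro tiltW_close_to_Zc[OF xi be(1,2) _ x]) auto
 also have "...<=be*1" using n1 be by (intro mult_left_mono) auto
 finally show ?case using be(3) by (simp add:dist_norm)
 qed
 qed
 from tendsto_diff[OF A this] show ?thesis by simp
qed

text \<open>Positivity of \<open>sg\<close> and the comparison with \<open>Dsum\<close> hold from
  some index on, so the abstract theory is applied to a shifted sequence; \<open>n1\<close> leaves
  room for a further eventual property.\<close>

lemma char_laws_shifted:
 obtains n0 c where "n1<=n0" "char_laws (%n. D (n+n0)) (%n. sg (n+n0)) th0 c"
proof -
 obtain c1 c2 where c:"0 < c1" "0 < c2" "!!N. 1<=Dsum N th0 ==> sqrt (c1 * Dsum N th0)<=sg N & sg N<=sqrt (c2 * Dsum N th0) & (sg N)^2 = kappa2 N (xi N) & 0 < sg N"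
 using comparison by metis
 obtain n2 where n2:"!!N. n2<=N ==> 1<=Dsum N th0"
 using top[unfolded filterlim_at_top,rule_format,of 1] unfolding eventually_sequentially by blast
 define n0 where "n0 = max n1 n2"
 have n0:"!!N. n0<=N ==> 1<=Dsum N th0" using n2 by (simp add:n0_def)
 define k where "k = decay R/(2 * th0^2 * c2)"
 have k:"0 < k" using decay_pos[OF R_nonneg] theta0 c by (simp add:k_def)
 have "char_laws (%n. D (n+n0)) (%n. sg (n+n0)) th0 k"
 proof (intro char_laws.intro local_char_limit.intro char_laws_axioms.intro)
 show "char (D (n+n0)) : bm borel" "cmod (char (D (n+n0)) th)<=1" for n th
 using real_distribution.char_measurable[OF D] real_distribution.cmod_char_le_1[OF D] by auto
 show "0 < sg (n+n0)" for n using c(3)[OF n0[of "n+n0"]] by simp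
 show "filterlim (%n. sg (n+n0)) at_top sequentially"
 using filterlim_compose[OF sigma_top filterlim_add_const_nat_at_top] by simp
 show "(%n. char (D (n+n0)) (t/sg (n+n0))) ----> of_real (exp (- t\<^sup>2/2))" for t
 using LIMSEQ_ignore_initial_segment[OF char_central_limit] .
 show "\<forall>\<^sub>F n in sequentially. \<forall>th. abs th<=th0 --> cmod (char (D (n+n0)) th)<=exp (- k*(sg (n+n0) * th)^2)"
 proof (intro always_eventually allI impI)
 fix n th assume th:"abs th<=th0"
 let ?N = "n+n0"
 note cN = c(3)[OF n0[of ?N]]
 have "(sg ?N)^2<=(sqrt (c2 * Dsum ?N th0))^2" using cN by (intro power_mono) auto
 hence le:"(sg ?N)^2<=c2 * Dsum ?N th0" using c(2) by simp
 have "k*(sg ?N * th)^2 = k * th^2*(sg ?N)^2" by (simp add:power_mult_distrib)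
 also have "...<=k * th^2*(c2 * Dsum ?N th0)" using le k by (intro mult_left_mono) auto
 also have "... = decay R*((th/th0)^2/2 * Dsum ?N th0)" using c(2) by (simp add:k_def power_divide)
 also have "...<=decay R * Dsum ?N th"
 using Dsum_scale[OF theta0(2,1) th] decay_pos[OF R_nonneg] by (intro mult_left_mono) auto
 finally show "cmod (char (D ?N) th)<=exp (- k*(sg ?N * th)^2)"
 using norm_char_le[of ?N th] by (simp add:order_trans)
 qed
 qed (use theta0 k D in auto)
 thus ?thesis by (intro that) (simp_all add:n0_def)
qed

lemma far_char_limit:
 assumes inf:"!!th. th0<=abs th ==> abs th<=T+th0 ==> filterlim (%N. Dsum N th) at_top sequentially"
 shows "(%N. sg N*(LINT th|lborel. indicator ({-T..T} - {-th0..th0}) th * cmod (char (D N) th))) ----> 0"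
proof -
 obtain c1 c2 where c:"0 < c2" "!!N. 1<=Dsum N th0 ==> sg N<=sqrt (c2 * Dsum N th0) & 0 < sg N"
 using comparison by metis
 have D1:"\<forall>\<^sub>F N in sequentially. 1<=Dsum N th0" using top[unfolded filterlim_at_top,rule_format,of 1] .
 have ev:"\<forall>\<^sub>F N in sequentially. 0 < Dsum N th0 & 0<=sg N & sg N<=sqrt c2 * sqrt (Dsum N th0)"
 using D1 by eventually_elim (use c(2) in \<open>force simp:real_sqrt_mult\<close>)
 define A where "A = {-T..T} - {-th0..th0}"
 have Am [measurable]:"A : sets borel" by (simp add:A_def)
 have i:"integrable lborel (%th. indicator A th * exp (- decay R * Dsum N th))" for N
 proof (rule LINT_integrable_bound[OF integrable_interval_exp_Dsum[of "-T" T "decay R" N]])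
 have "Dsum N : bm borel" using continuous_on_Dsum by (rule borel_measurable_continuous_onI)
 thus "(%th. indicator A th * exp (- decay R * Dsum N th)) : bm lborel" by measurable
 qed (auto simp:A_def indicator_def)
 show ?thesis
 proof (rule tendsto_sandwich[where f = "%_. 0"])
 show "(%N. sg N*(LINT th|lborel. indicator ({-T..T} - {-th0..th0}) th * exp (- decay R * Dsum N th))) ----> 0"
 by (rule far_limit[OF decay_pos[OF R_nonneg] theta0 ev inf])
 have le:"(LINT th|lborel. indicator A th * cmod (char (D N) th))<=(LINT th|lborel. indicator A th * exp (- decay R * Dsum N th))" for N
 by (intro integral_mono_AE' i AE_I2 mult_left_mono norm_char_le) auto
 show "\<forall>\<^sub>F N in sequentially. sg N*(LINT th|lborel. indicator ({-T..T} - {-th0..th0}) th * cmod (char (D N) th))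
<=sg N*(LINT th|lborel. indicator ({-T..T} - {-th0..th0}) th * exp (- decay R * Dsum N th))"
 using ev unfolding A_def[symmetric] by eventually_elim (intro mult_left_mono le,simp)
 show "\<forall>\<^sub>F N in sequentially. 0<=sg N*(LINT th|lborel. indicator ({-T..T} - {-th0..th0}) th * cmod (char (D N) th))"
 using ev by eventually_elim (auto intro!:mult_nonneg_nonneg integral_nonneg_AE)
 qed (rule tendsto_const)
qed

theorem interval_local_limit:
 assumes inf:"!!th. th ~= 0 ==> filterlim (%N. Dsum N th) at_top sequentially"
 shows "(%N. sg N*(LINT y|D N. indicator {u<..<v} y * exp (- y * xi N))
 - (LINT y|lborel. indicator {u<..<v} y * exp (- y * xi N))/sqrt (2 * pi)) ----> 0"
proof -
 obtain n0 c where "0<=n0" "char_laws (%n. D (n+n0)) (%n. sg (n+n0)) th0 c" by (rule char_laws_shifted)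
 then interpret C: char_laws "%n. D (n+n0)" "%n. sg (n+n0)" th0 c by simp
 show ?thesis
 proof (rule LIMSEQ_offset[of _ n0],rule C.interval_limit_varying[where R = R])
 show "(%n. sg (n+n0)*(LINT th|lborel. indicator ({-T..T} - {-th0..th0}) th * cmod (char (D (n+n0)) th))) ----> 0" for T
 using theta0 by (intro LIMSEQ_ignore_initial_segment[OF far_char_limit] inf) auto
 qed (rule xi)
qed

theorem lattice_local_limit:
 assumes inf:"!!th. th0<=abs th ==> abs th<=pi+th0 ==> filterlim (%N. Dsum N th) at_top sequentially"
 and lat:"!!N. n1<=N ==> AE y in D N. y : \<int>"
 shows "(%N. sg N * measure (D N) {of_int k}) ----> 1/sqrt (2 * pi)"
proof -
 obtain n0 c where n0:"n1<=n0" and "char_laws (%n. D (n+n0)) (%n. sg (n+n0)) th0 c" by (rule char_laws_shifted)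
 then interpret C: char_laws "%n. D (n+n0)" "%n. sg (n+n0)" th0 c by simp
 show ?thesis
 by (rule LIMSEQ_offset[of _ n0],rule C.lattice_limit)
 (use inf lat n0 in \<open>auto intro!:LIMSEQ_ignore_initial_segment[OF far_char_limit]\<close>)
qed

end

section \<open>From the given chain to the locales\<close>

lemma space_borel_spaces:"space (borel_spaces S d n) = S n"
 by (simp add:borel_spaces_def space_measure_of_conv)

text \<open>Time is shifted by one and the density set to 0 off the carriers. That it integrates to
  1 is inherited from the kernels being probability measures.\<close>

lemma uniformly_elliptic_kernels:
 assumes Q:"transition_kernels B Q" and ue:"uniformly_elliptic B Q"
 obtains ep mu p where "elliptic_kernels (%n. B (Suc n)) mu p ep"
 "!!n x. x : space (B (Suc n)) ==> Q (Suc n) x = elliptic_kernels.K mu p n x"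
proof -
 obtain ep :: real and mu p where eps:"0 < ep" "ep < 1"
 and 1:"\<forall>n\<ge>1. mu n : space (prob_algebra (B n)) & (%(x,y). p n x y) : bm (B n \<Otimes>\<^sub>M B (Suc n))"
 and 2:"\<forall>n\<ge>1. \<forall>x\<in>space (B n). Q n x = density (mu (Suc n)) (%y. ennreal (p n x y))"
 and 3:"\<forall>n\<ge>1. \<forall>x\<in>space (B n). \<forall>y\<in>space (B (Suc n)). 0<=p n x y & p n x y<=1/ep"
 and 4:"\<forall>n\<ge>1. \<forall>x\<in>space (B n). \<forall>z\<in>space (B (n+2)). (LINT y|mu (Suc n). p n x y * p (Suc n) y z) > ep"
 using ue unfolding uniformly_elliptic_def by (elim exE conjE) (rule that)
 have mu:"!!n. 1<=n ==> mu n : space (prob_algebra (B n))"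
 and pm:"!!n. 1<=n ==> (%(x,y). p n x y) : bm (B n \<Otimes>\<^sub>M B (Suc n))"
 and Qd:"!!n x. 1<=n ==> x : space (B n) ==> Q n x = density (mu (Suc n)) (%y. ennreal (p n x y))"
 and pb:"!!n x y. 1<=n ==> x : space (B n) ==> y : space (B (Suc n)) ==> 0<=p n x y & p n x y<=1/ep"
 and two:"!!n x z. 1<=n ==> x : space (B n) ==> z : space (B (n+2)) ==> (LINT y|mu (Suc n). p n x y * p (Suc n) y z) > ep"
 using 1 2 3 4 by blast+
 define q where "q n x y = (if x : space (B (Suc n)) & y : space (B (Suc2 n)) then p (Suc n) x y else 0)" for n x y
 have sp:"space (mu n) = space (B n)" "prob_space (mu n)" "sets (mu n) = sets (B n)" if "1<=n" for n
 using mu[OF that] by (auto simp:space_prob_algebra dest: sets_eq_imp_space_eq)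
 have qp:"density (mu (Suc2 n)) (%y. ennreal (q n x y)) = Q (Suc n) x" if x:"x : space (B (Suc n))" for n x
 proof -
 have pm':"p (Suc n) x : bm (mu (Suc2 n))"
 using measurable_compose[OF measurable_Pair1'[OF x] pm[of "Suc n"]] by (simp add:measurable_cong_sets[OF sp(3)])
 have "q n x : bm (mu (Suc2 n)) \<longleftrightarrow> p (Suc n) x : bm (mu (Suc2 n))"
 using x by (intro measurable_cong) (simp add:q_def sp)
 with pm' have qm:"q n x : bm (mu (Suc2 n))" by simp
 show ?thesis unfolding Qd[OF _ x,simplified] 
 proof (rule density_cong)
 show "AE y in mu (Suc2 n). ennreal (q n x y) = ennreal (p (Suc n) x y)" using x by (intro AE_I2) (simp add:q_def sp)
 qed (rule measurable_compose[OF qm measurable_ennreal] measurable_compose[OF pm' measurable_ennreal])+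
 qed
 have ek:"elliptic_kernels (%n. B (Suc n)) (%n. mu (Suc n)) q ep"
 proof (intro elliptic_kernels.intro)
 show "0 < ep" "ep < 1" by (rule eps)+
 fix n :: nat
 show "prob_space (mu (Suc n))" by (simp add:sp)
 show "sets (mu (Suc n)) = sets (B (Suc n))" by (simp add:sp)
 next
 show qm:"(%(x,y). q n x y) : bm (B (Suc n) \<Otimes>\<^sub>M B (Suc2 n))" for n
 proof -
 have "(%(x,y). q n x y) : bm (B (Suc n) \<Otimes>\<^sub>M B (Suc2 n))
 \<longleftrightarrow> (%(x,y). p (Suc n) x y) : bm (B (Suc n) \<Otimes>\<^sub>M B (Suc2 n))"
 by (intro measurable_cong) (auto simp:q_def space_pair_measure)
 thus ?thesis using pm[of "Suc n"] by simp
 qed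
 show q0:"0<=q n x y" for n x y using pb[of "Suc n" x y] by (simp add:q_def)
 show "q n x y<=1/ep" for n x y using pb[of "Suc n" x y] eps by (simp add:q_def)
 show "(LINT y|mu (Suc2 n). q n x y) = 1" if x:"x : space (B (Suc n))" for n x
 proof -
 have qm':"(%y. q n x y) : bm (mu (Suc2 n))"
 using measurable_compose[OF measurable_Pair1'[OF x] qm] by (simp add:measurable_cong_sets[OF sp(3)])
 have "Q (Suc n) x : space (prob_algebra (B (Suc2 n)))"
 using Q x unfolding transition_kernels_def by (auto dest: measurable_space)
 hence "prob_space (Q (Suc n) x)" by (simp add:space_prob_algebra)
 from prob_space.emeasure_space_1[OF this]
 have "emeasure (density (mu (Suc2 n)) (%y. ennreal (q n x y))) (space (mu (Suc2 n))) = 1"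
 unfolding qp[OF x,symmetric] by simp
 also have "emeasure (density (mu (Suc2 n)) (%y. ennreal (q n x y))) (space (mu (Suc2 n))) = (NN y|mu (Suc2 n). ennreal (q n x y))"
 using qm' by (subst emeasure_density) (auto intro!:nn_integral_cong)
 finally show ?thesis by (subst integral_eq_nn_integral) (use qm' q0 in auto)
 qed
 show "ep<=(LINT y|mu (Suc2 n). q n x y * q (Suc n) y z)"
 if "x : space (B (Suc n))" "z : space (B (Suc3 n))" for n x z
 proof -
 have "(LINT y|mu (Suc2 n). q n x y * q (Suc n) y z) = (LINT y|mu (Suc2 n). p (Suc n) x y * p (Suc2 n) y z)"
 using that by (intro LINT_cong) (auto simp:q_def sp)
 thus ?thesis using two[of "Suc n" x z] that by simp
 qed
 qed
 show ?thesis
 by (rule that[OF ek]) (simp add:elliptic_kernels.K_def[OF ek] qp)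
qed

text \<open>Conditional probabilities of single sets determine the joint law of past and next state
  on rectangles; these form an intersection-stable generator, so two finite measures on the product
  coincide and the identity holds for all nonnegative functions.\<close>

lemma markov_chain_elliptic_process:
 fixes M ::"'w measure" and B ::"nat => 'a measure"
 assumes mc:"markov_chain B nu Q M X" and ef:"elliptic_functional (%n. B (Suc n)) mu p ep f L"
 and Q:"!!n x. x : space (B (Suc n)) ==> Q (Suc n) x = elliptic_kernels.K mu p n x"
 shows "elliptic_process (%n. B (Suc n)) mu p ep f L M (%n. past_algebra B M X (Suc n)) (%n. X (Suc n))"
proof -
 interpret E: elliptic_functional "%n. B (Suc n)" mu p ep f L by (rule ef)
 interpret prob_space M using mc by (simp add:markov_chain_def)
 have Xm [measurable]:"X (Suc n) : M \<rightarrow>\<^sub>M B (Suc n)" for n using mc by (simp add:markov_chain_def)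
 let ?F = "%n. past_algebra B M X (Suc n)"
 let ?r = "%n om. \<lambda>i\<in>{1..Suc n}. X i om"
 have rM:"?r n : M \<rightarrow>\<^sub>M PiM {1..Suc n} B" for n
 using mc by (intro measurable_restrict) (auto simp:markov_chain_def)
 have rF:"?r n : ?F n \<rightarrow>\<^sub>M PiM {1..Suc n} B" for n
 unfolding past_algebra_def by (rule measurable_vimage_algebra1) (use measurable_space[OF rM] in auto)
 have XF:"X (Suc i) : ?F n \<rightarrow>\<^sub>M B (Suc i)" if "i<=n" for i n
 using measurable_compose[OF rF[of n] measurable_component_singleton[of "Suc i" "{1..Suc n}" B]] that by simp
 have sub:"subalgebra M (?F n)" for n
 unfolding subalgebra_def using sets_image_in_sets[OF refl rM[of n]] by (auto simp:past_algebra_def)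
 have spF:"space (?F n) = space M" for n by (simp add:past_algebra_def)
 have mono:"(%x. x) : ?F (Suc n) \<rightarrow>\<^sub>M ?F n" for n
 unfolding past_algebra_def[of B M X "Suc n"]
 proof (rule measurable_vimage_algebra2)
 show "?r n : ?F (Suc n) \<rightarrow>\<^sub>M PiM {1..Suc n} B"
 proof (rule measurable_restrict)
 fix i assume "i : {1..Suc n}"
 thus "X i : ?F (Suc n) \<rightarrow>\<^sub>M B i" using XF[of "i-1" "Suc n"] by (cases i) auto
 qed
 qed (simp add:spF)
 have markov:"(NN om|M. Ps (om,X (Suc2 n) om)) = (NN om|M. (NN y|E.K n (X (Suc n) om). Ps (om,y)))"
 if Ps:"Ps : bm (?F n \<Otimes>\<^sub>M B (Suc2 n))" for n and Ps ::"'w \<times> 'a => ennreal"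
 proof -
 define F where "F = ?F n"
 have Fs:"subalgebra M F" and [simp]:"space F = space M" by (auto simp:F_def sub spF)
 interpret FS: finite_measure_subalgebra M F by unfold_locales (rule Fs)
 have XnF [measurable]:"X (Suc n) : F \<rightarrow>\<^sub>M B (Suc n)" unfolding F_def by (rule XF) simp
 have idF [measurable]:"(%x. x) : M \<rightarrow>\<^sub>M F" using Fs by (auto simp:subalgebra_def measurable_def)
 define G where "G = restr_to_subalg M F"
 have sG [measurable_cong,simp]:"sets G = sets F" and spG [simp]:"space G = space M"
 unfolding G_def by (simp_all add:sets_restr_to_subalg[OF Fs] space_restr_to_subalg)
 have intG:"(NN om|G. u om) = (NN om|M. u om)" if "u : bm F" for u ::"'w => ennreal"
 unfolding G_def by (rule nn_integral_subalgebra2[OF Fs that])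
 \<comment> \<open>\<open>N1\<close> is the joint law of the past and the next state,
   \<open>N2\<close> the law built from the past and the kernel.\<close>
 define N1 where "N1 = distr M (F \<Otimes>\<^sub>M B (Suc2 n)) (%om. (om,X (Suc2 n) om))"
 define N2 where "N2 = density (G \<Otimes>\<^sub>M mu (Suc n)) (%z. ennreal (p n (X (Suc n) (fst z)) (snd z)))"
 interpret mu: prob_space "mu (Suc n)" by (rule E.prob_mu)
 have N1_int:"(NN z|N1. u z) = (NN om|M. u (om,X (Suc2 n) om))"
 if [measurable]:"u : bm (F \<Otimes>\<^sub>M B (Suc2 n))" for u ::"'w \<times> 'a => ennreal"
 unfolding N1_def by (rule nn_integral_distr) measurable
 have N2_int:"(NN z|N2. u z) = (NN om|M. (NN y|E.K n (X (Suc n) om). u (om,y)))"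
 if [measurable]:"u : bm (F \<Otimes>\<^sub>M B (Suc2 n))" for u ::"'w \<times> 'a => ennreal"
 proof -
 have "(NN z|N2. u z) = (NN z|(G \<Otimes>\<^sub>M mu (Suc n)). ennreal (p n (X (Suc n) (fst z)) (snd z)) * u z)"
 unfolding N2_def by (rule nn_integral_density) measurable
 also have "... = (NN om|G. (NN y|mu (Suc n). ennreal (p n (X (Suc n) om) y) * u (om,y)))"
 proof (subst mu.nn_integral_fst[symmetric])
 show "(%z. ennreal (p n (X (Suc n) (fst z)) (snd z)) * u z) : bm (G \<Otimes>\<^sub>M mu (Suc n))" by measurable
 qed simp
 also have "... = (NN om|G. (NN y|E.K n (X (Suc n) om). u (om,y)))"
 using measurable_space[OF Xm] by (intro nn_integral_cong) (subst E.nn_integral_K,auto)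
 also have "... = (NN om|M. (NN y|E.K n (X (Suc n) om). u (om,y)))"
 by (rule intG) measurable
 finally show ?thesis .
 qed
 have rect:"emeasure N1 (A \<times> C) = emeasure N2 (A \<times> C)" if A [measurable]:"A : sets F" and C [measurable]:"C : sets (B (Suc2 n))" for A C
 proof -
 define k where "k om = measure (E.K n (X (Suc n) om)) C" for om
 have AM [measurable]:"A : sets M" using A Fs by (auto simp:subalgebra_def)
 have Ksets:"sets (E.K n x) = sets (B (Suc2 n))" for x by (simp add:E.K_def)
 have pK:"prob_space (E.K n (X (Suc n) om))" if "om : space M" for om
 using measurable_space[OF Xm that] by (rule E.prob_K)
 have ek:"(NN y|E.K n (X (Suc n) om). indicator C y) = ennreal (k om)" if "om : space M" for om
 using finite_measure.emeasure_eq_measure[OF prob_space.finite_measure[OF pK[OF that]]] by (simp add:k_def Ksets)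
 have km [measurable]:"k : bm M"
 proof -
 have "(%om. enn2real (NN y|E.K n (X (Suc n) om). indicator C y)) : bm M" by measurable
 moreover have "(%om. enn2real (NN y|E.K n (X (Suc n) om). indicator C y)) : bm M \<longleftrightarrow> k : bm M"
 by (intro measurable_cong) (simp add:k_def measure_def Ksets)
 ultimately show ?thesis by simp
 qed
 have k01:"0<=k om" "om : space M ==> k om<=1" for om
 using prob_space.prob_le_1[OF pK] by (auto simp:k_def)
 have ce:"AE om in M. real_cond_exp M F (%om'. indicator C (X (Suc2 n) om')) om = k om"
 proof -
 have "AE om in M. real_cond_exp M F (%om'. indicator C (X (Suc2 n) om')) om = measure (Q (Suc n) (X (Suc n) om)) C"
 using mc C unfolding markov_chain_def F_def by auto
 thus ?thesis using measurable_space[OF Xm] by (auto simp:k_def Q elim: AE_mp)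
 qed
 have i1:"integrable M (%om. indicator A om * indicator C (X (Suc2 n) om) :: real)"
 by (rule integrable_const_bound[where B = 1]) (auto simp:indicator_def)
 have ind:"indicator A (fst z) * indicator C (snd z) = (indicator (A \<times> C) z :: ennreal)" for z
 by (cases z) (simp add:indicator_times)
 have eN:"emeasure N (A \<times> C) = (NN z|N. indicator A (fst z) * indicator C (snd z))"
 if "sets N = sets (F \<Otimes>\<^sub>M B (Suc2 n))" for N
 unfolding ind using that by (simp add:nn_integral_indicator)
 have "emeasure N1 (A \<times> C) = (NN z|N1. indicator A (fst z) * indicator C (snd z))"
 by (rule eN) (simp add:N1_def)
 also have "... = (NN om|M. ennreal (indicator A om * indicator C (X (Suc2 n) om)))"
 by (subst N1_int) (auto simp:indicator_def intro!:nn_integral_cong)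
 also have "... = ennreal (LINT om|M. indicator A om * indicator C (X (Suc2 n) om))"
 by (rule nn_integral_eq_integral[OF i1]) simp
 also have "(LINT om|M. indicator A om * indicator C (X (Suc2 n) om)) = (LINT om|M. indicator A om * real_cond_exp M F (%om'. indicator C (X (Suc2 n) om')) om)"
 by (rule FS.real_cond_exp_intg(2)[symmetric]) (use i1 in auto)
 also have "... = (LINT om|M. indicator A om * k om)"
 using ce by (intro integral_cong_AE) auto
 also have "ennreal ... = (NN om|M. ennreal (indicator A om * k om))"
 proof (rule nn_integral_eq_integral[symmetric])
 show "integrable M (%om. indicator A om * k om)"
 by (rule integrable_const_bound[where B = 1]) (use k01 in \<open>auto simp:indicator_def\<close>)
 qed (use k01 in auto)
 also have "... = (NN om|M. (NN y|E.K n (X (Suc n) om). indicator A om * indicator C y))"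
 using ek by (intro nn_integral_cong) (auto simp:indicator_def Ksets)
 also have "... = (NN z|N2. indicator A (fst z) * indicator C (snd z))"
 by (subst N2_int) auto
 also have "... = emeasure N2 (A \<times> C)"
 by (rule eN[symmetric]) (simp add:N2_def cong: sets_pair_measure_cong)
 finally show ?thesis .
 qed
 have "N1 = N2"
 proof (rule measure_eqI_generator_eq[OF Int_stable_pair_measure_generator[of F "B (Suc2 n)"]])
 let ?E = "{a \<times> b |a b. a : sets F & b : sets (B (Suc2 n))}"
 show "?E \<subseteq> Pow (space F \<times> space (B (Suc2 n)))" by (rule pair_measure_closed)
 show "emeasure N1 Y = emeasure N2 Y" if "Y : ?E" for Y using that rect by auto
 show "sets N1 = sigma_sets (space F \<times> space (B (Suc2 n))) ?E" by (simp add:N1_def sets_pair_measure)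
 show "sets N2 = sigma_sets (space F \<times> space (B (Suc2 n))) ?E"
 using sets_eq_imp_space_eq[OF E.sets_mu[of "Suc n"]] by (simp add:N2_def sets_pair_measure)
 show "range (%_::nat. space F \<times> space (B (Suc2 n))) \<subseteq> ?E"
 using sets.top[of F] sets.top[of "B (Suc2 n)"] by blast
 have "prob_space N1" unfolding N1_def by (rule prob_space_distr) measurable
 thus "emeasure N1 (space F \<times> space (B (Suc2 n))) ~= \<infinity>"
 by (rule finite_measure.emeasure_finite[OF prob_space.finite_measure,unfolded infinity_ennreal_def[symmetric]])
 qed simp
 thus ?thesis using N1_int[of Ps] N2_int[of Ps] Ps by (simp add:F_def)
 qed
 show ?thesis
 by (intro elliptic_process.intro elliptic_process_axioms.intro ef prob_space_axioms sub mono XF markov)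
qed

section \<open>Tilt parameters and the factor \<open>rho\<close>\<close>

context elliptic_process
begin

lemma has_real_derivative_ln_Z:"((%xi. ln (Z N xi)) has_real_derivative tmean N xi) (at xi)"
 and has_real_derivative_tmean:"(tmean N has_real_derivative kappa2 N xi) (at xi)"
 using bounded_variable.has_real_derivative_ln_mgf[OF bounded_variable_S] bounded_variable.has_real_derivative_tilted_mean[OF bounded_variable_S]
 by (simp_all add:Z_eq_weighted_mgf tmean_def kappa2_eq_tilted_variance)

lemma kappa2_0:"kappa2 N 0 = variance (S N)" and tmean_0:"tmean N 0 = expectation (S N)"
 using bounded_variable.tilted_variance_0[OF bounded_variable_S] bounded_variable.tilted_mean_0[OF bounded_variable_S]
 by (simp_all add:tmean_def kappa2_eq_tilted_variance)

lemma kappa2_pos:"0 < kappa2 N 0 ==> 0 < kappa2 N xi"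
 unfolding kappa2_0 using bounded_variable.tilted_variance_pos[OF bounded_variable_S] by (simp add:kappa2_eq_tilted_variance)

lemma tmean_strict_mono:
 assumes "0 < kappa2 N 0" "xi < xi'"
 shows "tmean N xi < tmean N xi'"
proof (rule DERIV_pos_imp_increasing[OF assms(2)])
 show "\<exists>y. (tmean N has_real_derivative y) (at t) & 0 < y" for t
 using has_real_derivative_tmean[of N t] kappa2_pos[OF assms(1),of t] by (intro exI conjI)
qed

lemma tmean_inj:"0 < kappa2 N 0 ==> tmean N xi = tmean N xi' \<longleftrightarrow> xi = xi'"
 using tmean_strict_mono[of N xi xi'] tmean_strict_mono[of N xi' xi] by (cases xi xi' rule: linorder_cases) auto

lemma tmean_mean_value:
 obtains s where "abs s<=abs xi" "tmean N xi-tmean N 0 = xi * kappa2 N s"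
proof (cases "xi = 0")
 case False
 show ?thesis
 proof (cases "0 < xi")
 case True
 thus ?thesis using MVT2[OF True,of "tmean N" "kappa2 N"] has_real_derivative_tmean that by force
 next
 case n: False
 hence "xi < 0" using False by simp
 then obtain s where "xi < s" "s < 0" "tmean N 0-tmean N xi = (0-xi) * kappa2 N s"
 using MVT2[of xi 0 "tmean N" "kappa2 N"] has_real_derivative_tmean by blast
 thus ?thesis by (intro that[of s]) auto
 qed
qed (use that in force)

lemma tmean_surj:
 assumes "tmean N (- R)<=m" "m<=tmean N R" "0<=R"
 obtains xi where "abs xi<=R" "tmean N xi = m"
proof -
 have "\<forall>x. - R<=x & x<=R --> isCont (tmean N) x" using has_real_derivative_tmean DERIV_isCont by blast
 then obtain xi where "- R<=xi" "xi<=R" "tmean N xi = m" using IVT[of "tmean N" "- R" m R] assms by auto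
 thus ?thesis by (intro that) auto
qed

text \<open>Here as a function of the tilt \<open>xi\<close>. The first factor passes from the
  initial law to the start \<open>x\<close>; the second replaces the untilted standard deviation in
  \<open>ld_factor\<close> by the tilted one.\<close>

definition rho ::"nat => 'a => real => real" where
 "rho N x xi = W N 0 xi x/Z N xi * sqrt (kappa2 N 0/kappa2 N xi)"

lemma kappa2_uniform:
 assumes R:"0<=R" and th:"0 < th" "6 * L * th<=1"
 obtains q r C where "1<=q" "0 < r" "0 < C"
 "!!N xi. 1<=Dsum N th ==> abs xi<=R ==> 0 < kappa2 N 0 & kappa2 N 0/q<=kappa2 N xi & kappa2 N xi<=q * kappa2 N 0"
 "!!N xi. 1<=Dsum N th ==> abs xi<=r ==> abs (kappa2 N xi-kappa2 N 0)<=C * abs xi * kappa2 N 0"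
proof -
 obtain c1 c2 where c:"0 < c1" "0 < c2"
 "!!N xi. abs xi<=R ==> c1 * Dsum N th<=kappa2 N xi & kappa2 N xi<=c2*(Dsum N th+1)"
 using kappa2_comparison[OF R th] by blast
 obtain r C where r:"0 < r" "0 < C" "!!N xi s. abs xi<=0 ==> abs s<=r ==> abs (kappa2 N (xi+s)-kappa2 N xi)<=C*(Dsum N th+1) * abs s"
 using log_mgf_expansion_uniform[OF order_refl th] by metis
 define q where "q = 2 * c2/c1"
 have up:"c2*(Dsum N th+1)<=q*(c1 * Dsum N th)" if "1<=Dsum N th" for N
 proof -
 have "c2*(Dsum N th+1)<=c2*(2 * Dsum N th)" using that c by (intro mult_left_mono) auto
 thus ?thesis using c by (simp add:q_def)
 qed
 have q0:"0 < q" using c by (simp add:q_def)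
 have main:"0 < kappa2 N 0 & kappa2 N 0/q<=kappa2 N xi & kappa2 N xi<=q * kappa2 N 0" if D:"1<=Dsum N th" and xi:"abs xi<=R" for N xi
 proof -
 have 0:"c1 * Dsum N th<=kappa2 N 0" "kappa2 N 0<=c2*(Dsum N th+1)" using c(3)[of 0 N] R by auto
 have 1:"c1 * Dsum N th<=kappa2 N xi" "kappa2 N xi<=c2*(Dsum N th+1)" using c(3)[OF xi,of N] by auto
 have p:"0 < c1 * Dsum N th" using c D by (intro mult_pos_pos) auto
 have "kappa2 N 0<=q * kappa2 N xi"
 using 0(2) up[OF D] mult_left_mono[OF 1(1),of q] q0 by linarith
 moreover have "kappa2 N xi<=q * kappa2 N 0"
 using 1(2) up[OF D] mult_left_mono[OF 0(1),of q] q0 by linarith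
 ultimately show ?thesis using 0(1) p q0 by (auto simp:divide_le_eq mult.commute)
 qed
 show ?thesis
 proof (rule that[of "max 1 q" r "2 * C/c1"])
 show "0 < kappa2 N 0 & kappa2 N 0/max 1 q<=kappa2 N xi & kappa2 N xi<=max 1 q * kappa2 N 0"
 if D:"1<=Dsum N th" and xi:"abs xi<=R" for N xi
 proof -
 note m = main[OF D xi]
 have "kappa2 N 0/max 1 q<=kappa2 N 0/q" using m q0 by (intro divide_left_mono) auto
 moreover have "q * kappa2 N 0<=max 1 q * kappa2 N 0" using m by (intro mult_right_mono) auto
 ultimately show ?thesis using m by linarith
 qed
 show "abs (kappa2 N xi-kappa2 N 0)<=2 * C/c1 * abs xi * kappa2 N 0" if D:"1<=Dsum N th" and xi:"abs xi<=r" for N xi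
 proof -
 have "c1 * Dsum N th<=kappa2 N 0" using c(3)[of 0 N] R by auto
 hence "Dsum N th<=kappa2 N 0/c1" using c(1) by (simp add:le_divide_eq mult.commute)
 hence "Dsum N th+1<=2*(kappa2 N 0/c1)" using D by linarith
 hence "C*(Dsum N th+1) * abs xi<=C*(2*(kappa2 N 0/c1)) * abs xi" using r by (intro mult_right_mono mult_left_mono) auto
 thus ?thesis using r(3)[of 0 xi N] xi by (simp add:mult_ac)
 qed
 qed (use r c in auto)
qed

lemma rho_bounds:
 assumes R:"abs xi<=R" and x:"x : space (B 0)" and q:"1<=q"
 and k:"0 < kappa2 N 0" "kappa2 N 0/q<=kappa2 N xi" "kappa2 N xi<=q * kappa2 N 0"
 shows "1/(harnack R * sqrt q)<=rho N x xi" "rho N x xi<=harnack R * sqrt q"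
proof -
 have R0:"0<=R" using R by linarith
 have h:"1<=harnack R" by (rule harnack_ge_1[OF R0])
 have Z:"0 < Z N xi" and W:"0 < W N 0 xi x" using Z_pos W_pos[OF x] by auto
 have kxi:"0 < kappa2 N xi" using kappa2_pos k by simp
 have w:"W N 0 xi x/Z N xi<=harnack R" "1/harnack R<=W N 0 xi x/Z N xi"
 using Z_harnack[OF R x,of N] Z h by (auto simp:divide_le_eq le_divide_eq mult.commute)
 have s:"sqrt (kappa2 N 0/kappa2 N xi)<=sqrt q" "1/sqrt q<=sqrt (kappa2 N 0/kappa2 N xi)"
 proof -
 show "sqrt (kappa2 N 0/kappa2 N xi)<=sqrt q" using k kxi q by (simp add:divide_le_eq mult.commute)
 have "1/q<=kappa2 N 0/kappa2 N xi" using k kxi q by (simp add:divide_le_eq le_divide_eq mult.commute)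
 hence "sqrt (1/q)<=sqrt (kappa2 N 0/kappa2 N xi)" by (simp only: real_sqrt_le_iff)
 moreover have "sqrt (1/q) = 1/sqrt q" by (simp add:real_sqrt_divide)
 ultimately show "1/sqrt q<=sqrt (kappa2 N 0/kappa2 N xi)" by (simp only:)
 qed
 show "rho N x xi<=harnack R * sqrt q" unfolding rho_def using w s Z W k kxi h by (intro mult_mono) auto
 have "1/harnack R*(1/sqrt q)<=rho N x xi" unfolding rho_def using w s Z W k kxi h q by (intro mult_mono) auto
 thus "1/(harnack R * sqrt q)<=rho N x xi" by simp
qed

text \<open>Near tilt 0 both \<open>Z N xi/W N 0 xi x\<close> and
  \<open>kappa2 N xi/kappa2 N 0\<close> are close to 1 uniformly in \<open>N\<close> and
  \<open>x\<close>, and \<open>rho\<close> is a fixed continuous function of these two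
  ratios.\<close>

lemma rho_limit:
 assumes th:"0 < th" "6 * L * th<=1" and e:"0 < e"
 obtains d where "0 < d" "!!N x xi. 1<=Dsum N th ==> x : space (B 0) ==> abs xi < d ==> abs (rho N x xi-1) < e"
proof -
 obtain q r C where C:"0 < r" "0 < C"
 "!!N xi. 1<=Dsum N th ==> abs xi<=0 ==> 0 < kappa2 N 0 & kappa2 N 0/q<=kappa2 N xi & kappa2 N xi<=q * kappa2 N 0"
 "!!N xi. 1<=Dsum N th ==> abs xi<=r ==> abs (kappa2 N xi-kappa2 N 0)<=C * abs xi * kappa2 N 0"
 using kappa2_uniform[OF order_refl th] by metis
 have "isCont (%z::real \<times> real. 1/(fst z * sqrt (snd z))) (1,1)" by (intro continuous_intros) auto
 then obtain b where b:"0 < b" "!!z::real \<times> real. dist z (1,1) < b ==> dist (1/(fst z * sqrt (snd z))) 1 < e"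
 unfolding continuous_at_eps_delta using e by force
 define be where "be = min (b/3) (ep/4)"
 have be:"0 < be" "be<=ep/4" "be<=b/3" using b eps by (auto simp:be_def)
 obtain s where s:"0 < s" "!!xi. abs xi<=s ==> exp (2 * L * abs xi)-1<=ep * be/6"
 using exp_radius[of "ep * be/6"] eps be by auto
 define d where "d = min s (min r (b/(3 * C)))"
 show ?thesis
 proof (rule that[of d])
 show "0 < d" using s C b by (simp add:d_def)
 fix N x xi assume D:"1<=Dsum N th" and x:"x : space (B 0)" and xi:"abs xi < d"
 have V:"0 < kappa2 N 0" using C(3)[OF D,of 0] by simp
 have k:"0 < kappa2 N xi" by (rule kappa2_pos[OF V])
 have W:"0 < W N 0 xi x" by (rule W_pos[OF x])
 define a1 where "a1 = Z N xi/W N 0 xi x"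
 define a2 where "a2 = kappa2 N xi/kappa2 N 0"
 have "abs (Z N xi-W N 0 xi x)<=be * W N 0 xi x"
 by (rule W_close_to_Z[OF be(1,2) s(2) x]) (use xi in \<open>simp add:d_def\<close>)
 moreover have "a1-1 = (Z N xi-W N 0 xi x)/W N 0 xi x" using W by (simp add:a1_def diff_divide_distrib)
 ultimately have "abs (a1-1)<=be" using W by (simp add:abs_divide divide_le_eq)
 hence 1:"abs (a1-1)<=b/3" using be(3) by linarith
 have "abs (kappa2 N xi-kappa2 N 0)<=C * abs xi * kappa2 N 0" using C(4)[OF D,of xi] xi by (simp add:d_def)
 moreover have "a2-1 = (kappa2 N xi-kappa2 N 0)/kappa2 N 0" using V by (simp add:a2_def diff_divide_distrib)
 ultimately have "abs (a2-1)<=C * abs xi" using V by (simp add:abs_divide divide_le_eq)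
 also have "...<=b/3"
 proof -
 have "abs xi<=b/(3 * C)" using xi by (simp add:d_def)
 hence "C * abs xi<=C*(b/(3 * C))" using C(2) by (intro mult_left_mono) auto
 thus ?thesis using C(2) by simp
 qed
 finally have 2:"abs (a2-1)<=b/3" .
 have "dist (a1,a2) (1,1)<=abs (a1-1)+abs (a2-1)"
 by (simp add:dist_prod_def dist_real_def) (rule sqrt_sum_squares_le_sum_abs[of "a1-1" "a2-1",simplified])
 hence "dist (a1,a2) (1,1) < b" using 1 2 b(1) by linarith
 from b(2)[OF this] have "abs (1/(a1 * sqrt a2)-1) < e" by (simp add:dist_real_def)
 moreover have "1/(a1 * sqrt a2) = rho N x xi"
 using W V k by (simp add:rho_def a1_def a2_def real_sqrt_divide)
 ultimately show "abs (rho N x xi-1) < e" by simp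
 qed
qed

end

section \<open>Undoing the tilt\<close>

text \<open>The limit theorems give an additive error; it becomes a factor \<open>1+o(1)\<close>
  because the limiting integral or sum \<open>J N\<close> stays above a positive constant
  \<open>j\<close>.\<close>

lemma asymp_equiv_of_scaled_limit:
 fixes A J sg c m r ::"nat => real"
 assumes lim:"(%N. sg N * A N-J N/sqrt (2 * pi)) ----> 0" and j:"0 < j" "!!N. j<=J N"
 and ev:"\<forall>\<^sub>F N in sequentially. 0 < sg N & 0 < c N & m N = c N * A N & r N = c N/(sqrt (2 * pi) * sg N) * J N"
 shows "m \<sim>[sequentially] r"
proof (rule asymp_equivI')
 have "(%N. (sg N * A N-J N/sqrt (2 * pi))/J N) ----> 0"
 proof (rule Lim_null_comparison)
 show "(%N. abs (sg N * A N-J N/sqrt (2 * pi))/j) ----> 0"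
 using tendsto_divide[OF tendsto_rabs_zero[OF lim] tendsto_const,of j] j by simp
 show "\<forall>\<^sub>F N in sequentially. norm ((sg N * A N-J N/sqrt (2 * pi))/J N)<=abs (sg N * A N-J N/sqrt (2 * pi))/j"
 proof (intro always_eventually allI)
 fix N
 have "0 < J N" using j(1) j(2)[of N] by linarith
 thus "norm ((sg N * A N-J N/sqrt (2 * pi))/J N)<=abs (sg N * A N-J N/sqrt (2 * pi))/j"
 using j(1) j(2)[of N] by (simp add:divide_left_mono)
 qed
 qed
 from tendsto_add[OF tendsto_const[of 1] tendsto_mult_right_zero[OF this,of "sqrt (2 * pi)"]]
 have "(%N. 1+sqrt (2 * pi)*((sg N * A N-J N/sqrt (2 * pi))/J N)) ----> 1" by simp
 moreover have "\<forall>\<^sub>F N in sequentially. 1+sqrt (2 * pi)*((sg N * A N-J N/sqrt (2 * pi))/J N) = m N/r N"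
 using ev
 proof eventually_elim
 case (elim N)
 have "0 < J N" using j(1) j(2)[of N] by linarith
 with elim show ?case by (simp add:field_simps)
 qed
 ultimately show "(%N. m N/r N) ----> 1" by (rule Lim_transform_eventually)
qed

context elliptic_process
begin

definition tilted_law ::"nat => real => real => real measure" where
 "tilted_law N xi z = distr (Mtilt N xi) borel (%om. S N om-z)"

lemma real_distribution_tilted_law:"real_distribution (tilted_law N xi z)"
 unfolding tilted_law_def by (intro prob_space.real_distribution_distr prob_space_Mtilt) measurable

lemma char_tilted_law:
 "char (tilted_law N xi z) th = Zc N (of_real xi+\<i> * of_real th)/of_real (Z N xi) * exp (- (\<i> * of_real th) * of_real z)"
proof -
 have "char (tilted_law N xi z) th = (LINT om|Mtilt N xi. iexp (th*(S N om-z)))"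
 unfolding char_def tilted_law_def by (subst integral_distr) auto
 also have "... = (LINT om|Mtilt N xi. exp (- (\<i> * of_real th) * of_real z) * exp ((\<i> * of_real th) * of_real (S N om)))"
 by (intro LINT_cong) (simp add:exp_add[symmetric] algebra_simps)
 also have "... = exp (- (\<i> * of_real th) * of_real z)*(Zc N (of_real xi+\<i> * of_real th)/of_real (Z N xi))"
 by (simp only: integral_mult_right_zero integral_exp_Mtilt)
 finally show ?thesis by (simp only: mult.commute)
qed

text \<open>The weight \<open>exp (- y * xi)\<close> cancels the tilting density except for the
  constant \<open>exp (xi * z)/Z N xi\<close>.\<close>

lemma tilted_law_integral:
 assumes A [measurable]:"A : sets borel"
 shows "(LINT y|tilted_law N xi z. indicator A y * exp (- y * xi)) = exp (xi * z)/Z N xi * measure M {om : space M. S N om-z : A}"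
proof -
 have "(LINT y|tilted_law N xi z. indicator A y * exp (- y * xi)) = (LINT om|Mtilt N xi. indicator A (S N om-z) * exp (- (S N om-z) * xi))"
 unfolding tilted_law_def by (subst integral_distr) auto
 also have "... = (1/Z N xi) *\<^sub>R (LINT om|M. exp (xi * S N om) *\<^sub>R (indicator A (S N om-z) * exp (- (S N om-z) * xi)))"
 by (rule integral_Mtilt) measurable
 also have "(LINT om|M. exp (xi * S N om) *\<^sub>R (indicator A (S N om-z) * exp (- (S N om-z) * xi)))
 = (LINT om|M. exp (xi * z) * indicator {om : space M. S N om-z : A} om)"
 proof (intro LINT_cong)
 fix om assume "om : space M"
 moreover have "exp (xi * S N om) * exp (- (S N om-z) * xi) = exp (xi * z)"
 by (simp add:exp_add[symmetric] algebra_simps)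
 ultimately show "exp (xi * S N om) *\<^sub>R (indicator A (S N om-z) * exp (- (S N om-z) * xi)) = exp (xi * z) * indicator {om : space M. S N om-z : A} om"
 by (simp add:indicator_def)
 qed
 also have "... = exp (xi * z) * measure M {om : space M. S N om-z : A}"
 unfolding integral_mult_right_zero by (simp add:Int_def conj_commute)
 finally show ?thesis by simp
qed

lemma AE_tilted_law:
 assumes "AE om in M. S N om-z : \<int>"
 shows "AE y in tilted_law N xi z. y : \<int>"
proof -
 have "AE om in Mtilt N xi. S N om-z : \<int>"
 unfolding Mtilt_def using assms by (subst AE_density) auto
 thus ?thesis unfolding tilted_law_def by (subst AE_distr_iff) auto
qed

lemma Zc_from_point:
 assumes start:"distr M (B 0) (X 0) = return (B 0) x" and x:"x : space (B 0)"
 shows "Zc N w = W N 0 w x" "Z N xi = W N 0 xi x"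
proof -
 have X0:"X 0 : M \<rightarrow>\<^sub>M B 0" by measurable
 have "(LINT om|M. W N 0 w (X 0 om)) = W N 0 w x" for w :: complex
 proof -
 have "(LINT om|M. W N 0 w (X 0 om)) = (LINT y|distr M (B 0) (X 0). W N 0 w y)"
 by (rule integral_distr[symmetric,OF X0]) measurable
 also have "... = W N 0 w x" unfolding start by (rule integral_return[OF x]) measurable
 finally show ?thesis .
 qed
 thus Zc:"Zc N w = W N 0 w x" for w unfolding Zc_def expectation_exp_S .
 show "Z N xi = W N 0 xi x" using Zc[of "of_real xi"] unfolding Zc_of_real W_of_real of_real_eq_iff .
qed

text \<open>The process started at \<open>x\<close> shares only kernels and functional with the
  given one. For a point start the generating function is \<open>W N 0 w x\<close>, which is all
  that \<open>tilted_laws\<close> asks about.\<close>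

lemma tilted_laws_from_point:
 assumes P:"elliptic_process B mu p ep f L P F' Y" and start:"distr P (B 0) (Y 0) = return (B 0) x" and x:"x : space (B 0)"
 and R:"!!N. abs (xi N)<=R" and th:"0 < th0" "6 * L * th0<=1" and top:"filterlim (%N. Dsum N th0) at_top sequentially"
 shows "tilted_laws B mu p ep f L M F X R th0 xi x (%N. elliptic_process.tilted_law f P Y N (xi N) (tmean N (xi N)))"
proof -
 interpret P: elliptic_process B mu p ep f L P F' Y by (rule P)
 show ?thesis
 proof (intro tilted_laws.intro tilted_laws_axioms.intro R th x top P.real_distribution_tilted_law)
 show "elliptic_process B mu p ep f L M F X" ..
 show "char (P.tilted_law N (xi N) (tmean N (xi N))) th = tiltW N (xi N) (\<i> * of_real th) x * exp (- (\<i> * of_real th) * of_real (tmean N (xi N)))" for N th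
 unfolding P.char_tilted_law P.Zc_from_point[OF start x] tiltW_def ..
 qed
qed

lemma point_probability:
 assumes P:"elliptic_process B mu p ep f L P F' Y" and start:"distr P (B 0) (Y 0) = return (B 0) x" and x:"x : space (B 0)"
 and A:"A : sets borel"
 shows "measure P {om : space P. elliptic_process.S f Y N om-z : A}
 = exp (- (xi * z)) * W N 0 xi x*(LINT y|elliptic_process.tilted_law f P Y N xi z. indicator A y * exp (- y * xi))"
proof -
 interpret P: elliptic_process B mu p ep f L P F' Y by (rule P)
 show ?thesis
 unfolding P.tilted_law_integral[OF A] P.Zc_from_point[OF start x] using W_pos[OF x,of N xi] by (simp add:exp_minus)
qed

lemma interval_lower_bound:
 fixes u v :: real
 assumes "u < v" "abs xi<=R"
 shows "(v-u) * exp (- ((abs u+abs v) * R))<=(LINT y|lborel. indicator {u<..<v} y * exp (- y * xi))"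
proof -
 have "(LINT y|lborel. exp (- ((abs u+abs v) * R)) * indicator {u<..<v} y)<=(LINT y|lborel. indicator {u<..<v} y * exp (- y * xi))"
 proof (rule integral_mono)
 show "integrable lborel (%y. exp (- ((abs u+abs v) * R)) * indicator {u<..<v} y)" using assms by simp
 have "integrable lborel (%y. indicator {u..v} y *\<^sub>R exp (- y * xi))"
 by (intro borel_integrable_compact continuous_intros) auto
 thus "integrable lborel (%y. indicator {u<..<v} y * exp (- y * xi))"
 by (rule LINT_integrable_bound) (auto simp:indicator_def)
 show "exp (- ((abs u+abs v) * R)) * indicator {u<..<v} y<=indicator {u<..<v} y * exp (- y * xi)" for y
 proof -
 have "y * xi<=(abs u+abs v) * R" if "y : {u<..<v}"
 proof -
 have "y * xi<=abs y * abs xi" by (simp add:abs_mult[symmetric] del: abs_mult)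
 also have "...<=(abs u+abs v) * R" using that assms by (intro mult_mono) auto
 finally show ?thesis .
 qed
 thus "exp (- ((abs u+abs v) * R)) * indicator {u<..<v} y<=indicator {u<..<v} y * exp (- y * xi)"
 by (auto simp:indicator_def)
 qed
 qed
 thus ?thesis using assms by (simp add:mult.commute)
qed

theorem nonlattice_local_limit:
 assumes P:"elliptic_process B mu p ep f L P F' Y" and start:"distr P (B 0) (Y 0) = return (B 0) x" and x:"x : space (B 0)"
 and R:"!!N. abs (xi N)<=R" and th:"0 < th0" "6 * L * th0<=1"
 and inf:"!!th. th ~= 0 ==> filterlim (%N. Dsum N th) at_top sequentially" and uv:"u < v"
 shows "(%N. measure P {om : space P. elliptic_process.S f Y N om-tmean N (xi N) : {u<..<v}}) \<sim>[sequentially]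
 (%N. exp (- (xi N * tmean N (xi N))) * W N 0 (xi N) x/(sqrt (2 * pi) * sqrt (kappa2 N (xi N)))*(LINT y|lborel. indicator {u<..<v} y * exp (- y * xi N)))"
proof -
 have top:"filterlim (%N. Dsum N th0) at_top sequentially" using inf th by simp
 interpret T: tilted_laws B mu p ep f L M F X R th0 xi x "%N. elliptic_process.tilted_law f P Y N (xi N) (tmean N (xi N))"
 by (rule tilted_laws_from_point[OF P start x R th top])
 have s:"\<forall>\<^sub>F N in sequentially. 0 < T.sg N" using T.sigma_top by (simp add:filterlim_at_top_dense)
 show ?thesis
 proof (rule asymp_equiv_of_scaled_limit[OF T.interval_local_limit[OF inf]])
 show "0 < (v-u) * exp (- ((abs u+abs v) * R))" using uv by simp
 show "(v-u) * exp (- ((abs u+abs v) * R))<=(LINT y|lborel. indicator {u<..<v} y * exp (- y * xi N))" for N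
 by (rule interval_lower_bound[OF uv R])
 show "\<forall>\<^sub>F N in sequentially. 0 < T.sg N & 0 < exp (- (xi N * tmean N (xi N))) * W N 0 (xi N) x \<and>
 measure P {om : space P. elliptic_process.S f Y N om-tmean N (xi N) : {u<..<v}} = exp (- (xi N * tmean N (xi N))) * W N 0 (xi N) x *
 (LINT y|elliptic_process.tilted_law f P Y N (xi N) (tmean N (xi N)). indicator {u<..<v} y * exp (- y * xi N)) \<and>
 exp (- (xi N * tmean N (xi N))) * W N 0 (xi N) x/(sqrt (2 * pi) * sqrt (kappa2 N (xi N)))*(LINT y|lborel. indicator {u<..<v} y * exp (- y * xi N))
 = exp (- (xi N * tmean N (xi N))) * W N 0 (xi N) x/(sqrt (2 * pi) * T.sg N)*(LINT y|lborel. indicator {u<..<v} y * exp (- y * xi N))"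
 using s by eventually_elim (intro conjI point_probability[OF P start x]; simp add:W_pos[OF x] T.sg_def)
 qed
qed

theorem integer_local_limit:
 assumes P:"elliptic_process B mu p ep f L P F' Y" and start:"distr P (B 0) (Y 0) = return (B 0) x" and x:"x : space (B 0)"
 and R:"!!N. abs (xi N)<=R" and th:"0 < th0" "6 * L * th0<=1"
 and inf:"!!th. th0<=abs th ==> abs th<=pi+th0 ==> filterlim (%N. Dsum N th) at_top sequentially"
 and lat:"!!N. n1<=N ==> AE om in P. elliptic_process.S f Y N om-tmean N (xi N) : \<int>"
 shows "(%N. measure P {om : space P. elliptic_process.S f Y N om-tmean N (xi N) : {u<..<v}}) \<sim>[sequentially]
 (%N. exp (- (xi N * tmean N (xi N))) * W N 0 (xi N) x/(sqrt (2 * pi) * sqrt (kappa2 N (xi N)))*(\<Sum>t\<in>{u<..<v} \<inter> \<int>. exp (- t * xi N)))"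
proof -
 interpret P: elliptic_process B mu p ep f L P F' Y by (rule P)
 have top:"filterlim (%N. Dsum N th0) at_top sequentially" using inf[of th0] th pi_gt_zero by simp
 interpret T: tilted_laws B mu p ep f L M F X R th0 xi x "%N. P.tilted_law N (xi N) (tmean N (xi N))"
 by (rule tilted_laws_from_point[OF P start x R th top])
 interpret D: real_distribution "P.tilted_law N (xi N) (tmean N (xi N))" for N by (rule P.real_distribution_tilted_law)
 define D where "D N = P.tilted_law N (xi N) (tmean N (xi N))" for N
 define I where "I = {u<..<v} \<inter> \<int>"
 have s:"\<forall>\<^sub>F N in sequentially. 0 < T.sg N" using T.sigma_top by (simp add:filterlim_at_top_dense)
 have latD:"AE y in D N. y : \<int>" if "n1<=N" for N unfolding D_def by (rule P.AE_tilted_law[OF lat[OF that]])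
 have fI:"finite I"
 proof (rule finite_subset)
 show "I \<subseteq> of_int ` {\<lfloor>u\<rfloor>..\<lceil>v\<rceil>}"
 proof
 fix t assume "t : I"
 then obtain k where "t = of_int k" "u < of_int k" "of_int k < v" by (auto simp:I_def elim: Ints_cases)
 thus "t : of_int ` {\<lfloor>u\<rfloor>..\<lceil>v\<rceil>}" by (intro image_eqI[of _ _ k]) (auto,linarith+)
 qed
 qed simp
 have sum:"(LINT y|D N. indicator {u<..<v} y * exp (- y * xi N)) = (\<Sum>t\<in>I. exp (- t * xi N) * measure (D N) {t})" if N:"n1<=N" for N
 proof -
 have "(LINT y|D N. indicator {u<..<v} y * exp (- y * xi N)) = (LINT y|D N. (\<Sum>t\<in>I. exp (- t * xi N) * indicator {t} y))"
 proof (rule integral_cong_AE)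
 show "AE y in D N. indicator {u<..<v} y * exp (- y * xi N) = (\<Sum>t\<in>I. exp (- t * xi N) * indicator {t} y)"
 using latD[OF N]
 proof eventually_elim
 case (elim y)
 have "(\<Sum>t\<in>I. exp (- t * xi N) * indicator {t} y) = (\<Sum>t\<in>I. if t = y then exp (- y * xi N) else 0)"
 by (intro sum.cong) (auto simp:indicator_def)
 also have "... = (if y : I then exp (- y * xi N) else 0)" using fI by simp
 finally show ?case using elim by (auto simp:I_def indicator_def)
 qed
 qed (auto simp:D_def)
 also have "... = (\<Sum>t\<in>I. exp (- t * xi N) * measure (D N) {t})"
 by (subst LINT_sum) (auto simp:D_def D.emeasure_eq_measure)
 finally show ?thesis .
 qed
 have point:"measure P {om : space P. P.S N om-tmean N (xi N) : {u<..<v}} = exp (- (xi N * tmean N (xi N))) * W N 0 (xi N) x *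
 (LINT y|D N. indicator {u<..<v} y * exp (- y * xi N))" for N
 unfolding D_def by (rule point_probability[OF P start x]) simp
 show ?thesis
 proof (cases "I = {}")
 \<comment> \<open>If the interval contains no integer, both sides are eventually 0, and asymptotic
   equivalence holds between eventually equal functions.\<close>
 case True
 have "\<forall>\<^sub>F N in sequentially. measure P {om : space P. P.S N om-tmean N (xi N) : {u<..<v}} =
 exp (- (xi N * tmean N (xi N))) * W N 0 (xi N) x/(sqrt (2 * pi) * sqrt (kappa2 N (xi N)))*(\<Sum>t\<in>I. exp (- t * xi N))"
 using eventually_ge_at_top[of n1] by eventually_elim (simp only: point sum True sum.empty mult_zero_right)
 thus ?thesis unfolding I_def by (rule asymp_equiv_refl_ev)
 next
 case False
 then obtain t0 where t0:"t0 : I" by blast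
 let ?d = "%t N. T.sg N * measure (D N) {t} - 1/sqrt (2 * pi)"
 have lim:"(%N. T.sg N*(\<Sum>t\<in>I. exp (- t * xi N) * measure (D N) {t})-(\<Sum>t\<in>I. exp (- t * xi N))/sqrt (2 * pi)) ----> 0"
 proof -
 have "(%N. \<Sum>t\<in>I. exp (- t * xi N)*?d t N) ----> (\<Sum>t\<in>I. 0)"
 proof (rule tendsto_sum)
 fix t assume "t : I"
 then obtain k where k:"t = of_int k" by (auto simp:I_def elim: Ints_cases)
 have l:"(%N. ?d t N) ----> 0"
 using T.lattice_local_limit[of n1 k] inf latD unfolding k D_def LIM_zero_iff by blast
 show "(%N. exp (- t * xi N)*?d t N) ----> 0"
 proof (rule Lim_null_comparison)
 show "(%N. exp (abs t * R) * abs (?d t N)) ----> 0"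
 by (intro tendsto_mult_right_zero tendsto_rabs_zero l)
 show "\<forall>\<^sub>F N in sequentially. norm (exp (- t * xi N)*?d t N)<=exp (abs t * R) * abs (?d t N)"
 proof (intro always_eventually allI)
 fix N
 have "- t * xi N<=abs t * abs (xi N)" by (simp add:abs_mult[symmetric] del: abs_mult)
 also have "...<=abs t * R" using R by (intro mult_left_mono) auto
 finally show "norm (exp (- t * xi N)*?d t N)<=exp (abs t * R) * abs (?d t N)"
 unfolding real_norm_def abs_mult by (intro mult_right_mono) auto
 qed
 qed
 qed
 moreover have "(\<Sum>t\<in>I. exp (- t * xi N)*?d t N)
 = T.sg N*(\<Sum>t\<in>I. exp (- t * xi N) * measure (D N) {t})-(\<Sum>t\<in>I. exp (- t * xi N))/sqrt (2 * pi)" for N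
 by (simp add:right_diff_distrib sum_subtractf sum_distrib_left sum_divide_distrib mult.left_commute)
 ultimately show ?thesis by simp
 qed
 show ?thesis unfolding I_def[symmetric]
 proof (rule asymp_equiv_of_scaled_limit[OF lim])
 show "0 < exp (- (abs t0 * R))" by simp
 show "exp (- (abs t0 * R))<=(\<Sum>t\<in>I. exp (- t * xi N))" for N
 proof -
 have "t0 * xi N<=abs t0 * abs (xi N)" by (simp add:abs_mult[symmetric] del: abs_mult)
 also have "...<=abs t0 * R" using R by (intro mult_left_mono) auto
 finally have "exp (- (abs t0 * R))<=exp (- t0 * xi N)" by simp
 also have "...<=(\<Sum>t\<in>I. exp (- t * xi N))" by (rule member_le_sum[OF t0 _ fI]) auto
 finally show ?thesis .
 qed
 show "\<forall>\<^sub>F N in sequentially. 0 < T.sg N & 0 < exp (- (xi N * tmean N (xi N))) * W N 0 (xi N) x \<and>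
 measure P {om : space P. P.S N om-tmean N (xi N) : {u<..<v}} = exp (- (xi N * tmean N (xi N))) * W N 0 (xi N) x*(\<Sum>t\<in>I. exp (- t * xi N) * measure (D N) {t}) \<and>
 exp (- (xi N * tmean N (xi N))) * W N 0 (xi N) x/(sqrt (2 * pi) * sqrt (kappa2 N (xi N)))*(\<Sum>t\<in>I. exp (- t * xi N))
 = exp (- (xi N * tmean N (xi N))) * W N 0 (xi N) x/(sqrt (2 * pi) * T.sg N)*(\<Sum>t\<in>I. exp (- t * xi N))"
 using s eventually_ge_at_top[of n1] by eventually_elim (intro conjI,assumption,simp add:W_pos[OF x],simp only: point sum,simp only: T.sg_def)
 qed
 qed
qed

end

section \<open>Closed subgroups and center-tightness\<close>

lemma AE_le_ess_bound:
 assumes "ess_bound M X f<=ereal c" "1<=n"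
 shows "AE om in M. abs (f n (X n om) (X (Suc n) om))<=c"
proof -
 let ?g = "%om. ereal (abs (f n (X n om) (X (Suc n) om)))"
 have "esssup M ?g<=ess_bound M X f" unfolding ess_bound_def using assms(2) by (intro SUP_upper) auto
 hence le:"esssup M ?g<=ereal c" using assms(1) by (rule order_trans)
 show ?thesis using esssup_AE[of ?g M]
 proof eventually_elim
 case (elim om)
 from order_trans[OF elim le] show ?case by simp
 qed
qed

lemma closed_subgroup_multiples:"a ~= 0 ==> closed_subgroup (range (%k::int. a * of_int k))"
proof -
 assume a:"a ~= 0"
 have "closed ((%x. a *\<^sub>R x) ` (\<int> :: real set))" by (intro closed_scaling closed_Ints)
 also have "(%x. a *\<^sub>R x) ` (\<int> :: real set) = range (%k::int. a * of_int k)" by (simp add:Ints_def image_image)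
 finally show ?thesis unfolding closed_subgroup_def
 by (auto intro!:image_eqI[where x = 0] simp:image_iff)
 (metis distrib_left of_int_add,metis mult_minus_right of_int_minus)
qed

lemma closed_subgroup_zero:"closed_subgroup {0}"
 by (simp add:closed_subgroup_def)

lemma G_alg_subset:
 assumes "closed_subgroup G" "!!n. 1<=n ==> AE om in M. f n (X n om) (X (Suc n) om) : G"
 shows "G_alg M X f \<subseteq> G"
 unfolding G_alg_def using assms by (intro Inter_lower) (auto intro!:exI[of _ "%_. 0"])

text \<open>The intersection of the admissible groups need not be admissible; by compactness finitely many of them
 already have no common element of absolute value between \<open>L\<close> and \<open>2 * L\<close>,hence none up to \<open>2 * L\<close>.\<close>

lemma (in prob_space) constant_if_G_alg_trivial:
 assumes L:"0 < L" and bd:"AE om in M. abs (f n (X n om) (X (Suc n) om))<=L" and G:"G_alg M X f \<subseteq> {0}" and n:"1<=n"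
 shows "\<exists>v. AE om in M. f n (X n om) (X (Suc n) om) = v"
proof -
 let ?f = "%om. f n (X n om) (X (Suc n) om)"
 define GG where "GG = {G. closed_subgroup G & (\<exists>c :: nat => real. \<forall>n\<ge>1. AE om in M. f n (X n om) (X (Suc n) om)-c n : G)}"
 define U where "U = {-(2 * L)..-L} \<union> {L..2 * L}"
 have "compact U" by (simp add:U_def compact_Un)
 moreover have "\<forall>a\<in>GG. closed a" by (auto simp:GG_def closed_subgroup_def)
 moreover have "U \<inter> \<Inter>GG = {}"
 proof -
 have "\<Inter>GG \<subseteq> {0}" using G by (simp add:G_alg_def GG_def)
 moreover have "0 \<notin> U" using L by (simp add:U_def)
 ultimately show ?thesis by blast
 qed
 ultimately obtain H where H:"H \<subseteq> GG" "finite H" "U \<inter> \<Inter>H = {}" unfolding compact_fip by meson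
 have grp:"closed_subgroup G" if "G : H" for G using H(1) that by (auto simp:GG_def)
 have small:"t = 0" if t:"t : \<Inter>H" "abs t<=2 * L" for t
 proof (rule ccontr)
 assume "t ~= 0"
 hence t0:"0 < abs t" by simp
 have "t \<notin> U" using H(3) t(1) by blast
 hence tL:"abs t < L" using t(2) by (auto simp:U_def abs_if split: if_splits)
 define k where "k = nat \<lceil>L/abs t\<rceil>"
 have "L/abs t<=of_nat k" "of_nat k < L/abs t+1" using L t0 by (auto simp:k_def) linarith+
 hence "L<=of_nat k * abs t" "of_nat k * abs t < L+abs t" using t0 by (auto simp:field_simps)
 hence "of_nat k * t : U" using tL by (cases "0<=t") (auto simp:U_def abs_if)
 moreover have "of_nat k * t : G" if "G : H" for G
 proof -
 have "t : G" using t(1) that by blast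
 hence "of_nat j * t : G" for j
 using grp[OF that] by (induction j) (auto simp:closed_subgroup_def distrib_right)
 thus ?thesis .
 qed
 ultimately show False using H(3) by blast
 qed
 have "\<forall>G\<in>H. \<exists>c. AE om in M. ?f om-c : G" using H(1) n unfolding GG_def by blast
 then obtain c where "\<forall>G\<in>H. AE om in M. ?f om-c G : G" by metis
 hence "AE om in M. \<forall>G\<in>H. ?f om-c G : G" using H(2) by (intro AE_finite_allI) auto
 with bd have ae:"AE om in M. abs (?f om)<=L & (\<forall>G\<in>H. ?f om-c G : G)" by eventually_elim simp
 then obtain om0 where om0:"abs (?f om0)<=L" "\<forall>G\<in>H. ?f om0-c G : G"
 using eventually_happens[OF ae] ae_filter_bot by blast
 from ae have "AE om in M. ?f om = ?f om0"
 proof eventually_elim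
 case (elim om)
 have "?f om-?f om0 : \<Inter>H"
 proof
 fix G assume G:"G : H"
 have "(?f om-c G)+- (?f om0-c G) : G"
 using grp[OF G] elim om0(2) G unfolding closed_subgroup_def by blast
 thus "?f om-?f om0 : G" by simp
 qed
 moreover have "abs (?f om-?f om0)<=2 * L" using elim om0(1) by linarith
 ultimately show ?case using small by fastforce
 qed
 thus ?thesis by blast
qed

text \<open>Chebyshev's inequality about the centres \<open>c N\<close>, with one threshold for all
  \<open>N\<close>.\<close>

lemma (in prob_space) center_tightI:
 assumes int:"!!N. integrable M (%om. (u N om-c N)^2)" and le:"!!N. (LINT om|M. (u N om-c N)^2)<=C"
 and ae:"!!N. AE om in M. chain_sum X h N om = u N om" and u [measurable]:"!!N. u N : bm M"
 shows "center_tight M X h"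
 unfolding center_tight_def
proof (rule exI[of _ c],intro allI impI)
 fix e :: real assume e:"0 < e"
 define T where "T = sqrt ((abs C+1)/e)"
 have T:"0 < T" "T^2 = (abs C+1)/e" using e by (auto simp:T_def add_nonneg_pos)
 show "\<exists>T. \<forall>N\<ge>1. measure M {om : space M. T < abs (chain_sum X h N om-c N)} < e"
 proof (intro exI allI impI)
 fix N :: nat
 have "measure M {om : space M. T < abs (chain_sum X h N om-c N)}<=measure M {om : space M. T^2<=(u N om-c N)^2}"
 proof (rule finite_measure_mono_AE)
 show "AE om in M. om : {om : space M. T < abs (chain_sum X h N om-c N)} --> om : {om : space M. T^2<=(u N om-c N)^2}"
 using ae[of N]
 proof eventually_elim
 case (elim om)
 show ?case using power_mono[of T "abs (u N om-c N)" 2] T(1) by (auto simp:elim)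
 qed
 qed measurable
 also have "...<=(LINT om|M. (u N om-c N)^2)/T^2"
 by (rule integral_Markov_inequality_measure[OF int sets.empty_sets]) (use T(1) in auto)
 also have "...<=C/T^2" using le[of N] by (intro divide_right_mono) auto
 also have "... < e"
 proof -
 have "C < abs C+1" by linarith
 hence "C/T^2 < (abs C+1)/T^2" using T(1) by (intro divide_strict_right_mono) auto
 also have "... = e" using e by (simp add:T(2))
 finally show ?thesis .
 qed
 finally show "measure M {om : space M. T < abs (chain_sum X h N om-c N)} < e" .
 qed
qed

section \<open>Consequences of irreducibility\<close>

text \<open>\<open>f\<close> is the given functional, timed from 1, and \<open>g\<close> an
  everywhere bounded version, timed from 0, with the same values almost surely along the chain. All
  quantities of the theorem are computed from \<open>f\<close>, all estimates made for
  \<open>g\<close>.\<close>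

locale chain_functional = elliptic_process "%n. Bs (Suc n)" mu p ep g L M F "%n. X (Suc n)"
 for Bs mu ::"nat => 'a measure" and p ep g L and M ::"'w measure" and F X +
 fixes f ::"nat => 'a => 'a => real"
 assumes f_AE:"!!n. AE om in M. f (Suc n) (X (Suc n) om) (X (Suc2 n) om) = g n (X (Suc n) om) (X (Suc2 n) om)"
 and f_add:"additive_functional Bs f"
begin

lemma chain_sum_eq:"chain_sum X h N om = (\<Sum>m<N. h (Suc m) (X (Suc m) om) (X (Suc2 m) om))"
 by (simp add:chain_sum_def sum.atLeast1_atMost_eq)

lemma AE_chain_sum:"AE om in M. \<forall>N. chain_sum X f N om = S N om"
proof -
 have "AE om in M. \<forall>n. f (Suc n) (X (Suc n) om) (X (Suc2 n) om) = g n (X (Suc n) om) (X (Suc2 n) om)"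
 unfolding AE_all_countable using f_AE by blast
 thus ?thesis by eventually_elim (simp add:chain_sum_eq S_def)
qed

lemma chain_sum_measurable [measurable]:"chain_sum X f N : bm M"
proof -
 have "(%om. f (Suc m) (X (Suc m) om) (X (Suc2 m) om)) : bm M" for m
 using measurable_compose[OF measurable_Pair[OF X_M[of m] X_M[of "Suc m"]],of "%(x,y). f (Suc m) x y" borel]
 f_add[unfolded additive_functional_def,rule_format,of "Suc m"] by simp
 thus ?thesis unfolding chain_sum_eq[abs_def] by measurable
qed

lemma expectation_chain_sum:
 assumes [measurable]:"ph : bm borel"
 shows "expectation (%om. ph (chain_sum X f N om)) = (expectation (%om. ph (S N om)) :: real)"
 using AE_chain_sum by (intro integral_cong_AE) auto

lemma mean_S_eq:"mean_S M X f N = tmean N 0"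
 using expectation_chain_sum[of "%x. x" N] by (simp add:mean_S_def tmean_0)

lemma var_S_eq:"var_S M X f N = kappa2 N 0"
 using expectation_chain_sum[of "%x. (x-expectation (S N))^2" N] expectation_chain_sum[of "%x. x" N]
 by (simp add:var_S_def kappa2_0)

lemma free_energy_eq:"free_energy M X f N = (%xi. ln (Z N xi)/kappa2 N 0)"
 using expectation_chain_sum[of "%x. exp (_ * x)" N] by (simp add:fun_eq_iff free_energy_def var_S_eq Z_def)

lemma deriv_free_energy:"deriv (free_energy M X f N) xi = tmean N xi/kappa2 N 0"
 unfolding free_energy_eq by (intro DERIV_imp_deriv DERIV_cdivide has_real_derivative_ln_Z)

lemma window_iff:
 assumes "0 < kappa2 N 0"
 shows "et : window M X f R N \<longleftrightarrow> tmean N (- R)<=et * kappa2 N 0+tmean N 0 & et * kappa2 N 0+tmean N 0<=tmean N R"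
 using assms by (simp add:window_def deriv_free_energy mean_S_eq var_S_eq diff_divide_distrib[symmetric] divide_le_eq le_divide_eq algebra_simps)

text \<open>\<open>tmean\<close> is injective, so the maximiser in the Legendre transform at
  \<open>tmean N xi/kappa2 N 0\<close> is \<open>xi\<close>, and the exponential equals
  \<open>Z N xi * exp (- (xi * tmean N xi))\<close>. Then \<open>Z N xi\<close> and
  \<open>kappa2 N 0\<close> cancel against \<open>rho\<close>, leaving the prefactor of the local
  limit theorem.\<close>

lemma ld_factor_rho:
 assumes V:"0 < kappa2 N 0"
 shows "ld_factor M X f N (tmean N xi) * rho N x xi = exp (- (xi * tmean N xi)) * W N 0 xi x/(sqrt (2 * pi) * sqrt (kappa2 N xi))"
proof -
 define k where "k = kappa2 N 0"
 have k:"0 < k" "0 < kappa2 N xi" using V kappa2_pos[OF V] by (auto simp:k_def)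
 have Z:"0 < Z N xi" by (rule Z_pos)
 have "(THE t. tmean N t/k = tmean N xi/k) = xi"
 by (rule the_equality) (use k(1) tmean_inj[OF V] in auto)
 hence "rate_function M X f N (tmean N xi/k) = xi*(tmean N xi/k)-ln (Z N xi)/k"
 unfolding rate_function_def Let_def deriv_free_energy k_def[symmetric] by (simp only: free_energy_eq k_def)
 hence "- k * rate_function M X f N (tmean N xi/k) = ln (Z N xi)-xi * tmean N xi"
 using k(1) by (simp add:right_diff_distrib)
 hence "ld_factor M X f N (tmean N xi) = exp (ln (Z N xi)-xi * tmean N xi)/sqrt (2 * pi * k)"
 by (simp only: ld_factor_def var_S_eq k_def[symmetric])
 also have "exp (ln (Z N xi)-xi * tmean N xi) = Z N xi * exp (- (xi * tmean N xi))"
 using Z by (simp add:exp_diff exp_minus divide_inverse)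
 finally show ?thesis
 using k Z by (simp add:rho_def k_def[symmetric] real_sqrt_mult real_sqrt_divide)
qed

lemma Dsum_dichotomy:
 obtains C where "!!N. Dsum N th<=C" | "filterlim (%N. Dsum N th) at_top sequentially"
proof (cases "\<exists>C. \<forall>N. Dsum N th<=C")
 case False
 have "filterlim (%N. Dsum N th) at_top sequentially"
 unfolding filterlim_at_top
 proof
 fix C
 obtain n where "C < Dsum n th" using False by (auto simp:not_le)
 hence "C<=Dsum N th" if "n<=N" for N using Dsum_mono[OF that,of th] by linarith
 thus "\<forall>\<^sub>F N in sequentially. C<=Dsum N th" unfolding eventually_sequentially by blast
 qed
 thus ?thesis by (rule that(2))
qed (use that(1) in blast)

lemma G_ess_subset:
 assumes "additive_functional Bs h" "center_tight M X (%n x y. f n x y-h n x y)"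
 and "closed_subgroup G" "!!n. 1<=n ==> AE om in M. h n (X n om) (X (Suc n) om) : G"
 shows "G_ess Bs M X f \<subseteq> G"
proof -
 have "G_ess Bs M X f \<subseteq> G_alg M X h" unfolding G_ess_def by (intro Inter_lower CollectI exI[of _ h] conjI refl assms(1,2))
 also have "... \<subseteq> G" by (rule G_alg_subset) (rule assms(3,4),assumption?)+
 finally show ?thesis .
qed

text \<open>The lattice-valued functional of \<open>lattice_decomposition\<close> differs from
  \<open>f\<close> by a center-tight one and is therefore a competitor in
  \<open>G_ess\<close>.\<close>

lemma G_ess_subset_multiples:
 assumes th:"0 < th" and C:"!!N. Dsum N th<=C"
 shows "G_ess Bs M X f \<subseteq> range (%k::int. 2 * pi/th * of_int k)"
proof (rule lattice_decomposition[OF th C])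
 fix h c C'
 assume hm:"!!n. (%(x,y). h n x y) : bm (Bs (Suc n) \<Otimes>\<^sub>M Bs (Suc2 n))"
 and hl:"!!n x y. \<exists>k::int. h n x y = 2 * pi/th * of_int k" and hb:"!!n x y. abs (h n x y)<=2 * L+3 * pi/th"
 and h2:"!!N. (LINT om|M. ((\<Sum>m<N. g m (X (Suc m) om) (X (Suc2 m) om)-h m (X (Suc m) om) (X (Suc2 m) om))-c N)^2)<=C'"
 define u where "u N om = (\<Sum>m<N. g m (X (Suc m) om) (X (Suc2 m) om)-h m (X (Suc m) om) (X (Suc2 m) om))" for N om
 have hX:"(%om. h m (X (Suc m) om) (X (Suc2 m) om)) : bm M" for m
 using measurable_compose[OF measurable_Pair[OF X_M[of m] X_M[of "Suc m"]] hm[of m]] by simp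
 have um [measurable]:"u N : bm M" for N
 unfolding u_def[abs_def] using hX by (intro borel_measurable_sum borel_measurable_diff f_measurable X_M)
 show ?thesis
 proof (rule G_ess_subset[where h = "%n. h (n-1)"])
 show "additive_functional Bs (%n. h (n-1))"
 unfolding additive_functional_def
 proof (intro allI impI)
 fix n :: nat assume "1<=n"
 thus "(%(x,y). h (n-1) x y) : bm (Bs n \<Otimes>\<^sub>M Bs (Suc n))" using hm[of "n-1"] by simp
 qed
 show "center_tight M X (%n x y. f n x y-h (n-1) x y)"
 proof (rule center_tightI[OF _ h2[folded u_def]])
 fix N
 show "AE om in M. chain_sum X (%n x y. f n x y-h (n-1) x y) N om = u N om"
 using AE_chain_sum by eventually_elim (simp add:chain_sum_eq u_def sum_subtractf S_def)
 have ub:"abs (u N om)<=real N*(3 * L+3 * pi/th)" for om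
 proof -
 have "abs (u N om)<=(\<Sum>m<N. abs (g m (X (Suc m) om) (X (Suc2 m) om)-h m (X (Suc m) om) (X (Suc2 m) om)))"
 unfolding u_def by (rule sum_abs)
 also have "...<=(\<Sum>m<N. 3 * L+3 * pi/th)"
 proof (rule sum_mono)
 fix m
 show "abs (g m (X (Suc m) om) (X (Suc2 m) om)-h m (X (Suc m) om) (X (Suc2 m) om))<=3 * L+3 * pi/th"
 using f_bound[of m "X (Suc m) om" "X (Suc2 m) om"] hb[of m "X (Suc m) om" "X (Suc2 m) om"] by linarith
 qed
 finally show ?thesis by simp
 qed
 show "integrable M (%om. (u N om-c N)^2)"
 proof (rule integrable_const_bound[where B = "(real N*(3 * L+3 * pi/th)+abs (c N))^2"])
 have "abs (u N om-c N) ^ 2<=(real N*(3 * L+3 * pi/th)+abs (c N))^2" for om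
 using ub[of om] by (intro power_mono) linarith+
 thus "AE om in M. norm ((u N om-c N)^2)<=(real N*(3 * L+3 * pi/th)+abs (c N))^2" by simp
 qed measurable
 qed (rule um)
 show "closed_subgroup (range (%k::int. 2 * pi/th * of_int k))" using th by (intro closed_subgroup_multiples) simp
 show "AE om in M. h (n-1) (X n om) (X (Suc n) om) : range (%k::int. 2 * pi/th * of_int k)" if "1<=n" for n
 using hl by (intro AE_I2) (simp add:image_iff)
 qed
qed

text \<open>If \<open>Dsum\<close> is bounded at a small angle, then so are the variances;
  \<open>f\<close> itself is center-tight and the zero functional is a competitor in
  \<open>G_ess\<close>.\<close>

lemma G_ess_trivial:
 assumes th:"0 < th" "6 * L * th<=1" and C:"!!N. Dsum N th<=C"
 shows "G_ess Bs M X f \<subseteq> {0}"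
proof (rule G_ess_subset[where h = "%_ _ _. 0"])
 show "additive_functional Bs (%_ _ _. 0)" by (simp add:additive_functional_def)
 obtain c2 where c2:"0 < c2" "!!N xi. abs xi<=0 ==> kappa2 N xi<=c2*(Dsum N th+1)"
 using kappa2_comparison[OF order_refl th] by metis
 show "center_tight M X (%n x y. f n x y-0)"
 proof (rule center_tightI[where u = S and c = "%N. expectation (S N)" and C = "c2*(C+1)"])
 fix N
 have "kappa2 N 0<=c2*(Dsum N th+1)" by (rule c2(2)) simp
 also have "...<=c2*(C+1)" using C[of N] c2(1) by (intro mult_left_mono) auto
 finally show "variance (S N)<=c2*(C+1)" by (simp add:kappa2_0)
 show "AE om in M. chain_sum X (%n x y. f n x y-0) N om = S N om" using AE_chain_sum by eventually_elim simp
 define m where "m = expectation (S N)"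
 show "integrable M (%om. (S N om-expectation (S N))^2)" unfolding m_def[symmetric]
 proof (rule integrable_const_bound[where B = "(real N * L+abs m)^2"])
 have "abs (S N om-m) ^ 2<=(real N * L+abs m)^2" for om
 using abs_S_le[of N om] by (intro power_mono) linarith+
 thus "AE om in M. norm ((S N om-m)^2)<=(real N * L+abs m)^2" by simp
 qed measurable
 qed measurable
qed (auto intro:closed_subgroup_zero)

end

section \<open>The functions of the theorem\<close>

context chain_functional
begin

definition base :: real where "base = 1/(6 * L)"

definition good ::"nat => bool" where "good N \<longleftrightarrow> 1<=Dsum N base"

definition tilt ::"nat => real => real" where
 "tilt N et = (THE xi. tmean N xi = et * kappa2 N 0+tmean N 0)"

text \<open>The bounds in terms of the deviation are claimed for all \<open>N\<close>, including
  those where \<open>Dsum\<close> is still too small for the estimates; there the identity satisfies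
  them trivially. In the same way \<open>rho_fun\<close> takes the value 1.\<close>

definition xi_fun ::"nat => real => real" where
 "xi_fun N et = (if good N then tilt N et else et)"

definition rho_fun ::"nat => 'a => real => real" where
 "rho_fun N x et = (if good N then rho N x (tilt N et) else 1)"

lemma base:"0 < base" "6 * L * base<=1"
 using L_pos by (auto simp:base_def)

lemma kappa2_0_nonneg:"0<=kappa2 N 0"
 unfolding kappa2_0 by (rule variance_positive)

lemma tilt_window:
 assumes V:"0 < kappa2 N 0" and et:"et : window M X f R N" and R:"0<=R"
 shows "abs (tilt N et)<=R" "tmean N (tilt N et) = et * kappa2 N 0+tmean N 0"
proof -
 obtain xi where xi:"abs xi<=R" "tmean N xi = et * kappa2 N 0+tmean N 0"
 using tmean_surj[of N R "et * kappa2 N 0+tmean N 0"] et R unfolding window_iff[OF V] by blast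
 have "tilt N et = xi" unfolding tilt_def xi(2)[symmetric] tmean_inj[OF V] by simp
 thus "abs (tilt N et)<=R" "tmean N (tilt N et) = et * kappa2 N 0+tmean N 0" using xi by auto
qed

lemma uniform_constant:
 assumes R:"0<=R"
 obtains q where "1<=q"
 "!!N xi. good N ==> abs xi<=R ==> 0 < kappa2 N 0 & kappa2 N 0/q<=kappa2 N xi & kappa2 N xi<=q * kappa2 N 0"
 using kappa2_uniform[OF R base] unfolding good_def by metis

text \<open>By the mean value theorem the deviation is the tilt times a ratio of variances within
  \<open>{-R..R}\<close>, which lies between \<open>1/q\<close> and \<open>q\<close>.\<close>

lemma tilt_slope:
 assumes V:"0 < kappa2 N 0" and et:"et : window M X f R N" and R:"0<=R" and q:"1<=q"
 and k:"!!xi. abs xi<=R ==> kappa2 N 0/q<=kappa2 N xi & kappa2 N xi<=q * kappa2 N 0"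
 obtains s where "0 < s" "1/q<=s" "s<=q" "et = s * tilt N et"
proof -
 obtain t where t:"abs t<=abs (tilt N et)" "tmean N (tilt N et)-tmean N 0 = tilt N et * kappa2 N t"
 by (rule tmean_mean_value)
 define s where "s = kappa2 N t/kappa2 N 0"
 have tR:"abs t<=R" using t(1) tilt_window(1)[OF V et R] by linarith
 have "et * kappa2 N 0 = tilt N et * kappa2 N t" using t(2) tilt_window(2)[OF V et R] by simp
 hence "et = s * tilt N et" using V by (simp add:s_def field_simps)
 moreover have "1/q<=s" "s<=q" using k[OF tR] V by (auto simp:s_def divide_le_eq le_divide_eq)
 moreover have "0 < s" using kappa2_pos[OF V] V by (simp add:s_def)
 ultimately show ?thesis using that by blast
qed

lemma abs_tilt_bounds:
 assumes "0 < s" "1/q<=s" "s<=q" "1<=q" "et = s * t"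
 shows "abs et/q<=abs t" "abs t<=q * abs et" "sgn t = sgn (et :: real)"
proof -
 have "s * abs t<=q * abs t" using assms by (intro mult_right_mono) auto
 thus "abs et/q<=abs t" using assms by (simp add:abs_mult divide_le_eq mult.commute)
 have "1<=q * s" using assms by (simp add:divide_le_eq mult.commute)
 hence "1 * abs t<=q * s * abs t" by (intro mult_right_mono) auto
 thus "abs t<=q * abs et" using assms by (simp add:abs_mult mult.assoc)
 show "sgn t = sgn et" using assms by (simp add:sgn_mult)
qed

text \<open>The degenerate case: bounded \<open>Dsum\<close> makes the essential range trivial,
  irreducibility makes the algebraic range trivial, hence every increment is almost surely constant.
  All claims restricted to nonzero variance then become vacuous.\<close>

lemma kappa2_vanishes:
 assumes irr:"irreducible_functional Bs M X f" and nt:"\<not> filterlim (%N. Dsum N base) at_top sequentially"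
 shows "kappa2 N 0 = 0"
proof -
 obtain C where C:"!!N. Dsum N base<=C" using Dsum_dichotomy[of base] nt by metis
 have G:"G_alg M X f \<subseteq> {0}"
 using G_ess_trivial[OF base C] irr by (simp add:irreducible_functional_def)
 have "\<exists>v. AE om in M. f (Suc m) (X (Suc m) om) (X (Suc2 m) om) = v" for m
 proof (rule constant_if_G_alg_trivial[OF L_pos _ G])
 show "AE om in M. abs (f (Suc m) (X (Suc m) om) (X (Suc2 m) om))<=L"
 using f_AE[of m] by eventually_elim (simp add:f_bound)
 qed simp
 then obtain v where v:"!!m. AE om in M. f (Suc m) (X (Suc m) om) (X (Suc2 m) om) = v m" by metis
 have "AE om in M. \<forall>m. f (Suc m) (X (Suc m) om) (X (Suc2 m) om) = v m"
 unfolding AE_all_countable using v by blast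
 with AE_chain_sum have ae:"AE om in M. S N om = (\<Sum>m<N. v m)"
 proof eventually_elim
 case (elim om)
 hence "S N om = chain_sum X f N om" by simp
 with elim(2) show ?case by (simp add:chain_sum_eq)
 qed
 have "expectation (S N) = (LINT om|M. (\<Sum>m<N. v m))" using ae by (intro integral_cong_AE) auto
 hence m:"expectation (S N) = (\<Sum>m<N. v m)" by (simp add:prob_space)
 have "variance (S N) = (LINT om|M. 0)" unfolding m using ae by (intro integral_cong_AE) auto
 thus ?thesis by (simp add:kappa2_0)
qed

lemma eventually_good:"filterlim (%N. Dsum N base) at_top sequentially ==> \<forall>\<^sub>F N in sequentially. good N"
 unfolding good_def by (simp add:filterlim_at_top)

lemma window_contains_interval:
 assumes irr:"irreducible_functional Bs M X f" and R:"0 < R"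
 shows "\<exists>c>0. \<forall>\<^sub>F N in sequentially. var_S M X f N ~= 0 --> {-c..c} \<subseteq> window M X f R N"
proof (cases "filterlim (%N. Dsum N base) at_top sequentially")
 case True
 obtain q where q:"1<=q" "!!N xi. good N ==> abs xi<=R ==> 0 < kappa2 N 0 & kappa2 N 0/q<=kappa2 N xi & kappa2 N xi<=q * kappa2 N 0"
 using uniform_constant[of R] R by (metis less_imp_le)
 show ?thesis
 proof (intro exI conjI)
 show "0 < R/q" using R q by simp
 show "\<forall>\<^sub>F N in sequentially. var_S M X f N ~= 0 --> {-(R/q)..R/q} \<subseteq> window M X f R N"
 using eventually_good[OF True]
 proof (eventually_elim,intro impI subsetI)
 fix N et assume N:"good N" and "et : {-(R/q)..R/q}"
 hence et:"- (R/q)<=et" "et<=R/q" by auto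
 have V:"0 < kappa2 N 0" using q(2)[OF N,of 0] R by simp
 have lo:"R/q * kappa2 N 0<=R * kappa2 N s" if "abs s<=R" for s
 using q(2)[OF N that] R mult_left_mono[of "kappa2 N 0/q" "kappa2 N s" R] by simp
 obtain s where s:"abs s<=R" "tmean N R-tmean N 0 = R * kappa2 N s" using tmean_mean_value[of R N] R by auto
 obtain s' where s':"abs s'<=R" "tmean N (- R)-tmean N 0 = - R * kappa2 N s'" using tmean_mean_value[of "- R" N] R by auto
 have "et * kappa2 N 0<=R/q * kappa2 N 0" using et V by (intro mult_right_mono) auto
 moreover have "- (R/q) * kappa2 N 0<=et * kappa2 N 0" using et V by (intro mult_right_mono) auto
 ultimately show "et : window M X f R N"
 unfolding window_iff[OF V] using lo[OF s(1)] lo[OF s'(1)] s(2) s'(2) by (simp add:algebra_simps)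
 qed
 qed
next
 case False
 thus ?thesis using kappa2_vanishes[OF irr False] by (intro exI[of _ 1]) (simp add:var_S_eq)
qed

lemma xi_fun_bounds:
 assumes R:"0<=R"
 shows "\<exists>C>0. \<forall>N\<ge>1. var_S M X f N ~= 0 --> (\<forall>et\<in>window M X f R N.
 abs et/C<=abs (xi_fun N et) & abs (xi_fun N et)<=C * abs et & sgn (xi_fun N et) = sgn et)"
proof -
 obtain q where q:"1<=q" "!!N xi. good N ==> abs xi<=R ==> 0 < kappa2 N 0 & kappa2 N 0/q<=kappa2 N xi & kappa2 N xi<=q * kappa2 N 0"
 by (rule uniform_constant[OF R]) blast
 show ?thesis
 proof (intro exI[of _ q] conjI[of "0 < q"] allI impI ballI)
 fix N et assume "var_S M X f N ~= 0" and et:"et : window M X f R N"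
 hence V:"0 < kappa2 N 0" using kappa2_0_nonneg[of N] by (simp add:var_S_eq)
 show "abs et/q<=abs (xi_fun N et) & abs (xi_fun N et)<=q * abs et & sgn (xi_fun N et) = sgn et"
 proof (cases "good N")
 case True
 obtain s where s:"0 < s" "1/q<=s" "s<=q" "et = s * tilt N et"
 using tilt_slope[OF V et R q(1)] q(2)[OF True] by blast
 show ?thesis using abs_tilt_bounds[OF s(1-3) q(1) s(4)] True by (simp add:xi_fun_def)
 next
 case False
 have 1:"1 * abs et<=q * abs et" using q(1) by (intro mult_right_mono) auto
 hence "abs et/q<=abs et" using q(1) by (simp add:divide_le_eq mult.commute)
 with 1 show ?thesis using False by (simp add:xi_fun_def)
 qed
 qed (use q(1) in linarith)
qed

lemma rho_fun_bounds:
 assumes R:"0<=R"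
 shows "\<exists>l>0. \<exists>u. \<forall>N\<ge>1. var_S M X f N ~= 0 --> (\<forall>x\<in>space (Bs 1). \<forall>et\<in>window M X f R N. l<=rho_fun N x et & rho_fun N x et<=u)"
proof -
 obtain q where q:"1<=q" "!!N xi. good N ==> abs xi<=R ==> 0 < kappa2 N 0 & kappa2 N 0/q<=kappa2 N xi & kappa2 N xi<=q * kappa2 N 0"
 by (rule uniform_constant[OF R]) blast
 define h where "h = harnack R * sqrt q"
 have h:"1<=h" unfolding h_def using mult_mono[of 1 "harnack R" 1 "sqrt q"] harnack_ge_1[OF R] q(1) by simp
 show ?thesis
 proof (rule exI[of _ "1/h"],rule conjI,use h in simp,rule exI[of _ h],intro allI impI ballI)
 fix N x et assume "var_S M X f N ~= 0" and x:"x : space (Bs 1)" and et:"et : window M X f R N"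
 hence V:"0 < kappa2 N 0" using kappa2_0_nonneg[of N] by (simp add:var_S_eq)
 show "1/h<=rho_fun N x et & rho_fun N x et<=h"
 proof (cases "good N")
 case True
 have t:"abs (tilt N et)<=R" by (rule tilt_window(1)[OF V et R])
 have x':"x : space (Bs (Suc 0))" using x by simp
 show ?thesis using rho_bounds[OF t x' q(1)] q(2)[OF True t] True by (auto simp:rho_fun_def h_def)
 next
 case False
 thus ?thesis using h by (simp add:rho_fun_def divide_le_eq)
 qed
 qed
qed

lemma rho_fun_limit:
 assumes R:"0<=R" and e:"0 < e"
 shows "\<exists>de>0. \<forall>N\<ge>1. var_S M X f N ~= 0 --> (\<forall>x\<in>space (Bs 1). \<forall>et\<in>window M X f R N. abs et < de --> abs (rho_fun N x et-1) < e)"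
proof -
 obtain q where q:"1<=q" "!!N xi. good N ==> abs xi<=R ==> 0 < kappa2 N 0 & kappa2 N 0/q<=kappa2 N xi & kappa2 N xi<=q * kappa2 N 0"
 by (rule uniform_constant[OF R]) blast
 obtain d where d:"0 < d" "!!N x xi. 1<=Dsum N base ==> x : space (Bs (Suc 0)) ==> abs xi < d ==> abs (rho N x xi-1) < e"
 using rho_limit[OF base e] by metis
 show ?thesis
 proof (intro exI[of _ "d/q"] conjI[of "0 < d/q"] allI impI ballI)
 fix N x et assume "var_S M X f N ~= 0" and x:"x : space (Bs 1)" and et:"et : window M X f R N" "abs et < d/q"
 hence V:"0 < kappa2 N 0" using kappa2_0_nonneg[of N] by (simp add:var_S_eq)
 show "abs (rho_fun N x et-1) < e"
 proof (cases "good N")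
 case True
 obtain s where s:"0 < s" "1/q<=s" "s<=q" "et = s * tilt N et"
 using tilt_slope[OF V et(1) R q(1)] q(2)[OF True] by blast
 have "abs (tilt N et)<=q * abs et" by (rule abs_tilt_bounds(2)[OF s(1-3) q(1) s(4)])
 also have "... < d" using et(2) q(1) by (simp add:less_divide_eq mult.commute)
 finally show ?thesis using d(2)[of N x "tilt N et"] True x by (simp add:rho_fun_def good_def)
 next
 case False
 thus ?thesis using e by (simp add:rho_fun_def)
 qed
 qed (use d q in auto)
qed

lemma measure_chain_sum:
 assumes [measurable]:"A : sets borel"
 shows "measure M {om : space M. chain_sum X f N om-z : A} = measure M {om : space M. S N om-z : A}"
proof (rule measure_eq_AE)
 show "AE om in M. om : {om : space M. chain_sum X f N om-z : A} \<longleftrightarrow> om : {om : space M. S N om-z : A}"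
 using AE_chain_sum by eventually_elim simp
qed measurable

section \<open>Large deviations along a sequence of targets\<close>

definition tilts ::"(nat => real) => (nat => real) => nat => bool" where
 "tilts z xi N \<longleftrightarrow> tmean N (xi N) = z N & xi_fun N (deviation M X f N (z N)) = xi N \<and>
 (\<forall>x. ld_factor M X f N (z N) * rho_fun N x (deviation M X f N (z N)) = exp (- (xi N * z N)) * W N 0 (xi N) x/(sqrt (2 * pi) * sqrt (kappa2 N (xi N))))"

text \<open>Tilting so that the tilted mean equals \<open>z N\<close> turns the large deviation into
  a local limit at the centre. The finitely many exceptional indices receive tilt 0 to keep
  \<open>xi\<close> bounded.\<close>

lemma tilt_sequence:
 assumes top:"filterlim (%N. Dsum N base) at_top sequentially" and R:"0<=R"
 and z:"!!N. 1<=N ==> var_S M X f N ~= 0 ==> deviation M X f N (z N) : window M X f R N"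
 shows "\<exists>xi. (\<forall>N. abs (xi N)<=R) \<and>
 (\<forall>\<^sub>F N in sequentially. tilts z xi N)"
proof -
 let ?d = "%N. deviation M X f N (z N)"
 define xi where "xi N = (if 1<=N & good N then tilt N (?d N) else 0)" for N
 have V:"0 < kappa2 N 0" if "good N" for N
 using uniform_constant[OF order_refl] that by (metis abs_zero order_refl)
 have t:"abs (tilt N (?d N))<=R" "tmean N (tilt N (?d N)) = z N" if "1<=N" "good N" for N
 proof -
 note V' = V[OF that(2)]
 have w:"?d N : window M X f R N" using z[OF that(1)] V' by (simp add:var_S_eq)
 show "abs (tilt N (?d N))<=R" by (rule tilt_window(1)[OF V' w R])
 show "tmean N (tilt N (?d N)) = z N"
 using tilt_window(2)[OF V' w R] V' by (simp add:deviation_def mean_S_eq var_S_eq)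
 qed
 show ?thesis
 proof (intro exI[of _ xi] conjI allI)
 show "abs (xi N)<=R" for N using t[of N] R by (simp add:xi_def)
 show "\<forall>\<^sub>F N in sequentially. tilts z xi N"
 using eventually_good[OF top] eventually_ge_at_top[of 1]
 proof eventually_elim
 case (elim N)
 hence xi:"xi N = tilt N (?d N)" by (simp add:xi_def)
 hence zt:"tmean N (xi N) = z N" using t(2)[of N] elim by simp
 thus ?case
 using ld_factor_rho[OF V[OF elim(1)],of "xi N"] elim xi by (simp add:tilts_def xi_fun_def rho_fun_def)
 qed
 qed
qed

text \<open>Contrapositive of \<open>G_ess_subset_multiples\<close>: by irreducibility a bounded
  \<open>Dsum\<close> would put the algebraic range inside the multiples of
  \<open>2 pi/abs th\<close>.\<close>

lemma Dsum_top:
 assumes irr:"irreducible_functional Bs M X f" and th:"th ~= 0"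
 and G:"\<not> G_alg M X f \<subseteq> range (%k::int. 2 * pi/abs th * of_int k)"
 shows "filterlim (%N. Dsum N th) at_top sequentially"
proof -
 have D:"Dsum N (abs th) = Dsum N th" for N by (cases "0<=th") (auto simp:Dsum_minus)
 show ?thesis
 proof (cases rule: Dsum_dichotomy[of th])
 case (1 C)
 have "G_ess Bs M X f \<subseteq> range (%k::int. 2 * pi/abs th * of_int k)"
 by (rule G_ess_subset_multiples[where C = C]) (use th 1 D in auto)
 thus ?thesis using G irr by (simp add:irreducible_functional_def)
 qed
qed

lemma nonlattice_large_deviations:
 assumes irr:"irreducible_functional Bs M X f" and G:"G_alg M X f = UNIV" and R:"0<=R"
 and P:"chain_functional Bs mu p ep g L P F' Y f" and start:"distr P (Bs 1) (Y 1) = return (Bs 1) x" and x:"x : space (Bs 1)"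
 and z:"!!N. 1<=N ==> var_S M X f N ~= 0 ==> deviation M X f N (z N) : window M X f R N" and ab:"a < b"
 shows "(%N. measure P {om : space P. chain_sum Y f N om-z N : {a<..<b}}) \<sim>[sequentially]
 (%N. ld_factor M X f N (z N) * rho_fun N x (deviation M X f N (z N)) *
 (LBINT t:{a<..<b}. exp (- t * xi_fun N (deviation M X f N (z N)))))"
proof -
 interpret P: chain_functional Bs mu p ep g L P F' Y f by (rule P)
 have inf:"filterlim (%N. Dsum N th) at_top sequentially" if th:"th ~= 0" for th
 proof (rule Dsum_top[OF irr th])
 show "\<not> G_alg M X f \<subseteq> range (%k::int. 2 * pi/abs th * of_int k)"
 proof
 assume "G_alg M X f \<subseteq> range (%k::int. 2 * pi/abs th * of_int k)"
 \<comment> \<open>\<open>pi/abs th\<close> is half the lattice step, hence a real number outside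
   the lattice.\<close>
 then obtain k :: int where "pi/abs th = 2 * pi/abs th * of_int k" unfolding G by blast
 hence "1 = 2 * real_of_int k" using th by simp
 hence "(1 :: int) = 2 * k" by (metis of_int_1 of_int_eq_iff of_int_mult of_int_numeral)
 thus False by presburger
 qed
 qed
 have top:"filterlim (%N. Dsum N base) at_top sequentially" using inf base by simp
 obtain xi where xi':"\<forall>N. abs (xi N)<=R" and ev:"\<forall>\<^sub>F N in sequentially. tilts z xi N"
 proof -
 have "\<exists>xi. (\<forall>N. abs (xi N)<=R) \<and>
 (\<forall>\<^sub>F N in sequentially. tilts z xi N)"
 by (rule tilt_sequence[OF top R]) (rule z)
 thus thesis by (elim exE conjE) (rule that)
 qed
 note ev = ev[unfolded tilts_def]
 have xi:"abs (xi N)<=R" for N using xi' by (rule spec)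
 have "(%N. measure P {om : space P. P.S N om-tmean N (xi N) : {a<..<b}}) \<sim>[sequentially]
 (%N. exp (- (xi N * tmean N (xi N))) * W N 0 (xi N) x/(sqrt (2 * pi) * sqrt (kappa2 N (xi N)))*(LINT y|lborel. indicator {a<..<b} y * exp (- y * xi N)))"
 by (rule nonlattice_local_limit[OF P.elliptic_process_axioms _ _ xi base inf ab]) (use start x in auto)
 thus ?thesis
 proof (rule asymp_equiv_cong[THEN iffD1,rotated 2])
 show "\<forall>\<^sub>F N in sequentially. measure P {om : space P. P.S N om-tmean N (xi N) : {a<..<b}} = measure P {om : space P. chain_sum Y f N om-z N : {a<..<b}}"
 using ev by eventually_elim (subst P.measure_chain_sum,auto)
 show "\<forall>\<^sub>F N in sequentially. exp (- (xi N * tmean N (xi N))) * W N 0 (xi N) x/(sqrt (2 * pi) * sqrt (kappa2 N (xi N)))*(LINT y|lborel. indicator {a<..<b} y * exp (- y * xi N))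
 = ld_factor M X f N (z N) * rho_fun N x (deviation M X f N (z N))*(LBINT t:{a<..<b}. exp (- t * xi_fun N (deviation M X f N (z N))))"
 using ev by eventually_elim (simp add:set_lebesgue_integral_def)
 qed
qed

lemma lattice_large_deviations:
 assumes irr:"irreducible_functional Bs M X f" and G:"G_alg M X f = \<int>" and R:"0<=R" and L1:"1<=L"
 and P:"chain_functional Bs mu p ep g L P F' Y f" and start:"distr P (Bs 1) (Y 1) = return (Bs 1) x" and x:"x : space (Bs 1)"
 and z:"!!N. 1<=N ==> var_S M X f N ~= 0 ==> deviation M X f N (z N) : window M X f R N"
 and c:"!!N. 1<=N ==> z N-c N : \<int>" "!!N. 1<=N ==> AE om in P. chain_sum Y f N om-c N : \<int>"
 shows "(%N. measure P {om : space P. chain_sum Y f N om-z N : {a<..<b}}) \<sim>[sequentially]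
 (%N. ld_factor M X f N (z N) * rho_fun N x (deviation M X f N (z N)) *
 (\<Sum>t\<in>{a<..<b} \<inter> \<int>. exp (- t * xi_fun N (deviation M X f N (z N)))))"
proof -
 interpret P: chain_functional Bs mu p ep g L P F' Y f by (rule P)
 have inf:"filterlim (%N. Dsum N th) at_top sequentially" if th:"base<=abs th" "abs th<=pi+base" for th
 proof (rule Dsum_top[OF irr])
 show th0:"th ~= 0" using th(1) base by auto
 show "\<not> G_alg M X f \<subseteq> range (%k::int. 2 * pi/abs th * of_int k)"
 proof
 assume "G_alg M X f \<subseteq> range (%k::int. 2 * pi/abs th * of_int k)"
 hence "1 : range (%k::int. 2 * pi/abs th * of_int k)" by (rule subsetD) (simp add:G)
 then obtain k :: int where k:"1 = 2 * pi/abs th * of_int k" by blast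
 \<comment> \<open>If 1 is a multiple of \<open>2 pi/abs th\<close>, then \<open>abs th\<close> is
   at least \<open>2 pi\<close>; this contradicts \<open>abs th<=pi+base\<close>, because
   \<open>1<=L\<close> forces \<open>base<=1\<close>.\<close>
 hence "abs th = 2 * pi * of_int k" using th0 by (simp add:field_simps)
 moreover have "0 < k"
 proof (rule ccontr)
 assume "\<not> 0 < k"
 hence "2 * pi/abs th * of_int k<=0" by (intro mult_nonneg_nonpos) auto
 thus False using k by linarith
 qed
 hence "2 * pi*1<=2 * pi * real_of_int k" by (intro mult_left_mono) auto
 moreover have "base<=1" using L1 by (simp add:base_def)
 ultimately show False using th(2) pi_gt3 by linarith
 qed
 qed
 have top:"filterlim (%N. Dsum N base) at_top sequentially" using inf[of base] base pi_gt_zero by simp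
 obtain xi where xi':"\<forall>N. abs (xi N)<=R" and ev:"\<forall>\<^sub>F N in sequentially. tilts z xi N"
 proof -
 have "\<exists>xi. (\<forall>N. abs (xi N)<=R) \<and>
 (\<forall>\<^sub>F N in sequentially. tilts z xi N)"
 by (rule tilt_sequence[OF top R]) (rule z)
 thus thesis by (elim exE conjE) (rule that)
 qed
 note ev = ev[unfolded tilts_def]
 have xi:"abs (xi N)<=R" for N using xi' by (rule spec)
 obtain n1 where n1:"!!N. n1<=N ==> tmean N (xi N) = z N" using ev unfolding eventually_sequentially by blast
 have "(%N. measure P {om : space P. P.S N om-tmean N (xi N) : {a<..<b}}) \<sim>[sequentially]
 (%N. exp (- (xi N * tmean N (xi N))) * W N 0 (xi N) x/(sqrt (2 * pi) * sqrt (kappa2 N (xi N)))*(\<Sum>t\<in>{a<..<b} \<inter> \<int>. exp (- t * xi N)))"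
 proof (rule integer_local_limit[OF P.elliptic_process_axioms _ _ xi base inf,where ?n1.0 = "max 1 n1"])
 fix N assume N:"max 1 n1<=N"
 show "AE om in P. P.S N om-tmean N (xi N) : \<int>"
 using P.AE_chain_sum c(2)[of N,OF order_trans[OF max.cobounded1 N]]
 proof eventually_elim
 case (elim om)
 have "z N-c N : \<int>" by (rule c(1)) (use N in simp)
 with elim(2) have "(chain_sum Y f N om-c N)-(z N-c N) : \<int>" by (rule Ints_diff)
 moreover have "tmean N (xi N) = z N" by (rule n1) (use N in simp)
 ultimately show ?case using elim(1) by simp
 qed
 qed (use start x in auto)
 thus ?thesis
 proof (rule asymp_equiv_cong[THEN iffD1,rotated 2])
 show "\<forall>\<^sub>F N in sequentially. measure P {om : space P. P.S N om-tmean N (xi N) : {a<..<b}} = measure P {om : space P. chain_sum Y f N om-z N : {a<..<b}}"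
 using ev by eventually_elim (subst P.measure_chain_sum,auto)
 show "\<forall>\<^sub>F N in sequentially. exp (- (xi N * tmean N (xi N))) * W N 0 (xi N) x/(sqrt (2 * pi) * sqrt (kappa2 N (xi N)))*(\<Sum>t\<in>{a<..<b} \<inter> \<int>. exp (- t * xi N))
 = ld_factor M X f N (z N) * rho_fun N x (deviation M X f N (z N))*(\<Sum>t\<in>{a<..<b} \<inter> \<int>. exp (- t * xi_fun N (deviation M X f N (z N))))"
 using ev by eventually_elim simp
 qed
qed

end

theorem theorem6p5:
  fixes S :: "nat \<Rightarrow> 'a set" and d :: "nat \<Rightarrow> 'a \<Rightarrow> 'a \<Rightarrow> real"
    and Q :: "nat \<Rightarrow> 'a \<Rightarrow> 'a measure" and \<nu> :: "'a measure"
    and M :: "'w measure" and X :: "nat \<Rightarrow> 'w \<Rightarrow> 'a"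
    and Px :: "'a \<Rightarrow> 'v measure" and Y :: "nat \<Rightarrow> 'v \<Rightarrow> 'a"
    and f :: "nat \<Rightarrow> 'a \<Rightarrow> 'a \<Rightarrow> real" and K :: real
  assumes "\<forall>n\<ge>1. polish_metric (S n) (d n)"
    and "transition_kernels (borel_spaces S d) Q"
    and "uniformly_elliptic (borel_spaces S d) Q"
    and "\<nu> \<in> space (prob_algebra (borel_spaces S d 1))"
    and "markov_chain (borel_spaces S d) \<nu> Q M X"
    and "\<forall>x\<in>S 1. markov_chain (borel_spaces S d) (return (borel_spaces S d 1) x) Q (Px x) Y"
    and "additive_functional (borel_spaces S d) f"
    and "as_uniformly_bounded M X f"
    and "irreducible_functional (borel_spaces S d) M X f"
  shows "\<exists>R\<^sub>0>0. \<forall>R\<ge>R\<^sub>0. \<exists>(\<rho> :: nat \<Rightarrow> 'a \<Rightarrow> real \<Rightarrow> real) (\<xi> :: nat \<Rightarrow> real \<Rightarrow> real).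
    \<comment> \<open>(1)\<close>
    (\<exists>c>0. \<forall>\<^sub>F N in sequentially. var_S M X f N \<noteq> 0 \<longrightarrow> {- c..c} \<subseteq> window M X f R N) \<and>
    \<comment> \<open>(2) non-lattice case\<close>
    (G_alg M X f = UNIV \<longrightarrow>
      (\<forall>z :: nat \<Rightarrow> real.
        (\<forall>N\<ge>1. var_S M X f N \<noteq> 0 \<longrightarrow> deviation M X f N (z N) \<in> window M X f R N) \<longrightarrow>
        (\<forall>a b :: real. a < b \<longrightarrow>
          (\<forall>x\<in>S 1. ess_bound (Px x) Y f \<le> ereal K \<longrightarrow>
            (\<lambda>N. measure (Px x) {\<omega> \<in> space (Px x). chain_sum Y f N \<omega> - z N \<in> {a<..<b}})
              \<sim>[sequentially]
            (\<lambda>N. ld_factor M X f N (z N) * \<rho> N x (deviation M X f N (z N)) *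
                 (LBINT t:{a<..<b}. exp (- t * \<xi> N (deviation M X f N (z N))))))))) \<and>
    \<comment> \<open>(3) lattice case\<close>
    (G_alg M X f = \<int> \<longrightarrow>
      (\<forall>c :: nat \<Rightarrow> real. (\<forall>N\<ge>1. AE \<omega> in M. chain_sum X f N \<omega> - c N \<in> \<int>) \<longrightarrow>
      (\<forall>z :: nat \<Rightarrow> real.
        (\<forall>N\<ge>1. z N - c N \<in> \<int>) \<and>
        (\<forall>N\<ge>1. var_S M X f N \<noteq> 0 \<longrightarrow> deviation M X f N (z N) \<in> window M X f R N) \<longrightarrow>
        (\<forall>a b :: real. a < b \<longrightarrow>
          (\<forall>x\<in>S 1. ess_bound (Px x) Y f \<le> ereal K \<and>
                    (\<forall>N\<ge>1. AE \<omega> in Px x. chain_sum Y f N \<omega> - c N \<in> \<int>) \<longrightarrow>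
            (\<lambda>N. measure (Px x) {\<omega> \<in> space (Px x). chain_sum Y f N \<omega> - z N \<in> {a<..<b}})
              \<sim>[sequentially]
            (\<lambda>N. ld_factor M X f N (z N) * \<rho> N x (deviation M X f N (z N)) *
                 (\<Sum>t\<in>{a<..<b} \<inter> \<int>. exp (- t * \<xi> N (deviation M X f N (z N)))))))))) \<and>
    \<comment> \<open>(4a)\<close>
    (\<exists>l>0. \<exists>u. \<forall>N\<ge>1. var_S M X f N \<noteq> 0 \<longrightarrow>
      (\<forall>x\<in>S 1. \<forall>\<eta>\<in>window M X f R N. l \<le> \<rho> N x \<eta> \<and> \<rho> N x \<eta> \<le> u)) \<and>
    (\<forall>\<epsilon>>0. \<exists>\<delta>>0. \<forall>N\<ge>1. var_S M X f N \<noteq> 0 \<longrightarrow>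
      (\<forall>x\<in>S 1. \<forall>\<eta>\<in>window M X f R N. \<bar>\<eta>\<bar> < \<delta> \<longrightarrow> \<bar>\<rho> N x \<eta> - 1\<bar> < \<epsilon>)) \<and>
    \<comment> \<open>(4b)\<close>
    (\<exists>C>0. \<forall>N\<ge>1. var_S M X f N \<noteq> 0 \<longrightarrow>
      (\<forall>\<eta>\<in>window M X f R N.
        \<bar>\<eta>\<bar> / C \<le> \<bar>\<xi> N \<eta>\<bar> \<and> \<bar>\<xi> N \<eta>\<bar> \<le> C * \<bar>\<eta>\<bar> \<and> sgn (\<xi> N \<eta>) = sgn \<eta>))"
proof -
 let ?B = "borel_spaces S d"
 note Q = assms(2) and ue = assms(3) and mc = assms(5) and mcx = assms(6) and addf = assms(7) and irr = assms(9)
 obtain ep mu p where ek:"elliptic_kernels (%n. ?B (Suc n)) mu p ep"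
 and QK:"!!n x. x : space (?B (Suc n)) ==> Q (Suc n) x = elliptic_kernels.K mu p n x"
 using uniformly_elliptic_kernels[OF Q ue] by metis
 obtain k where k:"ess_bound M X f<=ereal k"
 using assms(8) unfolding as_uniformly_bounded_def by (cases "ess_bound M X f") auto
 \<comment> \<open>One bound for everything: \<open>k\<close> for the given law and \<open>K\<close>
   for the laws from points give a common truncation \<open>g\<close>, hence common kernels and
   functions \<open>W\<close>; the bound below by 1 is for the lattice case.\<close>
 define L where "L = max 1 (max K k)"
 have L:"1<=L" "K<=L" "k<=L" by (auto simp:L_def)
 \<comment> \<open>Truncation turns an almost sure bound into a bound at every argument; along each
   of the chains considered it changes nothing almost surely.\<close>
 define g where "g n x y = max (- L) (min L (f (Suc n) x y))" for n x y
 have ef:"elliptic_functional (%n. ?B (Suc n)) mu p ep g L"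
 proof (intro elliptic_functional.intro elliptic_functional_axioms.intro ek)
 show "(%(x,y). g n x y) : bm (?B (Suc n) \<Otimes>\<^sub>M ?B (Suc2 n))" for n
 proof -
 have [measurable]:"(%z. f (Suc n) (fst z) (snd z)) : bm (?B (Suc n) \<Otimes>\<^sub>M ?B (Suc2 n))"
 using addf by (simp add:additive_functional_def case_prod_unfold)
 show ?thesis unfolding g_def case_prod_unfold by measurable
 qed
 show "abs (g n x y)<=L" for n x y using L(1) by (auto simp:g_def abs_le_iff)
 show "0 < L" using L(1) by linarith
 qed
 have cf:"chain_functional ?B mu p ep g L P (%n. past_algebra ?B P V (Suc n)) V f"
 if m:"markov_chain ?B nu' Q P V" and b:"ess_bound P V f<=ereal L" for P ::"'p measure" and V nu'
 proof (intro chain_functional.intro chain_functional_axioms.intro addf markov_chain_elliptic_process[OF m ef QK])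
 fix n
 have "AE om in P. abs (f (Suc n) (V (Suc n) om) (V (Suc2 n) om))<=L" by (rule AE_le_ess_bound[OF b]) simp
 thus "AE om in P. f (Suc n) (V (Suc n) om) (V (Suc2 n) om) = g n (V (Suc n) om) (V (Suc2 n) om)"
 by eventually_elim (auto simp:g_def abs_le_iff)
 qed
 interpret C: chain_functional ?B mu p ep g L M "%n. past_algebra ?B M X (Suc n)" X f
 by (rule cf[OF mc]) (use k L(3) in \<open>auto intro:order_trans\<close>)
 have cfx:"chain_functional ?B mu p ep g L (Px x) (%n. past_algebra ?B (Px x) Y (Suc n)) Y f"
 if "x : S 1" "ess_bound (Px x) Y f<=ereal K" for x
 by (rule cf) (use mcx that L(2) in \<open>auto intro:order_trans\<close>)
 have start:"distr (Px x) (?B 1) (Y 1) = return (?B 1) x" if "x : S 1" for x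
 using mcx that by (simp add:markov_chain_def)
 note sp = space_borel_spaces[of S d]
 show ?thesis
 \<comment> \<open>The constant 1 only ensures that \<open>R\<close> is positive; the estimates
   place no further lower bound on \<open>R\<close>.\<close>
 proof (rule exI[of _ 1],rule conjI,simp,intro allI impI,rule exI[of _ C.rho_fun],rule exI[of _ C.xi_fun],intro conjI,goal_cases)
 case (1 R)
 thus ?case by (intro C.window_contains_interval[OF irr]) simp
 next
 case (2 R)
 hence R:"0<=R" by simp
 show ?case
 by (intro allI impI ballI,rule C.nonlattice_large_deviations[OF irr _ R cfx start]) (use sp in auto)
 next
 case (3 R)
 hence R:"0<=R" by simp
 show ?case
 proof (intro allI impI ballI,elim conjE,goal_cases)
 case (1 c z a b x)
 show ?case
 by (rule C.lattice_large_deviations[OF irr 1(1) R L(1) cfx start,where c = c]) (use 1 sp in auto)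
 qed
 next
 case (4 R)
 thus ?case using C.rho_fun_bounds[of R] unfolding sp by simp
 next
 case (5 R)
 thus ?case using C.rho_fun_limit[of R] unfolding sp by simp
 next
 case (6 R)
 thus ?case by (intro C.xi_fun_bounds) simp
 qed
qed

end
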